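(* Let $B$ be a compact space, let $F\colon B\to\widetilde{Fred}$, $b\mapsto F_b$, be a continuous map representing the class $[F]\in K^1(B)$, and let $k\in\mathbb{N}$ be such that there is $0<\varepsilon<1$ with $$\#\bigl(\mathrm{spec}(F_b)\cap(-\varepsilon,\varepsilon)\bigr)\le k\qquad\text{for all } b\in B.$$ Then for all natural numbers $i_0<\dots<i_k$ the equation $$c^{odd}_{i_0}([F])\smile\dots\smile c^{odd}_{i_k}([F])=0$$ holds in $H^*(B)$, where $\smile$ denotes the cup product.
   Context: Let $H$ be an infinite-dimensional separable (complex) Hilbert space. Put $Fred^0=\{F\colon H\to H \mid F$ bounded Fredholm, $FF^*-1$ and $F^*F-1$ compact$\}$ and $Fred^1=\{F\in Fred^0\mid F \text{ self-adjoint}\}$, both with the operator norm topology. The space $\widetilde{Fred}$ equals $Fred^1$ as a set, but carries the weakest topology such that the evaluation $\widetilde{Fred}\times H\to H$, $(F,v)\mapsto F(v)$, and the map $\widetilde{Fred}\to\mathcal{K}(H)$, $F\mapsto F^2-1$, are continuous; here $\mathcal{K}(H)$ is the space of compact operators on $H$ with the norm topology. $B$ is unbased, and $B_+$ is $B$ with a disjoint base point. $K^{-n}(B)=[S^n\wedge B_+,Fred^0]$ (the base point being mapped to an invertible operator), and $K^1(B)=K^{-1}(B)=K^0(S^1\wedge B_+)$ by Bott periodicity. A norm-continuous map $A\colon B\to Fred^1$ represents a class $[A]\in K^1(B)$ via the Atiyah–Singer construction: $A_b$ is sent to the path $t\mapsto \cos(\pi t)+i\sin(\pi t)A_b$, $t\in[0,1]$,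 in $Fred^0$ from $1$ to $-1$, closed up to a loop by a fixed path of unit scalars from $-1$ to $1$. A continuous map $F\colon B\to\widetilde{Fred}$ represents the class $[F]\in K^1(B)$ if $F$ is homotopic, as a map to $\widetilde{Fred}$, to the composition of a norm-continuous map $A\colon B\to Fred^1$ with the (continuous) identity map $Fred^1\to\widetilde{Fred}$, and $[F]=[A]$. (The identity map $Fred^1\to\widetilde{Fred}$ is a weak homotopy equivalence, so over a compact CW complex such an $A$ always exists and is unique up to homotopy.) For $i\ge1$ the odd Chern class is the composition $$c_i^{odd}\colon K^1(B)=K^0(S^1\wedge B_+)\xrightarrow{c_i}H^{2i}(S^1\wedge B_+)\xrightarrow{\cong}H^{2i-1}(B_+)=H^{2i-1}(B),$$ where $c_i$ is the usual $i$-th Chern class, the second map is the suspension isomorphism, and cohomology of based spaces is reduced. $\mathrm{spec}$ denotes the spectrum and $\#$ the cardinality of a set. The indices $i_0<\dots<i_k$ are positive integers. *)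

theory Defs
  imports "HOL-Analysis.Analysis" "HOL-Homology.Homology"
begin

section \<open>Complex Hilbert spaces and bounded operators\<close>

text \<open>The real inner product, norm and metric are those of the superclasses; the complex inner
  product is linear in its first argument and has the real one as its real part.\<close>

class complex_hilbert = real_inner + complete_space +
  fixes scaleC :: "complex \<Rightarrow> 'a \<Rightarrow> 'a"  (infixr "*\<^sub>C" 75)
    and cinner :: "'a \<Rightarrow> 'a \<Rightarrow> complex"
  assumes scaleC_add_right: "a *\<^sub>C (x + y) = a *\<^sub>C x + a *\<^sub>C y"
    and scaleC_add_left: "(a + b) *\<^sub>C x = a *\<^sub>C x + b *\<^sub>C x"
    and scaleC_scaleC: "a *\<^sub>C b *\<^sub>C x = (a * b) *\<^sub>C x"
    and scaleC_of_real: "complex_of_real r *\<^sub>C x = r *\<^sub>R x"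
    and cinner_commute: "cinner x y = cnj (cinner y x)"
    and cinner_add_left: "cinner (x + y) z = cinner x z + cinner y z"
    and cinner_scaleC_left: "cinner (a *\<^sub>C x) y = a * cinner x y"
    and Re_cinner: "Re (cinner x y) = inner x y"

text \<open>Bounded complex-linear operators are the complex-linear elements of the library type of
  bounded real-linear maps, which carries the operator norm.  A complex subspace is finite
  dimensional over the complex numbers iff it is so over the reals.\<close>

definition complex_linear :: "('h::complex_hilbert \<Rightarrow>\<^sub>L 'h) \<Rightarrow> bool" where
  "complex_linear F \<longleftrightarrow> (\<forall>c x. F (c *\<^sub>C x) = c *\<^sub>C F x)"

definition complex_subspace :: "'h::complex_hilbert set \<Rightarrow> bool" where
  "complex_subspace S \<longleftrightarrow> subspace S \<and> (\<forall>c. \<forall>x\<in>S. c *\<^sub>C x \<in> S)"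

definition finite_dimensional :: "'h::real_vector set \<Rightarrow> bool" where
  "finite_dimensional S \<longleftrightarrow> (\<exists>T. finite T \<and> S \<subseteq> span T)"

definition finite_codimensional :: "'h::real_vector set \<Rightarrow> bool" where
  "finite_codimensional S \<longleftrightarrow> (\<exists>T. finite T \<and> span (S \<union> T) = UNIV)"

definition scaleC_op :: "complex \<Rightarrow> ('h::complex_hilbert \<Rightarrow>\<^sub>L 'h) \<Rightarrow> 'h \<Rightarrow>\<^sub>L 'h" where
  "scaleC_op c F = Blinfun (\<lambda>x. c *\<^sub>C F x)"

definition adj :: "('h::complex_hilbert \<Rightarrow>\<^sub>L 'h) \<Rightarrow> 'h \<Rightarrow>\<^sub>L 'h" where
  "adj F = (THE G. \<forall>x y. cinner (F x) y = cinner x (blinfun_apply G y))"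

definition self_adjoint :: "('h::complex_hilbert \<Rightarrow>\<^sub>L 'h) \<Rightarrow> bool" where
  "self_adjoint F \<longleftrightarrow> (\<forall>x y. cinner (F x) y = cinner x (F y))"

definition invertible_op :: "('h::complex_hilbert \<Rightarrow>\<^sub>L 'h) \<Rightarrow> bool" where
  "invertible_op F \<longleftrightarrow> complex_linear F \<and>
     (\<exists>G. complex_linear G \<and> F o\<^sub>L G = id_blinfun \<and> G o\<^sub>L F = id_blinfun)"

definition spec :: "('h::complex_hilbert \<Rightarrow>\<^sub>L 'h) \<Rightarrow> complex set" where
  "spec F = {z. \<not> invertible_op (F - scaleC_op z id_blinfun)}"

definition compact_ops :: "('h::complex_hilbert \<Rightarrow>\<^sub>L 'h) set" where
  "compact_ops = {K. complex_linear K \<and> compact (closure (blinfun_apply K ` cball 0 1))}"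

definition fredholm :: "('h::complex_hilbert \<Rightarrow>\<^sub>L 'h) \<Rightarrow> bool" where
  "fredholm F \<longleftrightarrow> complex_linear F \<and> finite_dimensional {x. F x = 0} \<and>
     finite_codimensional (range (blinfun_apply F))"

definition Fred0 :: "('h::complex_hilbert \<Rightarrow>\<^sub>L 'h) set" where
  "Fred0 = {F. fredholm F \<and> (F o\<^sub>L adj F) - id_blinfun \<in> compact_ops \<and>
                (adj F o\<^sub>L F) - id_blinfun \<in> compact_ops}"

definition Fred1 :: "('h::complex_hilbert \<Rightarrow>\<^sub>L 'h) set" where
  "Fred1 = {F \<in> Fred0. self_adjoint F}"


section \<open>The space $\widetilde{Fred}$\<close>

definition makes_continuous :: "('h::complex_hilbert \<Rightarrow>\<^sub>L 'h) topology \<Rightarrow> bool" where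
  "makes_continuous T \<longleftrightarrow> topspace T = Fred1 \<and>
     continuous_map (prod_topology T euclidean) euclidean (\<lambda>(F, v). blinfun_apply F v) \<and>
     continuous_map T (top_of_set compact_ops) (\<lambda>F. (F o\<^sub>L F) - id_blinfun)"

text \<open>The weakest topology is the intersection of all topologies with the required property.  That
  this intersection has the property itself is shown in \<open>makes_continuous_Fred_tilde\<close> below; the
  point is that \<open>F \<mapsto> F\<^sup>2 - 1\<close> being norm continuous makes \<open>F\<close> locally bounded.\<close>

definition Fred_tilde :: "('h::complex_hilbert \<Rightarrow>\<^sub>L 'h) topology" where
  "Fred_tilde = topology (\<lambda>U. U \<subseteq> Fred1 \<and> (\<forall>T. makes_continuous T \<longrightarrow> openin T U))"


lemma openin_Fred_tilde:
  fixes U :: "('h::complex_hilbert \<Rightarrow>\<^sub>L 'h) set"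
  shows "openin Fred_tilde U \<longleftrightarrow> U \<subseteq> Fred1 \<and> (\<forall>T. makes_continuous T \<longrightarrow> openin T U)"
proof -
  have "istopology (\<lambda>U :: ('h \<Rightarrow>\<^sub>L 'h) set. U \<subseteq> Fred1 \<and> (\<forall>T. makes_continuous T \<longrightarrow> openin T U))"
    unfolding istopology_def by blast
  then show ?thesis
    unfolding Fred_tilde_def by (simp add: topology_inverse')
qed

lemma Fred_tilde_weakest: "makes_continuous T \<Longrightarrow> openin Fred_tilde U \<Longrightarrow> openin T U"
  by (simp add: openin_Fred_tilde)

lemma topspace_Fred_tilde: "topspace (Fred_tilde :: ('h::complex_hilbert \<Rightarrow>\<^sub>L 'h) topology) = Fred1"
proof (rule antisym)
  show "topspace Fred_tilde \<subseteq> (Fred1 :: ('h \<Rightarrow>\<^sub>L 'h) set)"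
    using openin_Fred_tilde openin_topspace by blast
  have "openin T Fred1" if "makes_continuous T" for T :: "('h \<Rightarrow>\<^sub>L 'h) topology"
    using that openin_topspace[of T] by (simp add: makes_continuous_def)
  then have "openin Fred_tilde (Fred1 :: ('h \<Rightarrow>\<^sub>L 'h) set)"
    by (simp add: openin_Fred_tilde)
  then show "(Fred1 :: ('h \<Rightarrow>\<^sub>L 'h) set) \<subseteq> topspace Fred_tilde"
    by (rule openin_subset)
qed

lemma continuous_map_Fred_tilde:
  assumes "\<And>T. makes_continuous T \<Longrightarrow> continuous_map T Y f"
    and "f \<in> Fred1 \<rightarrow> topspace Y"
  shows "continuous_map Fred_tilde Y f"
  unfolding continuous_map_def topspace_Fred_tilde openin_Fred_tilde
  using assms unfolding continuous_map_def makes_continuous_def by fastforce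

lemma adj_self_adjoint:
  assumes "self_adjoint F"
  shows "adj F = F"
  unfolding adj_def
proof (rule the_equality)
  show "\<forall>x y. cinner (F x) y = cinner x (F y)"
    using assms by (simp add: self_adjoint_def)
  fix G assume G: "\<forall>x y. cinner (F x) y = cinner x (blinfun_apply G y)"
  have "inner x (G y) = inner x (F y)" for x y
    using G assms by (metis Re_cinner self_adjoint_def)
  then have "G y = F y" for y
    by (metis vector_eq_ldot)
  then show "G = F"
    by (rule blinfun_eqI)
qed

lemma norm_self_adjoint_le:
  assumes "self_adjoint F"
  shows "(norm F)\<^sup>2 \<le> norm (F o\<^sub>L F)"
proof -
  have "norm (F x) \<le> sqrt (norm (F o\<^sub>L F)) * norm x" for x
  proof -
    have "(norm (F x))\<^sup>2 = inner (F x) (F x)"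
      by (simp add: power2_norm_eq_inner)
    also have "\<dots> = inner x ((F o\<^sub>L F) x)"
      using assms by (metis Re_cinner blinfun_apply_blinfun_compose self_adjoint_def)
    also have "\<dots> \<le> norm x * norm ((F o\<^sub>L F) x)"
      by (rule norm_cauchy_schwarz)
    also have "\<dots> \<le> norm x * (norm (F o\<^sub>L F) * norm x)"
      by (intro mult_left_mono norm_blinfun norm_ge_zero)
    also have "\<dots> = (sqrt (norm (F o\<^sub>L F)) * norm x)\<^sup>2"
      by (simp add: power_mult_distrib power2_eq_square)
    finally show ?thesis
      by (rule power2_le_imp_le) simp
  qed
  then have "norm F \<le> sqrt (norm (F o\<^sub>L F))"
    by (intro norm_blinfun_bound) auto
  then show ?thesis
    by (simp add: real_le_rsqrt sqrt_ge_absD)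
qed

lemma makes_continuous_Fred_tilde:
  "makes_continuous (Fred_tilde :: ('h::complex_hilbert \<Rightarrow>\<^sub>L 'h) topology)"
  unfolding makes_continuous_def
proof (intro conjI topspace_Fred_tilde)
  have sq: "(F o\<^sub>L F) - id_blinfun \<in> compact_ops" if "F \<in> Fred1" for F :: "'h \<Rightarrow>\<^sub>L 'h"
    using that adj_self_adjoint[of F] by (auto simp: Fred1_def Fred0_def)
  show cont_sq: "continuous_map Fred_tilde (top_of_set compact_ops)
      (\<lambda>F :: 'h \<Rightarrow>\<^sub>L 'h. (F o\<^sub>L F) - id_blinfun)"
    by (rule continuous_map_Fred_tilde) (use sq in \<open>auto simp: makes_continuous_def\<close>)
  have cont_at: "continuous_map Fred_tilde euclidean (\<lambda>F :: 'h \<Rightarrow>\<^sub>L 'h. F v)" for v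
  proof (rule continuous_map_Fred_tilde)
    fix T :: "('h \<Rightarrow>\<^sub>L 'h) topology" assume T: "makes_continuous T"
    have "continuous_map T (prod_topology T euclidean) (\<lambda>F. (F, v))"
      by (simp add: continuous_map_paired)
    then have "continuous_map T euclidean ((\<lambda>(F, v). blinfun_apply F v) \<circ> (\<lambda>F. (F, v)))"
      using T continuous_map_compose unfolding makes_continuous_def by blast
    then show "continuous_map T euclidean (\<lambda>F. F v)"
      by (simp add: o_def)
  qed simp
  show "continuous_map (prod_topology Fred_tilde euclidean) euclidean (\<lambda>(F :: 'h \<Rightarrow>\<^sub>L 'h, v). F v)"
    unfolding continuous_map_def
  proof (intro conjI allI impI)
    fix O' :: "'h set" assume "openin euclidean O'"
    then have O': "open O'" by simp
    show "openin (prod_topology Fred_tilde euclidean)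
        {z \<in> topspace (prod_topology Fred_tilde euclidean).
          (case z of (F, v) \<Rightarrow> blinfun_apply F v) \<in> O'}" (is "openin ?P ?S")
    proof (subst openin_subopen, intro ballI)
      fix z assume "z \<in> ?S"
      then obtain F0 v0 where z: "z = (F0, v0)" and F0: "F0 \<in> Fred1" and "blinfun_apply F0 v0 \<in> O'"
        by (auto simp: topspace_Fred_tilde)
      then obtain e where e: "e > 0" "ball (F0 v0) e \<subseteq> O'"
        using O' openE by blast
      define M where "M = sqrt (norm (F0 o\<^sub>L F0) + 1)"
      have M: "M \<ge> 1" unfolding M_def by simp
      let ?sq = "\<lambda>F :: 'h \<Rightarrow>\<^sub>L 'h. (F o\<^sub>L F) - id_blinfun"
      define U1 where "U1 = {F \<in> topspace Fred_tilde. ?sq F \<in> ball (?sq F0) 1}"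
      define U2 where "U2 = {F \<in> topspace Fred_tilde. blinfun_apply F v0 \<in> ball (F0 v0) (e / 2)}"
      have "openin Fred_tilde U1"
        unfolding U1_def
        by (rule openin_continuous_map_preimage[where Y=euclidean])
           (use cont_sq in \<open>auto intro: continuous_map_into_fulltopology\<close>)
      moreover have "openin Fred_tilde U2"
        unfolding U2_def by (rule openin_continuous_map_preimage[OF cont_at]) simp
      ultimately have op: "openin ?P ((U1 \<inter> U2) \<times> ball v0 (e / (2 * M)))"
        by (simp add: openin_prod_Times_iff openin_Int)
      have mem: "z \<in> (U1 \<inter> U2) \<times> ball v0 (e / (2 * M))"
        using e M F0 by (simp add: z U1_def U2_def topspace_Fred_tilde)
      have "(U1 \<inter> U2) \<times> ball v0 (e / (2 * M)) \<subseteq> ?S"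
      proof clarify
        fix F v assume F: "F \<in> U1" "F \<in> U2" and v: "v \<in> ball v0 (e / (2 * M))"
        have F1: "F \<in> Fred1" using F by (simp add: U1_def topspace_Fred_tilde)
        have "norm ((F o\<^sub>L F) - (F0 o\<^sub>L F0)) < 1"
          using F(1) norm_minus_commute[of "F0 o\<^sub>L F0" "F o\<^sub>L F"]
          by (simp add: U1_def dist_norm algebra_simps)
        then have "norm (F o\<^sub>L F) \<le> norm (F0 o\<^sub>L F0) + 1"
          using norm_triangle_ineq2[of "F o\<^sub>L F" "F0 o\<^sub>L F0"] by linarith
        then have "(norm F)\<^sup>2 \<le> norm (F0 o\<^sub>L F0) + 1"
          using norm_self_adjoint_le[of F] F1 by (simp add: Fred1_def)
        then have "norm F \<le> M"
          unfolding M_def by (rule real_le_rsqrt)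
        then have "norm (F (v - v0)) \<le> M * norm (v - v0)"
          by (meson norm_blinfun mult_right_mono norm_ge_zero order_trans)
        also have "\<dots> < M * (e / (2 * M))"
          using v M by (intro mult_strict_left_mono) (auto simp: dist_norm norm_minus_commute)
        also have "\<dots> = e / 2" using M by simp
        finally have "dist (F v0) (F v) < e / 2"
          by (simp add: dist_norm blinfun.diff_right norm_minus_commute)
        moreover have "dist (F0 v0) (F v0) < e / 2"
          using F(2) by (simp add: U2_def)
        ultimately have "F v \<in> ball (F0 v0) e"
          using dist_triangle[of "F0 v0" "F v" "F v0"] by simp
        then show "(F, v) \<in> topspace ?P \<and> blinfun_apply F v \<in> O'"
          using e F1 by (auto simp: topspace_Fred_tilde)
      qed
      then show "\<exists>T. openin ?P T \<and> z \<in> T \<and> T \<subseteq> ?S"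
        using op mem by blast
    qed
  qed simp
qed


section \<open>Singular cohomology with integer coefficients\<close>

type_synonym 'a cochain = "((nat \<Rightarrow> real) \<Rightarrow> 'a) \<Rightarrow> int"

definition cochains :: "nat \<Rightarrow> 'a topology \<Rightarrow> 'a cochain set" where
  "cochains n X = {\<phi>. \<forall>\<sigma>. \<not> singular_simplex n X \<sigma> \<longrightarrow> \<phi> \<sigma> = 0}"

definition coboundary :: "nat \<Rightarrow> 'a topology \<Rightarrow> 'a cochain \<Rightarrow> 'a cochain" where
  "coboundary n X \<phi> = (\<lambda>\<sigma>. if singular_simplex (Suc n) X \<sigma>
     then (\<Sum>k\<le>Suc n. (-1) ^ k * \<phi> (singular_face (Suc n) k \<sigma>)) else 0)"

definition cocycle_group :: "nat \<Rightarrow> 'a topology \<Rightarrow> 'a cochain monoid" where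
  "cocycle_group n X = \<lparr>carrier = {\<phi> \<in> cochains n X. coboundary n X \<phi> = (\<lambda>_. 0)},
     monoid.mult = (\<lambda>\<phi> \<psi> \<sigma>. \<phi> \<sigma> + \<psi> \<sigma>), one = (\<lambda>_. 0)\<rparr>"

definition coboundaries :: "nat \<Rightarrow> 'a topology \<Rightarrow> 'a cochain set" where
  "coboundaries n X = (case n of 0 \<Rightarrow> {\<lambda>_. 0} | Suc m \<Rightarrow> coboundary m X ` cochains m X)"

text \<open>As for the library's homology groups, the group operation (addition of classes) is written
  multiplicatively; the zero class is \<open>\<one>\<close>.\<close>

definition cohomology_group :: "nat \<Rightarrow> 'a topology \<Rightarrow> 'a cochain set monoid" where
  "cohomology_group n X = cocycle_group n X Mod coboundaries n X"

lemma coboundary_coboundary: "coboundary (Suc n) X (coboundary n X \<phi>) = (\<lambda>_. 0)"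
proof
  fix \<sigma>
  define L where "L c = Poly_Mapping.lookup (frag_extend (\<lambda>\<sigma>. frag_cmul (\<phi> \<sigma>) (frag_of ())) c) ()"
    for c
  have L_sum: "L (\<Sum>k\<in>K. c k) = (\<Sum>k\<in>K. L (c k))" if "finite K" for K :: "nat set" and c
    using that by (simp add: L_def frag_extend_sum lookup_sum o_def)
  have L_cmul: "L (frag_cmul m c) = m * L c" for m c
    by (simp add: L_def frag_extend_cmul)
  have L_of: "L (frag_of \<tau>) = \<phi> \<tau>" for \<tau>
    by (simp add: L_def)
  have L_boundary: "L (chain_boundary (Suc n) (frag_of \<tau>)) =
      (\<Sum>k\<le>Suc n. (-1) ^ k * \<phi> (singular_face (Suc n) k \<tau>))" for \<tau>
    by (simp add: chain_boundary_of L_sum L_cmul L_of del: sum.atMost_Suc)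
  show "coboundary (Suc n) X (coboundary n X \<phi>) \<sigma> = 0"
  proof (cases "singular_simplex (Suc (Suc n)) X \<sigma>")
    case True
    have "coboundary n X \<phi> (singular_face (Suc (Suc n)) k \<sigma>) =
        L (chain_boundary (Suc n) (frag_of (singular_face (Suc (Suc n)) k \<sigma>)))"
      if "k \<le> Suc (Suc n)" for k
      using singular_simplex_singular_face[OF True _ that] L_boundary
      by (simp add: coboundary_def del: sum.atMost_Suc)
    then have "coboundary (Suc n) X (coboundary n X \<phi>) \<sigma> =
        L (chain_boundary (Suc n) (chain_boundary (Suc (Suc n)) (frag_of \<sigma>)))"
      using True
      by (subst coboundary_def)
        (simp add: chain_boundary_of chain_boundary_sum chain_boundary_cmul L_sum L_cmul o_def
          del: sum.atMost_Suc)
    also have "\<dots> = 0"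
      using chain_boundary_boundary[of "Suc (Suc n)" X "frag_of \<sigma>"] True
      by (simp add: singular_chain_of L_def)
    finally show ?thesis .
  qed (simp add: coboundary_def)
qed

lemma coboundary_zero: "coboundary n X (\<lambda>_. 0) = (\<lambda>_. 0)"
  by (auto simp: coboundary_def)

lemma coboundary_add:
  "coboundary n X (\<lambda>\<sigma>. \<phi> \<sigma> + \<psi> \<sigma>) = (\<lambda>\<sigma>. coboundary n X \<phi> \<sigma> + coboundary n X \<psi> \<sigma>)"
  by (auto simp: coboundary_def distrib_left sum.distrib)

lemma coboundary_uminus: "coboundary n X (\<lambda>\<sigma>. - \<phi> \<sigma>) = (\<lambda>\<sigma>. - coboundary n X \<phi> \<sigma>)"
  by (auto simp: coboundary_def simp flip: sum_negf)

lemma coboundary_in_cochains: "coboundary n X \<phi> \<in> cochains (Suc n) X"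
  by (simp add: coboundary_def cochains_def)

lemma comm_group_cocycle_group: "comm_group (cocycle_group n X)"
proof (rule comm_groupI)
  fix \<phi> assume "\<phi> \<in> carrier (cocycle_group n X)"
  then show "\<exists>\<psi>\<in>carrier (cocycle_group n X). \<psi> \<otimes>\<^bsub>cocycle_group n X\<^esub> \<phi> = \<one>\<^bsub>cocycle_group n X\<^esub>"
    by (intro bexI[of _ "\<lambda>\<sigma>. - \<phi> \<sigma>"])
       (auto simp: cocycle_group_def cochains_def coboundary_uminus)
qed (auto simp: cocycle_group_def cochains_def coboundary_add coboundary_zero add.assoc add.commute)

lemma subgroup_coboundaries: "subgroup (coboundaries n X) (cocycle_group n X)"
proof -
  interpret comm_group "cocycle_group n X" by (rule comm_group_cocycle_group)
  show ?thesis
  proof (cases n)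
    case 0
    then show ?thesis
      using triv_subgroup by (simp add: coboundaries_def cocycle_group_def)
  next
    case (Suc m)
    show ?thesis
    proof (rule subgroupI)
      show sub: "coboundaries n X \<subseteq> carrier (cocycle_group n X)"
        by (auto simp: Suc coboundaries_def cocycle_group_def coboundary_in_cochains
            coboundary_coboundary)
      show "coboundaries n X \<noteq> {}"
        by (auto simp: Suc coboundaries_def cochains_def)
      show "inv\<^bsub>cocycle_group n X\<^esub> a \<in> coboundaries n X" if a: "a \<in> coboundaries n X" for a
      proof -
        have *: "(\<lambda>\<sigma>. - a \<sigma>) \<in> coboundaries n X"
          using a by (auto simp: Suc coboundaries_def cochains_def simp flip: coboundary_uminus)
        have "inv\<^bsub>cocycle_group n X\<^esub> a = (\<lambda>\<sigma>. - a \<sigma>)"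
          using sub a * by (intro inv_equality) (auto simp: cocycle_group_def)
        with * show ?thesis by simp
      qed
      show "a \<otimes>\<^bsub>cocycle_group n X\<^esub> b \<in> coboundaries n X"
        if "a \<in> coboundaries n X" "b \<in> coboundaries n X" for a b
        using that
        by (auto simp: Suc coboundaries_def cochains_def cocycle_group_def simp flip: coboundary_add)
    qed
  qed
qed

lemma comm_group_cohomology_group: "comm_group (cohomology_group n X)"
  unfolding cohomology_group_def
  by (intro comm_group.abelian_FactGroup comm_group_cocycle_group subgroup_coboundaries)

definition coh_class :: "nat \<Rightarrow> 'a topology \<Rightarrow> 'a cochain \<Rightarrow> 'a cochain set" where
  "coh_class n X \<phi> = coboundaries n X #>\<^bsub>cocycle_group n X\<^esub> \<phi>"

text \<open>Induced maps and cup products of classes: the unions below run over all representatives, each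
  of which yields the same class.\<close>

definition cochain_pull :: "nat \<Rightarrow> 'a topology \<Rightarrow> ('a \<Rightarrow> 'b) \<Rightarrow> 'b cochain \<Rightarrow> 'a cochain" where
  "cochain_pull n X f \<phi> =
     (\<lambda>\<sigma>. if singular_simplex n X \<sigma> then \<phi> (simplex_map n f \<sigma>) else 0)"

definition coh_pull ::
    "nat \<Rightarrow> 'a topology \<Rightarrow> ('a \<Rightarrow> 'b) \<Rightarrow> 'b cochain set \<Rightarrow> 'a cochain set" where
  "coh_pull n X f c = (\<Union>\<phi>\<in>c. coh_class n X (cochain_pull n X f \<phi>))"

text \<open>A standard simplex consists of functions on all natural numbers vanishing beyond the
  dimension, so the inclusion of the front face is the identity and that of the back face is a shift.\<close>

definition front_face :: "nat \<Rightarrow> ((nat \<Rightarrow> real) \<Rightarrow> 'a) \<Rightarrow> (nat \<Rightarrow> real) \<Rightarrow> 'a" where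
  "front_face p \<sigma> = restrict \<sigma> (standard_simplex p)"

definition back_face :: "nat \<Rightarrow> nat \<Rightarrow> ((nat \<Rightarrow> real) \<Rightarrow> 'a) \<Rightarrow> (nat \<Rightarrow> real) \<Rightarrow> 'a" where
  "back_face p q \<sigma> =
     restrict (\<lambda>x. \<sigma> (\<lambda>i. if i < p then 0 else x (i - p))) (standard_simplex q)"

definition cochain_cup ::
    "nat \<Rightarrow> nat \<Rightarrow> 'a topology \<Rightarrow> 'a cochain \<Rightarrow> 'a cochain \<Rightarrow> 'a cochain" where
  "cochain_cup p q X \<phi> \<psi> = (\<lambda>\<sigma>. if singular_simplex (p + q) X \<sigma>
     then \<phi> (front_face p \<sigma>) * \<psi> (back_face p q \<sigma>) else 0)"

definition cup ::
    "nat \<Rightarrow> nat \<Rightarrow> 'a topology \<Rightarrow> 'a cochain set \<Rightarrow> 'a cochain set \<Rightarrow> 'a cochain set" where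
  "cup p q X a b = (\<Union>\<phi>\<in>a. \<Union>\<psi>\<in>b. coh_class (p + q) X (cochain_cup p q X \<phi> \<psi>))"

definition unit_class :: "'a topology \<Rightarrow> 'a cochain set" where
  "unit_class X = coh_class 0 X (\<lambda>\<sigma>. if singular_simplex 0 X \<sigma> then 1 else 0)"

fun cup_power :: "nat \<Rightarrow> 'a topology \<Rightarrow> 'a cochain set \<Rightarrow> nat \<Rightarrow> 'a cochain set" where
  "cup_power d X c 0 = unit_class X"
| "cup_power d X c (Suc m) = cup (d * m) d X (cup_power d X c m) c"

text \<open>\<open>cup_product X d c k = c 0 \<smile> \<dots> \<smile> c k\<close>, where \<open>c j\<close> has degree \<open>d j\<close>.\<close>

fun cup_product ::
    "'a topology \<Rightarrow> (nat \<Rightarrow> nat) \<Rightarrow> (nat \<Rightarrow> 'a cochain set) \<Rightarrow> nat \<Rightarrow> 'a cochain set" where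
  "cup_product X d c 0 = c 0"
| "cup_product X d c (Suc k) = cup (\<Sum>j\<le>k. d j) (d (Suc k)) X (cup_product X d c k) (c (Suc k))"


section \<open>Chern classes of vector bundles\<close>

text \<open>Vector bundles occur as families \<open>E\<close> of finite-dimensional subspaces of a fixed Hilbert space.
  Complex lines are identified with the orthogonal projections onto them, and the complex projective
  space of the Hilbert space has the norm topology on these projections.\<close>

definition line_proj :: "'h::complex_hilbert \<Rightarrow> 'h \<Rightarrow>\<^sub>L 'h" where
  "line_proj v = (let u = (1 / norm v) *\<^sub>R v in Blinfun (\<lambda>x. cinner x u *\<^sub>C u))"

definition proj_space :: "('h::complex_hilbert \<Rightarrow>\<^sub>L 'h) topology" where
  "proj_space = top_of_set (line_proj ` (UNIV - {0}))"

text \<open>For orthonormal \<open>u\<close>, \<open>v\<close> the singular simplex \<open>line_simplex u v\<close> collapses the boundary of the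
  2-simplex to the line of \<open>v\<close> and maps its interior bijectively, preserving orientations, onto the
  affine line consisting of the lines of \<open>u + z v\<close> with \<open>z\<close> complex.  So its difference with the
  constant simplex is a fundamental cycle of the projective line of \<open>span {u, v}\<close> with its complex
  orientation, and \<open>hyperplane_class\<close> is the positive generator of \<open>H\<^sup>2\<close> of projective
  space, the first Chern class of the dual of the tautological line bundle.\<close>

definition line_simplex :: "'h::complex_hilbert \<Rightarrow> 'h \<Rightarrow> (nat \<Rightarrow> real) \<Rightarrow> 'h \<Rightarrow>\<^sub>L 'h" where
  "line_simplex u v = restrict
     (\<lambda>x. line_proj (complex_of_real (x 0 * x 1 * x 2) *\<^sub>C u + Complex (x 1 - 1/3) (x 2 - 1/3) *\<^sub>C v))
     (standard_simplex 2)"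

definition hyperplane_class :: "('h::complex_hilbert \<Rightarrow>\<^sub>L 'h) cochain set" where
  "hyperplane_class = (THE c. c \<in> carrier (cohomology_group 2 proj_space) \<and>
     (\<forall>u v. norm u = 1 \<and> norm v = 1 \<and> cinner u v = 0 \<longrightarrow>
       (\<forall>\<phi>\<in>c. \<phi> (line_simplex u v) - \<phi> (restrict (\<lambda>_. line_proj v) (standard_simplex 2)) = 1)))"

text \<open>The part of the base where \<open>E\<close> has complex rank \<open>n\<close> (\<open>dim\<close> is the real dimension), and the
  projective bundle of \<open>E\<close> over it.\<close>

definition rank_part :: "'x topology \<Rightarrow> ('x \<Rightarrow> 'h::complex_hilbert set) \<Rightarrow> nat \<Rightarrow> 'x topology" where
  "rank_part X E n = subtopology X {x. dim (E x) = 2 * n}"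

definition proj_bundle ::
    "'x topology \<Rightarrow> ('x \<Rightarrow> 'h::complex_hilbert set) \<Rightarrow> nat \<Rightarrow> ('x \<times> ('h \<Rightarrow>\<^sub>L 'h)) topology" where
  "proj_bundle X E n = subtopology (prod_topology (rank_part X E n) proj_space)
     {(x, p). range (blinfun_apply p) \<subseteq> E x}"

text \<open>Chern classes after Grothendieck: with \<open>\<pi>\<close> the projection of the projective bundle of a bundle
  of rank \<open>n\<close> and \<open>h\<close> the hyperplane class, \<open>\<Sum>i\<le>n. \<pi>\<^sup>* c\<^sub>i(E) \<smile> h\<^bsup>n - i\<^esup> = 0\<close>,
  where \<open>c\<^sub>0(E) = 1\<close>, and \<open>c\<^sub>i(E) = 0\<close> for \<open>i > n\<close>.  The rank may vary from component to
  component.\<close>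

definition are_chern_classes ::
    "'x topology \<Rightarrow> ('x \<Rightarrow> 'h::complex_hilbert set) \<Rightarrow> (nat \<Rightarrow> 'x cochain set) \<Rightarrow> bool" where
  "are_chern_classes X E c \<longleftrightarrow>
     c 0 = unit_class X \<and>
     (\<forall>i. c i \<in> carrier (cohomology_group (2 * i) X)) \<and>
     (\<forall>n. \<forall>i>n. coh_pull (2 * i) (rank_part X E n) id (c i)
                  = \<one>\<^bsub>cohomology_group (2 * i) (rank_part X E n)\<^esub>) \<and>
     (\<forall>n. let P = proj_bundle X E n in
        (\<Otimes>\<^bsub>cohomology_group (2 * n) P\<^esub>i\<in>{..n}.
            cup (2 * i) (2 * (n - i)) P (coh_pull (2 * i) P fst (c i))
              (cup_power 2 P (coh_pull 2 P snd hyperplane_class) (n - i)))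
        = \<one>\<^bsub>cohomology_group (2 * n) P\<^esub>)"

definition chern_bundle :: "'x topology \<Rightarrow> ('x \<Rightarrow> 'h::complex_hilbert set) \<Rightarrow> nat \<Rightarrow> 'x cochain set" where
  "chern_bundle X E = (THE c. are_chern_classes X E c)"


section \<open>K-theory\<close>

text \<open>For a space \<open>X\<close> with base point \<open>x0\<close>, \<open>K\<^sup>0(X)\<close> consists of the homotopy classes of maps to
  \<open>Fred0\<close> which, like the homotopies, map \<open>x0\<close> to an invertible operator.\<close>

definition K0_class ::
    "'x topology \<Rightarrow> 'x \<Rightarrow> ('x \<Rightarrow> 'h::complex_hilbert \<Rightarrow>\<^sub>L 'h) \<Rightarrow> ('x \<Rightarrow> 'h \<Rightarrow>\<^sub>L 'h) set" where
  "K0_class X x0 f = {g. homotopic_with (\<lambda>h. invertible_op (h x0)) X (top_of_set Fred0) f g}"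

definition K0 :: "'x topology \<Rightarrow> 'x \<Rightarrow> ('x \<Rightarrow> 'h::complex_hilbert \<Rightarrow>\<^sub>L 'h) set set" where
  "K0 X x0 = {K0_class X x0 f | f. continuous_map X (top_of_set Fred0) f \<and> invertible_op (f x0)}"

text \<open>Over a compact space there is a finite-dimensional \<open>W\<close> such that \<open>range (f x) + W\<close> is the
  whole space for all \<open>x\<close>.  Then the subspaces \<open>f x -` W\<close> form a vector bundle \<open>E\<close>, and the
  Atiyah-Jaenich index bundle of \<open>f\<close> is \<open>[E] - [X \<times> W]\<close>.  Its Chern classes are those of \<open>E\<close>,
  since \<open>X \<times> W\<close> is trivial.\<close>

definition is_index_bundle ::
    "'x topology \<Rightarrow> ('x \<Rightarrow> 'h::complex_hilbert \<Rightarrow>\<^sub>L 'h) \<Rightarrow> ('x \<Rightarrow> 'h set) \<Rightarrow> 'h set \<Rightarrow> bool" where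
  "is_index_bundle X f E W \<longleftrightarrow> complex_subspace W \<and> finite_dimensional W \<and>
     (\<forall>x\<in>topspace X. {a + w |a w. a \<in> range (blinfun_apply (f x)) \<and> w \<in> W} = UNIV \<and>
        E x = blinfun_apply (f x) -` W)"

definition chern_K0 ::
    "'x topology \<Rightarrow> nat \<Rightarrow> ('x \<Rightarrow> 'h::complex_hilbert \<Rightarrow>\<^sub>L 'h) set \<Rightarrow> 'x cochain set" where
  "chern_K0 X i \<kappa> =
     (THE c. \<exists>f\<in>\<kappa>. \<exists>E W. is_index_bundle X f E W \<and> c = chern_bundle X E i)"


section \<open>Suspensions and odd Chern classes\<close>

definition plus_topology :: "'b topology \<Rightarrow> 'b option topology" where
  "plus_topology B = topology (\<lambda>U. U \<subseteq> insert None (Some ` topspace B) \<and>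
     openin B {b \<in> topspace B. Some b \<in> U})"

lemma openin_plus_topology:
  "openin (plus_topology B) U \<longleftrightarrow>
     U \<subseteq> insert None (Some ` topspace B) \<and> openin B {b \<in> topspace B. Some b \<in> U}"
proof -
  have "istopology (\<lambda>U. U \<subseteq> insert None (Some ` topspace B) \<and>
          openin B {b \<in> topspace B. Some b \<in> U})"
  proof -
    have "{b \<in> topspace B. Some b \<in> S \<inter> T} =
        {b \<in> topspace B. Some b \<in> S} \<inter> {b \<in> topspace B. Some b \<in> T}" for S T
      by auto
    moreover have "{b \<in> topspace B. Some b \<in> \<Union>K} = (\<Union>S\<in>K. {b \<in> topspace B. Some b \<in> S})" for K
      by auto
    ultimately show ?thesis
      unfolding istopology_def by (auto simp del: Int_iff Union_iff)
  qed
  then show ?thesis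
    by (simp add: plus_topology_def topology_inverse')
qed

definition quotient_topology :: "'a topology \<Rightarrow> ('a \<Rightarrow> 'b) \<Rightarrow> 'b topology" where
  "quotient_topology X q =
     topology (\<lambda>U. U \<subseteq> q ` topspace X \<and> openin X {x \<in> topspace X. q x \<in> U})"

lemma openin_quotient_topology:
  "openin (quotient_topology X q) U \<longleftrightarrow>
     U \<subseteq> q ` topspace X \<and> openin X {x \<in> topspace X. q x \<in> U}"
proof -
  have "istopology (\<lambda>U. U \<subseteq> q ` topspace X \<and> openin X {x \<in> topspace X. q x \<in> U})"
  proof -
    have "{x \<in> topspace X. q x \<in> S \<inter> T} = {x \<in> topspace X. q x \<in> S} \<inter> {x \<in> topspace X. q x \<in> T}"
      for S T by auto
    moreover have "{x \<in> topspace X. q x \<in> \<Union>K} = (\<Union>S\<in>K. {x \<in> topspace X. q x \<in> S})" for K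
      by auto
    ultimately show ?thesis
      unfolding istopology_def by (auto simp del: Int_iff Union_iff)
  qed
  then show ?thesis
    by (simp add: quotient_topology_def topology_inverse')
qed

definition smash_map :: "'a \<Rightarrow> 'b \<Rightarrow> 'a \<times> 'b \<Rightarrow> ('a \<times> 'b) option" where
  "smash_map x0 y0 = (\<lambda>(x, y). if x = x0 \<or> y = y0 then None else Some (x, y))"

definition smash :: "'a topology \<Rightarrow> 'a \<Rightarrow> 'b topology \<Rightarrow> 'b \<Rightarrow> ('a \<times> 'b) option topology" where
  "smash X x0 Y y0 = quotient_topology (prod_topology X Y) (smash_map x0 y0)"

text \<open>Spheres are unit circles with base point 1; added base points and base points of smash products
  are \<open>None\<close>.\<close>

definition S1_smash :: "'y topology \<Rightarrow> 'y \<Rightarrow> (complex \<times> 'y) option topology" where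
  "S1_smash Y y0 = smash (top_of_set (sphere 0 1)) 1 Y y0"

definition vanishes_on :: "nat \<Rightarrow> 'a topology \<Rightarrow> 'a set \<Rightarrow> 'a cochain \<Rightarrow> bool" where
  "vanishes_on n X A \<phi> \<longleftrightarrow> (\<forall>\<sigma>. singular_simplex n (subtopology X A) \<sigma> \<longrightarrow> \<phi> \<sigma> = 0)"

text \<open>The suspension isomorphism from the reduced \<open>H\<^bsup>n + 1\<^esup>\<close> of \<open>S\<^sup>1 \<and> Y\<close> to the reduced
  \<open>H\<^sup>n\<close> of a well-pointed space \<open>Y\<close>, for \<open>n \<ge> 1\<close>.  Reduced and unreduced classes of positive degree
  agree; the representative vanishing at the base point is a relative cocycle.  The map is pullback
  along the quotient map \<open>q\<close> from \<open>[0,1] \<times> Y\<close>, followed by the inverse of the connecting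
  isomorphism of the triple with members \<open>[0,1] \<times> Y\<close>, \<open>{0,1} \<times> Y \<union> [0,1] \<times> {y0}\<close> and
  \<open>{0} \<times> Y \<union> [0,1] \<times> {y0}\<close> and by restriction to \<open>{1} \<times> Y\<close>.\<close>

definition suspension_iso ::
    "'y topology \<Rightarrow> 'y \<Rightarrow> nat \<Rightarrow> (complex \<times> 'y) option cochain set \<Rightarrow> 'y cochain set" where
  "suspension_iso Y y0 n c =
    (let I = prod_topology (top_of_set {0..1::real}) Y;
         q = (\<lambda>(t, y). smash_map 1 y0 (cis (2 * pi * t), y))
     in \<Union> {coh_class n Y (cochain_pull n Y (\<lambda>y. (1, y)) \<phi>) | \<phi> \<xi>.
           \<xi> \<in> c \<and> vanishes_on (Suc n) (S1_smash Y y0) {None} \<xi> \<and>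
           \<phi> \<in> cochains n I \<and> vanishes_on n I {(t, y). t = 0 \<or> y = y0} \<phi> \<and>
           coboundary n I \<phi> = cochain_pull (Suc n) I q \<xi>})"

abbreviation S1_smash_plus :: "'b topology \<Rightarrow> (complex \<times> 'b option) option topology" where
  "S1_smash_plus B \<equiv> S1_smash (plus_topology B) None"

text \<open>\<open>K\<^sup>1(B) = K\<^sup>0(S\<^sup>1 \<and> B\<^sub>+)\<close>.  In \<open>c_odd\<close>, pullback along \<open>Some\<close> is the identification of
  the reduced cohomology of \<open>B\<^sub>+\<close> with the cohomology of \<open>B\<close>; \<open>c_odd B i \<kappa>\<close> has degree \<open>2 * i - 1\<close>.\<close>

abbreviation K1 :: "'b topology \<Rightarrow> ((complex \<times> 'b option) option \<Rightarrow> 'h::complex_hilbert \<Rightarrow>\<^sub>L 'h) set set"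
  where "K1 B \<equiv> K0 (S1_smash_plus B) None"

definition c_odd ::
    "'b topology \<Rightarrow> nat \<Rightarrow> ((complex \<times> 'b option) option \<Rightarrow> 'h::complex_hilbert \<Rightarrow>\<^sub>L 'h) set
      \<Rightarrow> 'b cochain set" where
  "c_odd B i \<kappa> = coh_pull (2 * i - 1) B Some
     (suspension_iso (plus_topology B) None (2 * i - 1) (chern_K0 (S1_smash_plus B) i \<kappa>))"

text \<open>The Atiyah-Singer loop.  The path \<open>cos (\<pi> t) + i sin (\<pi> t) A\<^sub>b\<close>, \<open>0 \<le> t \<le> 1\<close>, is
  parametrised by the point \<open>z = cis (\<pi> t)\<close> of the upper half of the circle, and the returning path
  of unit scalars from \<open>-1\<close> to \<open>1\<close> is the lower half of the circle.\<close>

definition atiyah_singer ::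
    "('b \<Rightarrow> 'h::complex_hilbert \<Rightarrow>\<^sub>L 'h) \<Rightarrow> (complex \<times> 'b option) option \<Rightarrow> 'h \<Rightarrow>\<^sub>L 'h" where
  "atiyah_singer A s = (case s of
       Some (z, Some b) \<Rightarrow>
         if Im z \<ge> 0 then Re z *\<^sub>R id_blinfun + scaleC_op (\<i> * complex_of_real (Im z)) (A b)
         else scaleC_op z id_blinfun
     | _ \<Rightarrow> id_blinfun)"

definition represents_K1 ::
    "'b topology \<Rightarrow> ('b \<Rightarrow> 'h::complex_hilbert \<Rightarrow>\<^sub>L 'h)
      \<Rightarrow> ((complex \<times> 'b option) option \<Rightarrow> 'h \<Rightarrow>\<^sub>L 'h) set \<Rightarrow> bool" where
  "represents_K1 B F \<kappa> \<longleftrightarrow> \<kappa> \<in> K1 B \<and>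
     (\<exists>A. continuous_map B (top_of_set Fred1) A \<and>
          homotopic_with (\<lambda>_. True) B Fred_tilde F A \<and>
          \<kappa> = K0_class (S1_smash_plus B) None (atiyah_singer A))"

end

(* Let lambda_j run through k + 1 distinct small positive numbers.  By the spectral hypothesis B is
covered by k + 1 open sets V_j with closed neighbourhoods K_j over which F - lambda_j is invertible.  Over
K_j, F is homotopic to F + a (F^2 - 1) = a (F - lambda_j) (F + 1 / lambda_j) with a > 0, which is invertible.
So over the suspension of K_j the Atiyah-Singer loop deforms to invertible operators, and the Chern classes of
its index bundle vanish there.  Hence the j-th odd Chern class is represented by a cocycle vanishing on V_j.
The product of k + 1 such cocycles vanishes on all simplices that are small for the cover, so it is exact.
The Leray-Hirsch theorem for projective bundles, needed for the Chern classes, is proved by splitting off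
lines over small open sets, using a local Thom isomorphism, and by Mayer-Vietoris over the compact base. *)
theory Submission
  imports Defs "HOL-Library.Function_Algebras"
begin

text \<open>Maps into \<open>Fred_tilde\<close> are only strongly continuous, and this shapes the
  analysis. What varies norm continuously is built from \<open>F^2 - 1\<close>, so the index bundle
  belonging to a finite-dimensional space with projection P is obtained as the kernel of
  \<open>adj F (1 - P) F\<close>, which is \<open>adj F F\<close> minus finitely many rank one
  terms. For the same reason F is moved to \<open>F + a (F^2 - 1)\<close> and not to
  \<open>F - lambda\<close>: the former is a compact perturbation of F, and its square minus 1
  involves only \<open>F^2 - 1\<close> and \<open>F (F^2 - 1)\<close>. Leray-Hirsch is stated on
  cochains as acyclicity of a mapping cone, so that injectivity and surjectivity are glued in a
  single Mayer-Vietoris step. The definitions by description (\<open>hyperplane_class\<close>,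
  \<open>chern_bundle\<close>, \<open>chern_K0\<close>) force uniqueness proofs; for the hyperplane
  class this means that a class of degree two on infinite projective space is determined by its
  values on projective lines. The odd classes are handled as unions of classes, all of which have
  representatives vanishing on the same sets.\<close>

abbreviation (input) iff_ascii (infixr "<->" 25) where "A <-> B == (A :: bool) = B"
notation blinfun_compose (infixl "oL" 55) and scaleR (infixr "*R" 75) and scaleC (infixr "*C" 75)
type_synonym 'h op = "'h \<Rightarrow>\<^sub>L 'h"
abbreviation (input) "ASg == atiyah_singer"
abbreviation (input) "PSp1 == proj_space"
abbreviation (input) "SSP == S1_smash_plus"
abbreviation (input) "bapp == blinfun_apply"
abbreviation (input) "bdry1 == chain_boundary"
abbreviation (input) "bfc == back_face"
abbreviation (input) "cin1 == cinner"
abbreviation (input) "clin1 == complex_linear"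
abbreviation (input) "cmap == continuous_map"
abbreviation (input) "cofr == complex_of_real"
abbreviation (input) "cohG == cohomology_group"
abbreviation (input) "cont_on == continuous_on"
abbreviation (input) "coop == compact_ops"
abbreviation (input) "cspc == compact_space"
abbreviation (input) "euc == euclideanreal"
abbreviation (input) "eucl1 == euclidean"
abbreviation (input) "fdim == finite_dimensional"
abbreviation (input) "ffc == front_face"
abbreviation (input) "frof == frag_of"
abbreviation (input) "idb == id_blinfun"
abbreviation (input) "lpr1 == line_proj"
abbreviation (input) "lsx1 == line_simplex"
abbreviation (input) "plt == plus_topology"
abbreviation (input) "pmk == Poly_Mapping.keys"
abbreviation (input) "prt == prod_topology"
abbreviation (input) "sadj1 == self_adjoint"
abbreviation (input) "sbt1 == subtopology"
abbreviation (input) "schain == singular_chain"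
abbreviation (input) "sface1 == singular_face"
abbreviation (input) "smap1 == simplex_map"
abbreviation (input) "ssx1 == singular_simplex"
abbreviation (input) "stsx == standard_simplex"
abbreviation (input) "topo == top_of_set"
abbreviation (input) "tsp1 == topspace"
abbreviation (input) "xface1 == simplical_face"
lemmas alsi = algebra_simps
lemmas babc = blinfun_apply_blinfun_compose
lemmas bbco = bounded_bilinear.continuous_on
lemmas bblr = blinfun.bounded_linear_right
lemmas bbs = blinfun.bilinear_simps
lemmas bdl1 = blinfun.diff_left
lemmas bdr = blinfun.diff_right
lemmas bleq = blinfun_eqI
lemmas bsl = blinfun.sum_left
lemmas bsl1 = blinfun.scaleR_left
lemmas cal = cinner_add_left
lemmas cei = complex_eq_iff
lemmas cico = cinner_commute
lemmas cld = complex_linear_def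
lemmas cmc = continuous_map_compose
lemmas cmd = continuous_map_def
lemmas cmf = continuous_map_fst
lemmas cmfs = continuous_map_from_subtopology
lemmas cmis = continuous_map_in_subtopology
lemmas cmp = continuous_map_pairwise
lemmas cms = continuous_map_snd
lemmas csd = complex_subspace_def
lemmas csl = cinner_scaleC_left
lemmas fei = fun_eq_iff
lemmas mrm = mult_right_mono
lemmas muco = mult.commute
lemmas n2e2 = numeral_2_eq_2
lemmas ocmp = openin_continuous_map_preimage
lemmas pes = power2_eq_square
lemmas pmd = power_mult_distrib
lemmas sad = self_adjoint_def
lemmas sas = sum.atMost_Suc
lemmas scsc = scaleC_scaleC
lemmas sfd = singular_face_def
lemmas sfd1 = simplical_face_def
lemmas smd = simplex_map_def
lemmas sor = scaleC_of_real
lemmas spde = split_def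
lemmas srbw = sum.reindex_bij_witness
lemmas ssd = singular_simplex_def
lemmas ssd1 = standard_simplex_def
lemmas sss = singular_simplex_subtopology
lemmas suco = sum.cong

section \<open>Singular cochains of all degrees\<close>

text \<open>Total cochains assign a value to every function from every simplex; identities between them are only required on a face-closed set of simplices.\<close>

type_synonym 'a simp = "(nat=>real)=>'a"

type_synonym 'a tc = "nat=>'a simp=>int"

type_synonym 'a simps = "nat=>'a simp set"

definition cd :: "'a tc=>'a tc" where
 "cd fi n sg=(if n=0 then 0 else (\<Sum>k\<le>n. (-1) ^ k * fi (n - 1) (sface1 n k sg)))"

definition cupt :: "'a tc=>'a tc=>'a tc"  (infixl "\<smile>" 70) where
 "(fi \<smile> ps) n sg=(\<Sum>p\<le>n. fi p (ffc p sg) * ps (n - p) (bfc p (n - p) sg))"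

text \<open>The grading involution. With it the Leibniz rule \<open>cd_cup\<close> and the rule
  \<open>hop_cup\<close> hold for inhomogeneous cochains, without degrees in the statements.\<close>

definition ci :: "'a tc=>'a tc" where
 "ci fi n sg=(-1) ^ n * fi n sg"

definition pb :: "('a=>'b)=>'b tc=>'a tc" where
 "pb f fi n sg=fi n (smap1 n f sg)"

definition un :: "'a tc" where
 "un n sg=(if n=0 then 1 else 0)"

definition eqn :: "'a simps=>'a tc=>'a tc=>bool" where
 "eqn T fi ps<->(ALL n. ALL sg:T n. fi n sg=ps n sg)"

text \<open>Faces are what \<open>cd\<close> needs, front and back faces what \<open>cupt\<close>
  needs; extensionality makes \<open>bfc 0 n\<close> and \<open>ffc n\<close> act as the identity,
  so that \<open>un\<close> is a unit.\<close>

definition fclosed :: "'a simps=>bool" where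
 "fclosed T<->(ALL n. ALL sg:T n. sg:extensional (stsx n) &
  (0 < n-->(ALL k<=n. sface1 n k sg:T (n - 1))) &
  (ALL p<=n. ffc p sg:T p&bfc p (n - p) sg:T (n - p)))"

definition Sing :: "'a topology=>'a simps" where
 "Sing X n={sg. ssx1 n X sg}"

abbreviation Sub :: "'a topology=>'a set=>'a simps" where
 "Sub X U == Sing (sbt1 X U)"

section \<open>Faces, front faces and back faces of singular simplices\<close>

lemma stx_shift:
 assumes "x:stsx q"
 shows "(%i. if i < p then 0 else x (i - p)):stsx (p+q)"
proof -
 have "(\<Sum>i\<le>p+q. if i < p then 0 else x (i - p))=(\<Sum>i\<in>{p..p+q}. x (i - p))"
  by (rule sum.mono_neutral_cong_right) auto
 also have "... = (\<Sum>i\<le>q. x i)"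
  by (rule srbw[of _ "%i. i+p" "%i. i - p"]) auto
 finally show ?thesis
  using assms by (auto simp: ssd1)
qed

lemma stx_shift':
 assumes "x:stsx (n - p)" "p<=n"
 shows "(%i. if i < p then 0 else x (i - p)):stsx n"
 using stx_shift[OF assms(1), of p] assms(2) by simp

lemma stx_le:
 "x:stsx p==>p<=n==>x:stsx n"
 using standard_simplex_mono by blast

lemma stx_face:
 "k<=Suc n==>x:stsx n==>xface1 k x:stsx (Suc n)"
 using simplical_face_in_standard_simplex[of "Suc n" k x] by simp

lemma stx_zero: "x:stsx n==>n < i==>x i=0"
 by (simp add: ssd1)

lemma stx_sum: "x:stsx n==>(\<Sum>i\<le>n. x i)=1"
 by (simp add: ssd1)

lemma ff_ff: "p<=q==>ffc p (ffc q sg) = ffc p sg"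
 by (auto simp: front_face_def fei restrict_def dest: stx_le)

lemma bf_bf:
 "bfc q r (bfc p (q+r) sg)=bfc (p+q) r sg"
 by (auto simp: back_face_def fei restrict_def stx_shift
   intro!: arg_cong[where f=sg])

lemma ff_bf:
 "ffc q (bfc p (q+r) sg)=bfc p q (ffc (p+q) sg)"
 by (auto simp: back_face_def front_face_def fei restrict_def stx_shift
   dest: stx_le[of _ _ "q+r"])

lemma ff_sface_le:
 assumes "k<=p" "p<=n"
 shows "ffc p (sface1 (Suc n) k sg)=sface1 (Suc p) k (ffc (Suc p) sg)"
 using assms
 by (auto simp: front_face_def sfd fei stx_face
   dest: stx_le[of _ _ n])

lemma bf_sface_le:
 assumes "k<=p" "p<=n"
 shows "bfc p (n - p) (sface1 (Suc n) k sg)=bfc (Suc p) (n - p) sg"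
 using assms
 by (auto simp: back_face_def sfd fei stx_shift'
   sfd1 intro!: arg_cong[where f=sg])

lemma ff_sface_gt:
 assumes "p < k" "p<=n"
 shows "ffc p (sface1 (Suc n) k sg) = ffc p sg"
proof -
 have "sg (xface1 k x)=sg x" "x:stsx n" if "x:stsx p" for x
 proof -
  have "xface1 k x=x"
   using assms stx_zero[OF that] by (auto simp: sfd1 fei)
  then show "sg (xface1 k x)=sg x" by simp
  show "x:stsx n" using that assms stx_le by blast
 qed
 then show ?thesis
  by (auto simp: front_face_def sfd fei)
qed

lemma bf_sface_gt:
 assumes "p<=n" "1<=j" "j<=Suc n - p"
 shows "bfc p (n - p) (sface1 (Suc n) (p+j) sg)
   = sface1 (Suc n - p) j (bfc p (Suc n - p) sg)"
proof -
 have "sg (xface1 (p+j) (%i. if i < p then 0 else x (i - p)))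
   = sg (%i. if i < p then 0 else xface1 j x (i - p))" for x
  using assms(2) by (intro arg_cong[where f=sg]) (auto simp: sfd1 fei)
 moreover have "xface1 j x:stsx (Suc (n - p))" if "x:stsx (n - p)" for x
  using stx_face assms that by (simp add: Suc_diff_le)
 ultimately show ?thesis
  using assms by (auto simp: back_face_def sfd fei stx_shift' Suc_diff_le)
qed

text \<open>Together with \<open>sface_last_ff\<close> this identifies the two splittings at which
  the last face of the front part meets the zeroth face of the back part; their terms cancel in
  \<open>cd_cup\<close>.\<close>

lemma sface_0_bf:
 assumes "p<=n"
 shows "sface1 (Suc n - p) 0 (bfc p (Suc n - p) sg)=bfc (Suc p) (n - p) sg"
proof -
 have "sg (%i. if i < p then 0 else xface1 0 x (i - p))
   = sg (%i. if i < Suc p then 0 else x (i - Suc p))" for x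
  using assms by (intro arg_cong[where f=sg]) (auto simp: sfd1 fei)
 moreover have "xface1 0 x:stsx (Suc (n - p))" if "x:stsx (n - p)" for x
  using stx_face[of 0] that by simp
 ultimately show ?thesis
  using assms by (auto simp: back_face_def sfd fei Suc_diff_le)
qed

lemma sface_last_ff:
 "sface1 (Suc p) (Suc p) (ffc (Suc p) sg) = ffc p sg"
proof -
 have "xface1 (Suc p) x=x" if "x:stsx p" for x
  using stx_zero[OF that] by (auto simp: sfd1 fei)
 moreover have "x:stsx (Suc p)" if "x:stsx p" for x
  using that stx_le by simp
 ultimately show ?thesis
  by (intro ext) (simp add: front_face_def sfd)
qed

lemma sface_sface:
 assumes "i<=j" "j<=Suc n"
 shows "sface1 (Suc n) i (sface1 (Suc (Suc n)) (Suc j) sg)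
   = sface1 (Suc n) j (sface1 (Suc (Suc n)) i sg)"
proof -
 have "sg (xface1 (Suc j) (xface1 i x))=sg (xface1 i (xface1 j x))"
  for x :: "nat=>real"
  using assms by (intro arg_cong[where f=sg]) (auto simp: sfd1 fei)
 then show ?thesis
  using assms by (auto simp: sfd fei stx_face)
qed

lemma sum_split_at:
 fixes f :: "nat=>'a::comm_monoid_add"
 assumes "p<=n"
 shows "(\<Sum>k\<le>Suc n. f k)=(\<Sum>k\<le>p. f k)+(\<Sum>j=1..Suc n - p. f (p+j))"
proof -
 have "(\<Sum>k\<le>Suc n. f k)=(\<Sum>k\<in>{..p} Un {Suc p..Suc n}. f k)"
  using assms by (intro suco) auto
 also have "... = (\<Sum>k\<le>p. f k)+(\<Sum>k=Suc p..Suc n. f k)"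
  by (rule sum.union_disjoint) auto
 also have "(\<Sum>k=Suc p..Suc n. f k)=(\<Sum>j=1..Suc n - p. f (p+j))"
  by (rule srbw[of _ "%j. p+j" "%k. k - p"]) (use assms in auto)
 finally show ?thesis .
qed

section \<open>The differential graded algebra of total cochains\<close>

lemma cd_Suc: "cd fi (Suc n) sg=(\<Sum>k\<le>Suc n. (-1) ^ k * fi n (sface1 (Suc n) k sg))"
 by (simp add: cd_def del: sas)

lemma cd_0: "cd fi 0 sg=0"
 by (simp add: cd_def)

lemma cd_add: "cd (fi+ps) = cd fi + cd ps"
 by (auto simp: cd_def fei distrib_left sum.distrib)

lemma cd_um: "cd (- fi) = - cd fi"
 by (auto simp: cd_def fei sum_negf)

lemma cd_df: "cd (fi - ps) = cd fi - cd ps"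
 by (auto simp: cd_def fei right_diff_distrib sum_subtractf)

lemma cd_zero [simp]: "cd 0=0"
 by (auto simp: cd_def fei)

lemma cd_sum: "cd (\<Sum>i\<in>I. f i)=(\<Sum>i\<in>I. cd (f i))"
 using sum_comp_morphism[of cd f I] by (simp only: cd_zero cd_add o_def)

lemma ci_add: "ci (fi+ps) = ci fi + ci ps"
 and ci_um: "ci (- fi) = - ci fi"
 and ci_df: "ci (fi - ps) = ci fi - ci ps"
 and ci_zero [simp]: "ci 0=0"
 and ci_ci [simp]: "ci (ci fi)=fi"
 by (auto simp: ci_def fei alsi)

lemma cd_ci: "cd (ci fi) = - ci (cd fi)"
proof (intro ext)
 fix n sg
 show "cd (ci fi) n sg=(- ci (cd fi)) n sg"
 proof (cases n)
  case (Suc m)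
  have "cd (ci fi) n sg=(\<Sum>k\<le>Suc m. (-1) ^ k * ((-1) ^ m * fi m (sface1 (Suc m) k sg)))"
   by (simp add: Suc cd_Suc ci_def del: sas)
  also have "... = (-1) ^ m * cd fi n sg"
   unfolding Suc cd_Suc sum_distrib_left by (intro suco) auto
  finally show ?thesis by (simp add: Suc ci_def)
 qed (simp add: cd_0 ci_def)
qed

lemma pb_add: "pb f (fi+ps)=pb f fi+pb f ps"
 and pb_um: "pb f (- fi) = - pb f fi"
 and pb_df: "pb f (fi - ps)=pb f fi - pb f ps"
 and pb_zero [simp]: "pb f 0=0"
 and pb_ci: "pb f (ci fi) = ci (pb f fi)"
 and pb_un [simp]: "pb f un=un"
 by (auto simp: pb_def ci_def un_def fei)

lemma pb_sum: "pb f (\<Sum>i\<in>I. g i)=(\<Sum>i\<in>I. pb f (g i))"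
 using sum_comp_morphism[of "pb f" g I] by (simp only: pb_zero pb_add o_def)

lemma pb_pb: "pb f (pb g fi)=pb (g \<circ> f) fi"
 by (intro ext) (simp add: pb_def simplex_map_compose)

lemma smap_sface:
 "k<=Suc n==>smap1 n f (sface1 (Suc n) k sg)=sface1 (Suc n) k (smap1 (Suc n) f sg)"
 by (auto simp: smd sfd fei stx_face)

lemma smap_ff:
 "p<=n==>smap1 p f (ffc p sg) = ffc p (smap1 n f sg)"
 by (auto simp: smd front_face_def fei dest: stx_le)

lemma smap_bf:
 "p<=n==>smap1 (n - p) f (bfc p (n - p) sg)=bfc p (n - p) (smap1 n f sg)"
 by (auto simp: smd back_face_def fei stx_shift')

lemma pb_cd: "pb f (cd fi) = cd (pb f fi)"
proof (intro ext)
 fix n sg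
 show "pb f (cd fi) n sg = cd (pb f fi) n sg"
  by (cases n) (simp_all add: cd_0 cd_Suc pb_def smap_sface del: sas)
qed

lemma pb_cup: "pb f (fi \<smile> ps)=pb f fi \<smile> pb f ps"
 by (auto simp: pb_def cupt_def fei smap_ff smap_bf)

lemma cup_add_l: "(fi+ps) \<smile> tt=(fi \<smile> tt)+(ps \<smile> tt)"
 and cup_add_r: "tt \<smile> (fi+ps)=(tt \<smile> fi)+(tt \<smile> ps)"
 and cup_df_l: "(fi - ps) \<smile> tt=(fi \<smile> tt) - (ps \<smile> tt)"
 and cup_df_r: "tt \<smile> (fi - ps)=(tt \<smile> fi) - (tt \<smile> ps)"
 and cup_um_l: "(- fi) \<smile> tt = - (fi \<smile> tt)"
 and cup_um_r: "tt \<smile> (- fi) = - (tt \<smile> fi)"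
 and cup_zero_l [simp]: "0 \<smile> tt=0"
 and cup_zero_r [simp]: "tt \<smile> 0=0"
 by (auto simp: cupt_def fei alsi sum.distrib sum_subtractf sum_negf)

lemma cup_sum_l: "(\<Sum>i\<in>I. f i) \<smile> tt=(\<Sum>i\<in>I. f i \<smile> tt)"
 using sum_comp_morphism[of "%x. x \<smile> tt" f I] by (simp only: cup_zero_l cup_add_l o_def)

text \<open>Both sides are sums over the ways to cut a simplex into a front, a middle and a back
  part; \<open>F p q r\<close> is the term with degrees p, q and r.\<close>

lemma cup_assoc: "(fi \<smile> ps) \<smile> tt=fi \<smile> (ps \<smile> tt)"
proof (intro ext)
 fix n :: nat and sg :: "'a simp"
 define F where "F p q r=fi p (ffc p sg) * ps q (bfc p q (ffc (p+q) sg)) *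
  tt r (bfc (p+q) r sg)" for p q r
 have "((fi \<smile> ps) \<smile> tt) n sg=(\<Sum>s\<le>n. \<Sum>p\<le>s. F p (s - p) (n - s))"
  by (auto simp: cupt_def F_def sum_distrib_right ff_ff intro!: suco)
 also have "... = (\<Sum>(s, p)\<in>(SIGMA s:{..n}. {..s}). F p (s - p) (n - s))"
  by (rule sum.Sigma) auto
 also have "... = (\<Sum>(p, q)\<in>(SIGMA p:{..n}. {..n - p}). F p q (n - p - q))"
  by (rule srbw[of _ "%(p, q). (p+q, p)" "%(s, p). (p, s - p)"]) auto
 also have "... = (\<Sum>p\<le>n. \<Sum>q\<le>n - p. F p q (n - p - q))"
  by (rule sum.Sigma[symmetric]) auto
 also have "... = (fi \<smile> (ps \<smile> tt)) n sg"
 proof -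
  have "F p q (n - p - q)=fi p (ffc p sg) *
    (ps q (ffc q (bfc p (n - p) sg)) *
    tt (n - p - q) (bfc q (n - p - q) (bfc p (n - p) sg)))"
   if "p<=n" "q<=n - p" for p q
  proof -
   have "q+(n - p - q)=n - p" using that by simp
   then show ?thesis
    using ff_bf[of q p "n - p - q" sg] bf_bf[of q "n - p - q" p sg]
    by (simp add: F_def mult.assoc)
  qed
  then show ?thesis
   by (simp add: cupt_def sum_distrib_left)
 qed
 finally show "((fi \<smile> ps) \<smile> tt) n sg=(fi \<smile> (ps \<smile> tt)) n sg" .
qed

text \<open>The iterated faces (k, i) with i < k are matched with (i, k - 1) by the simplicial
  identity \<open>sface_sface\<close>, with opposite signs.\<close>

lemma cd_cd [simp]: "cd (cd fi)=0"
proof (intro ext)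
 fix n and sg :: "'a simp"
 consider "n < 2" | m where "n=Suc (Suc m)"
 proof (cases "n < 2")
  case False
  then have "n=Suc (Suc (n - 2))" by linarith
  with that(2) show ?thesis .
 qed
 then show "cd (cd fi) n sg=0 n sg"
 proof cases
  case 1
  then show ?thesis by (auto simp: cd_def less_2_cases_iff)
 next
  case 2
  define F where "F k i=(-1) ^ (k+i) * fi m (sface1 (Suc m) i (sface1 (Suc (Suc m)) k sg))" for k i
  have eq: "cd (cd fi) n sg=(\<Sum>k\<le>Suc (Suc m). \<Sum>i\<le>Suc m. F k i)"
   unfolding 2 cd_Suc F_def sum_distrib_left by (simp add: power_add mult.assoc del: sas)
  also have "... = (\<Sum>(k, i)\<in>{..Suc (Suc m)} \<times> {..Suc m}. F k i)"
   by (simp add: sum.cartesian_product del: sas)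
  also have "... = (\<Sum>(k, i)\<in>{(k, i). i < k&k<=Suc (Suc m)}. F k i) +
    (\<Sum>(k, i)\<in>{(k, i). k<=i&i<=Suc m}. F k i)"
  proof -
   have "{..Suc (Suc m)} \<times> {..Suc m}={(k, i). i < k&k<=Suc (Suc m)} Un {(k, i). k<=i&i<=Suc m}"
    by auto
   moreover have "finite {(k, i). i < k&k<=Suc (Suc m)}" "finite {(k, i). k<=i&i<=Suc m}"
    by (rule finite_subset[of _ "{..Suc (Suc m)} \<times> {..Suc (Suc m)}"]; force)+
   ultimately show ?thesis
    by (simp add: sum.union_disjoint[symmetric] disjoint_iff)
  qed
  also have "(\<Sum>(k, i)\<in>{(k, i). i < k&k<=Suc (Suc m)}. F k i) =
    (\<Sum>(k, i)\<in>{(k, i). k<=i&i<=Suc m}. - F k i)"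
  proof (rule srbw[of _ "%(i, j). (Suc j, i)" "%(k, i). (i, k - 1)"])
   fix a assume "a:{(k, i). i < k&k<=Suc (Suc m)}"
   then have "a=(Suc (fst a - 1), snd a)" "snd a <= fst a - 1" "fst a - 1<=Suc m"
    by (auto simp: spde)
   then obtain j i where a: "a=(Suc j, i)" "i<=j" "j<=Suc m"
    by blast
   then show "(case case a of (k, i)=>(i, k - 1) of (k, i) => - F k i)=(case a of (k, i)=>F k i)"
    using sface_sface[of i j m sg] by (simp add: F_def add.commute)
  qed auto
  finally show ?thesis by (simp add: sum_negf spde)
 qed
qed

text \<open>Faces with index at most p act on the front factor, the others on the back factor. The
  two products on the right contain in addition the last face of the front factor and the zeroth
  face of the back factor; by \<open>AB\<close> these terms are equal, and their signs are
  opposite.\<close>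

lemma cd_cup: "cd (fi \<smile> ps)=(cd fi \<smile> ps)+(ci fi \<smile> cd ps)"
proof (intro ext)
 fix n sg
 show "cd (fi \<smile> ps) n sg=((cd fi \<smile> ps)+(ci fi \<smile> cd ps)) n sg"
 proof (cases n)
  case 0
  then show ?thesis by (simp add: cupt_def cd_0)
 next
  case (Suc m)
  define A where "A p k=fi p (sface1 (Suc p) k (ffc (Suc p) sg)) *
   ps (m - p) (bfc (Suc p) (m - p) sg)" for p k
  define B where "B p j=fi p (ffc p sg) *
   ps (m - p) (sface1 (Suc m - p) j (bfc p (Suc m - p) sg))" for p j
  have AB: "A p (Suc p)=B p 0" if "p<=m" for p
   using that by (simp add: A_def B_def sface_0_bf sface_last_ff)
  have "cd (fi \<smile> ps) n sg=(\<Sum>p\<le>m. \<Sum>k\<le>Suc m. (-1) ^ k * (fi p (ffc p (sface1 (Suc m) k sg)) *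
    ps (m - p) (bfc p (m - p) (sface1 (Suc m) k sg))))"
   unfolding Suc cd_Suc cupt_def sum_distrib_left by (rule sum.swap)
  also have "... = (\<Sum>p\<le>m. (\<Sum>k\<le>p. (-1) ^ k * A p k)+(\<Sum>j=1..Suc m - p. (-1) ^ (p+j) * B p j))"
  proof (rule suco[OF refl])
   fix p assume "p:{..m}"
   then show "(\<Sum>k\<le>Suc m. (-1) ^ k * (fi p (ffc p (sface1 (Suc m) k sg)) *
    ps (m - p) (bfc p (m - p) (sface1 (Suc m) k sg))))
    = (\<Sum>k\<le>p. (-1) ^ k * A p k)+(\<Sum>j=1..Suc m - p. (-1) ^ (p+j) * B p j)"
    by (subst sum_split_at[of p m])
     (auto simp: A_def B_def ff_sface_le ff_sface_gt
      bf_sface_le bf_sface_gt intro!: arg_cong2[of _ _ _ _ "(+)"] suco)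
  qed
  finally have L: "cd (fi \<smile> ps) n sg = ..." .
  have "(cd fi \<smile> ps) n sg=(\<Sum>p\<le>m. \<Sum>k\<le>Suc p. (-1) ^ k * A p k)"
   unfolding Suc cupt_def
   by (subst sum.atMost_Suc_shift) (simp add: cd_0 cd_Suc A_def sum_distrib_right mult.assoc del: sas)
  also have "... = (\<Sum>p\<le>m. (\<Sum>k\<le>p. (-1) ^ k * A p k) - (-1) ^ p * B p 0)"
   by (rule suco) (auto simp: AB)
  finally have R1: "(cd fi \<smile> ps) n sg = ..." .
  have "(ci fi \<smile> cd ps) n sg=(\<Sum>p\<le>m. \<Sum>j\<le>Suc m - p. (-1) ^ (p+j) * B p j)"
   unfolding Suc cupt_def
   by (subst sas)
    (auto simp: cd_0 cd_Suc ci_def B_def sum_distrib_left Suc_diff_le power_add mult_ac simp del: sas intro!: suco)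
  also have "... = (\<Sum>p\<le>m. (-1) ^ p * B p 0+(\<Sum>j=1..Suc m - p. (-1) ^ (p+j) * B p j))"
  proof (rule suco[OF refl])
   fix p
   have "{..Suc m - p}=insert 0 {1..Suc m - p}" by auto
   then show "(\<Sum>j\<le>Suc m - p. (-1) ^ (p+j) * B p j)
     = (-1) ^ p * B p 0+(\<Sum>j=1..Suc m - p. (-1) ^ (p+j) * B p j)"
    by simp
  qed
  finally have R2: "(ci fi \<smile> cd ps) n sg = ..." .
  show ?thesis
   unfolding L plus_fun_apply R1 R2 by (simp only: sum.distrib sum_subtractf)
 qed
qed

section \<open>Equality of cochains on a set of simplices\<close>

lemma eq_refl [simp]: "eqn T fi fi" and eq_sym: "eqn T fi ps==>eqn T ps fi"
 and eq_trans [trans]: "eqn T fi ps==>eqn T ps tt==>eqn T fi tt"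
 by (auto simp: eqn_def)

lemma eq_mono: "eqn T fi ps==>S<=T==>eqn S fi ps"
 by (auto simp: eqn_def le_fun_def)

lemma eq_sup: "eqn (sup S T) fi ps<->eqn S fi ps&eqn T fi ps"
 by (auto simp: eqn_def)

lemma eq_df0: "eqn T fi ps<->eqn T (fi - ps) 0"
 by (auto simp: eqn_def)

lemma eq_add: "eqn T fi fi'==>eqn T ps ps'==>eqn T (fi+ps) (fi'+ps')"
 and eq_df: "eqn T fi fi'==>eqn T ps ps'==>eqn T (fi - ps) (fi' - ps')"
 and eq_um: "eqn T fi fi'==>eqn T (- fi) (- fi')"
 and eq_ci: "eqn T fi fi'==>eqn T (ci fi) (ci fi')"
 by (auto simp: eqn_def ci_def)

lemma eq_sum: "(!!i. i:I==>eqn T (f i) (g i))==>eqn T (\<Sum>i\<in>I. f i) (\<Sum>i\<in>I. g i)"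
 by (induction I rule: infinite_finite_induct) (auto intro: eq_add)

lemma eq_sum0: "(!!i. i:I==>eqn T (f i) 0)==>eqn T (\<Sum>i\<in>I. f i) 0"
 using eq_sum[of I T f "%_. 0"] by simp

lemma fcl_ext: "fclosed T==>sg:T n==>sg:extensional (stsx n)"
 by (auto simp: fclosed_def)

lemma fcl_face: "fclosed T==>sg:T (Suc n)==>k<=Suc n==>sface1 (Suc n) k sg:T n"
 unfolding fclosed_def by (metis diff_Suc_1 zero_less_Suc)

lemma fcl_front: "fclosed T==>sg:T n==>p<=n==>ffc p sg:T p"
 and fcl_back: "fclosed T==>sg:T n==>p<=n==>bfc p (n - p) sg:T (n - p)"
 unfolding fclosed_def by blast+

lemma eq_cd: "eqn T fi ps==>fclosed T==>eqn T (cd fi) (cd ps)"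
 unfolding eqn_def
proof (intro allI ballI)
 fix n sg assume "ALL n. ALL sg:T n. fi n sg=ps n sg" "fclosed T" "sg:T n"
 then show "cd fi n sg = cd ps n sg"
  by (cases n) (auto simp: cd_0 cd_Suc fcl_face simp del: sas)
qed

lemma eq_cup: "eqn T fi fi'==>eqn T ps ps'==>fclosed T==>eqn T (fi \<smile> ps) (fi' \<smile> ps')"
 by (auto simp: eqn_def cupt_def fcl_front fcl_back intro!: suco)

lemma eq_cup0_l: "eqn T fi 0==>fclosed T==>eqn T (fi \<smile> ps) 0"
 using eq_cup[of T fi 0 ps ps] by simp

lemma eq_cup0_r: "eqn T ps 0==>fclosed T==>eqn T (fi \<smile> ps) 0"
 using eq_cup[of T fi fi ps 0] by simp

lemma bf_0: "sg:extensional (stsx n)==>bfc 0 n sg=sg"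
 and ff_all: "sg:extensional (stsx n)==>ffc n sg=sg"
 by (simp_all add: back_face_def front_face_def extensional_restrict)

lemma un_cup: "fclosed T==>eqn T (un \<smile> fi) fi"
 and cup_un: "fclosed T==>eqn T (fi \<smile> un) fi"
proof -
 assume T: "fclosed T"
 show "eqn T (un \<smile> fi) fi"
  unfolding eqn_def
 proof (intro allI ballI)
  fix n sg assume "sg:T n"
  have "(un \<smile> fi) n sg=(\<Sum>p\<le>n. if p=0 then fi n (bfc 0 n sg) else 0)"
   unfolding cupt_def by (rule suco) (auto simp: un_def)
  then show "(un \<smile> fi) n sg=fi n sg"
   using fcl_ext[OF T `sg:T n`] by (simp add: bf_0)
 qed
 show "eqn T (fi \<smile> un) fi"
  unfolding eqn_def
 proof (intro allI ballI)
  fix n sg assume "sg:T n"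
  have "(fi \<smile> un) n sg=(\<Sum>p\<le>n. if p=n then fi n (ffc n sg) else 0)"
   unfolding cupt_def by (rule suco) (auto simp: un_def)
  then show "(fi \<smile> un) n sg=fi n sg"
   using fcl_ext[OF T `sg:T n`] by (simp add: ff_all)
 qed
qed

lemma cd_un [simp]: "cd un=0"
proof (intro ext)
 fix n and sg :: "'a simp"
 show "cd un n sg=0 n sg"
  by (cases "n=1") (auto simp: cd_def un_def)
qed

lemma ssx_ff:
 assumes "ssx1 n X sg" "p<=n"
 shows "ssx1 p X (ffc p sg)"
proof -
 have "cmap (sbt1 (powertop_real UNIV) (stsx p)) X sg"
  using assms standard_simplex_mono[of p n] unfolding ssd
  by (meson continuous_map_from_subtopology_mono)
 then show ?thesis
  unfolding ssd front_face_def by (simp add: continuous_map_eq)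
qed

lemma ssx_bf:
 assumes "ssx1 n X sg" "p<=n"
 shows "ssx1 (n - p) X (bfc p (n - p) sg)"
proof -
 let ?s = "%(x :: nat=>real) i. if i < p then 0 else x (i - p)"
 have "cmap (sbt1 (powertop_real UNIV) (stsx (n - p)))
   (sbt1 (powertop_real UNIV) (stsx n)) ?s"
  unfolding cmis
 proof
  show "cmap (sbt1 (powertop_real UNIV) (stsx (n - p))) (powertop_real UNIV) ?s"
   by (auto simp: continuous_map_componentwise_UNIV intro!: cmfs continuous_map_product_projection)
 qed (use stx_shift' assms in auto)
 then have "cmap (sbt1 (powertop_real UNIV) (stsx (n - p))) X (sg \<circ> ?s)"
  using assms(1) cmc unfolding ssd by blast
 then show ?thesis
  unfolding ssd back_face_def by (simp add: continuous_map_eq o_def)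
qed

lemma fcl_Sing [intro!, simp]: "fclosed (Sing X)"
 unfolding fclosed_def Sing_def mem_Collect_eq
proof (intro allI ballI conjI impI)
 fix n k sg assume "sg:{sg. ssx1 n X sg}" "0 < n" "k<=n"
 then show "ssx1 (n - 1) X (sface1 n k sg)"
  using singular_simplex_singular_face[of n X sg k] by simp
qed (auto simp: ssx_ff ssx_bf, simp add: ssd)

lemma fcl_sup: "fclosed S==>fclosed T==>fclosed (sup S T)"
 unfolding fclosed_def sup_fun_def by (metis Un_iff)

lemma fcl_inf: "fclosed S==>fclosed T==>fclosed (inf S T)"
 unfolding fclosed_def inf_fun_def by (metis Int_iff)

lemma Sing_map: "cmap X Y f==>sg:Sing X n==>smap1 n f sg:Sing Y n"
 by (simp add: Sing_def singular_simplex_simplex_map)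

lemma Sub_inf: "inf (Sub X U) (Sub X V)=Sub X (U Int V)"
 by (auto simp: Sing_def fei sss)

lemma Sub_mono: "U \<subseteq> V==>Sub X U<=Sub X V"
 by (auto simp: Sing_def le_fun_def sss)

lemma Sub_le: "Sub X U<=Sing X"
 by (auto simp: Sing_def le_fun_def sss)

text \<open>The degeneracy merging the vertices i and i + 1, in barycentric coordinates. With
  \<open>tsum\<close> as time it yields the standard triangulation of the prism, in which the
  vertices up to i lie at time 0 and the later ones at time 1.\<close>

definition mrg :: "nat=>(nat=>real)=>nat=>real" where
 "mrg i x=(%j. if j < i then x j else if j=i then x i+x (Suc i) else x (Suc j))"

definition tsum :: "nat=>nat=>(nat=>real)=>real" where
 "tsum a n x=(\<Sum>j=a..n. x j)"

definition prism :: "(real=>'a=>'b)=>nat=>nat=>'a simp=>'b simp" where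
 "prism H n i sg=restrict (%x. H (tsum (Suc i) (Suc n) x) (sg (mrg i x))) (stsx (Suc n))"

definition hop :: "(real=>'a=>'b)=>'b tc=>'a tc" where
 "hop H fi n sg=(\<Sum>i\<le>n. (-1) ^ i * fi (Suc n) (prism H n i sg))"

lemma tsum_face_le:
 assumes "k < a"
 shows "tsum a (Suc n) (xface1 k x)=tsum (a - 1) n x"
proof -
 obtain b where b: "a=Suc b" using assms by (cases a) auto
 have "tsum a (Suc n) (xface1 k x)=(\<Sum>j=Suc b..Suc n. x (j - 1))"
  unfolding tsum_def b by (rule suco) (use assms b in "auto simp: sfd1")
 also have "... = (\<Sum>j=b..n. x j)"
  by (subst sum.shift_bounds_cl_Suc_ivl) simp
 finally show ?thesis by (simp add: b tsum_def)
qed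

lemma tsum_face_ge:
 assumes "a<=k" "k<=Suc n"
 shows "tsum a (Suc n) (xface1 k x)=tsum a n x"
proof -
 have "tsum a (Suc n) (xface1 k x)=(\<Sum>j\<in>{a..Suc n} - {k}. xface1 k x j)"
  unfolding tsum_def by (rule sum.mono_neutral_right) (auto simp: sfd1)
 also have "... = (\<Sum>j=a..n. x j)"
  by (rule srbw[of _ "%j. if j < k then j else Suc j" "%j. if j < k then j else j - 1"])
   (use assms in "auto simp: sfd1")
 finally show ?thesis by (simp add: tsum_def)
qed

lemma mrg_face_lt: "k < i==>mrg i (xface1 k x)=xface1 k (mrg (i - 1) x)"
proof (rule ext)
 fix j
 assume "k < i"
 then show "(mrg i (xface1 k x)) j=(xface1 k (mrg (i - 1) x)) j"
  by (cases j; cases i) (auto simp: mrg_def sfd1 not_less le_Suc_eq)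
qed

lemma mrg_face_gt: "Suc i < k==>mrg i (xface1 k x)=xface1 (k - 1) (mrg i x)"
proof (rule ext)
 fix j
 assume "Suc i < k"
 then show "(mrg i (xface1 k x)) j=(xface1 (k - 1) (mrg i x)) j"
  by (cases j; cases i) (auto simp: mrg_def sfd1 not_less le_Suc_eq)
qed

lemma mrg_face_same: "mrg i (xface1 i x)=x"
proof (rule ext)
 fix j
 show "(mrg i (xface1 i x)) j=(x) j"
  by (cases j; cases i) (auto simp: mrg_def sfd1 not_less le_Suc_eq)
qed

lemma mrg_face_Suc: "mrg i (xface1 (Suc i) x)=x"
proof (rule ext)
 fix j
 show "(mrg i (xface1 (Suc i) x)) j=(x) j"
  by (cases j; cases i) (auto simp: mrg_def sfd1 not_less le_Suc_eq)
qed

lemma tsum_nonneg: "x:stsx n==>0<=tsum a m x"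
 by (auto simp: tsum_def ssd1 intro: sum_nonneg)

lemma tsum_le_1:
 assumes "x:stsx n" shows "tsum a n x<=1"
proof -
 have "tsum a n x<=(\<Sum>j\<le>n. x j)"
  unfolding tsum_def by (rule sum_mono2) (use assms in "auto simp: ssd1")
 then show ?thesis using stx_sum[OF assms] by simp
qed

lemma mrg_in_simplex:
 assumes "x:stsx (Suc n)" "i<=n"
 shows "mrg i x:stsx n"
proof -
 have sp: "(\<Sum>j\<le>m. mrg i x j)=(if m < i then \<Sum>j\<le>m. x j else \<Sum>j\<le>Suc m. x j)" for m
  by (induction m) (auto simp: mrg_def less_Suc_eq)
 have le: "x i+x (Suc i)<=1"
 proof -
  have "(\<Sum>j\<in>{i, Suc i}. x j)<=(\<Sum>j\<le>Suc n. x j)"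
   by (rule sum_mono2) (use assms in "auto simp: ssd1")
  then show ?thesis using stx_sum[OF assms(1)] by simp
 qed
 have "(\<Sum>j\<le>n. mrg i x j)=1"
  using assms stx_sum[OF assms(1)] sp[of n] by simp
 then show ?thesis
  using assms le by (auto simp: ssd1 mrg_def)
qed

lemma face_prism_lt:
 assumes "k < i" "i<=Suc n"
 shows "sface1 (Suc (Suc n)) k (prism H (Suc n) i sg)=prism H n (i - 1) (sface1 (Suc n) k sg)"
 unfolding prism_def sfd
 using assms
 by (intro ext) (auto simp: stx_face mrg_in_simplex tsum_face_le mrg_face_lt)

lemma face_prism_gt:
 assumes "Suc i < k" "k<=Suc (Suc n)"
 shows "sface1 (Suc (Suc n)) k (prism H (Suc n) i sg)=prism H n i (sface1 (Suc n) (k - 1) sg)"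
 unfolding prism_def sfd
 using assms
 by (intro ext) (auto simp: stx_face mrg_in_simplex tsum_face_ge mrg_face_gt)

lemma face_prism_same:
 assumes "i<=n"
 shows "sface1 (Suc n) i (prism H n i sg)=restrict (%x. H (tsum i n x) (sg x)) (stsx n)"
 unfolding prism_def sfd
 using assms
 by (intro ext) (auto simp: stx_face mrg_face_same tsum_face_le)

lemma face_prism_Suc:
 assumes "i<=n"
 shows "sface1 (Suc n) (Suc i) (prism H n i sg)=restrict (%x. H (tsum (Suc i) n x) (sg x)) (stsx n)"
 unfolding prism_def sfd
 using assms
 by (intro ext) (auto simp: stx_face mrg_face_Suc tsum_face_ge)

lemma prism_ends:
 "restrict (%x. H (tsum 0 n x) (sg x)) (stsx n)=smap1 n (H 1) sg"
 "restrict (%x. H (tsum (Suc n) n x) (sg x)) (stsx n)=smap1 n (H 0) sg"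
proof -
 have "tsum 0 n x=1" if "x:stsx n" for x
  using stx_sum[OF that] by (simp add: tsum_def atMost_atLeast0)
 then show "restrict (%x. H (tsum 0 n x) (sg x)) (stsx n)=smap1 n (H 1) sg"
  by (auto simp: smd fei)
qed (simp add: tsum_def smd o_def)

lemma hop_add: "hop H (fi+ps)=hop H fi+hop H ps"
 and hop_um: "hop H (- fi) = - hop H fi"
 and hop_df: "hop H (fi - ps)=hop H fi - hop H ps"
 and hop_zero [simp]: "hop H 0=0"
 by (auto simp: hop_def fei alsi sum.distrib sum_subtractf sum_negf)

text \<open>The faces i and i + 1 of the i-th prism piece are the cuts \<open>T i\<close> and
  \<open>T (Suc i)\<close>, whose differences telescope to the two ends of the homotopy. The
  remaining faces are prism pieces over the faces of the simplex, with opposite sign.\<close>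

lemma hop_cd: "hop H (cd fi) + cd (hop H fi)=pb (H 1) fi - pb (H 0) fi"
proof (intro ext)
 fix n sg
 define G where "G i k=(-1) ^ (i+k) * fi n (sface1 (Suc n) k (prism H n i sg))" for i k
 define T where "T i=fi n (restrict (%x. H (tsum i n x) (sg x)) (stsx n))" for i
 define A where "A={(i, k). i<=n&k<=Suc n&k~=i&k~=Suc i}"
 have finA: "finite A"
  unfolding A_def by (rule finite_subset[of _ "{..n} \<times> {..Suc n}"]) auto
 have "hop H (cd fi) n sg=(\<Sum>i\<le>n. \<Sum>k\<le>Suc n. G i k)"
  by (simp add: hop_def cd_Suc G_def sum_distrib_left power_add mult.assoc del: sas)
 also have "... = (\<Sum>(i, k)\<in>{..n} \<times> {..Suc n}. G i k)"
  by (simp add: sum.cartesian_product del: sas)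
 also have "... = (\<Sum>(i, k)\<in>A Un (\<Union>i\<le>n. {(i, i), (i, Suc i)}). G i k)"
  by (rule suco) (auto simp: A_def)
 also have "... = (\<Sum>(i, k)\<in>A. G i k)+(\<Sum>(i, k)\<in>(\<Union>i\<le>n. {(i, i), (i, Suc i)}). G i k)"
  by (rule sum.union_disjoint) (use finA in "auto simp: A_def")
 also have "(\<Sum>(i, k)\<in>(\<Union>i\<le>n. {(i, i), (i, Suc i)}). G i k)=(\<Sum>i\<le>n. G i i+G i (Suc i))"
  by (subst sum.UNION_disjoint) auto
 also have "... = (\<Sum>i\<le>n. T i - T (Suc i))"
  by (rule suco) (auto simp: G_def T_def face_prism_same face_prism_Suc simp flip: mult_2)
 also have "... = T 0 - T (Suc n)"
  by (rule sum_telescope)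
 also have "... = (pb (H 1) fi - pb (H 0) fi) n sg"
  by (simp add: T_def prism_ends pb_def)
 also have "(\<Sum>(i, k)\<in>A. G i k) = - cd (hop H fi) n sg"
 proof (cases n)
  case 0
  then have "A={}" by (auto simp: A_def)
  then show ?thesis by (simp add: 0 cd_0)
 next
  case (Suc m)
  have "cd (hop H fi) n sg=(\<Sum>k\<le>n. \<Sum>i\<le>m. (-1) ^ (k+i) * fi n (prism H m i (sface1 n k sg)))"
   by (simp add: Suc hop_def cd_Suc sum_distrib_left power_add mult.assoc del: sas)
  also have "... = (\<Sum>(k, i)\<in>{..n} \<times> {..m}. (-1) ^ (k+i) * fi n (prism H m i (sface1 n k sg)))"
   by (simp add: sum.cartesian_product del: sas)
  also have "... = (\<Sum>(i, k)\<in>A. - G i k)"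
  proof (rule srbw[of _ "%(i, k). if k < i then (k, i - 1) else (k - 1, i)"
     "%(k, i). if k<=i then (Suc i, k) else (i, Suc k)"])
   fix a assume a: "a:{..n} \<times> {..m}"
   obtain k i where ki: "a=(k, i)" by (cases a)
   have "k<=n" "i<=m" using a ki by auto
   show "(case case a of (k, i)=>if k<=i then (Suc i, k) else (i, Suc k) of (i, k) => - G i k) =
    (case a of (k, i)=>(-1) ^ (k+i) * fi n (prism H m i (sface1 n k sg)))"
   proof (cases "k<=i")
    case True
    then show ?thesis
     using face_prism_lt[of k "Suc i" m H sg] `i<=m` by (simp add: ki G_def Suc add.commute)
   next
    case False
    then show ?thesis
     using face_prism_gt[of i "Suc k" m H sg] `k<=n` by (simp add: ki G_def Suc add.commute)
   qed
  qed (use Suc in "auto simp: A_def split: if_splits")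
  finally show ?thesis by (simp add: sum_negf spde)
 qed
 finally show "(hop H (cd fi) + cd (hop H fi)) n sg=(pb (H 1) fi - pb (H 0) fi) n sg"
  by simp
qed

lemma ff_prism:
 assumes "p<=i" "i<=n"
 shows "ffc p (prism H n i sg)=smap1 p (H 0) (ffc p sg)"
proof -
 have "tsum (Suc i) (Suc n) x=0" "mrg i x=x" "x:stsx (Suc n)" if "x:stsx p" for x
 proof -
  have z: "x j=0" if "i < j" for j
   using stx_zero[OF `x:stsx p`] that assms by simp
  then show "tsum (Suc i) (Suc n) x=0" by (simp add: tsum_def)
  show "mrg i x=x" using z by (auto simp: mrg_def fei)
  show "x:stsx (Suc n)" using that assms stx_le by fastforce
 qed
 then show ?thesis
  by (intro ext) (simp add: front_face_def prism_def smd)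
qed

lemma bf_prism:
 assumes "p<=i" "i<=n"
 shows "bfc p (Suc n - p) (prism H n i sg)=prism H (n - p) (i - p) (bfc p (n - p) sg)"
proof -
 have "tsum (Suc i) (Suc n) (%j. if j < p then 0 else x (j - p))=tsum (Suc (i - p)) (Suc (n - p)) x" for x
 proof -
  have "tsum (Suc i) (Suc n) (%j. if j < p then 0 else x (j - p))=(\<Sum>j=Suc i..Suc n. x (j - p))"
   unfolding tsum_def by (rule suco) (use assms in auto)
  also have "... = (\<Sum>j=Suc (i - p)..Suc (n - p). x j)"
   by (rule srbw[of _ "%j. j+p" "%j. j - p"]) (use assms in auto)
  finally show ?thesis by (simp add: tsum_def)
 qed
 moreover have "mrg i (%j. if j < p then 0 else x (j - p))=(%j. if j < p then 0 else mrg (i - p) x (j - p))" for x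
  using assms by (auto simp: mrg_def fei Suc_diff_le)
 moreover have "mrg (i - p) x:stsx (n - p)" if "x:stsx (Suc (n - p))" for x
  using mrg_in_simplex[OF that, of "i - p"] assms by simp
 ultimately show ?thesis
  using assms stx_shift'[of _ "Suc n" p]
  by (intro ext) (simp add: back_face_def prism_def Suc_diff_le)
qed

lemma bf_prism_top:
 assumes "i < p" "p<=Suc n" "i<=n"
 shows "bfc p (Suc n - p) (prism H n i sg)=smap1 (Suc n - p) (H 1) (bfc (p - 1) (Suc n - p) sg)"
proof -
 have t: "tsum (Suc i) (Suc n) (%j. if j < p then 0 else x (j - p))=1" if x: "x:stsx (Suc n - p)" for x
 proof -
  have "tsum (Suc i) (Suc n) (%j. if j < p then 0 else x (j - p))=(\<Sum>j=p..Suc n. x (j - p))"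
   unfolding tsum_def by (rule sum.mono_neutral_cong_right) (use assms in auto)
  also have "... = (\<Sum>j\<le>Suc n - p. x j)"
   by (rule srbw[of _ "%j. j+p" "%j. j - p"]) (use assms in auto)
  finally show ?thesis using stx_sum[OF x] by simp
 qed
 have m: "mrg i (%j. if j < p then 0 else x (j - p))=(%j. if j < p - 1 then 0 else x (j - (p - 1)))" for x
  using assms by (auto simp: mrg_def fei)
 note m = m[unfolded One_nat_def]
 show ?thesis
  using assms stx_shift'[of _ "Suc n" p] t m
  by (intro ext) (simp add: back_face_def prism_def smd)
qed

text \<open>The prism pieces put the moving vertex first, so a cochain vanishing at the final end of the
 homotopy kills all terms in which the left factor sees the prism.\<close>

lemma hop_cup:
 assumes "fclosed T" "eqn T (pb (H 1) fi) 0"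
 shows "eqn T (hop H (al \<smile> fi)) (ci (pb (H 0) al) \<smile> hop H fi)"
 unfolding eqn_def
proof (intro allI ballI)
 fix n sg assume sg: "sg:T n"
 define F where "F i p=(-1) ^ i * (al p (ffc p (prism H n i sg)) *
   fi (Suc n - p) (bfc p (Suc n - p) (prism H n i sg)))" for i p
 have z: "F i p=0" if "i < p" "p<=Suc n" "i<=n" for i p
 proof -
  have "bfc (p - 1) (n - (p - 1)) sg:T (n - (p - 1))"
   using sg assms(1) that by (intro fcl_back) auto
  moreover have "n - (p - 1)=Suc n - p" using that by simp
  ultimately have "pb (H 1) fi (Suc n - p) (bfc (p - 1) (Suc n - p) sg)=0"
   using assms(2) by (simp add: eqn_def)
  then show ?thesis
   using bf_prism_top[OF that, of H sg] by (simp add: F_def pb_def)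
 qed
 have "hop H (al \<smile> fi) n sg=(\<Sum>i\<le>n. \<Sum>p\<le>Suc n. F i p)"
  by (simp add: hop_def cupt_def F_def sum_distrib_left del: sas)
 also have "... = (\<Sum>i\<le>n. \<Sum>p\<le>i. F i p)"
  by (intro suco sum.mono_neutral_right) (auto intro: z)
 also have "... = (\<Sum>(i, p)\<in>(SIGMA i:{..n}. {..i}). F i p)"
  by (rule sum.Sigma) auto
 also have "... = (\<Sum>(p, j)\<in>(SIGMA p:{..n}. {..n - p}). F (p+j) p)"
  by (rule srbw[of _ "%(p, j). (p+j, p)" "%(i, p). (p, i - p)"]) auto
 also have "... = (\<Sum>p\<le>n. \<Sum>j\<le>n - p. F (p+j) p)"
  by (rule sum.Sigma[symmetric]) auto
 also have "... = (\<Sum>p\<le>n. \<Sum>j\<le>n - p. (-1) ^ p * al p (smap1 p (H 0) (ffc p sg)) *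
   ((-1) ^ j * fi (Suc (n - p)) (prism H (n - p) j (bfc p (n - p) sg))))"
 proof (intro suco refl)
  fix p j assume "p:{..n}" "j:{..n - p}"
  then show "F (p+j) p=(-1) ^ p * al p (smap1 p (H 0) (ffc p sg)) *
   ((-1) ^ j * fi (Suc (n - p)) (prism H (n - p) j (bfc p (n - p) sg)))"
   using bf_prism[of p "p+j" n H sg]
   by (simp add: F_def ff_prism power_add Suc_diff_le)
 qed
 also have "... = (ci (pb (H 0) al) \<smile> hop H fi) n sg"
  by (simp add: cupt_def ci_def pb_def hop_def sum_distrib_left)
 finally show "hop H (al \<smile> fi) n sg=(ci (pb (H 0) al) \<smile> hop H fi) n sg" .
qed

lemma Sing_prism:
 assumes H: "cmap (prt (topo {0..1}) X) Y (%(t, x). H t x)"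
  and sg: "sg:Sing X n" and i: "i<=n"
 shows "prism H n i sg:Sing Y (Suc n)"
proof -
 let ?D = "%m. sbt1 (powertop_real UNIV) (stsx m)"
 have p: "cmap (?D m) euc (%x. x j)" for m j
  by (intro cmfs continuous_map_product_projection) auto
 have "cmap (?D (Suc n)) (topo {0..1}) (tsum (Suc i) (Suc n))"
  unfolding cmis
 proof
  show "cmap (?D (Suc n)) euc (tsum (Suc i) (Suc n))"
   unfolding tsum_def by (intro continuous_map_sum p) auto
 qed (auto intro: tsum_nonneg tsum_le_1)
 moreover have "cmap (?D (Suc n)) X (sg \<circ> mrg i)"
 proof (rule cmc)
  show "cmap (?D (Suc n)) (?D n) (mrg i)"
   unfolding cmis
  proof
   have "cmap (?D (Suc n)) euc (%x. mrg i x j)" for j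
    unfolding mrg_def by (auto intro!: continuous_map_add p)
   then show "cmap (?D (Suc n)) (powertop_real UNIV) (mrg i)"
    by (simp add: continuous_map_componentwise_UNIV)
  qed (use i mrg_in_simplex in auto)
  show "cmap (?D n) X sg"
   using sg by (simp add: Sing_def ssd)
 qed
 ultimately have "cmap (?D (Suc n)) (prt (topo {0..1}) X)
   (%x. (tsum (Suc i) (Suc n) x, (sg \<circ> mrg i) x))"
  by (rule continuous_map_pairedI)
 then have "cmap (?D (Suc n)) Y ((%(t, x). H t x) \<circ> (%x. (tsum (Suc i) (Suc n) x, (sg \<circ> mrg i) x)))"
  using H by (rule cmc)
 then show ?thesis
  unfolding Sing_def prism_def ssd by (simp add: o_def continuous_map_eq)
qed

lemma eq_hop:
 assumes "eqn R fi ps" "!!n i sg. sg:T n==>i<=n==>prism H n i sg:R (Suc n)"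
 shows "eqn T (hop H fi) (hop H ps)"
 using assms by (auto simp: eqn_def hop_def intro!: suco)

lemma eq_hop0:
 assumes "eqn R fi 0" "!!n i sg. sg:T n==>i<=n==>prism H n i sg:R (Suc n)"
 shows "eqn T (hop H fi) 0"
 using eq_hop[of R fi 0 T H] assms by simp

section \<open>Small simplices\<close>

definition ev :: "'a tc=>nat=>'a chain=>int" where
 "ev fi n c=(\<Sum>sg\<in>pmk c. Poly_Mapping.lookup c sg * fi n sg)"

lemma ev_alt: "ev fi n c=Poly_Mapping.lookup (frag_extend (%sg. frag_cmul (fi n sg) (frof ())) c) ()"
 by (simp add: ev_def frag_extend_def lookup_sum)

lemma ev_0 [simp]: "ev fi n 0=0"
 by (simp add: ev_def)

lemma ev_of [simp]: "ev fi n (frof sg)=fi n sg"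
 by (simp add: ev_def)

lemma ev_add: "ev fi n (a+b)=ev fi n a+ev fi n b"
 and ev_df: "ev fi n (a - b)=ev fi n a - ev fi n b"
 and ev_cmul: "ev fi n (frag_cmul m a)=m * ev fi n a"
 by (simp_all add: ev_alt frag_extend_add frag_extend_diff frag_extend_cmul lookup_add lookup_minus)

lemma ev_sum: "ev fi n (\<Sum>i\<in>I. f i)=(\<Sum>i\<in>I. ev fi n (f i))"
 by (induction I rule: infinite_finite_induct) (auto simp: ev_add)

lemma ev_cd: "ev (cd fi) (Suc n) c=ev fi n (bdry1 (Suc n) c)"
proof -
 have "c:{c. pmk c \<subseteq> UNIV}" by simp
 then show ?thesis
  unfolding mem_Collect_eq
 proof (induction c rule: frag_induction)
  case (one sg)
  then show ?case
   by (simp add: chain_boundary_of cd_Suc ev_sum ev_cmul del: sas)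
 qed (simp_all add: chain_boundary_diff ev_df)
qed

definition small :: "'a topology=>'a set set=>'a simps" where
 "small X CC n={sg. ssx1 n X sg&(EX U:CC. sg ` stsx n \<subseteq> U)}"

lemma fcl_UN:
 assumes "!!i. i:I==>fclosed (T i)" and "!!n. S n=(\<Union>i\<in>I. T i n)"
 shows "fclosed S"
 unfolding fclosed_def
proof (intro allI ballI)
 fix n sg assume "sg:S n"
 then obtain i where i: "i:I" "sg:T i n" using assms(2) by auto
 have "T i m \<subseteq> S m" for m using i(1) assms(2) by auto
 then show "sg:extensional (stsx n) &
   (0 < n-->(ALL k<=n. sface1 n k sg:S (n - 1))) &
   (ALL p<=n. ffc p sg:S p&bfc p (n - p) sg:S (n - p))"
  using assms(1)[OF i(1), unfolded fclosed_def, rule_format, OF i(2)] by blast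
qed

lemma fcl_small [simp]: "fclosed (small X CC)"
 by (rule fcl_UN[of CC "Sub X"]) (auto simp: small_def Sing_def sss)

lemma sm_pair: "small X {U, V}=sup (Sub X U) (Sub X V)"
 by (auto simp: fei small_def Sing_def sss)

abbreviation smc :: "'a topology=>'a set set=>nat=>'a chain=>bool" where
 "smc X CC n c == pmk c \<subseteq> small X CC n"

lemma smc_df: "smc X CC n a==>smc X CC n b==>smc X CC n (a - b)"
 using keys_diff[of a b] by blast

lemma ev_small: "eqn (small X CC) fi 0==>smc X CC n c==>ev fi n c=0"
 unfolding ev_def eqn_def by (intro sum.neutral) auto

lemma smc_boundary:
 assumes "smc X CC (Suc n) c"
 shows "smc X CC n (bdry1 (Suc n) c)"
 using assms
proof (induction c rule: frag_induction)
 case (one sg)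
 have "smc X CC n (frag_cmul ((-1) ^ k) (frof (sface1 (Suc n) k sg)))" if "k<=Suc n" for k
  using fcl_face[OF fcl_small one that] using keys_cmul[of "(-1) ^ k" "frof (sface1 (Suc n) k sg)"] by auto
 then have "(\<Union>k\<le>Suc n. pmk (frag_cmul ((-1) ^ k) (frof (sface1 (Suc n) k sg)))) \<subseteq> small X CC n"
  by blast
 with keys_sum have "smc X CC n (\<Sum>k\<le>Suc n. frag_cmul ((-1) ^ k) (frof (sface1 (Suc n) k sg)))"
  by (rule order_trans)
 then show ?case by (simp add: chain_boundary_of)
qed (simp_all add: chain_boundary_diff smc_df)

text \<open>A simplex inside U is a chain of the subspace U, and \<open>h\<close> maps chains of
  this subspace to chains of it. That is why \<open>h\<close> is required to work for all topologies
  at once.\<close>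

lemma smc_natural:
 assumes h0: "h p 0=0" and hd: "!!c1 c2. h p (c1 - c2)=h p c1 - h p c2"
  and h: "!!X c. schain p X c==>schain (Suc p) X (h p c)"
  and c: "smc X CC p c"
 shows "smc X CC (Suc p) (h p c)"
 using c
proof (induction c rule: frag_induction)
 case (one sg)
 then obtain U where U: "U:CC" "ssx1 p (sbt1 X U) sg"
  by (auto simp: small_def sss)
 then have "schain (Suc p) (sbt1 X U) (h p (frof sg))"
  by (intro h) (simp add: singular_chain_of)
 then show ?case
  using U(1) unfolding singular_chain_def small_def sss by blast
qed (simp_all add: h0 hd smc_df)

text \<open>With \<open>h\<close> the homotopy from the identity to m-fold subdivision,
  \<open>e = - h n c\<close> turns \<open>c - bdry1 (Suc n) e\<close> into the subdivided c minus
  \<open>h\<close> of its boundary, and both are small. By naturality of \<open>h\<close> the chain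
  e stays in A.\<close>

lemma sm_step:
 assumes op: "!!U. U:CC==>openin X U" and cov: "tsp1 X \<subseteq> \<Union>CC"
  and c: "schain n (sbt1 X A) c"
  and bd: "n=0 | smc X CC (n - 1) (bdry1 n c)"
 obtains e where "schain (Suc n) (sbt1 X A) e" "smc X CC n (c - bdry1 (Suc n) e)"
proof -
 have cX: "schain n X c"
  using c by (simp add: singular_chain_subtopology)
 obtain m where m: "!!k f. m<=k==>f:pmk ((singular_subdivision n ^^ k) c)==>EX V:CC. f:stsx n \<rightarrow> V"
  using sufficient_iterated_singular_subdivision_exists[OF op cov cX] by metis
 obtain h where h: "!!p. h p 0=(0 :: 'a chain)" "!!p c1 c2. h p (c1 - c2)=h p c1 - h p c2"
   "!!p X c. schain p X c==>schain (Suc p) X (h p c)"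
   "!!p X c. schain p X c==>bdry1 (Suc p) (h p c)+h (p - Suc 0) (bdry1 p c)
     = (singular_subdivision p ^^ m) c - c"
  by (rule chain_homotopic_iterated_singular_subdivision[of m]) blast
 have sd: "schain n X ((singular_subdivision n ^^ k) c)" for k
  by (induction k) (auto simp: cX singular_chain_singular_subdivision)
 have "smc X CC n ((singular_subdivision n ^^ m) c)"
 proof
  fix f assume f: "f:pmk ((singular_subdivision n ^^ m) c)"
  then have "ssx1 n X f" using sd[of m] by (auto simp: singular_chain_def)
  then show "f:small X CC n" using m[OF order_refl f] by (auto simp: small_def)
 qed
 moreover have "smc X CC n (h (n - Suc 0) (bdry1 n c))"
 proof (cases n)
  case 0
  then show ?thesis by (simp add: chain_boundary_def h(1))
 next
  case (Suc k)
  then show ?thesis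
   using smc_natural[where h=h, OF h(1,2) h(3), where X=X and CC=CC and p=k and c="bdry1 n c"] bd by simp
 qed
 ultimately have "smc X CC n ((singular_subdivision n ^^ m) c - h (n - Suc 0) (bdry1 n c))"
  by (rule smc_df)
 also have "(singular_subdivision n ^^ m) c - h (n - Suc 0) (bdry1 n c) = c - bdry1 (Suc n) (- h n c)"
  using h(4)[OF cX] by (simp add: chain_boundary_minus alsi)
 finally show ?thesis
  using that[of "- h n c"] h(3)[OF c] by (simp add: singular_chain_minus)
qed

lemma keys_bdry_sub:
 "schain n X c==>schain (n - 1) X (bdry1 n c)"
 using singular_chain_boundary by simp

text \<open>One degree of a chain homotopy from the identity to a map into small chains. It is
  carried by the image of each simplex and is 0 on small simplices; both properties control where
  the primitives in \<open>sm_xct\<close> vanish.\<close>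

definition cstep ::
  "'a topology=>'a set set=>nat=>('a simp=>'a chain)=>('a simp=>'a chain)=>bool" where
 "cstep X CC n D' D<->(ALL sg. ssx1 n X sg -->
  schain (Suc n) (sbt1 X (sg ` stsx n)) (D sg) &
  (sg:small X CC n-->D sg=0) &
  smc X CC n (frof sg - bdry1 (Suc n) (D sg) - frag_extend D' (bdry1 n (frof sg))))"

lemma cstep_chain:
 assumes "cstep X CC n D' D" "schain n X b"
 shows "smc X CC n (b - bdry1 (Suc n) (frag_extend D b) - frag_extend D' (bdry1 n b))"
 using assms(2) unfolding singular_chain_def
proof (induction b rule: frag_induction)
 case (one sg)
 then show ?case using assms(1) by (simp add: cstep_def)
next
 case (diff a b)
 from smc_df[OF diff] show ?case
  by (simp add: chain_boundary_diff frag_extend_diff alsi)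
qed simp

lemma frag_ext_small:
 assumes "cstep X CC n D' D" "smc X CC n b"
 shows "frag_extend D b=0"
 using assms(2)
proof (induction b rule: frag_induction)
 case (one sg)
 then show ?case using assms(1) by (auto simp: cstep_def small_def)
qed (simp_all add: frag_extend_diff)

text \<open>Recursion on the degree. For a simplex that is not small, the simplex minus
  \<open>D\<close> of its boundary has small boundary, by the homotopy property in the previous
  degree and because the boundary of a boundary is 0; then \<open>sm_step\<close> applies.\<close>

lemma cstep_ex:
 assumes op: "!!U. U:CC==>openin X U" and cov: "tsp1 X \<subseteq> \<Union>CC"
 obtains D where "cstep X CC 0 (%_. 0) (D 0)" "!!n. cstep X CC (Suc n) (D n) (D (Suc n))"
proof -
 have "EX D. cstep X CC 0 (%_. 0) (D 0)&(ALL n. cstep X CC (Suc n) (D n) (D (Suc n)))"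
 proof -
  \<comment> \<open>In degree 0 the preceding map is the zero map; afterwards it is enough to
    remember that some preceding map exists.\<close>
  define good where "good n D<->(if n=0 then cstep X CC 0 (%_. 0) D else EX D'. cstep X CC n D' D)"
   for n :: nat and D
  have base: "good 0 (%_. 0)"
  proof -
   have "sg:small X CC 0" if "ssx1 0 X sg" for sg
   proof -
    have "sg (%j. if j=0 then 1 else 0):tsp1 X"
     using that unfolding ssd by (force simp: standard_simplex_0 cmd)
    then show ?thesis
     using cov that unfolding small_def standard_simplex_0 by auto
   qed
   then show ?thesis
    by (auto simp: good_def cstep_def chain_boundary_def)
  qed
  have step: "EX E. good (Suc n) E&cstep X CC (Suc n) D E" if D: "good n D" for n D
  proof -
   obtain D' where D': "cstep X CC n D' D" using D by (auto simp: good_def split: if_splits)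
   have D'0: "n=0==>frag_extend D' (bdry1 n b)=0" for b
    by (simp add: chain_boundary_def)
   have "EX e. schain (Suc (Suc n)) (sbt1 X (sg ` stsx (Suc n))) e &
     (sg:small X CC (Suc n)-->e=0) &
     smc X CC (Suc n) (frof sg - bdry1 (Suc (Suc n)) e - frag_extend D (bdry1 (Suc n) (frof sg)))"
    if sg: "ssx1 (Suc n) X sg" for sg
   proof (cases "sg:small X CC (Suc n)")
    case True
    then have "smc X CC n (bdry1 (Suc n) (frof sg))"
     by (intro smc_boundary) simp
    then have "frag_extend D (bdry1 (Suc n) (frof sg))=0"
     by (rule frag_ext_small[OF D'])
    then show ?thesis using True by (intro exI[of _ 0]) simp
   next
    case False
    define A where "A=sg ` stsx (Suc n)"
    let ?b = "bdry1 (Suc n) (frof sg)"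
    have sgA: "schain (Suc n) (sbt1 X A) (frof sg)"
     using sg by (simp add: singular_chain_of sss A_def)
    have bA: "schain n (sbt1 X A) ?b"
     using keys_bdry_sub[OF sgA] by simp
    have "schain (Suc n) (sbt1 X A) (frag_extend D ?b)"
    proof (rule singular_chain_extend)
     fix ta assume "ta:pmk ?b"
     then have ta: "ssx1 n X ta" "ta ` stsx n \<subseteq> A"
      using bA unfolding singular_chain_def sss by blast+
     then have "schain (Suc n) (sbt1 X (ta ` stsx n)) (D ta)"
      using D' by (simp add: cstep_def)
     then show "schain (Suc n) (sbt1 X A) (D ta)"
      using ta(2) by (rule singular_chain_mono)
    qed
    then have c: "schain (Suc n) (sbt1 X A) (frof sg - frag_extend D ?b)"
     using sgA by (intro singular_chain_diff)
    have bX: "schain n X ?b" using bA by (simp add: singular_chain_subtopology)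
    have "bdry1 n ?b=0"
     using chain_boundary_boundary[of "Suc n" X "frof sg"] sg by (simp add: singular_chain_of)
    then have "smc X CC n (bdry1 (Suc n) (frof sg - frag_extend D ?b))"
     using cstep_chain[OF D' bX] by (simp add: chain_boundary_diff)
    then obtain e where "schain (Suc (Suc n)) (sbt1 X A) e"
      "smc X CC (Suc n) (frof sg - frag_extend D ?b - bdry1 (Suc (Suc n)) e)"
     using sm_step[OF op cov c] by auto
    then show ?thesis
     using False unfolding A_def by (intro exI[of _ e]) (simp add: alsi)
   qed
   then obtain E where "cstep X CC (Suc n) D E"
    unfolding cstep_def by metis
   then show ?thesis by (auto simp: good_def)
  qed
  obtain D where "!!n. good n (D n)" "!!n. cstep X CC (Suc n) (D n) (D (Suc n))"
   using dependent_nat_choice[of good "%n D E. cstep X CC (Suc n) D E"] base step by metis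
  then show ?thesis by (metis good_def)
 qed
 then show ?thesis using that by blast
qed

text \<open>The theorem of small simplices on cochains, with control of supports: the primitive
  evaluates \<open>ze\<close> on the homotopy \<open>D\<close>, which does not leave the image of a
  simplex, so it inherits the vanishing of \<open>ze\<close> on subspaces.\<close>

lemma sm_xct:
 assumes op: "!!U. U:CC==>openin X U" and cov: "tsp1 X \<subseteq> \<Union>CC"
  and cl: "eqn (Sing X) (cd ze) 0" and van: "eqn (small X CC) ze 0"
 obtains et where "eqn (Sing X) ze (cd et)" "eqn (small X CC) et 0"
  "!!A. eqn (Sub X A) ze 0==>eqn (Sub X A) et 0"
proof -
 obtain D where D0: "cstep X CC 0 (%_. 0) (D 0)"
  and DS: "!!n. cstep X CC (Suc n) (D n) (D (Suc n))"
  using cstep_ex[OF op cov] by metis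
 have D: "EX D'. cstep X CC n D' (D n)" for n
  using D0 DS by (cases n) auto
 define et :: "'a tc" where "et n sg=ev ze (Suc n) (D n sg)" for n sg
 have cl0: "ev (cd ze) n c=0" if "schain n X c" for n c
  using that cl by (auto simp: ev_def eqn_def singular_chain_def Sing_def intro!: sum.neutral)
 show ?thesis
 proof
  show "eqn (small X CC) et 0"
   unfolding eqn_def
  proof (intro allI ballI)
   fix n sg assume "sg:small X CC n"
   then have "D n sg=0" using D[of n] by (auto simp: cstep_def small_def)
   then show "et n sg=0 n sg" by (simp add: et_def)
  qed
  show "eqn (Sub X A) et 0" if A: "eqn (Sub X A) ze 0" for A
   unfolding eqn_def
  proof (intro allI ballI)
   fix n sg assume "sg:Sub X A n"
   then have sg: "ssx1 n X sg" "sg ` stsx n \<subseteq> A"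
    by (auto simp: Sing_def sss)
   then have "schain (Suc n) (sbt1 X A) (D n sg)"
    using D[of n] singular_chain_mono unfolding cstep_def by blast
   then show "et n sg=0 n sg"
    using A by (auto simp: et_def ev_def eqn_def singular_chain_def Sing_def intro!: sum.neutral)
  qed
  show "eqn (Sing X) ze (cd et)"
   unfolding eqn_def
  proof (intro allI ballI)
   fix n sg assume "sg:Sing X n"
   then have sg: "ssx1 n X sg" by (simp add: Sing_def)
   have ch: "schain (Suc n) X (D n sg)"
    using D[of n] sg by (auto simp: cstep_def singular_chain_subtopology)
   \<comment> \<open>A closed cochain vanishes on boundaries. What remains of the homotopy formula
     is \<open>ze\<close> on \<open>D\<close> of the boundary of \<open>sg\<close>, and this is
     \<open>cd et n sg\<close>.\<close>
   have b: "ev ze n (bdry1 (Suc n) (D n sg))=0"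
    using cl0[OF ch] by (simp add: ev_cd)
   show "ze n sg = cd et n sg"
   proof (cases n)
    case 0
    have "smc X CC 0 (frof sg - bdry1 (Suc 0) (D 0 sg))"
     using D0 sg 0 by (auto simp: cstep_def chain_boundary_def)
    from ev_small[OF van this] show ?thesis
     using b 0 by (simp add: ev_df cd_0)
   next
    case (Suc m)
    have "smc X CC n (frof sg - bdry1 (Suc n) (D n sg) - frag_extend (D m) (bdry1 n (frof sg)))"
     using DS[of m] sg Suc by (simp add: cstep_def)
    from ev_small[OF van this]
    have "ze n sg=ev ze n (frag_extend (D m) (bdry1 n (frof sg)))"
     using b by (simp add: ev_df)
    also have "bdry1 n (frof sg)=(\<Sum>k\<le>n. frag_cmul ((-1) ^ k) (frof (sface1 n k sg)))"
     by (simp add: chain_boundary_of Suc)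
    also have "ev ze n (frag_extend (D m) ...) = cd et n sg"
     unfolding Suc cd_Suc
     by (simp add: frag_extend_sum frag_extend_cmul ev_sum ev_cmul et_def del: sas)
    finally show ?thesis .
   qed
  qed
 qed
qed

section \<open>Leray-Hirsch and Thom data\<close>

lemma pb_cong: "(!!x. x:tsp1 X==>f x=g x)==>eqn (Sing X) (pb f ps) (pb g ps)"
 by (auto simp: eqn_def pb_def Sing_def simplex_map_eq[of _ X _ f g])

lemma pb_id_on: "(!!x. x:tsp1 X==>f x=x)==>eqn (Sing X) (pb f ps) ps"
 by (auto simp: eqn_def pb_def Sing_def simplex_map_id_gen)

lemma hty_cl:
 assumes "cmap (prt (topo {0..1}) X) Y (%(t, x). H t x)"
  and "eqn (Sing Y) (cd ps) 0"
 shows "eqn (Sing X) (pb (H 1) ps) (pb (H 0) ps + cd (hop H ps))"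
proof -
 have "eqn (Sing X) (hop H (cd ps)) 0"
  using eq_hop0[OF assms(2), of "Sing X" H] Sing_prism[OF assms(1)] by blast
 moreover have "pb (H 1) ps=pb (H 0) ps + cd (hop H ps)+hop H (cd ps)"
  using hop_cd[of H ps] by (simp add: alsi)
 ultimately show ?thesis
  by (simp add: eqn_def)
qed

definition lin :: "('a=>'b)=>nat=>(nat=>'a tc)=>(nat=>'b tc)=>'a tc" where
 "lin pj n e b=(\<Sum>j<n. pb pj (b j) \<smile> e j)"

text \<open>A pair (a, ps) as in the premise is a cocycle of the mapping cone of \<open>lin\<close>,
  from n copies of the cochains on R to the cochains on T relative to N; the conclusion makes it a
  coboundary. The case a = 0 is surjectivity in cohomology, and exactness of the \<open>a j\<close>
  is injectivity.\<close>

definition LH :: "'b simps=>'a simps=>'a simps=>('a=>'b)=>nat=>(nat=>'a tc)=>bool" where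
 "LH R T N pj n e<->(ALL a ps. (ALL j<n. eqn R (cd (a j)) 0)&eqn N ps 0&eqn T (cd ps) (lin pj n e a) -->
  (EX b tt. (ALL j<n. eqn R (a j) (cd (b j)))&eqn N tt 0&eqn T ps (lin pj n e b + cd tt)))"

text \<open>The Thom isomorphism as a cone condition: multiplication by \<open>et\<close> from the
  cohomology of T to that of the pair (T, N).\<close>

definition TH :: "'a simps=>'a simps=>'a tc=>bool" where
 "TH T N et<->(ALL a ps. eqn T (cd a) 0&eqn N ps 0&eqn T (cd ps) (a \<smile> et) -->
  (EX b tt. eqn T a (cd b)&eqn N tt 0&eqn T ps ((b \<smile> et) + cd tt)))"

definition maps :: "('a=>'b)=>'a simps=>'b simps=>bool" where
 "maps f T R<->(ALL n. ALL sg:T n. smap1 n f sg:R n)"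

lemma mp_eqn: "maps f T R==>eqn R fi ps==>eqn T (pb f fi) (pb f ps)"
 by (auto simp: maps_def eqn_def pb_def)

lemma mp_Sing: "cmap X Y f==>maps f (Sing X) (Sing Y)"
 by (simp add: maps_def Sing_map)

lemma mp_sup: "maps f T1 R1==>maps f T2 R2==>maps f (sup T1 T2) (sup R1 R2)"
 by (auto simp: maps_def)

lemma lin_df: "lin pj n e (%j. a j - b j)=lin pj n e a - lin pj n e b"
 by (simp add: lin_def pb_df cup_df_l sum_subtractf)

lemma eq_lin: "maps pj T R==>fclosed T==>(!!j. j < n==>eqn R (a j) (b j))==>eqn T (lin pj n e a) (lin pj n e b)"
 unfolding lin_def by (intro eq_sum eq_cup mp_eqn eq_refl) auto

lemma eq_lin_e: "fclosed T==>(!!j. j < n==>eqn T (e j) (f j))==>eqn T (lin pj n e a) (lin pj n f a)"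
 unfolding lin_def by (intro eq_sum eq_cup eq_refl) auto

lemma eq_lin0: "fclosed T==>(!!j. j < n==>eqn T (e j) 0)==>eqn T (lin pj n e a) 0"
 unfolding lin_def by (intro eq_sum0 eq_cup0_r) auto

lemma cd_lin:
 assumes "fclosed T" "!!j. j < n==>eqn T (cd (e j)) 0"
 shows "eqn T (cd (lin pj n e b)) (lin pj n e (%j. cd (b j)))"
proof -
 have "eqn T (cd (pb pj (b j) \<smile> e j)) (pb pj (cd (b j)) \<smile> e j)" if "j < n" for j
  using eq_cup0_r[OF assms(2)[OF that] assms(1), of "ci (pb pj (b j))"]
  by (simp add: cd_cup pb_cd eqn_def)
 then show ?thesis
  unfolding lin_def cd_sum by (intro eq_sum) auto
qed

text \<open>Total cochains are arbitrary functions on simplices, so a cochain on R extends by any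
  other one. This plays the part of surjectivity of restriction maps; \<open>pick0\<close> tells
  where an extension by zero vanishes.\<close>

definition pick :: "'a simps=>'a tc=>'a tc=>'a tc" where
 "pick R a b n sg=(if sg:R n then a n sg else b n sg)"

lemma pick_in: "eqn R (pick R a b) a"
 by (simp add: eqn_def pick_def)

lemma pick_out: "eqn (inf R S) a b==>eqn S (pick R a b) b"
 by (auto simp: eqn_def pick_def)

lemma pick0: "eqn (inf R S) a 0==>eqn S (pick R a 0) 0"
 by (rule pick_out)

lemma LHD:
 assumes "LH R T N pj n e" "!!j. j < n==>eqn R (cd (a j)) 0" "eqn N ps 0" "eqn T (cd ps) (lin pj n e a)"
 obtains b tt where "!!j. j < n==>eqn R (a j) (cd (b j))" "eqn N tt 0" "eqn T ps (lin pj n e b + cd tt)"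
 using assms unfolding LH_def by blast

text \<open>The two local solutions differ on the overlap by a cone cocycle. Its primitive (c, wm),
  with \<open>wm\<close> extended by zero, corrects the first solution so that it agrees with the
  second one.\<close>

lemma LH_MV:
 assumes fc: "fclosed R1" "fclosed R2" "fclosed T1" "fclosed T2" "fclosed N1" "fclosed N2"
  and m: "maps pj T1 R1" "maps pj T2 R2"
  and N: "N1<=T1" "N2<=T2" "inf N1 T2<=N2" "inf N2 T1<=N1"
  and cl: "!!j. j < n==>eqn (sup T1 T2) (cd (e j)) 0"
  and e0: "!!j. j < n==>eqn (sup N1 N2) (e j) 0"
  and L1: "LH R1 T1 N1 pj n e" and L2: "LH R2 T2 N2 pj n e"
  and L12: "LH (inf R1 R2) (inf T1 T2) (inf N1 N2) pj n e"
 shows "LH (sup R1 R2) (sup T1 T2) (sup N1 N2) pj n e"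
 unfolding LH_def
proof (intro allI impI, elim conjE)
 fix a ps
 assume a: "ALL j<n. eqn (sup R1 R2) (cd (a j)) 0" and ps0: "eqn (sup N1 N2) ps 0"
  and ps: "eqn (sup T1 T2) (cd ps) (lin pj n e a)"
 have cl1: "j < n==>eqn T1 (cd (e j)) 0" "j < n==>eqn T2 (cd (e j)) 0" for j
  using cl by (auto simp: eq_sup)
 obtain b1 tt1 where 1: "!!j. j < n==>eqn R1 (a j) (cd (b1 j))" "eqn N1 tt1 0" "eqn T1 ps (lin pj n e b1 + cd tt1)"
  by (rule LHD[OF L1, of a ps]) (use a ps0 ps in "auto simp: eq_sup")
 obtain b2 tt2 where 2: "!!j. j < n==>eqn R2 (a j) (cd (b2 j))" "eqn N2 tt2 0" "eqn T2 ps (lin pj n e b2 + cd tt2)"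
  by (rule LHD[OF L2, of a ps]) (use a ps0 ps in "auto simp: eq_sup")
 have i1: "inf T1 T2<=T1" "inf T1 T2<=T2" by simp_all
 have "eqn (inf T1 T2) (lin pj n e b1 + cd tt1) (lin pj n e b2 + cd tt2)"
  using eq_mono[OF 1(3) i1(1)] eq_mono[OF 2(3) i1(2)] eq_sym eq_trans by blast
 then have "eqn (inf T1 T2) (cd (tt2 - tt1)) (lin pj n e (%j. b1 j - b2 j))"
  by (auto simp: lin_df cd_df eqn_def alsi)
 moreover have "eqn (inf N1 N2) (tt2 - tt1) 0"
  using 1(2) 2(2) by (auto simp: eqn_def)
 moreover have "eqn (inf R1 R2) (cd (b1 j - b2 j)) 0" if "j < n" for j
  unfolding cd_df
  by (rule eq_df0[THEN iffD1], rule eq_trans[OF eq_sym[OF eq_mono[OF 1(1)[OF that]]] eq_mono[OF 2(1)[OF that]]])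
   simp_all
 ultimately obtain c wm where c: "!!j. j < n==>eqn (inf R1 R2) (b1 j - b2 j) (cd (c j))"
   and wm: "eqn (inf N1 N2) wm 0" "eqn (inf T1 T2) (tt2 - tt1) (lin pj n e c + cd wm)"
  using LHD[OF L12, of "%j. b1 j - b2 j" "tt2 - tt1"] by blast
 \<comment> \<open>\<open>wm\<close> is known to vanish on \<open>inf N1 N2\<close> only, its
   extension by zero on all of \<open>N1\<close>.\<close>
 define wm' where "wm'=pick (inf T1 T2) wm 0"
 have wm'T: "eqn (inf T1 T2) wm' wm" unfolding wm'_def by (rule pick_in)
 have wm'N: "eqn N1 wm' 0" unfolding wm'_def
  by (rule pick0) (rule eq_mono[OF wm(1)], use N in "auto simp: le_fun_def")
 define b where "b j=pick R1 (b1 j - cd (c j)) (b2 j)" for j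
 define tt where "tt=pick T1 (tt1+lin pj n e c + cd wm') tt2"
 have b: "eqn R1 (b j) (b1 j - cd (c j))" for j unfolding b_def by (rule pick_in)
 have b': "eqn R2 (b j) (b2 j)" if "j < n" for j unfolding b_def
  by (rule pick_out) (use c[OF that] in "auto simp: eqn_def alsi")
 have tt: "eqn T1 tt (tt1+lin pj n e c + cd wm')" unfolding tt_def by (rule pick_in)
 have tt': "eqn T2 tt tt2" unfolding tt_def
  by (rule pick_out) (use wm(2) eq_cd[OF wm'T] fc in "auto simp: fcl_inf eqn_def alsi")
 show "EX b tt. (ALL j<n. eqn (sup R1 R2) (a j) (cd (b j)))&eqn (sup N1 N2) tt 0 &
   eqn (sup T1 T2) ps (lin pj n e b + cd tt)"
 proof (intro exI[of _ b] exI[of _ tt] conjI allI impI)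
  fix j assume j: "j < n"
  show "eqn (sup R1 R2) (a j) (cd (b j))"
   using eq_cd[OF b fc(1), of j] eq_cd[OF b'[OF j] fc(2)] 1(1)[OF j] 2(1)[OF j]
   by (auto simp: eq_sup eqn_def cd_df)
 next
  have "eqn N1 (lin pj n e c) 0"
   by (rule eq_lin0) (use fc e0 in "auto simp: eq_sup")
  moreover have "eqn N1 (cd wm') 0"
   using eq_cd[OF wm'N fc(5)] by simp
  ultimately have "eqn N1 tt 0"
   using 1(2) eq_mono[OF tt N(1)] by (auto simp: eqn_def)
  moreover have "eqn N2 tt 0"
   using 2(2) eq_mono[OF tt' N(2)] by (auto simp: eqn_def)
  ultimately show "eqn (sup N1 N2) tt 0"
   by (simp add: eq_sup)
 next
  have "eqn T1 (lin pj n e b) (lin pj n e b1 - lin pj n e (%j. cd (c j)))"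
   using eq_lin[OF m(1) fc(3) b, where n=n and e=e] by (simp add: lin_df)
  moreover have "eqn T1 (cd tt) (cd tt1+lin pj n e (%j. cd (c j)))"
   using eq_cd[OF tt fc(3)] cd_lin[OF fc(3), of n e pj c] cl1
   by (auto simp: cd_add eqn_def)
  ultimately have "eqn T1 ps (lin pj n e b + cd tt)"
   using 1(3) by (auto simp: eqn_def)
  moreover have "eqn T2 ps (lin pj n e b + cd tt)"
   using eq_lin[OF m(2) fc(4) b', where n=n and e=e] eq_cd[OF tt' fc(4)] 2(3) by (auto simp: eqn_def)
  ultimately show "eqn (sup T1 T2) ps (lin pj n e b + cd tt)"
   by (simp add: eq_sup)
 qed
qed

text \<open>The solution on the smaller sets is extended; what remains is closed and vanishes on R'
  or T', and \<open>SR\<close> and \<open>ST\<close> make it exact. This serves to pass from small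
  simplices to all simplices, and for excision in \<open>LH_step\<close>.\<close>

lemma LH_ext:
 assumes fc: "fclosed R" "fclosed T" "fclosed N" "fclosed R'" "fclosed T'"
  and m: "maps pj T R" "maps pj T' R'" and le: "R' <= R" "T'<=T" "N<=T" "N'=inf N T'"
  and cl: "!!j. j < n==>eqn T (cd (e j)) 0"
  and e0: "!!j. j < n==>eqn N (e j) 0"
  and SR: "!!ze. eqn R (cd ze) 0==>eqn R' ze 0==>EX et. eqn R ze (cd et)&eqn R' et 0"
  and ST: "!!ze. eqn T (cd ze) 0==>eqn T' ze 0==>eqn N ze 0==>EX et. eqn T ze (cd et)&eqn N et 0"
  and L: "LH R' T' N' pj n e"
 shows "LH R T N pj n e"
 unfolding LH_def
proof (intro allI impI, elim conjE)
 fix a ps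
 assume a: "ALL j<n. eqn R (cd (a j)) 0" and ps0: "eqn N ps 0" and ps: "eqn T (cd ps) (lin pj n e a)"
 obtain b' tt' where 1: "!!j. j < n==>eqn R' (a j) (cd (b' j))" "eqn N' tt' 0" "eqn T' ps (lin pj n e b' + cd tt')"
  by (rule LHD[OF L, of a ps])
   (use a eq_mono[OF _ le(1)] eq_mono[OF ps0, of N'] eq_mono[OF ps le(2)] le(4) in auto)
 have "EX et. eqn R (a j - cd (b' j)) (cd et)&eqn R' et 0" if "j < n" for j
  by (rule SR) (use a 1(1)[OF that] that in "auto simp: eqn_def cd_df")
 then obtain b'' where b'': "!!j. j < n==>eqn R (a j - cd (b' j)) (cd (b'' j))" "!!j. j < n==>eqn R' (b'' j) 0"
  by metis
 define b where "b j=b' j+b'' j" for j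
 have b: "eqn R (a j) (cd (b j))" if "j < n" for j
  using b''(1)[OF that] by (auto simp: b_def cd_add eqn_def alsi)
 define tt0 where "tt0=pick T' tt' 0"
 have tt0T: "eqn T' tt0 tt'" and tt0N: "eqn N tt0 0"
  unfolding tt0_def by (rule pick_in, rule pick0) (use 1(2) le(4) in "auto simp: eqn_def")
 define ps1 where "ps1=ps - lin pj n e b - cd tt0"
 have "eqn T (lin pj n e (%j. cd (b j))) (lin pj n e a)"
  by (rule eq_lin[OF m(1) fc(2)]) (use b eq_sym in blast)
 then have c1: "eqn T (cd ps1) 0"
  using ps cd_lin[OF fc(2) cl, where pj=pj and b=b] unfolding ps1_def cd_df by (simp add: eqn_def)
 have "eqn T' (lin pj n e b) (lin pj n e b')"
  by (rule eq_lin[OF m(2) fc(5)]) (use b''(2) in "auto simp: b_def eqn_def")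
 then have c2: "eqn T' ps1 0"
  using 1(3) eq_cd[OF tt0T fc(5)] unfolding ps1_def by (simp add: eqn_def)
 have "eqn N (lin pj n e b) 0" "eqn N (cd tt0) 0"
  using eq_cd[OF tt0N fc(3)] by (auto intro!: eq_lin0 fc e0)
 then have c3: "eqn N ps1 0"
  using ps0 unfolding ps1_def by (simp add: eqn_def)
 obtain tt'' where "eqn T ps1 (cd tt'')" "eqn N tt'' 0"
  using ST[OF c1 c2 c3] by blast
 then show "EX b tt. (ALL j<n. eqn R (a j) (cd (b j)))&eqn N tt 0&eqn T ps (lin pj n e b + cd tt)"
  using b tt0N by (intro exI[of _ b] exI[of _ "tt0+tt''"])
   (auto simp: ps1_def cd_add eqn_def alsi)
qed

text \<open>By \<open>swap\<close> the maps \<open>lin\<close> for e and for e' are chain homotopic,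
  the homotopy being \<open>lin\<close> with the \<open>h j\<close> and the sign \<open>ci\<close>;
  ps and tt are shifted by it.\<close>

lemma LH_change:
 assumes fc: "fclosed R" "fclosed T" "fclosed N" and m: "maps pj T R" "N<=T"
  and ch: "!!j. j < n==>eqn T (e' j) (e j + cd (h j))" and h0: "!!j. j < n==>eqn N (h j) 0"
  and L: "LH R T N pj n e"
 shows "LH R T N pj n e'"
 unfolding LH_def
proof (intro allI impI, elim conjE)
 fix a ps
 assume a: "ALL j<n. eqn R (cd (a j)) 0" and ps0: "eqn N ps 0" and ps: "eqn T (cd ps) (lin pj n e' a)"
 have lin': "eqn T (lin pj n e' b) (lin pj n e b+lin pj n (%j. cd (h j)) b)" for b
 proof -
  have "eqn T (lin pj n e' b) (lin pj n (%j. e j + cd (h j)) b)"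
   by (rule eq_lin_e[OF fc(2)]) (use ch in auto)
  then show ?thesis by (simp add: lin_def cup_add_r sum.distrib)
 qed
 have swap: "cd (lin pj n h (%j. ci (b j)))=lin pj n (%j. cd (h j)) b - lin pj n h (%j. ci (cd (b j)))" for b
  by (simp add: lin_def cd_sum cd_cup pb_ci cd_ci pb_cd cup_um_l sum_subtractf)
 have "eqn T (lin pj n h (%j. ci (cd (a j)))) 0"
 proof -
  have "eqn T (lin pj n h (%j. ci (cd (a j)))) (lin pj n h (%j. 0))"
   by (rule eq_lin[OF m(1) fc(2)]) (use a in "auto simp: eqn_def ci_def")
  also have "lin pj n h (%j. 0)=0" by (simp add: lin_def)
  finally show ?thesis .
 qed
 then have "eqn T (cd (ps - lin pj n h (%j. ci (a j)))) (lin pj n e a)"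
  using ps lin'[of a] by (simp add: cd_df swap eqn_def)
 moreover have hN: "eqn N (lin pj n h b) 0" for b
  by (rule eq_lin0[OF fc(3)]) (rule h0)
 then have "eqn N (ps - lin pj n h (%j. ci (a j))) 0"
  using ps0 by (simp add: eqn_def)
 ultimately obtain b tt where b: "!!j. j < n==>eqn R (a j) (cd (b j))" "eqn N tt 0"
   "eqn T (ps - lin pj n h (%j. ci (a j))) (lin pj n e b + cd tt)"
  using LHD[OF L, of a] a by blast
 have "eqn T (lin pj n h (%j. ci (cd (b j)))) (lin pj n h (%j. ci (a j)))"
  by (rule eq_lin[OF m(1) fc(2)]) (use b(1) in "auto simp: eqn_def ci_def")
 then have "eqn T ps (lin pj n e' b + cd (tt - lin pj n h (%j. ci (b j))))"
  using b(3) lin'[of b] unfolding cd_df swap by (simp add: eqn_def alsi)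
 moreover have "eqn N (tt - lin pj n h (%j. ci (b j))) 0"
  using b(2) hN[of "%j. ci (b j)"] by (simp add: eqn_def)
 ultimately show "EX b tt. (ALL j<n. eqn R (a j) (cd (b j)))&eqn N tt 0&eqn T ps (lin pj n e' b + cd tt)"
  using b(1) by blast
qed

lemma TH_LH: "fclosed T==>TH T N et<->LH T T N id 1 (%_. et)"
proof -
 assume T: "fclosed T"
 have pid: "eqn T (pb id a) a" for a
  using fcl_ext[OF T] by (auto simp: eqn_def pb_def extensional_restrict)
 have l: "eqn T ps (lin id 1 (%_. et) a+wm)<->eqn T ps ((a 0 \<smile> et)+wm)" for ps a wm
  using eq_cup[OF pid[of "a 0"] eq_refl[of T et] T] by (auto simp: lin_def eqn_def)
 note l' = l[of _ _ 0, simplified]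
 show ?thesis
  unfolding TH_def LH_def l
  using l'[simplified] apply (simp only: l' One_nat_def less_Suc0)
  apply (safe)
  subgoal for a ps by (drule spec[of _ "a 0"], drule spec[of _ ps]) (auto intro: exI[of _ "%_. _"])
  subgoal for a ps by (drule spec[of _ "%_. a"], drule spec[of _ ps]) auto
  done
qed

text \<open>\<open>lin\<close> for the products is \<open>lin\<close> for the \<open>e j\<close>
  followed by multiplication with \<open>et\<close>, so the two cone primitives are
  composed.\<close>

lemma LH_Thom:
 assumes fc: "fclosed R" "fclosed T" "fclosed N" and m: "maps pj T R" "N<=T"
  and cl: "!!j. j < n==>eqn T (cd (e j)) 0"
  and et0: "eqn N et 0" and et: "eqn T (cd et) 0"
  and L: "LH R T bot pj n e" and Th: "TH T N et"
 shows "LH R T N pj n (%j. e j \<smile> et)"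
 unfolding LH_def
proof (intro allI impI, elim conjE)
 have l: "lin pj n (%j. e j \<smile> et) b=lin pj n e b \<smile> et" for b
  by (simp add: lin_def cup_sum_l cup_assoc)
 fix a ps
 assume a: "ALL j<n. eqn R (cd (a j)) 0" and ps0: "eqn N ps 0" and ps: "eqn T (cd ps) (lin pj n (%j. e j \<smile> et) a)"
 have "eqn T (lin pj n e (%j. cd (a j))) (lin pj n e (%j. 0))"
  by (rule eq_lin[OF m(1) fc(2)]) (use a in auto)
 then have "eqn T (cd (lin pj n e a)) 0"
  using cd_lin[OF fc(2) cl, where pj=pj and b=a] by (simp add: lin_def eqn_def)
 then obtain B tt where B: "eqn T (lin pj n e a) (cd B)" "eqn N tt 0" "eqn T ps ((B \<smile> et) + cd tt)"
  using Th ps0 ps unfolding TH_def l by blast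
 obtain b wm where b: "!!j. j < n==>eqn R (a j) (cd (b j))" "eqn T B (lin pj n e b + cd wm)"
  by (rule LHD[OF L, of a B]) (use a B(1) in "auto simp: eq_sym, auto simp: eqn_def")
 have clet: "eqn T (B \<smile> et) ((lin pj n e b \<smile> et)+(cd wm \<smile> et))"
  using eq_cup[OF b(2) eq_refl fc(2), of et] by (simp add: cup_add_l)
 show "EX b tt. (ALL j<n. eqn R (a j) (cd (b j)))&eqn N tt 0&eqn T ps (lin pj n (%j. e j \<smile> et) b + cd tt)"
 proof (intro exI[of _ b] exI[of _ "tt+(wm \<smile> et)"] conjI allI impI)
  show "eqn N (tt+(wm \<smile> et)) 0"
   using B(2) eq_cup0_r[OF et0 fc(3), of wm] by (simp add: eqn_def)
  show "eqn T ps (lin pj n (%j. e j \<smile> et) b + cd (tt+(wm \<smile> et)))"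
   using B(3) clet eq_cup0_r[OF et fc(2), of "ci wm"] unfolding l cd_add cd_cup by (simp add: eqn_def)
 qed (use b in auto)
qed

text \<open>The coefficients b are found on T0. Then \<open>ps - lin pj n e b\<close> is closed on T
  and exact on T0, hence exact on T by \<open>inj\<close>. In \<open>V_rtr\<close> T0 will be a
  deformation retract of T.\<close>

lemma LH_hty:
 assumes fc: "fclosed R" "fclosed T" "fclosed T0" and m: "maps pj T R" "maps g T0 T"
  and pj: "!!a. eqn T0 (pb g (pb pj a)) (pb pj0 a)"
  and cl: "!!j. j < n==>eqn T (cd (e j)) 0"
  and inj: "!!ps tt. eqn T (cd ps) 0==>eqn T0 (pb g ps) (cd tt)==>EX tt. eqn T ps (cd tt)"
  and L: "LH R T0 bot pj0 n (%j. pb g (e j))"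
 shows "LH R T bot pj n e"
 unfolding LH_def
proof (intro allI impI, elim conjE)
 fix a ps
 assume a: "ALL j<n. eqn R (cd (a j)) 0" and ps: "eqn T (cd ps) (lin pj n e a)"
 have l: "eqn T0 (pb g (lin pj n e b)) (lin pj0 n (%j. pb g (e j)) b)" for b
  unfolding lin_def pb_sum pb_cup by (intro eq_sum eq_cup pj eq_refl fc)
 have g: "eqn T0 (cd (pb g ps)) (lin pj0 n (%j. pb g (e j)) a)"
  using mp_eqn[OF m(2) ps] l[of a] by (metis eq_trans pb_cd)
 obtain b tt where b: "!!j. j < n==>eqn R (a j) (cd (b j))"
   "eqn T0 (pb g ps) (lin pj0 n (%j. pb g (e j)) b + cd tt)"
  by (rule LHD[OF L, of a "pb g ps"]) (use a g in "auto simp: eqn_def")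
 have "eqn T (lin pj n e (%j. cd (b j))) (lin pj n e a)"
  by (rule eq_lin[OF m(1) fc(2)]) (use b eq_sym in blast)
 then have "eqn T (cd (ps - lin pj n e b)) 0"
  using ps cd_lin[OF fc(2) cl, where pj=pj and b=b] unfolding cd_df by (simp add: eqn_def)
 moreover have "eqn T0 (pb g (ps - lin pj n e b)) (cd tt)"
  using b(2) l[of b] by (simp add: pb_df eqn_def)
 ultimately obtain tt' where "eqn T (ps - lin pj n e b) (cd tt')"
  using inj by blast
 then show "EX b tt. (ALL j<n. eqn R (a j) (cd (b j)))&eqn bot tt 0&eqn T ps (lin pj n e b + cd tt)"
  using b(1) by (intro exI[of _ b] exI[of _ tt']) (auto simp: eqn_def alsi)
qed

section \<open>Continuity rules and cochains on subspaces\<close>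

lemma cm_comp: "cmap X eucl1 f==>cont_on UNIV h==>cmap X eucl1 (%x. h (f x))"
 using cmc[of X euclidean f euclidean h] by (simp add: o_def)

lemma cm_comp2:
 assumes "cmap X eucl1 f" "cmap X eucl1 g" "cont_on UNIV (%(a, b). h a b)"
 shows "cmap X eucl1 (%x. h (f x) (g x))"
proof -
 have "cmap X (prt eucl1 eucl1) (%x. (f x, g x))"
  using assms by (intro continuous_map_pairedI)
 from cmc[OF this[unfolded euclidean_product_topology], of euclidean "%(a, b). h a b"]
 show ?thesis using assms(3) by (simp add: o_def)
qed

lemma cm_fst: "cmap (prt (topo S) X) eucl1 fst"
 using cmf[of "topo S" X] by (simp only: cmis)

lemma cm_snd: "cmap X Y f==>cmap (prt Z X) Y (%z. f (snd z))"
 using cmc[OF cms, of X Y f Z] by (simp add: o_def)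

lemma Sub_Sub: "Sub (sbt1 X A) B=Sub X (A Int B)"
 by (simp add: subtopology_subtopology)

lemma Sub_empty [simp]: "Sub X {}=bot"
 by (auto simp: fei Sing_def singular_simplex_empty)

lemma Sing_trivial [simp]: "Sing trivial_topology=bot"
 by (auto simp: fei Sing_def singular_simplex_empty)

lemma eq_Sub_mono: "eqn (Sub X V) fi ps==>U \<subseteq> V==>eqn (Sub X U) fi ps"
 by (rule eq_mono[OF _ Sub_mono])

lemma eq_Sub: "eqn (Sing X) fi ps==>eqn (Sub X U) fi ps"
 by (rule eq_mono[OF _ Sub_le])

lemma Sub_disjoint: "A Int B={}==>inf (Sub X A) (Sub X B)=bot"
 by (simp add: Sub_inf)

lemma eq_bot [simp]: "eqn bot fi ps"
 by (simp add: eqn_def)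

lemma fcl_bot [simp]: "fclosed bot"
 by (simp add: fclosed_def)

lemma LH_bot: "LH bot bot bot pj n e"
 by (simp add: LH_def)

lemma mp_Sub:
 assumes "cmap X Y f" "f ` (tsp1 X Int A) \<subseteq> B"
 shows "maps f (Sub X A) (Sub Y B)"
proof (rule mp_Sing)
 show "cmap (sbt1 X A) (sbt1 Y B) f"
  using assms by (auto simp: cmis cmfs)
qed

text \<open>\<open>LH_MV\<close> treats the simplices lying in one of the two open sets;
  \<open>LH_ext\<close> with \<open>sm_xct\<close> passes to all simplices of the union.\<close>

lemma LH_ou:
 assumes op: "openin X O1" "openin X O2" "openin P V1" "openin P V2"
  and pj: "cmap P X pj" "pj ` V1 \<subseteq> O1" "pj ` V2 \<subseteq> O2"
  and cl: "!!j. j < n==>eqn (Sub P (V1 Un V2)) (cd (e j)) 0"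
  and e0: "!!j. j < n==>eqn (Sub P ((V1 Un V2) Int Z)) (e j) 0"
  and L: "LH (Sub X O1) (Sub P V1) (Sub P (V1 Int Z)) pj n e"
   "LH (Sub X O2) (Sub P V2) (Sub P (V2 Int Z)) pj n e"
   "LH (Sub X (O1 Int O2)) (Sub P (V1 Int V2)) (Sub P (V1 Int V2 Int Z)) pj n e"
 shows "LH (Sub X (O1 Un O2)) (Sub P (V1 Un V2)) (Sub P ((V1 Un V2) Int Z)) pj n e"
proof -
 have m: "maps pj (Sub P V1) (Sub X O1)" "maps pj (Sub P V2) (Sub X O2)"
   "maps pj (Sub P (V1 Un V2)) (Sub X (O1 Un O2))"
  using pj by (auto intro!: mp_Sub)
 have smX: "small (sbt1 X (O1 Un O2)) {O1, O2}=sup (Sub X O1) (Sub X O2)"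
  and smP: "small (sbt1 P (V1 Un V2)) {V1, V2}=sup (Sub P V1) (Sub P V2)"
  unfolding sm_pair Sub_Sub by (simp_all add: Int_absorb1)
 have N: "sup (Sub P (V1 Int Z)) (Sub P (V2 Int Z))=inf (Sub P ((V1 Un V2) Int Z)) (sup (Sub P V1) (Sub P V2))"
  by (auto simp: fei Sing_def sss)
 have i3: "inf (Sub P (V1 Int Z)) (Sub P (V2 Int Z))=Sub P (V1 Int V2 Int Z)"
  by (simp add: Sub_inf Int_ac)
 show ?thesis
 proof (rule LH_ext[where R' = "sup (Sub X O1) (Sub X O2)" and T' = "sup (Sub P V1) (Sub P V2)"
    and N' = "sup (Sub P (V1 Int Z)) (Sub P (V2 Int Z))"])
  show "LH (sup (Sub X O1) (Sub X O2)) (sup (Sub P V1) (Sub P V2)) (sup (Sub P (V1 Int Z)) (Sub P (V2 Int Z))) pj n e"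
  proof (rule LH_MV)
   show "eqn (sup (Sub P V1) (Sub P V2)) (cd (e j)) 0" if "j < n" for j
    using eq_Sub_mono[OF cl[OF that]] by (auto simp: eq_sup)
   show "eqn (sup (Sub P (V1 Int Z)) (Sub P (V2 Int Z))) (e j) 0" if "j < n" for j
    unfolding eq_sup by (intro conjI eq_Sub_mono[OF e0[OF that]]) auto
   show "LH (inf (Sub X O1) (Sub X O2)) (inf (Sub P V1) (Sub P V2)) (inf (Sub P (V1 Int Z)) (Sub P (V2 Int Z))) pj n e"
    using L(3) by (simp only: i3 Sub_inf[of P V1 V2] Sub_inf[of X])
   show "inf (Sub P (V1 Int Z)) (Sub P V2)<=Sub P (V2 Int Z)" "inf (Sub P (V2 Int Z)) (Sub P V1)<=Sub P (V1 Int Z)"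
    unfolding Sub_inf by (auto intro!: Sub_mono)
  qed (use L m in "auto intro!: Sub_mono")
  show "EX et. eqn (Sub X (O1 Un O2)) ze (cd et)&eqn (sup (Sub X O1) (Sub X O2)) et 0"
   if "eqn (Sub X (O1 Un O2)) (cd ze) 0" "eqn (sup (Sub X O1) (Sub X O2)) ze 0" for ze
  proof (rule sm_xct[of "{O1, O2}" "sbt1 X (O1 Un O2)" ze])
   show "openin (sbt1 X (O1 Un O2)) U" if "U:{O1, O2}" for U
    using that op by (auto simp: openin_subtopology intro!: exI[of _ U])
  qed (use that smX in auto)
  show "EX et. eqn (Sub P (V1 Un V2)) ze (cd et)&eqn (Sub P ((V1 Un V2) Int Z)) et 0"
   if z: "eqn (Sub P (V1 Un V2)) (cd ze) 0" "eqn (sup (Sub P V1) (Sub P V2)) ze 0" "eqn (Sub P ((V1 Un V2) Int Z)) ze 0" for ze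
  proof (rule sm_xct[of "{V1, V2}" "sbt1 P (V1 Un V2)" ze])
   show "openin (sbt1 P (V1 Un V2)) U" if "U:{V1, V2}" for U
    using that op by (auto simp: openin_subtopology intro!: exI[of _ U])
   fix et assume "eqn (Sub P (V1 Un V2)) ze (cd et)"
    "!!A. eqn (Sub (sbt1 P (V1 Un V2)) A) ze 0==>eqn (Sub (sbt1 P (V1 Un V2)) A) et 0"
   then show ?thesis using z(3) unfolding Sub_Sub by blast
  qed (use z smP in auto)
 qed (use m N cl e0 in "auto intro!: Sub_mono fcl_sup mp_sup")
qed

definition LHo where
 "LHo X P Z pj n e U<->LH (Sub X U) (Sub P {p:tsp1 P. pj p:U}) (Sub P ({p:tsp1 P. pj p:U} Int Z)) pj n e"

text \<open>Induction on the number of charts. The local hypothesis concerns every member of S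
  inside a chart, and S is closed under intersections, so it also covers the overlaps that
  Mayer-Vietoris asks for.\<close>

lemma LH_fin_cover:
 assumes pj: "cmap P X pj"
  and cl: "!!j. j < n==>eqn (Sing P) (cd (e j)) 0"
  and e0: "!!j. j < n==>eqn (Sub P Z) (e j) 0"
  and S: "!!U. S U==>openin X U" "!!U V. S U==>S V==>S (U Int V)" "!!U V. S U==>S V==>S (U Un V)" "S {}"
  and I: "finite I" and W: "!!i. i:I==>S (W i)"
  and loc: "!!i U. i:I==>S U==>U \<subseteq> W i==>LHo X P Z pj n e U"
  and U: "S U" "U \<subseteq> (\<Union>i\<in>I. W i)"
 shows "LHo X P Z pj n e U"
 using I W loc U
proof (induction I arbitrary: U)
 case empty
 then show ?case by (simp add: LHo_def LH_bot)
next
 case (insert i I)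
 have "S (\<Union>i\<in>I. W i)" using insert.hyps(1) insert.prems(1)
  by (induction I) (auto intro: S)
 define U1 U2 where "U1=U Int W i" and "U2=U Int (\<Union>i\<in>I. W i)"
 have SU: "S U1" "S U2" using insert.prems(1,3) S(2) `S (\<Union>i\<in>I. W i)` by (auto simp: U1_def U2_def)
 have Ueq: "U=U1 Un U2" using insert.prems by (auto simp: U1_def U2_def)
 define V where "V U={p:tsp1 P. pj p:U}" for U
 have V: "V (U1 Un U2)=V U1 Un V U2" "V (U1 Int U2)=V U1 Int V U2" by (auto simp: V_def)
 have opV: "openin P (V U)" if "S U" for U
  unfolding V_def using pj S(1)[OF that] by (rule ocmp)
 have LL: "LHo X P Z pj n e U1" "LHo X P Z pj n e (U1 Int U2)"
  by (rule insert.prems(2)[of i]; use SU S(2) in "auto simp: U1_def U2_def")+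
 have L2: "LHo X P Z pj n e U2"
  by (rule insert.IH) (use SU insert.prems in "auto simp: U2_def")
 note LL' = LL[unfolded LHo_def, folded V_def, unfolded V] L2[unfolded LHo_def, folded V_def]
 show ?case
  unfolding Ueq LHo_def V_def[symmetric] V
 proof (rule LH_ou)
  show "pj ` V U1 \<subseteq> U1" "pj ` V U2 \<subseteq> U2" by (auto simp: V_def)
  show "eqn (Sub P (V U1 Un V U2)) (cd (e j)) 0" if "j < n" for j
   using cl[OF that] Sub_le by (rule eq_mono)
  show "eqn (Sub P ((V U1 Un V U2) Int Z)) (e j) 0" if "j < n" for j
   using e0[OF that] Sub_mono by (rule eq_mono) auto
 qed (use LL' SU opV S pj in auto)
qed

section \<open>Integration along a real and a complex coordinate\<close>

lemma Sub_sign: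
 assumes r: "cmap M euc r" and sg: "sg:Sub M {m. r m~=0} n"
 shows "sg:Sub M {m. r m > 0} n | sg:Sub M {m. r m < 0} n"
proof -
 have sg': "ssx1 n M sg" "sg ` stsx n \<subseteq> {m. r m~=0}"
  using sg by (auto simp: Sing_def sss)
 have "cmap (sbt1 (powertop_real UNIV) (stsx n)) euc (r \<circ> sg)"
  using sg'(1) r unfolding ssd by (blast intro: cmc)
 then have "connectedin euc ((r \<circ> sg) ` stsx n)"
  by (rule connectedin_continuous_map_image) (simp add: connectedin_standard_simplex connectedin_subtopology)
 then have c: "connected ((r \<circ> sg) ` stsx n)" by simp
 have "~ (EX x:stsx n. EX y:stsx n. r (sg x)<=0&0<=r (sg y))"
 proof
  assume "EX x:stsx n. EX y:stsx n. r (sg x)<=0&0<=r (sg y)"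
  then obtain x y where "x:stsx n" "y:stsx n" "r (sg x)<=0" "0<=r (sg y)"
   by blast
  then have "0:(r \<circ> sg) ` stsx n"
   using c[unfolded connected_iff_interval, rule_format, of "r (sg x)" "r (sg y)" 0] by simp
  then show False using sg'(2) by auto
 qed
 then have "(ALL x:stsx n. r (sg x) > 0) | (ALL x:stsx n. r (sg x) < 0)"
  by (meson linorder_not_le order_less_imp_le)
 then show ?thesis
  using sg'(1) by (auto simp: Sing_def sss)
qed

lemma cm_hty_Sub:
 assumes H: "cmap (prt (topo {0..1::real}) X) Y (%(t, x). H t x)"
  and "!!t m. m:tsp1 X==>t:{0..1}==>m:A==>H t m:B"
 shows "cmap (prt (topo {0..1}) (sbt1 X A)) (sbt1 Y B) (%(t, x). H t x)"
 unfolding cmis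
proof
 have "cmap (prt (topo {0..1::real}) (sbt1 X A)) (prt (topo {0..1}) X) (%z. (fst z, snd z))"
  by (intro continuous_map_pairedI cmf continuous_map_into_fulltopology[OF cms])
 from cmc[OF this H]
 show "cmap (prt (topo {0..1}) (sbt1 X A)) Y (%(t, x). H t x)"
  by (simp add: o_def)
qed (use assms(2) in auto)

lemma Sub_prism:
 assumes "cmap (prt (topo {0..1}) M) M (%(t, x). H t x)"
  and "!!t m. m:tsp1 M==>t:{0..1}==>m:A==>H t m:B"
  and "sg:Sub M A n" "i<=n"
 shows "prism H n i sg:Sub M B (Suc n)"
proof (rule Sing_prism)
 show "cmap (prt (topo {0..1}) (sbt1 M A)) (sbt1 M B) (%(t, x). H t x)"
  by (rule cm_hty_Sub[OF assms(1,2)])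
qed (use assms in auto)

lemma hop_Sub0:
 assumes "cmap (prt (topo {0..1}) M) M (%(t, x). H t x)"
  and "!!t m. m:tsp1 M==>t:{0..1}==>m:A==>H t m:B"
  and "eqn (Sub M B) fi 0"
 shows "eqn (Sub M A) (hop H fi) 0"
 using eq_hop0[OF assms(3)] Sub_prism[OF assms(1,2)] by blast

text \<open>\<open>K c\<close> sets the real coordinate \<open>r\<close> to \<open>c\<close>.  Integrating a cochain relative to \<open>r \<noteq> 0\<close> along
 the coordinate from \<open>-1\<close> to \<open>1\<close> is injective in cohomology.\<close>

lemma real_co_xct:
 fixes K :: "real=>'m=>'m"
 assumes r: "cmap M euc r"
  and K: "cmap (prt euc M) M (%(c, m). K c m)"
  and rK: "!!c m. m:tsp1 M==>r (K c m) = c"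
  and Kr: "!!m. m:tsp1 M==>K (r m) m=m"
  and A: "!!c m. m:tsp1 M==>m:A==>K c m:A"
  and fi: "eqn (Sing M) (cd fi) 0" "eqn (Sub M A) fi 0" "eqn (Sub M {m. r m~=0}) fi 0"
  and b: "eqn (Sing M) (hop (%t. K (2 * t - 1)) fi) (cd b)" "eqn (Sub M A) b 0"
 obtains tt where "eqn (Sing M) fi (cd tt)" "eqn (Sub M A) tt 0" "eqn (Sub M {m. r m~=0}) tt 0"
proof -
 let ?I = "topo {0..1::real}"
 have H: "cmap (prt ?I M) M (%(t, m). K (f t (r m)) m)"
  if f: "cont_on UNIV (%(t, x). f t x)" for f :: "real=>real=>real"
 proof -
  have "cmap (prt ?I M) euc (%z. f (fst z) (r (snd z)))"
   by (rule cm_comp2[OF cm_fst cm_snd[OF r] f])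
  then have "cmap (prt ?I M) (prt euc M) (%z. (f (fst z) (r (snd z)), snd z))"
   by (rule continuous_map_pairedI[OF _ cms])
  then have "cmap (prt ?I M) M ((%(c, m). K c m) \<circ> (%z. (f (fst z) (r (snd z)), snd z)))"
   using K by (rule cmc)
  then show ?thesis by (simp add: o_def spde)
 qed
 have KM: "K c m:tsp1 M" if "m:tsp1 M" for c m
  using K that by (auto simp: cmd Pi_iff)
 \<comment> \<open>\<open>H1\<close> pushes everything into r < 0, \<open>Hk\<close> moves the
   coordinate from -1 to 1, and \<open>H2\<close> moves it from its own value to 1, so that
   \<open>H2 1 = Hk 1\<close>.\<close>
 define H1 where "H1 t m=K ((1 - t) * r m - t * (\<bar>r m\<bar>+1)) m" for t m
 define Hk where "Hk t=K (2 * t - 1)" for t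
 define H2 where "H2 t m=K ((1 - t) * r m+t) m" for t m
 define Tp where "Tp=Sub M {m. r m > 0}"
 define Tm where "Tm=Sub M {m. r m < 0}"
 have c1: "cmap (prt ?I M) M (%(t, m). H1 t m)"
  unfolding H1_def by (rule H) (auto simp: spde intro!: continuous_intros)
 have ck: "cmap (prt ?I M) M (%(t, m). Hk t m)"
  unfolding Hk_def by (rule H[of "%t x. 2 * t - 1"]) (auto simp: spde intro!: continuous_intros)
 have c2: "cmap (prt ?I M) M (%(t, m). H2 t m)"
  unfolding H2_def by (rule H) (auto simp: spde intro!: continuous_intros)
 have c2p: "cmap (prt ?I (sbt1 M {m. r m > 0})) (sbt1 M {m. r m > 0}) (%(t, m). H2 t m)"
 proof -
  have "r (H2 t m) > 0" if "m:tsp1 M" "t:{0..1}" "m:{m. r m > 0}" for t m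
  proof -
   have "0<=(1 - t) * r m" "t=1 | 0 < (1 - t) * r m" using that by (auto simp: zero_less_mult_iff)
   then show ?thesis using that by (auto simp: H2_def rK)
  qed
  then show ?thesis by (intro cm_hty_Sub[OF c2]) simp
 qed
 have fip: "eqn Tp fi 0" and fim: "eqn Tm fi 0"
  unfolding Tp_def Tm_def by (rule eq_Sub_mono[OF fi(3)]; force)+
 \<comment> \<open>A primitive of \<open>fi\<close>, since \<open>H1 1\<close> lands in r < 0 where
   \<open>fi\<close> vanishes. It vanishes for r < 0, but for r > 0 so far it is merely
   closed.\<close>
 define tt where "tt = - hop H1 fi"
 have mm: "maps f (Sing M) Tm" if "cmap M M f" "!!m. m:tsp1 M==>r (f m) < 0" for f
  using mp_Sub[of M M f UNIV "{m. r m < 0}"] that by (auto simp: Tm_def)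
 have at: "cmap M M (H' t)" if "cmap (prt ?I M) M (%(t, m). H' t m)" "t:{0..1}" for H' t
 proof -
  have "cmap M (prt ?I M) (%m. (t, m))"
   using that(2) by (auto simp: cmp o_def)
  from cmc[OF this that(1)] show ?thesis by (simp add: o_def)
 qed
 have tt: "eqn (Sing M) fi (cd tt)"
 proof -
  have "eqn (Sing M) (pb (H1 1) fi) (pb (H1 0) fi + cd (hop H1 fi))"
   by (rule hty_cl[OF c1 fi(1)])
  moreover have "eqn (Sing M) (pb (H1 1) fi) 0"
  proof -
   have "maps (H1 1) (Sing M) Tm" by (rule mm[OF at[OF c1]]) (auto simp: H1_def rK)
   from mp_eqn[OF this fim] show ?thesis by simp
  qed
  moreover have "eqn (Sing M) (pb (H1 0) fi) fi"
   by (rule pb_id_on) (simp add: H1_def Kr)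
  ultimately show ?thesis by (simp add: tt_def cd_um eqn_def eq_neg_iff_add_eq_0)
 qed
 have ttm: "eqn Tm tt 0"
 proof -
  have "eqn Tm (hop H1 fi) 0"
   unfolding Tm_def
  proof (rule hop_Sub0[OF c1])
   fix t :: real and m assume "m:tsp1 M" "t:{0..1}" "m:{m. r m < 0}"
   then have "(1 - t) * r m<=(0::real)" "t=0 | t * (\<bar>r m\<bar>+1) > 0" by (auto simp: mult_nonneg_nonpos zero_less_mult_iff)
   then show "H1 t m:{m. r m < 0}"
    using `m:tsp1 M` `m:{m. r m < 0}` by (auto simp: H1_def rK)
  qed (use fim Tm_def in simp)
  then show ?thesis by (simp add: tt_def eqn_def)
 qed
 have ttA: "eqn (Sub M A) tt 0"
 proof -
  have "eqn (Sub M A) (hop H1 fi) 0"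
   by (rule hop_Sub0[OF c1 _ fi(2)]) (simp add: A H1_def)
  then show ?thesis by (simp add: tt_def eqn_def)
 qed
 \<comment> \<open>For r > 0, \<open>H2\<close> deforms \<open>tt\<close> to its value at r = 1,
   which by \<open>Hk\<close> is the integral of \<open>fi\<close> up to exact terms; the hypothesis
   on b makes it exact.\<close>
 define be where "be=b+hop Hk tt - hop H2 tt"
 have ttbe: "eqn Tp tt (cd be)"
 proof -
  have "eqn Tp (cd tt) 0"
   using eq_mono[OF tt, of Tp] fip Sub_le[of M] by (simp add: Tp_def eqn_def)
  then have "eqn Tp (pb (H2 1) tt) (pb (H2 0) tt + cd (hop H2 tt))"
   unfolding Tp_def by (rule hty_cl[OF c2p])
  moreover have "eqn Tp (pb (H2 0) tt) tt"
   unfolding Tp_def by (rule pb_id_on) (simp add: H2_def Kr)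
  moreover have "H2 1=Hk 1" by (simp add: H2_def Hk_def fei)
  ultimately have 1: "eqn Tp tt (pb (Hk 1) tt - cd (hop H2 tt))"
   by (simp add: eqn_def)
  have "eqn (Sing M) (hop Hk (cd tt)) (hop Hk fi)"
   by (rule eq_hop[OF eq_sym[OF tt]]) (rule Sing_prism[OF ck])
  moreover have "eqn (Sing M) (pb (Hk 0) tt) 0"
  proof -
   have "maps (Hk 0) (Sing M) Tm" by (rule mm[OF at[OF ck]]) (auto simp: Hk_def rK)
   from mp_eqn[OF this ttm] show ?thesis by simp
  qed
  moreover have "pb (Hk 1) tt=hop Hk (cd tt) + cd (hop Hk tt)+pb (Hk 0) tt"
   using hop_cd[of Hk tt] by (simp add: alsi)
  moreover have "eqn (Sing M) (hop Hk fi) (cd b)"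
   using b(1) by (simp add: Hk_def[abs_def])
  ultimately have "eqn (Sing M) (pb (Hk 1) tt) (cd (b+hop Hk tt))"
   by (simp add: eqn_def cd_add)
  then have "eqn Tp (pb (Hk 1) tt) (cd (b+hop Hk tt))"
   unfolding Tp_def using Sub_le by (rule eq_mono)
  with 1 show ?thesis
   by (simp add: be_def cd_df eqn_def)
 qed
 have beA: "eqn (Sub M (A Int {m. r m > 0})) be 0"
 proof -
  have "eqn (Sub M A) (hop Hk tt) 0"
   by (rule hop_Sub0[OF ck _ ttA]) (simp add: A Hk_def)
  moreover have "eqn (Sub M A) (hop H2 tt) 0"
   by (rule hop_Sub0[OF c2 _ ttA]) (simp add: A H2_def)
  ultimately have "eqn (Sub M A) be 0"
   using b(2) by (simp add: be_def eqn_def)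
  then show ?thesis by (rule eq_mono) (auto intro: Sub_mono)
 qed
 define be' where "be'=pick Tp be 0"
 have be'p: "eqn Tp be' be" unfolding be'_def by (rule pick_in)
 have be'm: "eqn Tm be' 0" unfolding be'_def
 proof (rule pick0)
  have "{m. r m > 0} Int {m. r m < 0}={}" by auto
  from Sub_disjoint[OF this] show "eqn (inf Tp Tm) be 0" by (simp add: Tp_def Tm_def)
 qed
 have be'A: "eqn (Sub M A) be' 0" unfolding be'_def
  by (rule pick0) (use beA in "simp add: Tp_def Sub_inf Int_commute")
 have fcl: "fclosed Tp" "fclosed Tm" by (simp_all add: Tp_def Tm_def)
 show ?thesis
 proof (rule that[of "tt - cd be'"])
  show "eqn (Sing M) fi (cd (tt - cd be'))" using tt by (simp add: cd_df)
  show "eqn (Sub M A) (tt - cd be') 0"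
   using ttA eq_cd[OF be'A] by (simp add: eqn_def)
  have p: "eqn Tp (tt - cd be') 0"
   using ttbe eq_cd[OF be'p fcl(1)] by (simp add: eqn_def)
  have m: "eqn Tm (tt - cd be') 0"
   using ttm eq_cd[OF be'm fcl(2)] by (simp add: eqn_def)
  show "eqn (Sub M {m. r m~=0}) (tt - cd be') 0"
   unfolding eqn_def using p m Sub_sign[OF r] unfolding Tp_def Tm_def eqn_def by blast
 qed
qed

text \<open>\<open>G c\<close> sets the complex coordinate \<open>z\<close> to \<open>c\<close>.\<close>

locale complex_coordinate =
 fixes M :: "'m topology" and z :: "'m=>complex" and G :: "complex=>'m=>'m"
 assumes z: "cmap M eucl1 z"
  and G: "cmap (prt eucl1 M) M (%(c, m). G c m)"
  and zG: "m:tsp1 M==>z (G c m) = c"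
  and Gz: "m:tsp1 M==>G (z m) m=m"
  and GG: "m:tsp1 M==>G c (G c' m)=G c m"

begin

definition Kx where "Kx x m=G (Complex x (Im (z m))) m"

definition Ky where "Ky y m=G (Complex (Re (z m)) y) m"

definition Dx where "Dx fi=hop (%t. Kx (2 * t - 1)) fi"

definition Dy where "Dy fi=hop (%t. Ky (2 * t - 1)) fi"

abbreviation nz where "nz == {m. z m~=0}"

lemma cm_G: "cmap X eucl1 f==>cmap X M g==>cmap X M (%x. G (f x) (g x))"
 using cmc[OF continuous_map_pairedI G] by (simp add: o_def)

lemma cm_Complex:
 assumes "cmap X euc f" "cmap X euc g"
 shows "cmap X eucl1 (%x. Complex (f x) (g x))"
 by (rule cm_comp2[OF assms]) (auto simp: spde Complex_eq intro!: continuous_intros)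

lemma cm_Re: "cmap M euc (%m. Re (z m))" and cm_Im: "cmap M euc (%m. Im (z m))"
 by (rule cm_comp[OF z], intro continuous_intros)+

lemma cm_K:
 "cmap (prt euc M) M (%(c, m). Kx c m)"
 "cmap (prt euc M) M (%(c, m). Ky c m)"
 unfolding Kx_def Ky_def spde
 by (intro cm_G cm_Complex cmf cm_snd cm_Re cm_Im cms)+

lemma K:
 assumes "m:tsp1 M"
 shows "Re (z (Kx c m)) = c" "Im (z (Kx c m))=Im (z m)" "Kx (Re (z m)) m=m"
  "Re (z (Ky c m)) = Re (z m)" "Im (z (Ky c m)) = c" "Ky (Im (z m)) m=m"
 using assms by (simp_all add: Kx_def Ky_def zG Gz)

lemma cm_2: "cmap (prt (topo {0..1}) M) M (%(t, m). Kx (2 * t - 1) m)"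
 "cmap (prt (topo {0..1}) M) M (%(t, m). Ky (2 * t - 1) m)"
proof -
 have "cmap (prt (topo {0..1}) M) euc (%w. 2 * fst w - 1)"
  by (rule cm_comp[OF cm_fst]) (intro continuous_intros)
 then have p: "cmap (prt (topo {0..1}) M) (prt euc M) (%w. (2 * fst w - 1, snd w))"
  by (rule continuous_map_pairedI[OF _ cms])
 show "cmap (prt (topo {0..1}) M) M (%(t, m). Kx (2 * t - 1) m)"
  "cmap (prt (topo {0..1}) M) M (%(t, m). Ky (2 * t - 1) m)"
  using cmc[OF p cm_K(1)] cmc[OF p cm_K(2)] by (simp_all add: o_def spde)
qed

lemma nonzero_Re_Im: "{m. Re (z m)~=0} \<subseteq> nz" "{m. Im (z m)~=0} \<subseteq> nz" by auto

lemma Dy_vanish: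
 assumes "eqn (Sub M nz) fi 0"
 shows "eqn (Sub M {m. Re (z m)~=0}) (Dy fi) 0"
 unfolding Dy_def
 by (rule hop_Sub0[OF cm_2(2) _ eq_Sub_mono[OF assms nonzero_Re_Im(1)]]) (simp add: K)

lemma at_1:
 assumes "eqn (Sub M nz) fi 0" "c~=0"
 shows "eqn (Sing M) (pb (Ky c) fi) 0"
proof -
 have "cmap M M (Ky c)"
  unfolding Ky_def by (intro cm_G cm_Complex cm_Re continuous_map_id[unfolded id_def]) simp
 then have "maps (Ky c) (Sub M UNIV) (Sub M nz)"
  using assms(2) by (intro mp_Sub) (auto, metis K(5) zero_complex.sel(2))
 from mp_eqn[OF this assms(1)] show ?thesis by simp
qed

lemma at_1x:
 assumes "eqn (Sub M {m. Re (z m)~=0}) fi 0" "c~=0"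
 shows "eqn (Sing M) (pb (Kx c) fi) 0"
proof -
 have "cmap M M (Kx c)"
  unfolding Kx_def by (intro cm_G cm_Complex cm_Im continuous_map_id[unfolded id_def]) simp
 then have "maps (Kx c) (Sub M UNIV) (Sub M {m. Re (z m)~=0})"
  using assms(2) by (intro mp_Sub) (auto simp: K)
 from mp_eqn[OF this assms(1)] show ?thesis by simp
qed

lemma Dy_cd:
 assumes "eqn (Sub M nz) fi 0"
 shows "eqn (Sing M) (Dy (cd fi)) (- cd (Dy fi))"
proof -
 have "Dy (cd fi)=pb (Ky 1) fi - pb (Ky (-1)) fi - cd (Dy fi)"
  using hop_cd[of "%t. Ky (2 * t - 1)" fi] by (simp add: Dy_def eq_diff_eq)
 then show ?thesis
  using at_1[OF assms, of 1] at_1[OF assms, of "-1"] by (simp add: eqn_def)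
qed

lemma Dx_cd:
 assumes "eqn (Sub M {m. Re (z m)~=0}) fi 0"
 shows "eqn (Sing M) (Dx (cd fi)) (- cd (Dx fi))"
proof -
 have "Dx (cd fi)=pb (Kx 1) fi - pb (Kx (-1)) fi - cd (Dx fi)"
  using hop_cd[of "%t. Kx (2 * t - 1)" fi] by (simp add: Dx_def eq_diff_eq)
 then show ?thesis
  using at_1x[OF assms, of 1] at_1x[OF assms, of "-1"] by (simp add: eqn_def)
qed

lemma eq_Dx: "eqn (Sing M) fi ps==>eqn (Sing M) (Dx fi) (Dx ps)"
 and eq_Dy: "eqn (Sing M) fi ps==>eqn (Sing M) (Dy fi) (Dy ps)"
 unfolding Dx_def Dy_def by (erule eq_hop, erule (1) Sing_prism[OF cm_2(1)], erule eq_hop, erule (1) Sing_prism[OF cm_2(2)])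

text \<open>Integration over the square where the real and the imaginary part of z lie in [-1, 1].
  It stands for integration along the whole fibre, since cochains relative to z ~= 0 vanish on the
  boundary of the square.\<close>

definition DD where "DD fi=Dx (Dy fi)"

lemma eq_DD: "eqn (Sing M) fi ps==>eqn (Sing M) (DD fi) (DD ps)"
 by (simp add: DD_def eq_Dx eq_Dy)

lemma DD_um: "DD (- fi) = - DD fi" and DD_df: "DD (fi - ps)=DD fi - DD ps"
 by (simp_all add: DD_def Dx_def Dy_def hop_um hop_df)

lemma DD_cd:
 assumes "eqn (Sub M nz) fi 0"
 shows "eqn (Sing M) (DD (cd fi)) (cd (DD fi))"
proof -
 have "eqn (Sing M) (DD (cd fi)) (Dx (cd (- Dy fi)))"
  unfolding DD_def using eq_Dx[OF Dy_cd[OF assms]] by (simp add: cd_um)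
 also have "eqn (Sing M) (Dx (cd (- Dy fi))) (cd (DD fi))"
  using Dx_cd[of "- Dy fi"] Dy_vanish[OF assms] by (simp add: DD_def Dx_def hop_um cd_um eqn_def)
 finally show ?thesis .
qed

text \<open>\<open>hop_cup\<close> twice: the left factor is evaluated at the initial corner -1 - i
  of the square, and the two signs \<open>ci\<close> cancel.\<close>

lemma DD_cup:
 assumes "eqn (Sub M nz) fi 0"
 shows "eqn (Sing M) (DD (al \<smile> fi)) (pb (G (Complex (-1) (-1))) al \<smile> DD fi)"
proof -
 have "eqn (Sing M) (Dy (al \<smile> fi)) (ci (pb (Ky (-1)) al) \<smile> Dy fi)"
  using hop_cup[of "Sing M" "%t. Ky (2 * t - 1)" fi al] at_1[OF assms, of 1] by (simp add: Dy_def)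
 from eq_Dx[OF this] have "eqn (Sing M) (DD (al \<smile> fi)) (Dx (ci (pb (Ky (-1)) al) \<smile> Dy fi))"
  by (simp add: DD_def)
 also have "eqn (Sing M) ... (ci (pb (Kx (-1)) (ci (pb (Ky (-1)) al))) \<smile> DD fi)"
  using hop_cup[of "Sing M" "%t. Kx (2 * t - 1)" "Dy fi" "ci (pb (Ky (-1)) al)"]
   at_1x[OF Dy_vanish[OF assms], of 1] by (simp add: Dx_def DD_def)
 also have "ci (pb (Kx (-1)) (ci (pb (Ky (-1)) al)))=pb (Ky (-1) \<circ> Kx (-1)) al"
  by (simp add: pb_ci pb_pb)
 also have "eqn (Sing M) (pb (Ky (-1) \<circ> Kx (-1)) al \<smile> DD fi) (pb (G (Complex (-1) (-1))) al \<smile> DD fi)"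
  by (intro eq_cup pb_cong) (auto simp: Kx_def Ky_def zG GG)
 finally show ?thesis .
qed

text \<open>One coordinate at a time: exactness of the double integral yields a primitive of the
  inner integral, and this one a primitive of \<open>fi\<close>. It vanishes on simplices with Re z
  ~= 0 and on those with Im z ~= 0; these two sets cover z ~= 0, so \<open>sm_xct\<close> provides
  the remaining correction.\<close>

lemma DD_xct:
 assumes fi: "eqn (Sing M) (cd fi) 0" "eqn (Sub M nz) fi 0" and b: "eqn (Sing M) (DD fi) (cd b)"
 obtains tt where "eqn (Sing M) fi (cd tt)" "eqn (Sub M nz) tt 0"
proof -
 let ?R = "{m. Re (z m)~=0}" and ?J = "{m. Im (z m)~=0}"
 have fi': "eqn (Sub M ?R) fi 0" "eqn (Sub M ?J) fi 0"
  using eq_Sub_mono[OF fi(2)] nonzero_Re_Im by auto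
 have "eqn (Sing M) (Dy (cd fi)) 0"
  using eq_Dy[OF fi(1)] by (simp add: Dy_def)
 then have cl: "eqn (Sing M) (cd (Dy fi)) 0"
  using Dy_cd[OF fi(2)] by (simp add: eqn_def)
 have "eqn (Sing M) (hop (%t. Kx (2 * t - 1)) (Dy fi)) (cd b)"
  using b by (simp add: DD_def Dx_def)
 then obtain tt1 where tt1: "eqn (Sing M) (Dy fi) (cd tt1)" "eqn (Sub M ?R) tt1 0"
  using real_co_xct[OF cm_Re cm_K(1), of "{}" "Dy fi" b] cl Dy_vanish[OF fi(2)] by (auto simp: K)
 have "eqn (Sing M) (hop (%t. Ky (2 * t - 1)) fi) (cd tt1)"
  using tt1(1) by (simp add: Dy_def)
 then obtain tt where tt: "eqn (Sing M) fi (cd tt)" "eqn (Sub M ?R) tt 0" "eqn (Sub M ?J) tt 0"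
  using real_co_xct[OF cm_Im cm_K(2), of ?R fi tt1] fi(1) fi' tt1(2) by (auto simp: K)
 have op: "openin (sbt1 M nz) U" if "U:{?R Int tsp1 M, ?J Int tsp1 M}" for U
 proof -
  have "openin M {m:tsp1 M. Re (z m) : - {0}}" "openin M {m:tsp1 M. Im (z m) : - {0}}"
   using ocmp[OF cm_Re, of "- {0}"] ocmp[OF cm_Im, of "- {0}"]
   by (simp_all add: open_Compl)
  moreover have "{m:tsp1 M. Re (z m) : - {0}}=?R Int tsp1 M"
    "{m:tsp1 M. Im (z m) : - {0}}=?J Int tsp1 M"
   by auto
  ultimately have "openin M U" using that by auto
  then show ?thesis using that by (auto simp: openin_subtopology intro!: exI[of _ U])
 qed
 have sm': "small (sbt1 M nz) {?R Int tsp1 M, ?J Int tsp1 M}=sup (Sub M ?R) (Sub M ?J)"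
 proof -
  have "nz Int (?R Int tsp1 M)=tsp1 M Int ?R" "nz Int (?J Int tsp1 M)=tsp1 M Int ?J"
   by auto
  then show ?thesis
   unfolding sm_pair Sub_Sub by (simp only: subtopology_restrict)
 qed
 have "eqn (Sub M nz) (cd tt) 0"
  using eq_Sub[OF tt(1), of nz] fi(2) by (simp add: eqn_def)
 moreover have "eqn (sup (Sub M ?R) (Sub M ?J)) tt 0"
  using tt by (simp add: eq_sup)
 moreover have "tsp1 (sbt1 M nz) \<subseteq> \<Union> {?R Int tsp1 M, ?J Int tsp1 M}"
  by (auto simp: cei)
 ultimately obtain wm where wm: "eqn (Sub M nz) tt (cd wm)"
  using sm_xct[of "{?R Int tsp1 M, ?J Int tsp1 M}" "sbt1 M nz" tt] op unfolding sm' by metis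
 have p: "eqn (Sub M nz) (pick (Sub M nz) wm 0) wm" by (rule pick_in)
 show ?thesis
  by (rule that[of "tt - cd (pick (Sub M nz) wm 0)"])
   (use tt(1) wm eq_cd[OF p] in "auto simp: cd_df eqn_def")
qed

text \<open>\<open>u = DD et\<close> is its own inverse, so the sign of the integral need not be
  fixed. Integrating \<open>cd ps = a et\<close> gives a primitive of a times u, hence one of a.
  After subtracting the corresponding multiple of et, ps is closed; a further multiple with the same
  integral differs from it by a relative coboundary, by \<open>DD_xct\<close>.\<close>

theorem local_Thom:
 assumes et: "eqn (Sing M) (cd et) 0" "eqn (Sub M nz) et 0"
  and unit: "eqn (Sing M) (DD et \<smile> DD et) un"
 shows "TH (Sing M) (Sub M nz) et"
 unfolding TH_def
proof (intro allI impI, elim conjE)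
 fix a ps
 assume a: "eqn (Sing M) (cd a) 0" and ps0: "eqn (Sub M nz) ps 0" and ps: "eqn (Sing M) (cd ps) (a \<smile> et)"
 define u where "u=DD et"
 define g where "g=G (Complex (-1) (-1))"
 have "eqn (Sing M) (DD (cd et)) 0"
  using eq_DD[OF et(1)] by (simp add: DD_def Dx_def Dy_def)
 then have ucl: "eqn (Sing M) (cd u) 0"
  using DD_cd[OF et(2)] unfolding u_def eqn_def by metis
 have uu: "eqn (Sing M) (x \<smile> u \<smile> u) x" for x
  unfolding cup_assoc u_def
  by (rule eq_trans[OF eq_cup[OF eq_refl unit fcl_Sing] cup_un[OF fcl_Sing]])
 \<comment> \<open>\<open>g\<close> sets z to the corner -1 - i; \<open>Hg\<close> joins the
   identity to it, so pullback along \<open>g\<close> changes closed cochains by exact ones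
   only.\<close>
 define Hg where "Hg t m=G ((1 - of_real t) * z m + of_real t * Complex (-1) (-1)) m" for t m
 have cHg: "cmap (prt (topo {0..1}) M) M (%(t, m). Hg t m)"
  unfolding Hg_def spde
  by (rule cm_G[OF cm_comp2[OF cm_fst cm_snd[OF z]] cms])
   (auto simp: spde intro!: continuous_intros)
 have pbg: "eqn (Sing M) (pb g x) (x + cd (hop Hg x))" if x: "eqn (Sing M) (cd x) 0" for x
 proof -
  have "Hg 1=g" by (simp add: Hg_def g_def fei)
  moreover have "eqn (Sing M) (pb (Hg 0) x) x" by (rule pb_id_on) (simp add: Hg_def Gz)
  ultimately show ?thesis
   using hty_cl[OF cHg x] by (simp add: eqn_def)
 qed
 have xu: "eqn (Sing M) (cd (x \<smile> u)) (cd x \<smile> u)" for x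
  using eq_cup0_r[OF ucl fcl_Sing, of "ci x"] by (simp add: cd_cup eqn_def)
 define v where "v=DD ps"
 have "eqn (Sing M) (cd v) (pb g a \<smile> u)"
  using DD_cd[OF ps0] eq_DD[OF ps] DD_cup[OF et(2), of a] unfolding v_def g_def u_def eqn_def by metis
 from eq_cup[OF this eq_refl fcl_Sing, of u]
 have "eqn (Sing M) (pb g a) (cd (v \<smile> u))"
  using uu[of "pb g a"] xu[of v] by (simp add: eqn_def)
 define b0 where "b0=(v \<smile> u) - hop Hg a"
 have b0: "eqn (Sing M) a (cd b0)"
  using pbg[OF a] `eqn (Sing M) (pb g a) (cd (v \<smile> u))` by (simp add: b0_def cd_df eqn_def eq_diff_eq)
 have xet: "eqn (Sing M) (cd (x \<smile> et)) (cd x \<smile> et)" for x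
  using eq_cup0_r[OF et(1) fcl_Sing, of "ci x"] by (simp add: cd_cup eqn_def)
 have xet0: "eqn (Sub M nz) (x \<smile> et) 0" for x
  by (rule eq_cup0_r[OF et(2)]) simp
 define ps1 where "ps1=ps - (b0 \<smile> et)"
 have ps1: "eqn (Sing M) (cd ps1) 0"
  using ps xet[of b0] eq_cup[OF b0 eq_refl fcl_Sing, of et] by (simp add: ps1_def cd_df eqn_def)
 have ps10: "eqn (Sub M nz) ps1 0"
  using ps0 xet0[of b0] by (simp add: ps1_def eqn_def)
 define a1 where "a1=DD ps1"
 have "eqn (Sing M) (DD (cd ps1)) 0"
  using eq_DD[OF ps1] by (simp add: DD_def Dx_def Dy_def)
 then have a1: "eqn (Sing M) (cd a1) 0"
  using DD_cd[OF ps10] unfolding a1_def eqn_def by metis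
 define b1 where "b1=a1 \<smile> u"
 have b1: "eqn (Sing M) (cd b1) 0"
  using xu[of a1] eq_cup0_l[OF a1 fcl_Sing, of u] by (simp add: b1_def eqn_def)
 have "eqn (Sing M) (DD (b1 \<smile> et)) (a1 + cd (hop Hg b1 \<smile> u))"
 proof -
  have "eqn (Sing M) (DD (b1 \<smile> et)) (pb g b1 \<smile> u)"
   using DD_cup[OF et(2), of b1] by (simp add: g_def u_def)
  also have "eqn (Sing M) (pb g b1 \<smile> u) ((b1 + cd (hop Hg b1)) \<smile> u)"
   by (rule eq_cup[OF pbg[OF b1]]) simp_all
  also have "eqn (Sing M) ... (a1 + cd (hop Hg b1 \<smile> u))"
   using uu[of a1] xu[of "hop Hg b1"] by (simp add: cup_add_l b1_def eqn_def)
  finally show ?thesis .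
 qed
 then have "eqn (Sing M) (DD (ps1 - (b1 \<smile> et))) (cd (- (hop Hg b1 \<smile> u)))"
  by (simp add: DD_df a1_def cd_um eqn_def)
 moreover have "eqn (Sing M) (cd (ps1 - (b1 \<smile> et))) 0"
  using ps1 xet[of b1] eq_cup0_l[OF b1 fcl_Sing, of et] by (simp add: cd_df eqn_def)
 moreover have "eqn (Sub M nz) (ps1 - (b1 \<smile> et)) 0"
  using ps10 xet0[of b1] by (simp add: eqn_def)
 ultimately obtain tt where tt: "eqn (Sing M) (ps1 - (b1 \<smile> et)) (cd tt)" "eqn (Sub M nz) tt 0"
  using DD_xct by metis
 show "EX b tt. eqn (Sing M) a (cd b)&eqn (Sub M nz) tt 0&eqn (Sing M) ps ((b \<smile> et) + cd tt)"
  using b0 b1 tt by (intro exI[of _ "b0+b1"] exI[of _ tt])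
   (simp add: ps1_def cup_add_l cd_add eqn_def alsi)
qed

end

section \<open>Complex projective space\<close>

lemma sC_one [simp]: "(1::complex) *C x=(x::'h::complex_hilbert)"
 using sor[of 1 x] by simp

lemma sC_zero_l [simp]: "(0::complex) *C x=(0::'h::complex_hilbert)"
 using sor[of 0 x] by simp

lemma sC_zero_r [simp]: "a *C (0::'h::complex_hilbert)=0"
 using scaleC_add_right[of a 0 "0::'h"] by simp

lemma sC_minus_l: "(- a) *C x = - (a *C (x::'h::complex_hilbert))"
 using scaleC_add_left[of a "-a" x] by (simp add: eq_neg_iff_add_eq_0 add.commute)

lemma sC_minus_r: "a *C (- x) = - (a *C (x::'h::complex_hilbert))"
 using scaleC_add_right[of a x "-x"] by (simp add: eq_neg_iff_add_eq_0 add.commute)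

lemma sC_df_r: "a *C (x - y)=a *C x - a *C (y::'h::complex_hilbert)"
 using scaleC_add_right[of a x "-y"] by (simp add: sC_minus_r)

lemma sR_sC: "r *R x = cofr r *C (x::'h::complex_hilbert)"
 by (simp add: sor)

lemma sC_sR: "a *C (r *R x)=r *R (a *C (x::'h::complex_hilbert))"
 by (simp add: sR_sC scsc muco)

lemma cin_add_r: "cin1 x (y+z) = cin1 x y + cin1 x (z::'h::complex_hilbert)"
 by (metis cal cico complex_cnj_add)

lemma cin_sC_r: "cin1 x (a *C y) = cnj a * cin1 x (y::'h::complex_hilbert)"
 by (metis csl cico complex_cnj_mult)

lemma cin_zero_l [simp]: "cin1 0 (y::'h::complex_hilbert)=0"
 using cal[of 0 0 y] by simp

lemma cin_zero_r [simp]: "cin1 (y::'h::complex_hilbert) 0=0"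
 using cin_add_r[of y 0 0] by simp

lemma cin_minus_l: "cin1 (- x) y = - cin1 x (y::'h::complex_hilbert)"
 using cal[of x "-x" y] by (simp add: eq_neg_iff_add_eq_0 add.commute)

lemma cin_minus_r: "cin1 x (- y) = - cin1 x (y::'h::complex_hilbert)"
 using cin_add_r[of x y "-y"] by (simp add: eq_neg_iff_add_eq_0 add.commute)

lemma cin_df_l: "cin1 (x - y) z = cin1 x z - cin1 y (z::'h::complex_hilbert)"
 using cal[of x "-y" z] by (simp add: cin_minus_l)

lemma cin_df_r: "cin1 x (y - z) = cin1 x y - cin1 x (z::'h::complex_hilbert)"
 using cin_add_r[of x y "-z"] by (simp add: cin_minus_r)

lemma cin_sR_l: "cin1 (r *R x) y = cofr r * cin1 x (y::'h::complex_hilbert)"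
 by (simp add: sR_sC csl)

lemma cin_sR_r: "cin1 x (r *R y) = cofr r * cin1 x (y::'h::complex_hilbert)"
 by (simp add: sR_sC cin_sC_r)

lemma cin_self: "cin1 x x = cofr ((norm (x::'h::complex_hilbert))\<^sup>2)"
proof -
 have "Im (cin1 x x)=0"
  using arg_cong[OF cico[of x x], of Im] by simp
 then show ?thesis
  by (simp add: cei Re_cinner power2_norm_eq_inner)
qed

lemma cin_self_eq_0 [simp]: "cin1 x x=0<->x=(0::'h::complex_hilbert)"
 by (simp add: cin_self)

lemma norm_sC: "norm (a *C x) = cmod a * norm (x::'h::complex_hilbert)"
proof -
 have "cin1 (a *C x) (a *C x)=(a * cnj a) * cin1 x x"
  by (simp add: csl cin_sC_r)
 then have "cofr ((norm (a *C x))\<^sup>2) = cofr ((cmod a * norm x)\<^sup>2)"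
  by (simp only: cin_self complex_norm_square[symmetric] pmd of_real_mult)
 then have "(norm (a *C x))\<^sup>2=(cmod a * norm x)\<^sup>2"
  using of_real_eq_iff by blast
 then show ?thesis by simp
qed

lemma sC_eq_0_iff [simp]: "a *C x=0<->a=0 | x=(0::'h::complex_hilbert)"
 by (metis mult_eq_0_iff norm_eq_zero norm_sC)

lemma cmod_cin_le: "cmod (cin1 x y)<=norm x * norm (y::'h::complex_hilbert)"
proof (cases "cin1 x y=0")
 case False
 \<comment> \<open>This phase turns the inner product into a positive real number, to which the real
   Cauchy-Schwarz inequality applies.\<close>
 define u where "u = cnj (cin1 x y) / cofr (cmod (cin1 x y))"
 have "cmod u=1" using False by (simp add: u_def norm_divide)
 have "cnj (cin1 x y) * cin1 x y = cofr (cmod (cin1 x y)) * cofr (cmod (cin1 x y))"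
  by (metis complex_norm_square muco of_real_power pes)
 then have "cin1 (u *C x) y = cofr (cmod (cin1 x y))"
  using False by (simp add: csl u_def)
 then have "cmod (cin1 x y)=inner (u *C x) y"
  by (metis Re_cinner Re_complex_of_real)
 also have "... <= norm (u *C x) * norm y" by (rule norm_cauchy_schwarz)
 finally show ?thesis by (simp add: norm_sC `cmod u=1`)
qed simp

lemma bbl_cin: "bounded_bilinear (cin1 :: 'h::complex_hilbert=>'h=>complex)"
 by (rule bounded_bilinear.intro)
  (auto simp: cal cin_add_r cin_sR_l cin_sR_r scaleR_conv_of_real
   intro!: exI[of _ 1] cmod_cin_le)

lemma bbl_sC: "bounded_bilinear (scaleC :: complex=>'h=>'h::complex_hilbert)"
 by (rule bounded_bilinear.intro)
  (auto simp: scaleC_add_left scaleC_add_right sR_sC scsc muco scaleR_conv_of_real norm_sC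
   intro!: exI[of _ 1])

lemmas con_cin [continuous_intros] = bbco[OF bbl_cin]

lemmas con_sC [continuous_intros] = bbco[OF bbl_sC]

definition tens :: "'h::complex_hilbert=>'h=>'h op" where
 "tens v w=Blinfun (%x. cin1 x w *C v)"

lemma bounded_linear_tens: "bounded_linear (%x. cin1 x w *C (v::'h::complex_hilbert))"
proof (rule bounded_linear_intro[where K="norm w * norm v"])
 show "norm (cin1 x w *C v)<=norm x * (norm w * norm v)" for x
  using mrm[OF cmod_cin_le[of x w], of "norm v"] by (simp add: norm_sC mult.assoc)
qed (auto simp: cal scaleC_add_left csl scsc sR_sC)

lemma tens_ap [simp]: "bapp (tens v w) x = cin1 x w *C v"
 unfolding tens_def by (simp add: bounded_linear_Blinfun_apply bounded_linear_tens)

lemma norm_tens: "norm (tens v w)=norm v * norm w"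
proof (rule antisym)
 show "norm (tens v w)<=norm v * norm w"
 proof (rule norm_blinfun_bound)
  show "norm (tens v w x)<=norm v * norm w * norm x" for x
   using mrm[OF cmod_cin_le[of x w], of "norm v"] by (simp add: norm_sC mult_ac)
 qed simp
 show "norm v * norm w<=norm (tens v w)"
 proof (cases "w=0")
  case False
  have "norm (tens v w w)<=norm (tens v w) * norm w" by (rule norm_blinfun)
  then show ?thesis
   using False by (simp add: norm_sC cin_self pes norm_mult mult_ac del: of_real_power of_real_mult)
 qed simp
qed

lemma bbl_tens: "bounded_bilinear (tens :: 'h::complex_hilbert=>'h=>'h op)"
 by (rule bounded_bilinear.intro)
  (auto intro!: bleq exI[of _ 1] simp: bbs scaleC_add_right scaleC_add_left cin_add_r
   cin_sC_r norm_tens sR_sC scsc muco)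

lemmas con_tens [continuous_intros] = bbco[OF bbl_tens]

lemma clin_tens [simp]: "clin1 (tens v w)"
 by (simp add: cld csl scsc)

lemma lpr_eq: "lpr1 v=(1 / (norm v)\<^sup>2) *R tens v v"
proof (rule bleq)
 fix x
 let ?u = "(1 / norm v) *R v"
 have "lpr1 v x = cin1 x ?u *C ?u"
  unfolding line_proj_def Let_def by (subst bounded_linear_Blinfun_apply[OF bounded_linear_tens]) simp
 also have "... = ((1 / (norm v)\<^sup>2) *R tens v v) x"
  by (simp add: sR_sC cin_sC_r scsc bsl1 pes mult_ac)
 finally show "lpr1 v x=((1 / (norm v)\<^sup>2) *R tens v v) x" .
qed

lemma lpr_ap: "lpr1 v x=(cin1 x v / cofr ((norm v)\<^sup>2)) *C v"
 by (simp add: lpr_eq bsl1 sR_sC scsc)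

lemma lpr_self [simp]: "lpr1 v v=v"
 by (cases "v=0") (simp_all add: lpr_ap cin_self del: of_real_power)

lemma lpr_sC: "a~=0==>lpr1 (a *C v)=lpr1 v"
proof (rule bleq)
 fix x assume "a~=0"
 then have "cnj a * a = cofr ((cmod a)\<^sup>2)" "cmod a~=0"
  by (metis complex_norm_square muco, simp)
 then show "lpr1 (a *C v) x=lpr1 v x"
  by (simp add: lpr_ap cin_sC_r norm_sC scsc pmd field_simps del: of_real_power)
   (simp add: mult.assoc[symmetric] muco[of a "cnj a"])
qed

lemma lpr_sR: "r~=0==>lpr1 (r *R v)=lpr1 v"
 by (simp add: sR_sC lpr_sC)

lemma clin_lpr [simp]: "clin1 (lpr1 v)"
 by (simp add: cld lpr_ap csl scsc)

lemma clinD: "clin1 F==>F (c *C x) = c *C F x"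
 by (simp add: cld)

lemma lpr_norm: "norm v=1==>lpr1 v=tens v v"
 by (simp add: lpr_eq)

lemma con_lpr [continuous_intros]:
 "cont_on S f==>(!!x. x:S==>f x~=0)==>cont_on S (%x. lpr1 (f x))"
 unfolding lpr_eq by (intro continuous_intros) auto

definition PH :: "('h::complex_hilbert op) set" where
 "PH=lpr1 ` (UNIV - {0})"

lemma PSp_eq: "PSp1=topo PH"
 by (simp add: proj_space_def PH_def)

lemma lpr_PH: "v~=0==>lpr1 v:PH"
 by (simp add: PH_def)

lemma PH_E:
 assumes "l:PH"
 obtains v where "norm v=1" "l=lpr1 v" "l=tens v v"
proof -
 obtain w where w: "w~=0" "l=lpr1 w" using assms by (auto simp: PH_def)
 have "norm ((1 / norm w) *R w)=1" "l=lpr1 ((1 / norm w) *R w)"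
  using w by (auto simp: lpr_sR)
 then show ?thesis using that lpr_norm by metis
qed

lemma PH_ap: "l:PH==>l x~=0==>lpr1 (l x)=l"
 by (auto simp: PH_def lpr_ap lpr_sC)

lemma PH_idem: "l:PH==>l (l x)=l x"
 by (auto simp: PH_def lpr_ap[of _ x] clinD)

lemma PH_selfadj: "l:PH==>cin1 (l x) y = cin1 x (l y)"
proof (elim PH_E)
 fix v assume "l=tens v v"
 then show ?thesis
  by (simp add: csl cin_sC_r muco) (metis cico muco)
qed

lemma PH_cin_ap: "l:PH==>cin1 (l x) x = cofr ((norm (l x))\<^sup>2)"
 by (metis PH_idem PH_selfadj cin_self)

lemma lpr_eqD:
 assumes "v~=0" "w~=0" "lpr1 v=lpr1 w"
 shows "v=(cin1 v w / cin1 w w) *C w" "cin1 v w / cin1 w w~=0"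
proof -
 have "v=lpr1 w v" using assms(3) by (metis lpr_self)
 then show *: "v=(cin1 v w / cin1 w w) *C w" by (simp add: lpr_ap cin_self)
 then show "cin1 v w / cin1 w w~=0" using assms(1) by force
qed

text \<open>The action of T on lines, sending the line of v to that of T v (\<open>act_lpr\<close>).
  Written with projections it is visibly continuous and chooses no vectors.\<close>

definition act :: "('h::complex_hilbert op)=>('h op)=>'h op" where
 "act T l=(1 / norm (T oL l oL T)) *R (T oL l oL T)"

lemma o_tens:
 assumes "clin1 T" "sadj1 T"
 shows "T oL tens v w oL T=tens (T v) (T w)"
 using assms by (intro bleq) (simp add: cld sad)

lemma act_lpr:
 assumes "clin1 T" "sadj1 T" "T v~=0"
 shows "act T (lpr1 v)=lpr1 (T v)"
proof -
 have v: "v~=0" using assms(3) by force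
 have "T oL lpr1 v oL T=(1 / (norm v)\<^sup>2) *R tens (T v) (T v)"
  unfolding lpr_eq o_tens[OF assms(1,2), symmetric]
  by (intro bleq) (simp add: bbs)
 then show ?thesis
  using v by (simp add: act_def lpr_eq norm_tens pes)
qed

section \<open>The hyperplane cocycle\<close>

abbreviation Dl :: "nat=>(nat=>real) set" where "Dl == stsx"

definition vx :: "nat=>nat=>real" where "vx i=(%j. if j=i then 1 else 0)"

lemma vx_Dl [simp]: "vx i:Dl n<->i<=n"
 by (simp add: vx_def)

lemma pt_euclidean: "powertop_real UNIV=(eucl1 :: (nat=>real) topology)"
 by (simp add: euclidean_product_topology)

lemma ssx_eucl:
 "ssx1 n (topo S) sg<->cont_on (Dl n) sg&sg ` Dl n \<subseteq> S&sg:extensional (Dl n)"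
 by (auto simp: ssd pt_euclidean cmis)

lemma cpt_Dl [simp]: "compact (Dl n)"
 using compactin_standard_simplex[of n] by (simp add: pt_euclidean)

lemma cnd_Dl [simp]: "connected (Dl n)"
 using connectedin_standard_simplex[of n] by (simp add: pt_euclidean)

section \<open>Logarithms and lifts on simplices by continuation along rays\<close>

definition ray :: "real=>(nat=>real)=>nat=>real" where
 "ray t x=(%i. (1 - t) * vx 0 i+t * x i)"

lemma ray_Dl: "x:Dl n==>0<=t==>t<=1==>ray t x:Dl n"
 unfolding ray_def by (rule convex_standard_simplex) auto

lemma ray_0 [simp]: "ray 0 x=vx 0" and ray_1 [simp]: "ray 1 x=x"
 by (auto simp: ray_def)

lemma con_ray: "cont_on S (%(t, x). ray t x)"
proof (rule continuous_on_coordinatewise_then_product)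
 fix i
 have "cont_on S (%z. snd z i)"
  by (rule continuous_on_product_then_coordinatewise) (intro continuous_intros)
 then show "cont_on S (%z. (case z of (t, x)=>ray t x) i)"
  unfolding ray_def spde by (intro continuous_intros)
qed

lemma ray_subdivision:
 fixes fi :: "(nat=>real)=>'a::metric_space"
 assumes "cont_on (Dl n) fi" "0 < e"
 obtains N where "N > 0" "!!x k. x:Dl n==>k < N==>dist (fi (ray (real (Suc k) / real N) x)) (fi (ray (real k / real N) x)) < e"
proof -
 have c: "cont_on ({0..1} \<times> Dl n) (%(t, x). fi (ray t x))"
  unfolding spde
  by (rule continuous_on_compose2[OF assms(1)]) (use con_ray[unfolded spde] ray_Dl in auto)
 have uc: "uniformly_continuous_on ({0..1} \<times> Dl n) (%(t, x). fi (ray t x))"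
  by (rule compact_uniformly_continuous[OF c compact_Times[OF compact_Icc cpt_Dl]])
 from uc[unfolded uniformly_continuous_on_def, rule_format, OF assms(2)]
 obtain d where d: "d > 0" "!!z w. z:{0..1} \<times> Dl n==>w:{0..1} \<times> Dl n==>dist w z < d ==>
   dist ((%(t, x). fi (ray t x)) w) ((%(t, x). fi (ray t x)) z) < e"
  by (elim exE conjE) (rule that, assumption, blast)
 obtain N :: nat where N: "N > 0" "1 / real N < d"
  using d(1) by (metis nat_approx_posE zero_less_Suc)
 show ?thesis
 proof (rule that[OF N(1)])
  fix x k assume xk: "x:Dl n" "k < N"
  have "real (Suc k) / real N - real k / real N=1 / real N" by (simp add: diff_divide_distrib[symmetric])
  then have "dist (real (Suc k) / real N, x) (real k / real N, x) < d"
   using N by (simp add: dist_Pair_Pair dist_real_def)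
  then show "dist (fi (ray (real (Suc k) / real N) x)) (fi (ray (real k / real N) x)) < e"
   using d(2)[of "(real k / real N, x)" "(real (Suc k) / real N, x)"] xk by simp
 qed
qed

text \<open>Along the rays each small step multiplies f by a quotient of positive real part, whose
  principal logarithm is continuous; \<open>c\<close> sums these logarithms.\<close>

lemma log_on_sx:
 assumes f: "cont_on (Dl n) f" "!!x. x:Dl n==>f x~=(0::complex)"
 shows "EX c. cont_on (Dl n) c&(ALL x:Dl n. f x=exp (c x))"
proof -
 have "compact (f ` Dl n)" using f(1) by (rule compact_continuous_image) simp
 then have "closed (f ` Dl n)" by (rule compact_imp_closed)
 moreover have "0 ~: f ` Dl n" using f(2) by auto
 ultimately obtain e where e: "e > 0" "!!x. x:Dl n==>e<=dist 0 (f x)"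
  using separate_point_closed[of "f ` Dl n" 0] by auto
 obtain N where N: "N > 0" "!!x k. x:Dl n==>k < N==>dist (f (ray (real (Suc k) / real N) x)) (f (ray (real k / real N) x)) < e"
  using ray_subdivision[OF f(1) e(1)] by metis
 define g where "g k x = f (ray (real k / real N) x)" for k x
 have rD: "ray (real k / real N) x:Dl n" if "x:Dl n" "k<=N" for k x
  by (rule ray_Dl) (use that N(1) in auto)
 have gc: "cont_on (Dl n) (g k)" if "k<=N" for k
 proof -
  have "cont_on (Dl n) (%x. ray (real k / real N) x)"
   using continuous_on_compose2[OF con_ray[of UNIV], of "Dl n" "%x. (real k / real N, x)"]
   by (simp add: continuous_on_Pair)
  then show ?thesis unfolding g_def
   by (rule continuous_on_compose2[OF f(1)]) (use rD that in auto)
 qed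
 have g0: "g k x~=0" if "x:Dl n" "k<=N" for k x
  using f(2) rD that by (simp add: g_def)
 define c where "c k x = Ln (g 0 x)+(\<Sum>j<k. Ln (g (Suc j) x / g j x))" for k x
 have ratio: "Re (g (Suc k) x / g k x) > 0" if "x:Dl n" "k < N" for k x
 proof -
  have "norm (g (Suc k) x - g k x) < norm (g k x)"
   using N(2)[OF that] e(2)[OF rD[OF that(1), of k]] that(2) by (simp add: g_def dist_norm)
  moreover have "g k x~=0" using g0 that by simp
  moreover from `g k x~=0` have "g (Suc k) x / g k x - 1=(g (Suc k) x - g k x) / g k x"
   by (simp add: diff_divide_distrib)
  ultimately have "norm (g (Suc k) x / g k x - 1) < 1"
   by (simp add: norm_divide)
  then have "\<bar>Re (g (Suc k) x / g k x - 1)\<bar> < 1"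
   using abs_Re_le_cmod order_le_less_trans by blast
  then show ?thesis by simp
 qed
 have "cont_on (Dl n) (c k)&(ALL x:Dl n. g k x=exp (c k x))" if "k<=N" for k
  using that
 proof (induction k)
  case 0
  have "g 0 x = f (vx 0)" for x by (simp add: g_def)
  then show ?case using f(2) by (simp add: c_def)
 next
  case (Suc k)
  have "cont_on (Dl n) (%x. Ln (g (Suc k) x / g k x))"
  proof (rule continuous_on_Ln')
   show "g (Suc k) x / g k x ~: \<real>\<^sub>\<le>\<^sub>0" if "x:Dl n" for x
    using ratio[OF that, of k] Suc.prems by (auto simp: complex_nonpos_Reals_iff)
  qed (use Suc.prems g0 in "auto intro!: continuous_intros gc")
  moreover have "c (Suc k)=(%x. c k x + Ln (g (Suc k) x / g k x))" by (intro ext) (simp add: c_def add.assoc)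
  ultimately show ?case
   using Suc g0 by (auto simp: exp_add intro!: continuous_intros)
 qed
 from this[of N] show ?thesis using N(1) by (auto simp: g_def)
qed

text \<open>The lift is continued along the rays by applying the next projection to it. The result
  is not 0, because successive projections have distance less than 1.\<close>

lemma lift_on_simplex:
 assumes "sg:Sing PSp1 n"
 shows "EX L. cont_on (Dl n) L&(ALL x:Dl n. L x~=(0::'h::complex_hilbert)&lpr1 (L x)=sg x)"
proof -
 have sg: "cont_on (Dl n) sg" "!!x. x:Dl n==>sg x:PH"
  using assms by (auto simp: Sing_def PSp_eq ssx_eucl)
 obtain N where N: "N > 0" "!!x k. x:Dl n==>k < N==>dist (sg (ray (real (Suc k) / real N) x)) (sg (ray (real k / real N) x)) < 1"
  using ray_subdivision[OF sg(1), of 1] by auto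
 define g where "g k x=sg (ray (real k / real N) x)" for k x
 have rD: "ray (real k / real N) x:Dl n" if "x:Dl n" "k<=N" for k x
  by (rule ray_Dl) (use that N(1) in auto)
 have gc: "cont_on (Dl n) (g k)" if "k<=N" for k
 proof -
  have "cont_on (Dl n) (%x. ray (real k / real N) x)"
   using continuous_on_compose2[OF con_ray[of UNIV], of "Dl n" "%x. (real k / real N, x)"]
   by (simp add: continuous_on_Pair)
  then show ?thesis unfolding g_def
   by (rule continuous_on_compose2[OF sg(1)]) (use rD that in auto)
 qed
 have gP: "g k x:PH" if "x:Dl n" "k<=N" for k x
  using sg(2) rD that by (simp add: g_def)
 have "EX L. cont_on (Dl n) L&(ALL x:Dl n. L x~=0&lpr1 (L x)=g k x)" if "k<=N" for k
  using that
 proof (induction k)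
  case 0
  have "sg (vx 0):PH" using sg(2)[of "vx 0"] by simp
  then obtain v where "norm v=1" "lpr1 v=sg (vx 0)" by (metis PH_E)
  then show ?case by (intro exI[of _ "%_. v"]) (auto simp: g_def)
 next
  case (Suc k)
  then obtain L where L: "cont_on (Dl n) L" "!!x. x:Dl n==>L x~=0&lpr1 (L x)=g k x" by auto
  have nz: "g (Suc k) x (L x)~=0" if x: "x:Dl n" for x
  proof
   assume 0: "g (Suc k) x (L x)=0"
   have "g k x (L x) = L x" using L(2)[OF x] by (metis lpr_self)
   with 0 have "norm (L x)=norm ((g (Suc k) x - g k x) (L x))" by (simp add: bdl1)
   also have "... <= norm (g (Suc k) x - g k x) * norm (L x)" by (rule norm_blinfun)
   also have "... < 1 * norm (L x)"
    using N(2)[OF x, of k] Suc.prems L(2)[OF x] by (intro mult_strict_right_mono) (auto simp: g_def dist_norm)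
   finally show False by simp
  qed
  show ?case
  proof (intro exI[of _ "%x. g (Suc k) x (L x)"] conjI ballI)
   show "cont_on (Dl n) (%x. g (Suc k) x (L x))"
    by (intro bbco[OF bounded_bilinear_blinfun_apply] gc L Suc.prems)
   show "lpr1 (g (Suc k) x (L x))=g (Suc k) x" if "x:Dl n" for x
    using gP[OF that Suc.prems] nz[OF that] by (rule PH_ap)
  qed (rule nz)
 qed
 from this[of N] show ?thesis using N(1) by (auto simp: g_def)
qed

text \<open>The variation of a continuous logarithm of f along an edge; by \<open>log_uq\<close> it
  does not depend on the logarithm.\<close>

definition logch :: "((nat=>real)=>complex)=>complex" where
 "logch f=(THE d. EX c. cont_on (Dl 1) c&(ALL x:Dl 1. f x=exp (c x))&d = c (vx 1) - c (vx 0))"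

lemma exp_eq_1_int:
 assumes "exp w=1"
 shows "w / (2 * of_real pi * \<i>) = of_int \<lfloor>Re (w / (2 * of_real pi * \<i>))\<rfloor>"
proof -
 obtain n :: int where "Re w=0" "Im w = of_int (2 * n) * pi"
  using assms unfolding exp_eq_1 by blast
 then have "w = of_int n * (2 * of_real pi * \<i>)" by (simp add: cei)
 then have "w / (2 * of_real pi * \<i>) = of_int n" by (simp add: field_simps)
 then show ?thesis by simp
qed

text \<open>The difference of the two logarithms, divided by 2 pi i, is continuous and integer
  valued on a connected set, hence constant.\<close>

lemma log_uq:
 fixes c c' :: "'a::topological_space=>complex"
 assumes "cont_on S c" "cont_on S c'" "connected S" "!!x. x:S==>exp (c x)=exp (c' x)"
  "x:S" "y:S"
 shows "c x - c y = c' x - c' y"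
proof -
 define k where "k x=(c x - c' x) / (2 * of_real pi * \<i>)" for x
 have kint: "k x:\<int>" if "x:S" for x
 proof -
  have "exp (c x - c' x)=1" using assms(4)[OF that] by (simp add: exp_diff)
  from exp_eq_1_int[OF this] show ?thesis unfolding k_def by (metis Ints_of_int)
 qed
 have "k constant_on S"
 proof (rule continuous_discrete_range_constant[OF assms(3)])
  show "cont_on S k" unfolding k_def by (intro continuous_intros assms) auto
  show "EX e>0. ALL y. y:S&k y~=k x-->e<=norm (k y - k x)" if "x:S" for x
  proof (intro exI[of _ 1] conjI allI impI)
   fix y assume y: "y:S&k y~=k x"
   have "k y:\<int>" "k x:\<int>" using kint that y by blast+
   then obtain a b :: int where ab: "k y = of_int a" "k x = of_int b"
    by (elim Ints_cases)
   then have "k y - k x = of_int (a - b)" "a~=b" using y by auto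
   then show "1<=norm (k y - k x)" by (simp only: norm_of_int)
  qed simp
 qed
 then obtain d where "k x=d" "k y=d" using assms(5,6) by (auto simp: constant_on_def)
 moreover have "c x - c' x=k x * (2 * of_real pi * \<i>)" "c y - c' y=k y * (2 * of_real pi * \<i>)"
  by (simp_all add: k_def)
 ultimately have "c x - c' x = c y - c' y" by simp
 moreover have "c x - c y=(c x - c' x) - (c y - c' y)+(c' x - c' y)" by simp
 ultimately show ?thesis by simp
qed

lemma logch_eq:
 assumes "cont_on (Dl 1) c" "!!x. x:Dl 1==>f x=exp (c x)"
 shows "logch f = c (vx 1) - c (vx 0)"
 unfolding logch_def
proof (rule the_equality)
 fix d assume "EX c. cont_on (Dl 1) c&(ALL x:Dl 1. f x=exp (c x))&d = c (vx 1) - c (vx 0)"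
 then obtain c' where c': "cont_on (Dl 1) c'" "ALL x:Dl 1. f x=exp (c' x)" "d = c' (vx 1) - c' (vx 0)"
  by blast
 have "c' (vx 1) - c' (vx 0) = c (vx 1) - c (vx 0)"
  by (rule log_uq[of "Dl 1"]) (use assms c' in auto)
 then show "d = c (vx 1) - c (vx 0)" using c'(3) by simp
qed (use assms in blast)

lemma logch_exp:
 assumes "cont_on (Dl 1) f" "!!x. x:Dl 1==>f x~=0"
 shows "exp (logch f) = f (vx 1) / f (vx 0)"
proof -
 obtain c where c: "cont_on (Dl 1) c" "ALL x:Dl 1. f x=exp (c x)"
  using log_on_sx[OF assms] by blast
 then show ?thesis using logch_eq[of c f] by (simp add: exp_diff)
qed

lemma logch_mult:
 assumes "cont_on (Dl 1) f" "!!x. x:Dl 1==>f x~=0" "cont_on (Dl 1) g" "!!x. x:Dl 1==>g x~=0"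
 shows "logch (%x. f x * g x)=logch f+logch g"
proof -
 obtain c where c: "cont_on (Dl 1) c" "ALL x:Dl 1. f x=exp (c x)"
  using log_on_sx[OF assms(1,2)] by blast
 obtain d where d: "cont_on (Dl 1) d" "ALL x:Dl 1. g x=exp (d x)"
  using log_on_sx[OF assms(3,4)] by blast
 have "logch (%x. f x * g x)=(c (vx 1)+d (vx 1)) - (c (vx 0)+d (vx 0))"
  by (rule logch_eq) (use c d in "auto intro!: continuous_intros simp: exp_add")
 then show ?thesis using logch_eq[of c f] logch_eq[of d g] c d by simp
qed

lemma logch_cong: "(!!x. x:Dl 1==>f x=g x)==>logch f=logch g"
 unfolding logch_def by (intro arg_cong[where f=The] ext) auto

lemma logch_hp:
 assumes f: "cont_on (Dl 1) f" and a: "!!x. x:Dl 1==>Re (a * f x) > 0"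
 shows "logch f = Ln (a * f (vx 1)) - Ln (a * f (vx 0))"
proof -
 have "a~=0" using a[of "vx 0"] by auto
 have nz: "a * f x~=0" if "x:Dl 1" for x using a[OF that] by force
 have c: "cont_on (Dl 1) (%x. Ln (a * f x) - Ln a)"
 proof (intro continuous_on_diff continuous_on_const continuous_on_Ln')
  show "a * f x ~: \<real>\<^sub>\<le>\<^sub>0" if "x:Dl 1" for x
   using a[OF that] unfolding complex_nonpos_Reals_iff by linarith
 qed (intro continuous_intros f)
 have e: "f x=exp (Ln (a * f x) - Ln a)" if "x:Dl 1" for x
  using nz[OF that] `a~=0` by (simp only: exp_diff exp_Ln) simp
 show ?thesis
  using logch_eq[OF c e] by simp
qed

lemma xface_vx: "xface1 k (vx i)=vx (if i < k then i else Suc i)"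
 by (auto simp: sfd1 vx_def fei)

lemma con_xface: "cont_on S (xface1 k :: (nat=>real)=>nat=>real)"
proof (rule continuous_on_coordinatewise_then_product)
 fix i
 have "cont_on S (%x :: nat=>real. x j)" for j
  by (rule continuous_on_subset[OF continuous_on_product_coordinates subset_UNIV])
 then show "cont_on S (%x :: nat=>real. xface1 k x i)"
  by (cases "i < k"; cases "i=k") (simp_all add: sfd1)
qed

lemma con_face:
 assumes "cont_on (Dl (Suc n)) f" "k<=Suc n"
 shows "cont_on (Dl n) (%x. f (xface1 k x))"
 by (rule continuous_on_compose2[OF assms(1) con_xface]) (use assms(2) stx_face in auto)

lemma logch_triangle:
 assumes f: "cont_on (Dl 2) f" "!!x. x:Dl 2==>f x~=0"
 shows "(\<Sum>k\<le>2. (-1) ^ k * logch (%x. f (xface1 k x)))=0"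
proof -
 obtain c where c: "cont_on (Dl 2) c" "ALL x:Dl 2. f x=exp (c x)"
  using log_on_sx[OF f] by blast
 have "logch (%x. f (xface1 k x)) = c (xface1 k (vx 1)) - c (xface1 k (vx 0))" if "k<=2" for k
  by (rule logch_eq[of "%x. c (xface1 k x)"])
   (use c that con_face[of 1 c k] stx_face[of k 1] in "auto simp: n2e2")
 then show ?thesis
  by (simp add: n2e2 xface_vx)
qed

definition ratio :: "'h::complex_hilbert=>'h=>complex" where
 "ratio a b = cin1 a b / cin1 b b"

lemma ratio:
 assumes "a~=0" "b~=0" "lpr1 a=lpr1 b"
 shows "ratio a b~=0" "a=ratio a b *C b"
 using lpr_eqD[OF assms] by (auto simp: ratio_def)

lemma ratio_sC_l: "ratio (c *C a) b = c * ratio a b"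
 by (simp add: ratio_def csl)

lemma con_ratio:
 "cont_on S f==>cont_on S g==>(!!x. x:S==>g x~=0)==>cont_on S (%x. ratio (f x) (g x))"
 unfolding ratio_def by (intro continuous_intros) auto

definition isl :: "nat=>((nat=>real)=>'h::complex_hilbert op)=>((nat=>real)=>'h)=>bool" where
 "isl n sg L<->cont_on (Dl n) L&(ALL x:Dl n. L x~=0&lpr1 (L x)=sg x)"

lemma isl_ratio:
 assumes "isl n sg L" "isl n sg L'" "x:Dl n"
 shows "ratio (L x) (L' x)~=0" "L x=ratio (L x) (L' x) *C L' x"
 using ratio[of "L x" "L' x"] assms by (auto simp: isl_def)

lemma con_isl_ratio:
 "isl n sg L==>isl n sg L'==>cont_on (Dl n) (%x. ratio (L x) (L' x))"
 by (rule con_ratio) (auto simp: isl_def)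

definition thl where "thl n sg=(SOME L. isl n sg L)"

lemma thl: "sg:Sing PSp1 n==>isl n sg (thl n sg)"
 unfolding thl_def using lift_on_simplex[of sg n, folded isl_def] by (rule someI_ex)

definition pick_vec :: "('h::complex_hilbert op)=>'h" where
 "pick_vec l=(SOME v. v~=0&lpr1 v=l)"

lemma pick_vec: "l:PH==>pick_vec l~=0&lpr1 (pick_vec l)=l"
 unfolding pick_vec_def by (rule someI_ex) (auto simp: PH_def)

text \<open>The variation of the logarithm of a lift \<open>L\<close> along an edge \<open>e\<close>, measured against a reference
 lift of \<open>e\<close> and against reference vectors at the end points.\<close>

definition elog :: "((nat=>real)=>'h::complex_hilbert op)=>((nat=>real)=>'h)=>complex" where
 "elog e L=logch (%x. ratio (L x) (thl 1 e x)) +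
  (Ln (ratio (thl 1 e (vx 1)) (pick_vec (e (vx 1)))) - Ln (ratio (thl 1 e (vx 0)) (pick_vec (e (vx 0)))))"

lemma elog_mult:
 assumes e: "e:Sing PSp1 1" and L: "isl 1 e L" and m: "cont_on (Dl 1) m" "!!x. x:Dl 1==>m x~=0"
 shows "elog e (%x. m x *C L x)=logch m+elog e L"
proof -
 have l: "isl 1 e (thl 1 e)" using e by (rule thl)
 have "logch (%x. ratio (m x *C L x) (thl 1 e x))=logch (%x. m x * ratio (L x) (thl 1 e x))"
  by (simp add: ratio_sC_l)
 also have "... = logch m+logch (%x. ratio (L x) (thl 1 e x))"
  by (rule logch_mult) (use m isl_ratio[OF L l] con_isl_ratio[OF L l] in auto)
 finally show ?thesis by (simp add: elog_def)
qed

lemma elog_exp: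
 assumes e: "e:Sing PSp1 1" and L: "isl 1 e L"
 shows "exp (elog e L)=ratio (L (vx 1)) (pick_vec (e (vx 1))) / ratio (L (vx 0)) (pick_vec (e (vx 0)))"
proof -
 let ?l = "thl 1 e"
 have l: "isl 1 e ?l" using e by (rule thl)
 have nz: "ratio (L x) (?l x)~=0" "ratio (?l x) (pick_vec (e x))~=0"
   "ratio (L x) (pick_vec (e x))=ratio (L x) (?l x) * ratio (?l x) (pick_vec (e x))" if x: "x:Dl 1" for x
 proof -
  have "e x:PH" using e x by (auto simp: Sing_def PSp_eq ssx_eucl)
  then have p: "pick_vec (e x)~=0" "lpr1 (pick_vec (e x))=e x" using pick_vec by auto
  have a: "L x=ratio (L x) (?l x) *C ?l x" "ratio (L x) (?l x)~=0"
   using ratio[of "L x" "?l x"] l L x by (auto simp: isl_def)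
  have b: "?l x=ratio (?l x) (pick_vec (e x)) *C pick_vec (e x)" "ratio (?l x) (pick_vec (e x))~=0"
   using ratio[of "?l x" "pick_vec (e x)"] l p x by (auto simp: isl_def)
  show "ratio (L x) (?l x)~=0" "ratio (?l x) (pick_vec (e x))~=0" by (fact a(2), fact b(2))
  show "ratio (L x) (pick_vec (e x))=ratio (L x) (?l x) * ratio (?l x) (pick_vec (e x))"
   using a(1) p(1) by (metis ratio_sC_l)
 qed
 have "exp (logch (%x. ratio (L x) (?l x)))=ratio (L (vx 1)) (?l (vx 1)) / ratio (L (vx 0)) (?l (vx 0))"
  by (rule logch_exp) (use nz con_isl_ratio[OF L l] in auto)
 then show ?thesis
  using nz[of "vx 0"] nz[of "vx 1"] by (simp add: elog_def exp_add exp_diff)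
qed

text \<open>The obstruction cocycle to lifting lines to vectors: the variation of the logarithm of a
  lift around the boundary of the simplex, relative to the references \<open>thl\<close> on edges
  and \<open>pick_vec\<close> at vertices, in units of 2 pi i. By \<open>hyp_eq\<close> this number
  is an integer, which \<open>Re\<close> and the floor extract.\<close>

definition hyp :: "('h::complex_hilbert op) tc" where
 "hyp n sg=(if n=2 then \<lfloor>Re ((\<Sum>k\<le>2. (-1) ^ k * elog (sface1 2 k sg) (%x. thl 2 sg (xface1 k x)))
   / (2 * of_real pi * \<i>))\<rfloor> else 0)"

lemma isl_face: "isl (Suc n) sg L==>k<=Suc n==>isl n (sface1 (Suc n) k sg) (%x. L (xface1 k x))"
 unfolding isl_def by (auto simp: con_face stx_face sfd)

lemma Sing_face: "sg:Sing X (Suc n)==>k<=Suc n==>sface1 (Suc n) k sg:Sing X n"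
 by (rule fcl_face) auto

text \<open>Another lift differs by a nowhere vanishing function m, whose logarithmic variations
  around the triangle add up to 0. The sum is a multiple of 2 pi i because the vertex ratios cancel
  in its exponential.\<close>

lemma hyp_eq:
 assumes sg: "sg:Sing PSp1 2" and L: "isl 2 sg L"
 shows "of_int (hyp 2 sg)=(\<Sum>k\<le>2. (-1) ^ k * elog (sface1 2 k sg) (%x. L (xface1 k x))) / (2 * of_real pi * \<i>)"
proof -
 let ?l = "thl 2 sg"
 let ?S = "%L. \<Sum>k\<le>2. (-1) ^ k * elog (sface1 2 k sg) (%x. L (xface1 k x))"
 have l: "isl 2 sg ?l" using sg by (rule thl)
 have f: "sface1 2 k sg:Sing PSp1 1" if "k<=2" for k
  using Sing_face[of sg proj_space 1 k] sg that by (simp add: n2e2)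
 have lf: "isl 1 (sface1 2 k sg) (%x. L (xface1 k x))" if "k<=2" "isl 2 sg L" for k L
  using isl_face[of 1 sg L k] that by (simp add: n2e2)
 define m where "m x=ratio (L x) (?l x)" for x
 have m: "cont_on (Dl 2) m" "!!x. x:Dl 2==>m x~=0" "!!x. x:Dl 2==>L x=m x *C ?l x"
  unfolding m_def using isl_ratio[OF L l] con_isl_ratio[OF L l] by blast+
 have "elog (sface1 2 k sg) (%x. L (xface1 k x)) =
   logch (%x. m (xface1 k x))+elog (sface1 2 k sg) (%x. ?l (xface1 k x))" if k: "k<=2" for k
 proof -
  have D: "xface1 k x:Dl 2" if "x:Dl 1" for x
   using stx_face[of k 1 x] k that by (simp add: n2e2)
  have "elog (sface1 2 k sg) (%x. L (xface1 k x)) =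
    elog (sface1 2 k sg) (%x. m (xface1 k x) *C ?l (xface1 k x))"
   unfolding elog_def by (intro arg_cong2[of _ _ _ _ "(+)"] logch_cong refl) (simp add: m(3)[OF D, symmetric])
  also have "... = logch (%x. m (xface1 k x))+elog (sface1 2 k sg) (%x. ?l (xface1 k x))"
   by (rule elog_mult[OF f[OF k] lf[OF k l]])
    (use m D k con_face[of 1 m k] in "auto simp: n2e2")
  finally show ?thesis .
 qed
 then have "?S L=(\<Sum>k\<le>2. (-1) ^ k * logch (%x. m (xface1 k x)))+?S ?l"
  by (simp add: distrib_left sum.distrib)
 also have "... = ?S ?l"
  using logch_triangle[OF m(1,2)] by simp
 finally have eq: "?S L=?S ?l" .
 have "exp (?S ?l)=1"
 proof -
  define r where "r i=ratio (?l (vx i)) (pick_vec (sg (vx i)))" for i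
  have r: "r i~=0" if "i<=2" for i
  proof -
   have "sg (vx i):PH" using sg that by (auto simp: Sing_def PSp_eq ssx_eucl)
   then show ?thesis using pick_vec l that ratio(1) unfolding r_def isl_def by (metis vx_Dl)
  qed
  define E where "E k=elog (sface1 2 k sg) (%x. ?l (xface1 k x))" for k
  have "exp (E k)=r (if 1 < k then 1 else 2) / r (if 0 < k then 0 else 1)" if "k<=2" for k
   using elog_exp[OF f[OF that] lf[OF that l]]
   by (auto simp: E_def r_def xface_vx sfd n2e2)
  from this[of 0] this[of 1] this[of 2]
  have "exp (E 0)=r 2 / r 1" "exp (E 1)=r 2 / r 0" "exp (E 2)=r 1 / r 0" by simp_all
  moreover have "?S ?l=E 0 - E 1+E 2" by (simp add: n2e2 E_def)
  ultimately show ?thesis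
   using r[of 0] r[of 1] r[of 2] by (simp only: exp_add exp_diff) simp
 qed
 from exp_eq_1_int[OF this] show ?thesis
  unfolding eq by (simp add: hyp_def)
qed

text \<open>The logarithmic variation of a global lift g along an edge, made an integer by vertex
  terms that drop out of the coboundary; so it is a primitive of the pulled back \<open>hyp\<close>
  (\<open>hyp_lift\<close>).\<close>

definition liftc :: "('y=>'h::complex_hilbert)=>'y tc" where
 "liftc g n e=(if n=1 then
  \<lfloor>Re ((elog (smap1 1 (%y. lpr1 (g y)) e) (%x. g (e x)) -
    (Ln (ratio (g (e (vx 1))) (pick_vec (lpr1 (g (e (vx 1)))))) - Ln (ratio (g (e (vx 0))) (pick_vec (lpr1 (g (e (vx 0))))))))
    / (2 * of_real pi * \<i>))\<rfloor> else 0)"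

lemma lift_simplex:
 assumes g: "cmap Y eucl1 g" "!!y. y:tsp1 Y==>g y~=0" and sg: "sg:Sing Y n"
 shows "smap1 n (%y. lpr1 (g y)) sg:Sing PSp1 n"
  "isl n (smap1 n (%y. lpr1 (g y)) sg) (%x. g (sg x))"
proof -
 have s: "cmap (topo (Dl n)) Y sg"
  using sg by (simp add: Sing_def ssd pt_euclidean)
 have "cmap (topo (Dl n)) eucl1 (g \<circ> sg)"
  using s g(1) by (rule cmc)
 then have c: "cont_on (Dl n) (%x. g (sg x))" by (simp add: o_def)
 have "sg x:tsp1 Y" if "x:Dl n" for x
  using s that by (auto simp: cmd Pi_iff)
 then have nz: "g (sg x)~=0" if "x:Dl n" for x using g(2) that by blast
 show "smap1 n (%y. lpr1 (g y)) sg:Sing PSp1 n"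
  using c nz by (auto simp: Sing_def PSp_eq ssx_eucl smd o_def lpr_PH
    intro!: con_lpr cong: continuous_on_cong)
 show "isl n (smap1 n (%y. lpr1 (g y)) sg) (%x. g (sg x))"
  using c nz by (auto simp: isl_def smd)
qed

lemma liftc_eq:
 assumes g: "cmap Y eucl1 g" "!!y. y:tsp1 Y==>g y~=0" and e: "e:Sing Y 1"
 shows "of_int (liftc g 1 e)=(elog (smap1 1 (%y. lpr1 (g y)) e) (%x. g (e x)) -
    (Ln (ratio (g (e (vx 1))) (pick_vec (lpr1 (g (e (vx 1)))))) - Ln (ratio (g (e (vx 0))) (pick_vec (lpr1 (g (e (vx 0))))))))
    / (2 * of_real pi * \<i>)" (is "_=?w / _")
proof -
 note L = lift_simplex[OF g e]
 have "e (vx i):tsp1 Y" if "i<=1" for i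
  using e that by (auto simp: Sing_def ssd cmd Pi_iff)
 then have n: "g (e (vx i))~=0" if "i<=1" for i using g(2) that by blast
 have r: "ratio (g (e (vx i))) (pick_vec (lpr1 (g (e (vx i)))))~=0" if "i<=1" for i
  using pick_vec[OF lpr_PH[OF n[OF that]]] n[OF that] by (intro ratio) auto
 have "exp ?w=1"
  using elog_exp[OF L] r[of 0] r[of 1] by (simp add: exp_diff smd)
 from exp_eq_1_int[OF this] show ?thesis
  by (simp add: liftc_def)
qed

lemma hyp_lift:
 assumes g: "cmap Y eucl1 g" "!!y. y:tsp1 Y==>g y~=0"
 shows "eqn (Sing Y) (pb (%y. lpr1 (g y)) hyp) (cd (liftc g))"
 unfolding eqn_def
proof (intro allI ballI)
 fix n sg assume sg: "sg:Sing Y n"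
 show "pb (%y. lpr1 (g y)) hyp n sg = cd (liftc g) n sg"
 proof (cases "n=2")
  case False
  then have "n=0 | n - 1~=1" by arith
  then show ?thesis using False by (auto simp: pb_def hyp_def cd_def liftc_def)
 next
  case True
  then have sg2: "sg:Sing Y (Suc 1)" using sg by (simp add: n2e2)
  note L = lift_simplex[OF g, of sg 2]
  define nu where "nu i = Ln (ratio (g (sg (vx i))) (pick_vec (lpr1 (g (sg (vx i))))))" for i
  have "complex_of_int (liftc g 1 (sface1 2 k sg)) =
    (elog (sface1 2 k (smap1 2 (%y. lpr1 (g y)) sg)) (%x. g (sg (xface1 k x))) -
    (nu (if 1 < k then 1 else 2) - nu (if 0 < k then 0 else 1))) / (2 * of_real pi * \<i>)" if k: "k<=2" for k
  proof -
   have f: "sface1 2 k sg:Sing Y 1" using Sing_face[OF sg2, of k] k by (simp add: n2e2)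
   have v: "sface1 2 k sg (vx i)=sg (vx (if i < k then i else Suc i))" if "i<=1" for i
    using that by (simp add: sfd xface_vx)
   have "elog (smap1 1 (%y. lpr1 (g y)) (sface1 2 k sg)) (%x. g (sface1 2 k sg x)) =
     elog (sface1 2 k (smap1 2 (%y. lpr1 (g y)) sg)) (%x. g (sg (xface1 k x)))"
    using smap_sface[of k 1 "%y. lpr1 (g y)" sg] k unfolding elog_def
    by (intro arg_cong2[of _ _ _ _ "(+)"]) (auto simp: n2e2 sfd intro!: logch_cong)
   note el = this
   have v': "sface1 2 k sg (vx 0)=sg (vx (if 0 < k then 0 else 1))"
     "sface1 2 k sg (vx 1)=sg (vx (if 1 < k then 1 else 2))"
    using v[of 0] v[of 1] by (simp_all add: n2e2)
   show ?thesis
    unfolding nu_def v'[symmetric] el[symmetric] by (rule liftc_eq[OF g f])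
  qed
  note F = this
  have "complex_of_int (cd (liftc g) 2 sg)=(\<Sum>k\<le>2. (-1) ^ k * complex_of_int (liftc g 1 (sface1 2 k sg)))"
   by (simp add: cd_def)
  also have "... = (\<Sum>k\<le>2. (-1) ^ k * (elog (sface1 2 k (smap1 2 (%y. lpr1 (g y)) sg)) (%x. g (sg (xface1 k x))) -
    (nu (if 1 < k then 1 else 2) - nu (if 0 < k then 0 else 1)))) / (2 * of_real pi * \<i>)"
   unfolding sum_divide_distrib by (rule suco[OF refl]) (simp only: F atMost_iff times_divide_eq_right)
  also have "... = (\<Sum>k\<le>2. (-1) ^ k * elog (sface1 2 k (smap1 2 (%y. lpr1 (g y)) sg)) (%x. g (sg (xface1 k x)))) / (2 * of_real pi * \<i>)"
   by (rule arg_cong2[of _ _ _ _ "(/)"]) (simp_all add: n2e2)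
  also have "... = of_int (hyp 2 (smap1 2 (%y. lpr1 (g y)) sg))"
   using hyp_eq[OF L] sg True by simp
  finally show ?thesis using True by (simp add: pb_def)
 qed
qed

text \<open>Every simplex is the image of the identity simplex under itself. On the standard simplex
  a lift exists, so there the pulled back \<open>hyp\<close> is a coboundary.\<close>

lemma hyp_closed: "eqn (Sing PSp1) (cd hyp) (0 :: ('h::complex_hilbert op) tc)"
 unfolding eqn_def
proof (intro allI ballI)
 fix n and sg :: "('h op) simp" assume sg: "sg:Sing PSp1 n"
 define Y where "Y=topo (Dl n)"
 define io :: "(nat=>real) simp" where "io=restrict id (Dl n)"
 obtain L where L: "isl n sg L" using thl[OF sg] by blast
 have g: "cmap Y eucl1 L" "!!y. y:tsp1 Y==>L y~=0"
  using L by (auto simp: Y_def isl_def)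
 have io: "io:Sing Y n"
  by (auto simp: io_def Sing_def Y_def ssx_eucl intro: continuous_on_eq[OF continuous_on_id])
 have "smap1 n (%y. lpr1 (L y)) io=sg"
  using L sg by (auto simp: io_def smd isl_def fei Sing_def ssd extensional_def)
 then have "cd hyp n sg=pb (%y. lpr1 (L y)) (cd hyp) n io"
  by (simp add: pb_def)
 also have "... = cd (pb (%y. lpr1 (L y)) hyp) n io"
  by (simp only: pb_cd)
 also have "... = cd (cd (liftc L)) n io"
  using eq_cd[OF hyp_lift[OF g] fcl_Sing] io by (simp add: eqn_def)
 finally show "cd hyp n sg=0 n sg" by simp
qed

section \<open>Winding numbers, values on projective lines, the local Thom class\<close>

lemma Ln_df_hp:
 assumes "Re a > 0" "Re b > 0"
 shows "Ln a - Ln b = Ln (a / b)"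
proof -
 have nz: "a~=0" "b~=0" using assms by auto
 have "\<bar>Im (Ln a)\<bar> < pi / 2" "\<bar>Im (Ln b)\<bar> < pi / 2"
  using assms Re_Ln_pos_lt nz by blast+
 then have "- pi < Im (Ln a - Ln b)" "Im (Ln a - Ln b)<=pi"
  by (auto simp: abs_less_iff)
 moreover have "exp (Ln a - Ln b)=a / b" using nz by (simp add: exp_diff)
 ultimately show ?thesis by (metis Ln_exp)
qed

lemma exp_eq_1_first:
 assumes "exp w=1" "0 < Im w" "Im w < 4 * pi"
 shows "w=2 * of_real pi * \<i>"
proof -
 obtain n :: int where n: "Re w=0" "Im w = of_int (2 * n) * pi"
  using assms(1) unfolding exp_eq_1 by blast
 have "0 < real_of_int n" "real_of_int n < 2"
  using assms(2,3) pi_gt_zero by (auto simp: n(2) zero_less_mult_iff)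
 then have "n=1" by linarith
 then show ?thesis using n by (simp add: cei)
qed

lemma Im_Ln_upper:
 assumes "Im z > 0" shows "0 < Im (Ln z)" "Im (Ln z) < pi"
 using assms Im_Ln_pos_lt[of z] by force+

text \<open>The factors 1 - i, -1 and i rotate the sides of the triangle into the right half plane.
  Regrouped by vertices, the sum consists of three logarithms with imaginary parts in (0, pi), so it
  is a multiple of 2 pi i with imaginary part strictly between 0 and 4 pi.\<close>

lemma winding_triangle:
 fixes z0 z1 z2 :: complex
 assumes "z0 = Complex (-1/3) (-1/3)" "z1 = Complex (2/3) (-1/3)" "z2 = Complex (-1/3) (2/3)"
 shows "(Ln ((1 - \<i>) * z2) - Ln ((1 - \<i>) * z1)) - (Ln (- z2) - Ln (- z0))+(Ln (\<i> * z1) - Ln (\<i> * z0))=2 * of_real pi * \<i>"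
  (is "?w=_")
proof -
 have 1: "Ln (\<i> * z1) - Ln ((1 - \<i>) * z1) = Ln (Complex (-1/2) (1/2))"
 proof -
  have "(\<i> * z1) / ((1 - \<i>) * z1) = Complex (-1/2) (1/2)"
   by (simp add: assms cei Re_divide Im_divide pes)
  then show ?thesis
   by (subst Ln_df_hp) (simp_all add: assms)
 qed
 have 2: "Ln ((1 - \<i>) * z2) - Ln (- z2) = Ln (Complex (-1) 1)"
 proof -
  have "((1 - \<i>) * z2) / (- z2) = Complex (-1) 1"
   by (simp add: assms cei Re_divide Im_divide pes)
  then show ?thesis
   by (subst Ln_df_hp) (simp_all add: assms)
 qed
 have 3: "Ln (- z0) - Ln (\<i> * z0) = Ln (\<i>)"
 proof -
  have "(- z0) / (\<i> * z0)=\<i>"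
   by (simp add: assms cei Re_divide Im_divide pes)
  then show ?thesis
   by (subst Ln_df_hp) (simp_all add: assms)
 qed
 have w: "?w = Ln (Complex (-1/2) (1/2)) + Ln (Complex (-1) 1) + Ln \<i>"
  unfolding 1[symmetric] 2[symmetric] 3[symmetric] by simp
 have "exp ?w=1"
  unfolding w exp_add by (subst exp_Ln, simp add: cei)+ (simp add: cei)
 moreover have "0 < Im ?w" "Im ?w < 4 * pi"
  unfolding w using Im_Ln_upper[of "Complex (-1/2) (1/2)"] Im_Ln_upper[of "Complex (-1) 1"] pi_gt_zero by auto
 ultimately show ?thesis by (rule exp_eq_1_first)
qed

text \<open>The normalisation that makes \<open>hyp\<close> the positive generator. On the boundary
  the coefficient of u vanishes, so all faces are the constant edge at the line of v, while the lift
  is \<open>ze x *C v\<close> with \<open>ze\<close> running once around 0.\<close>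

lemma hyp_lsx:
 fixes u v :: "'h::complex_hilbert"
 assumes uv: "norm u=1" "norm v=1" "cin1 u v=0"
 shows "hyp 2 (lsx1 u v) - hyp 2 (restrict (%_. lpr1 v) (Dl 2))=1"
  "lsx1 u v:Sing PSp1 2" "restrict (%_. lpr1 v) (Dl 2):Sing PSp1 2"
  "k<=2==>sface1 2 k (lsx1 u v)=sface1 2 k (restrict (%_. lpr1 v) (Dl 2))"
  "x:Dl 2==>EX a b. a *C u+b *C v~=0&lsx1 u v x=lpr1 (a *C u+b *C v)"
proof -
 define ze where "ze x = Complex (x 1 - 1/3) (x 2 - 1/3)" for x :: "nat=>real"
 define rh where "rh x = cofr (x 0 * x 1 * x 2)" for x :: "nat=>real"
 define L where "L x=rh x *C u+ze x *C v" for x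
 define sg0 where "sg0=restrict (%_. lpr1 v) (Dl 2)"
 define ep where "ep=restrict (%_. lpr1 v) (Dl 1)"
 have v0: "v~=0" using uv by auto
 have co: "cont_on S (%x :: nat=>real. x j)" for S j
  by (rule continuous_on_subset[OF continuous_on_product_coordinates subset_UNIV])
 have cze: "cont_on S ze" and cL: "cont_on S L" for S
  unfolding L_def rh_def ze_def Complex_eq by (intro continuous_intros co)+
 have rh0: "ze x=0==>x:Dl 2==>rh x~=0" for x
  using stx_sum[of x 2] by (auto simp: ze_def rh_def cei n2e2)
 have L0: "L x~=0" if x: "x:Dl 2" for x
 proof
  assume "L x=0"
  then have "cin1 (L x) u=0" "cin1 (L x) v=0" by simp_all
  then have "rh x=0" "ze x=0"
   using uv cico[of v u] by (auto simp: L_def cal csl cin_self)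
  then show False using rh0 x by blast
 qed
 have ls: "lsx1 u v=restrict (%x. lpr1 (L x)) (Dl 2)"
  by (simp add: line_simplex_def L_def rh_def ze_def)
 have Lls: "isl 2 (lsx1 u v) L"
  using L0 cL by (auto simp: isl_def ls)
 have Lsg: "isl 2 sg0 (%_. v)" and Lep: "isl 1 ep (%_. v)"
  using v0 by (auto simp: isl_def sg0_def ep_def)
 have S: "lsx1 u v:Sing PSp1 2" "sg0:Sing PSp1 2" "ep:Sing PSp1 1"
  using L0 cL v0 by (auto simp: Sing_def PSp_eq ssx_eucl ls sg0_def ep_def lpr_PH
    intro!: con_lpr cong: continuous_on_cong)
 have D: "xface1 k x:Dl 2" if "k<=2" "x:Dl 1" for k x
  using stx_face[of k 1 x] that by (simp add: n2e2)
 have rhf: "rh (xface1 k x)=0" if "k<=2" for k x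
 proof -
  have "k=0 | k=1 | k=2" using that by linarith
  then show ?thesis by (auto simp: rh_def sfd1)
 qed
 have zef: "ze (xface1 k x)~=0" if "k<=2" "x:Dl 1" for k x
  using rh0[OF _ D[OF that]] rhf[OF that(1)] by blast
 have fls: "sface1 2 k (lsx1 u v)=ep" if "k<=2" for k
  using D[OF that] zef[OF that] by (auto simp: sfd ls ep_def L_def rhf[OF that] lpr_sC fei)
 have fsg: "sface1 2 k sg0=ep" if "k<=2" for k
  using D[OF that] by (auto simp: sfd sg0_def ep_def fei)
 have e: "elog ep (%x. L (xface1 k x))=logch (%x. ze (xface1 k x))+elog ep (%_. v)" if k: "k<=2" for k
 proof -
  have "(%x. L (xface1 k x))=(%x. ze (xface1 k x) *C v)"
   by (simp add: L_def rhf[OF k])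
  then show ?thesis
   using elog_mult[OF S(3) Lep, of "%x. ze (xface1 k x)"] con_face[of 1 ze k] cze zef[OF k] k
   by (simp add: n2e2)
 qed
 define l where "l k=logch (%x. ze (xface1 k x))" for k
 have fc: "cont_on (Dl 1) (%x. ze (xface1 k x))" if "k<=2" for k
  using con_face[of 1 ze k] cze that by (simp add: n2e2)
 have x01: "x 0+x 1=1" if "x:Dl 1" for x
  using stx_sum[OF that] by simp
 have z: "ze (vx 0) = Complex (-1/3) (-1/3)" "ze (vx 1) = Complex (2/3) (-1/3)" "ze (vx 2) = Complex (-1/3) (2/3)"
  by (simp_all add: ze_def vx_def)
 have l0: "l 0 = Ln ((1 - \<i>) * ze (vx 2)) - Ln ((1 - \<i>) * ze (vx 1))"
 proof -
  have "Re ((1 - \<i>) * ze (xface1 0 x)) > 0" if "x:Dl 1" for x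
   using x01[OF that] by (simp add: ze_def sfd1 n2e2)
  from logch_hp[OF fc this] show ?thesis
   by (simp add: l_def xface_vx n2e2)
 qed
 have l1: "l 1 = Ln (- ze (vx 2)) - Ln (- ze (vx 0))"
 proof -
  have "Re ((- 1) * ze (xface1 1 x)) > 0" if "x:Dl 1" for x
   by (simp add: ze_def sfd1 n2e2)
  from logch_hp[OF fc this] show ?thesis
   by (simp add: l_def xface_vx n2e2)
 qed
 have l2: "l 2 = Ln (\<i> * ze (vx 1)) - Ln (\<i> * ze (vx 0))"
 proof -
  have "Re (\<i> * ze (xface1 2 x)) > 0" if "x:Dl 1" for x
   by (simp add: ze_def sfd1 n2e2)
  from logch_hp[OF fc this] show ?thesis
   by (simp add: l_def xface_vx n2e2)
 qed
 have w: "l 0 - l 1+l 2=2 * of_real pi * \<i>"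
  unfolding l0 l1 l2 by (rule winding_triangle[OF z])
 define c where "c=elog ep (%_. v)"
 have "complex_of_int (hyp 2 (lsx1 u v))=(\<Sum>k\<le>2. (-1) ^ k * (l k + c)) / (2 * of_real pi * \<i>)"
  unfolding hyp_eq[OF S(1) Lls] by (intro arg_cong2[of _ _ _ _ "(/)"] suco) (auto simp: fls e l_def c_def)
 moreover have "complex_of_int (hyp 2 sg0)=(\<Sum>k\<le>2. (-1) ^ k * c) / (2 * of_real pi * \<i>)"
  unfolding hyp_eq[OF S(2) Lsg] by (intro arg_cong2[of _ _ _ _ "(/)"] suco) (auto simp: fsg c_def)
 ultimately have "complex_of_int (hyp 2 (lsx1 u v) - hyp 2 sg0)=(l 0 - l 1+l 2) / (2 * of_real pi * \<i>)"
  by (simp add: n2e2 diff_divide_distrib add_divide_distrib)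
 also have "... = of_int 1" unfolding w by simp
 finally show "hyp 2 (lsx1 u v) - hyp 2 (restrict (%_. lpr1 v) (Dl 2))=1"
  unfolding of_int_eq_iff sg0_def .
 show "lsx1 u v:Sing PSp1 2" "restrict (%_. lpr1 v) (Dl 2):Sing PSp1 2"
  using S by (simp_all add: sg0_def)
 show "sface1 2 k (lsx1 u v)=sface1 2 k (restrict (%_. lpr1 v) (Dl 2))" if "k<=2"
  using fls[OF that] fsg[OF that] by (simp add: sg0_def)
 show "EX a b. a *C u+b *C v~=0&lsx1 u v x=lpr1 (a *C u+b *C v)" if "x:Dl 2"
  using L0[OF that] that by (intro exI[of _ "rh x"] exI[of _ "ze x"]) (simp add: ls L_def)
qed

lemma prism_vertex:
 "prism H 0 0 sg=restrict (%x. H (x 1) (sg (vx 0))) (Dl 1)"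
proof (rule ext)
 fix x
 show "prism H 0 0 sg x=restrict (%x. H (x 1) (sg (vx 0))) (Dl 1) x"
 proof (cases "x:Dl 1")
  case True
  then have "x 0+x 1=1" "!!j. j > 1==>x j=0"
   using stx_sum[OF True] stx_zero[OF True] by auto
  then have "mrg 0 x=vx 0" by (auto simp: mrg_def vx_def fei)
  then show ?thesis using True by (simp add: prism_def tsum_def)
 qed (simp add: prism_def)
qed

definition sgm :: "complex=>complex=>(nat=>real)=>complex" where
 "sgm a b x=a + of_real (x 1)*(b - a)"

lemma con_sgm: "cont_on S (sgm a b)"
 unfolding sgm_def[abs_def]
 by (intro continuous_intros continuous_on_subset[OF continuous_on_product_coordinates subset_UNIV])

text \<open>Top, bottom, right and left side, with the signs in which they arise in
  \<open>DD_unit\<close>: together they run clockwise around 0, whence the minus sign. Each side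
  lies in a half plane, where \<open>logch_hp\<close> applies.\<close>

lemma winding_square:
 "logch (sgm (Complex (-1) 1) (Complex 1 1)) - logch (sgm (Complex (-1) (-1)) (Complex 1 (-1)))
  - logch (sgm (Complex 1 (-1)) (Complex 1 1))+logch (sgm (Complex (-1) (-1)) (Complex (-1) 1))
  = - (2 * of_real pi * \<i>)"
proof -
 have h: "logch (sgm a b) = Ln (c * b) - Ln (c * a)" if "Re (c * a) > 0" "Re (c * b) > 0" for a b c
 proof -
  have re: "Re (c * sgm a b x) > 0" if "x:Dl 1" for x
  proof -
   have x: "0<=x 1" "x 1<=1" using that by (auto simp: ssd1)
   have "Re (c * sgm a b x)=(1 - x 1) * Re (c * a)+x 1 * Re (c * b)"
    by (simp add: sgm_def alsi)
   also have "... > 0"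
   proof (cases "x 1=1")
    case False
    then have "(1 - x 1) * Re (c * a) > 0" using x `Re (c * a) > 0` by simp
    moreover have "x 1 * Re (c * b) >= 0" using x `Re (c * b) > 0` by simp
    ultimately show ?thesis by linarith
   qed (use `Re (c * b) > 0` in simp)
   finally show ?thesis .
  qed
  have "sgm a b (vx 1)=b" "sgm a b (vx 0)=a"
   by (simp_all add: sgm_def vx_def)
  then show ?thesis
   using logch_hp[OF con_sgm re] by simp
 qed
 define d where "d = Ln (Complex 1 1) - Ln (Complex 1 (-1))"
 have "Complex 1 1 / Complex 1 (-1)=\<i>"
  by (simp add: cei Re_divide Im_divide pes)
 then have d: "d = Ln \<i>" unfolding d_def by (subst Ln_df_hp) simp_all
 have c: "- \<i> * Complex 1 1 = Complex 1 (-1)" "- \<i> * Complex (-1) 1 = Complex 1 1"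
  "\<i> * Complex 1 (-1) = Complex 1 1" "\<i> * Complex (-1) (-1) = Complex 1 (-1)"
  "(-1) * Complex (-1) 1 = Complex 1 (-1)" "(-1) * Complex (-1) (-1) = Complex 1 1"
  by (simp_all add: cei)
 have 1: "logch (sgm (Complex (-1) 1) (Complex 1 1)) = - d"
  using h[of "- \<i>" "Complex (-1) 1" "Complex 1 1"] unfolding c d_def by simp
 have 2: "logch (sgm (Complex (-1) (-1)) (Complex 1 (-1)))=d"
  using h[of "\<i>" "Complex (-1) (-1)" "Complex 1 (-1)"] unfolding c d_def by simp
 have 3: "logch (sgm (Complex 1 (-1)) (Complex 1 1))=d"
  using h[of 1 "Complex 1 (-1)" "Complex 1 1"] unfolding d_def by simp
 have 4: "logch (sgm (Complex (-1) (-1)) (Complex (-1) 1)) = - d"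
  using h[of "- 1" "Complex (-1) (-1)" "Complex (-1) 1"] unfolding c d_def by simp
 show ?thesis unfolding 1 2 3 4 d by (simp add: field_simps)
qed

context complex_coordinate

begin

lemma Dx_0: "Dx fi 0 sg=fi 1 (restrict (%x. Kx (2 * x 1 - 1) (sg (vx 0))) (Dl 1))"
 and Dy_0: "Dy fi 0 sg=fi 1 (restrict (%x. Ky (2 * x 1 - 1) (sg (vx 0))) (Dl 1))"
 by (simp_all add: Dx_def Dy_def hop_def prism_vertex[simplified])

text \<open>Stokes: the integral of \<open>cd W\<close> over the square is the sum of
  \<open>W\<close> over its sides. The values of mu at the corners cancel and the logarithms of z
  give one turn, so \<open>DD et\<close> is -1, with square 1.\<close>

lemma DD_unit:
 assumes et: "eqn (Sing M) et (cd W)" and deg: "!!n. n~=1==>W n=0"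
  and W: "!!e. e:Sub M nz 1==>of_int (W 1 e)*(2 * of_real pi * \<i>)=logch (%x. z (e x)) - (mu (e (vx 1)) - mu (e (vx 0)))"
 shows "eqn (Sing M) (DD et \<smile> DD et) un"
proof -
 have deg0: "DD (cd W) n sg=0" if "n~=0" for n sg
  using that deg by (auto simp: DD_def Dx_def Dy_def hop_def cd_def intro!: sum.neutral)
 have val: "DD (cd W) 0 sg = -1" if sg: "sg:Sing M 0" for sg
 proof -
  define m where "m=sg (vx 0)"
  have m: "m:tsp1 M"
   using sg by (auto simp: m_def Sing_def ssd cmd Pi_iff)
  define E where "E a b=restrict (%x. G (sgm a b x) m) (Dl 1)" for a b
  define A B C D where "A = Complex (-1) (-1)" and "B = Complex 1 (-1)" and "C = Complex 1 1" and "D = Complex (-1) 1"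
  have seg: "sgm D C x = Complex (2 * x 1 - 1) 1" "sgm A B x = Complex (2 * x 1 - 1) (-1)"
    "sgm B C x = Complex 1 (2 * x 1 - 1)" "sgm A D x = Complex (-1) (2 * x 1 - 1)" for x
   by (auto simp: sgm_def A_def B_def C_def D_def cei)
  have s0: "smap1 0 f sg (vx 0) = f m" for f :: "'m=>'m"
   by (simp add: smd m_def)
  have Dycd: "Dy (cd W)=pb (Ky 1) W - pb (Ky (-1)) W - cd (Dy W)"
   using hop_cd[of "%t. Ky (2 * t - 1)" W] by (simp add: Dy_def eq_diff_eq)
  have Dxcd: "Dx (cd (Dy W)) 0 sg=Dy W 0 (smap1 0 (Kx 1) sg) - Dy W 0 (smap1 0 (Kx (-1)) sg)"
  proof -
   have "Dx (cd (Dy W))=pb (Kx 1) (Dy W) - pb (Kx (-1)) (Dy W) - cd (Dx (Dy W))"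
    using hop_cd[of "%t. Kx (2 * t - 1)" "Dy W"] by (simp add: Dx_def eq_diff_eq)
   then show ?thesis by (simp add: pb_def cd_0)
  qed
  have "DD (cd W) 0 sg=Dx (pb (Ky 1) W) 0 sg - Dx (pb (Ky (-1)) W) 0 sg - Dx (cd (Dy W)) 0 sg"
   unfolding DD_def Dycd by (simp add: Dx_def hop_df)
  also have "Dx (pb (Ky 1) W) 0 sg=W 1 (E D C)"
   unfolding Dx_0 pb_def E_def seg m_def[symmetric]
   by (intro arg_cong[where f="W 1"]) (auto simp: smd fei Kx_def Ky_def zG GG m)
  also have "Dx (pb (Ky (-1)) W) 0 sg=W 1 (E A B)"
   unfolding Dx_0 pb_def E_def seg m_def[symmetric]
   by (intro arg_cong[where f="W 1"]) (auto simp: smd fei Kx_def Ky_def zG GG m)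
  also have "Dx (cd (Dy W)) 0 sg=W 1 (E B C) - W 1 (E A D)"
   unfolding Dxcd Dy_0 s0 E_def seg
   by (intro arg_cong2[of _ _ _ _ "(-)"] arg_cong[where f="W 1"]) (auto simp: fei Kx_def Ky_def zG GG m)
  finally have u: "DD (cd W) 0 sg=W 1 (E D C) - W 1 (E A B) - (W 1 (E B C) - W 1 (E A D))" .
  have EW: "of_int (W 1 (E a b))*(2 * of_real pi * \<i>)=logch (sgm a b) - (mu (G b m) - mu (G a m))"
   if "!!x. x:Dl 1==>sgm a b x~=0" for a b
  proof -
   have "cmap (topo (Dl 1)) M (%x. G (sgm a b x) m)"
    using m by (intro cm_G) (auto intro: con_sgm)
   then have "ssx1 1 M (E a b)"
    by (simp add: ssd pt_euclidean E_def continuous_map_eq)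
   then have "E a b:Sub M nz 1"
    using that m by (auto simp: Sing_def sss E_def zG)
   from W[OF this] show ?thesis
    using logch_cong[of "%x. z (E a b x)" "sgm a b"] m by (simp add: E_def zG sgm_def vx_def)
  qed
  have nz: "sgm D C x~=0" "sgm A B x~=0" "sgm B C x~=0" "sgm A D x~=0" for x
   unfolding seg by (auto simp: cei)
  have "complex_of_int (DD (cd W) 0 sg)*(2 * of_real pi * \<i>) =
    logch (sgm D C) - logch (sgm A B) - logch (sgm B C)+logch (sgm A D)"
   using EW[OF nz(1)] EW[OF nz(2)] EW[OF nz(3)] EW[OF nz(4)] unfolding u
   by (simp add: left_diff_distrib)
  also have "... = - (2 * of_real pi * \<i>)"
   unfolding A_def B_def C_def D_def by (rule winding_square)
  finally have "complex_of_int (DD (cd W) 0 sg)*(2 * of_real pi * \<i>) = - (2 * of_real pi * \<i>)" .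
  then have "complex_of_int (DD (cd W) 0 sg)*(2 * of_real pi * \<i>)=(- 1)*(2 * of_real pi * \<i>)"
   by simp
  then have "complex_of_int (DD (cd W) 0 sg) = - 1"
   by (subst (asm) mult_right_cancel) auto
  then have "complex_of_int (DD (cd W) 0 sg) = of_int (-1)"
   by simp
  then show ?thesis unfolding of_int_eq_iff .
 qed
 have u: "eqn (Sing M) (DD et) (- un)"
  using eq_DD[OF et] deg0 val by (auto simp: eqn_def un_def)
 have "eqn (Sing M) (DD et \<smile> DD et) ((- un) \<smile> (- un))"
  using u u by (rule eq_cup) simp
 also have "(- un) \<smile> (- un)=(un \<smile> un :: 'm tc)"
  by (simp add: cup_um_l cup_um_r)
 also have "eqn (Sing M) (un \<smile> un) un" by (rule un_cup) simp
 finally show ?thesis .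
qed

text \<open>\<open>s\<close> is a lift to \<open>H\<close>; \<open>z\<^sup>-\<^sup>1 s\<close> is a lift away from the zero section.\<close>

theorem local_Thom_hyp:
 fixes s s' :: "'m=>'h::complex_hilbert"
 assumes s: "cmap M eucl1 s" "!!m. m:tsp1 M==>s m~=0"
  and s': "cmap (sbt1 M nz) eucl1 s'" "!!m. m:tsp1 M==>z m~=0==>s m=z m *C s' m"
  and et: "eqn (Sing M) et (pb (%m. lpr1 (s m)) hyp - cd (pick (Sub M nz) (liftc s') 0))"
 shows "TH (Sing M) (Sub M nz) et"
proof (rule local_Thom)
 define q where "q=pick (Sub M nz) (liftc s') 0"
 have s'0: "s' m~=0" if "m:tsp1 M" "z m~=0" for m
  using s(2)[OF that(1)] s'(2)[OF that] by auto
 have q: "eqn (Sub M nz) q (liftc s')" unfolding q_def by (rule pick_in)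
 have h: "eqn (Sing M) (pb (%m. lpr1 (s m)) hyp) (cd (liftc s))"
  by (rule hyp_lift[OF s])
 \<comment> \<open>\<open>liftc s\<close> comes from a lift on all of M, whereas \<open>q\<close>
   extends \<open>liftc s'\<close> from z ~= 0. On edges away from the zero section their difference
   measures the logarithm of z, as \<open>s = z s'\<close>; it is the \<open>W\<close> of
   \<open>DD_unit\<close>.\<close>
 have et': "eqn (Sing M) et (cd (liftc s - q))"
  using et h by (simp add: q_def cd_df eqn_def)
 show "eqn (Sing M) (cd et) 0"
  using eq_cd[OF et'] by simp
 have lp: "lpr1 (s m)=lpr1 (s' m)" if "m:tsp1 M" "z m~=0" for m
  using s'(2)[OF that] that by (simp add: lpr_sC)
 have "eqn (Sub M nz) (pb (%m. lpr1 (s' m)) hyp) (cd (liftc s'))"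
  by (rule hyp_lift[OF s'(1)]) (use s'0 in auto)
 moreover have "eqn (Sub M nz) (pb (%m. lpr1 (s m)) hyp) (pb (%m. lpr1 (s' m)) hyp)"
  by (rule pb_cong) (use lp in auto)
 ultimately show "eqn (Sub M nz) et 0"
  using eq_Sub[OF et, of nz] eq_cd[OF q] by (simp add: q_def eqn_def)
 show "eqn (Sing M) (DD et \<smile> DD et) un"
 proof (rule DD_unit[OF et'])
  show "(liftc s - q) n=0" if "n~=1" for n
   using that by (auto simp: fei liftc_def q_def pick_def)
  fix e assume e: "e:Sub M nz 1"
  then have eM: "e:Sing M 1" using Sub_le[of M nz] by (auto simp: le_fun_def)
  have ex: "e x:tsp1 M" "z (e x)~=0" if "x:Dl 1" for x
   using e that by (auto simp: Sing_def sss ssd cmd Pi_iff image_subset_iff)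
  let ?e = "smap1 1 (%y. lpr1 (s' y)) e"
  have ee: "smap1 1 (%y. lpr1 (s y)) e=?e"
   using lp ex by (auto simp: smd fei)
  have L: "?e:Sing PSp1 1" "isl 1 ?e (%x. s' (e x))"
   using lift_simplex[OF s'(1) _ e] s'0 by auto
  have "cmap (topo (Dl 1)) M e"
   using eM by (simp add: Sing_def ssd pt_euclidean)
  from cmc[OF this z]
  have cz: "cont_on (Dl 1) (%x. z (e x))" by (simp add: o_def)
  have "elog ?e (%x. s (e x))=elog ?e (%x. z (e x) *C s' (e x))"
   unfolding elog_def by (intro arg_cong2[of _ _ _ _ "(+)"] logch_cong refl) (use s'(2) ex in auto)
  also have "... = logch (%x. z (e x))+elog ?e (%x. s' (e x))"
   by (rule elog_mult[OF L cz]) (use ex in auto)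
  finally have el: "elog ?e (%x. s (e x)) = ..." .
  define mu1 mu2 where "mu1 m = Ln (ratio (s m) (pick_vec (lpr1 (s m))))" and "mu2 m = Ln (ratio (s' m) (pick_vec (lpr1 (s' m))))" for m
  have 1: "of_int (liftc s 1 e)*(2 * of_real pi * \<i>)=elog ?e (%x. s (e x)) - (mu1 (e (vx 1)) - mu1 (e (vx 0)))"
   using liftc_eq[OF s eM, unfolded ee] by (simp add: mu1_def)
  have 2: "of_int (liftc s' 1 e)*(2 * of_real pi * \<i>)=elog ?e (%x. s' (e x)) - (mu2 (e (vx 1)) - mu2 (e (vx 0)))"
   using liftc_eq[OF s'(1) _ e] s'0 by (simp add: mu2_def)
  have "(liftc s - q) 1 e=liftc s 1 e - liftc s' 1 e"
   using q e by (simp add: eqn_def)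
  then show "of_int ((liftc s - q) 1 e)*(2 * of_real pi * \<i>) =
    logch (%x. z (e x)) - ((%m. Ln (ratio (s m) (pick_vec (lpr1 (s m)))) - Ln (ratio (s' m) (pick_vec (lpr1 (s' m))))) (e (vx 1)) -
     (%m. Ln (ratio (s m) (pick_vec (lpr1 (s m)))) - Ln (ratio (s' m) (pick_vec (lpr1 (s' m))))) (e (vx 0)))"
   using 1 2 unfolding el by (simp add: left_diff_distrib mu1_def mu2_def alsi)
 qed
qed

end

section \<open>Projective bundles\<close>

lemma cm_comp_on:
 assumes "cmap X eucl1 f" "!!x. x:tsp1 X==>f x:S" "cont_on S h"
 shows "cmap X eucl1 (%x. h (f x))"
proof -
 have "cmap X (topo S) f"
  using assms(1,2) by (auto simp: cmis)
 from cmc[OF this, of euclidean h] show ?thesis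
  using assms(3) by (simp add: o_def)
qed

lemma cm_bilinear:
 assumes "bounded_bilinear h" "cmap X eucl1 f" "cmap X eucl1 g"
 shows "cmap X eucl1 (%x. h (f x) (g x))"
 by (rule cm_comp2[OF assms(2,3)])
  (auto simp: spde intro!: bbco[OF assms(1)] continuous_intros)

lemmas cm_ap = cm_bilinear[OF bounded_bilinear_blinfun_apply]

lemmas cm_o = cm_bilinear[OF bounded_bilinear_blinfun_compose]

lemmas cm_cin = cm_bilinear[OF bbl_cin]

lemmas cm_sC = cm_bilinear[OF bbl_sC]

lemmas cm_sR = cm_bilinear[OF bounded_bilinear_scaleR]

lemmas cm_tens = cm_bilinear[OF bbl_tens]

lemma cm_add:
 fixes f g :: "'x=>'a::real_normed_vector"
 shows "cmap X eucl1 f==>cmap X eucl1 g==>cmap X eucl1 (%x. f x+g x)"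
 by (rule cm_comp2) (auto simp: spde intro!: continuous_intros)

lemma cm_df:
 fixes f g :: "'x=>'a::real_normed_vector"
 shows "cmap X eucl1 f==>cmap X eucl1 g==>cmap X eucl1 (%x. f x - g x)"
 by (rule cm_comp2) (auto simp: spde intro!: continuous_intros)

lemma cm_sum:
 fixes f :: "'i=>'x=>'a::real_normed_vector"
 shows "(!!i. i:I==>cmap X eucl1 (f i))==>cmap X eucl1 (%x. \<Sum>i\<in>I. f i x)"
 by (induction I rule: infinite_finite_induct) (auto intro: cm_add)

lemma cm_cst [simp]: "cmap X eucl1 (%x. c)"
 by simp

lemma cm_norm: "cmap X eucl1 f==>cmap X eucl1 (%x. norm (f x))"
 by (rule cm_comp) (auto intro: continuous_intros)

lemma cm_lpr:
 "cmap X eucl1 f==>(!!x. x:tsp1 X==>f x~=0)==>cmap X PSp1 (%x. lpr1 (f x))"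
 unfolding PSp_eq cmis
proof
 assume f: "cmap X eucl1 f" "!!x. x:tsp1 X==>f x~=0"
 have "cont_on (- {0}) (lpr1 :: 'b=>_)"
  by (rule con_lpr[OF continuous_on_id]) simp
 then show "cmap X eucl1 (%x. lpr1 (f x))"
  by (rule cm_comp_on[OF f(1), rotated]) (simp add: f(2))
qed (simp add: lpr_PH)

lemma act_PH:
 assumes "l:PH" "clin1 T" "sadj1 T" "T oL l~=0"
 obtains v where "norm v=1" "l=lpr1 v" "T v~=0" "act T l=lpr1 (T v)"
proof -
 obtain v where v: "norm v=1" "l=lpr1 v" "l=tens v v" using assms(1) by (rule PH_E)
 have "T v~=0"
 proof
  assume "T v=0"
  then have "T oL l=0"
   using assms(2) by (intro bleq) (simp add: v(3) cld)
  then show False using assms(4) by simp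
 qed
 then show ?thesis using that v act_lpr[OF assms(2,3)] by metis
qed

lemma cm_act:
 assumes f: "cmap X eucl1 f" and g: "cmap X eucl1 g"
  and fg: "!!x. x:tsp1 X==>clin1 (f x)&sadj1 (f x)&g x:PH&f x oL g x~=0"
 shows "cmap X PSp1 (%x. act (f x) (g x))"
 unfolding PSp_eq cmis
proof
 have nz: "f x oL g x oL f x~=0" if x: "x:tsp1 X" for x
 proof -
  obtain v where v: "norm v=1" "g x=lpr1 v" "f x v~=0" "act (f x) (g x)=lpr1 (f x v)"
   using act_PH[of "g x" "f x"] fg[OF x] by metis
  then have "f x oL g x oL f x=tens (f x v) (f x v)"
   using o_tens[of "f x" v v] fg[OF x] by (simp add: lpr_norm)
  then show ?thesis using v(3) norm_tens[of "f x v" "f x v"] by (metis mult_eq_0_iff norm_eq_zero norm_zero)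
 qed
 have "cmap X eucl1 (%x. f x oL g x oL f x)"
  by (intro cm_o f g)
 then have "cmap X eucl1 (%x. (%A. (1 / norm A) *R A) (f x oL g x oL f x))"
  by (rule cm_comp_on[where S="- {0}"]) (auto simp: nz intro!: continuous_intros)
 then show "cmap X eucl1 (%x. act (f x) (g x))" by (simp add: act_def)
 show "(%x. act (f x) (g x)):tsp1 X \<rightarrow> PH"
 proof
  fix x assume "x:tsp1 X"
  then obtain v where "f x v~=0" "act (f x) (g x)=lpr1 (f x v)"
   using act_PH[of "g x" "f x"] fg by metis
  then show "act (f x) (g x):PH" by (simp add: lpr_PH)
 qed
qed

section \<open>Cup powers, projective bundles and their affine charts\<close>

fun cpow :: "'a tc=>nat=>'a tc" where
 "cpow et 0=un"
| "cpow et (Suc j) = cpow et j \<smile> et"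

lemma pb_cpow: "pb f (cpow et j) = cpow (pb f et) j"
 by (induction j) (auto simp: pb_cup)

lemma cd_cpow:
 assumes "eqn T (cd et) 0" "fclosed T"
 shows "eqn T (cd (cpow et j)) 0"
proof (induction j)
 case (Suc j)
 then show ?case
  using eq_cup0_l[OF Suc assms(2), of et] eq_cup0_r[OF assms, of "ci (cpow et j)"]
  by (simp add: cd_cup eqn_def)
qed simp

lemma cpow_change:
 assumes T: "fclosed T" and et: "eqn T (cd et) 0" and et': "eqn T et' (et + cd tt)"
 shows "EX h. eqn T (cpow et' j) (cpow et j + cd h)"
proof (induction j)
 case (Suc j)
 then obtain h where h: "eqn T (cpow et' j) (cpow et j + cd h)" by blast
 let ?h = "(h \<smile> et)+(ci (cpow et j) \<smile> tt)+(h \<smile> cd tt)"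
 have c: "eqn T (cd (cpow et j)) 0" by (rule cd_cpow[OF et T])
 have "eqn T (cpow et' (Suc j)) ((cpow et j + cd h) \<smile> (et + cd tt))"
  using eq_cup[OF h et' T] by simp
 moreover have "eqn T (cd (h \<smile> et)) (cd h \<smile> et)"
  using eq_cup0_r[OF et T, of "ci h"] by (simp add: cd_cup eqn_def)
 moreover have "eqn T (cd (ci (cpow et j) \<smile> tt)) (cpow et j \<smile> cd tt)"
  using eq_cup0_l[OF eq_ci[OF c, unfolded ci_zero] T, of tt] by (simp add: cd_cup cd_ci cup_um_l eqn_def)
 moreover have "cd (h \<smile> cd tt) = cd h \<smile> cd tt" by (simp add: cd_cup)
 ultimately have "eqn T (cpow et' (Suc j)) (cpow et (Suc j) + cd ?h)"
  by (simp add: cd_add cup_add_l cup_add_r eqn_def)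
 then show ?case by blast
qed (auto intro: exI[of _ 0])

lemma LH_change_cpow:
 assumes fc: "fclosed R" "fclosed T" and m: "maps pj T R"
  and et: "eqn T (cd et) 0" "eqn T et' (et + cd tt)"
  and L: "LH R T bot pj n (cpow et)"
 shows "LH R T bot pj n (cpow et')"
proof -
 obtain h where "!!j. eqn T (cpow et' j) (cpow et j + cd (h j))"
  using cpow_change[OF fc(2) et] by metis
 then show ?thesis
  using LH_change[OF fc fcl_bot m _ _ _ L, of "cpow et'" h] by simp
qed

definition PB :: "'y topology=>('y=>'h::complex_hilbert op)=>('y \<times> ('h op)) topology" where
 "PB Y p=sbt1 (prt Y PSp1) {(y, l). p y oL l=l}"

lemma tsp_PB: "tsp1 (PB Y p)={(y, l). y:tsp1 Y&l:PH&p y oL l=l}"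
 by (auto simp: PB_def PSp_eq)

lemma cm_PB:
 "cmap X (PB Y p) (%x. (f x, g x)) <->
  cmap X Y f&cmap X PSp1 g&(ALL x:tsp1 X. p (f x) oL g x=g x)"
 by (auto simp: PB_def cmis cmp o_def)

lemma cm_PB_fst: "cmap (PB Y p) Y fst"
 unfolding PB_def by (intro cmfs cmf)

lemma cm_PB_snd: "cmap (PB Y p) PSp1 snd"
 unfolding PB_def by (intro cmfs cms)

lemma cm_PB_snd': "cmap (PB Y p) eucl1 snd"
 using cm_PB_snd by (auto simp: PSp_eq cmis)

text \<open>An affine chart of projective space: for a line not orthogonal to w, its vector with
  inner product 1 with w.\<close>

definition sec :: "'h::complex_hilbert=>('h op)=>'h" where
 "sec w l=(1 / (norm (l w))\<^sup>2) *R l w"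

lemma sec:
 assumes "l:PH" "l w~=0"
 shows "cin1 (sec w l) w=1" "lpr1 (sec w l)=l" "sec w l~=0" "l (sec w l)=sec w l"
 using assms PH_cin_ap[OF assms(1), of w] PH_ap[OF assms] PH_idem[OF assms(1)]
 by (auto simp: sec_def cin_sR_l lpr_sR blinfun.scaleR_right simp flip: of_real_mult)

lemma lpr_ap_eq_0: "v~=0==>lpr1 v w=0<->cin1 v w=0"
 by (simp add: lpr_ap) (metis cico complex_cnj_zero)

lemma sec_lpr:
 assumes "cin1 v w=1"
 shows "sec w (lpr1 v)=v"
proof -
 have v: "v~=0" using assms by auto
 then have nz: "lpr1 v w~=0" using assms by (simp add: lpr_ap_eq_0)
 have "lpr1 (sec w (lpr1 v))=lpr1 v" by (rule sec(2)[OF lpr_PH[OF v] nz])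
 from lpr_eqD(1)[OF sec(3)[OF lpr_PH[OF v] nz] v this]
 obtain c where c: "sec w (lpr1 v) = c *C v" by blast
 then have "c=1" using sec(1)[OF lpr_PH[OF v] nz] assms by (simp add: csl)
 then show ?thesis using c by simp
qed

lemma cm_sec:
 assumes "cmap X eucl1 f" "cmap X eucl1 g" "!!x. x:tsp1 X==>bapp (g x) (f x)~=0"
 shows "cmap X eucl1 (%x. sec (f x) (g x))"
proof -
 have "cmap X eucl1 (%x. (%v. (1 / (norm v)\<^sup>2) *R v) (g x (f x)))"
  by (rule cm_comp_on[OF cm_ap[OF assms(2,1)], where S="- {0}"]) (use assms(3) in "auto intro!: continuous_intros")
 then show ?thesis by (simp add: sec_def)
qed

definition fp :: "nat=>(nat=>'y=>'h::complex_hilbert)=>'y=>'h op" where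
 "fp n e y=(\<Sum>i<n. tens (e i y) (e i y))"

definition frame :: "'y topology=>nat=>(nat=>'y=>'h::complex_hilbert)=>bool" where
 "frame Y n e<->(ALL i<n. cmap Y eucl1 (e i)) &
  (ALL y:tsp1 Y. ALL i<n. ALL j<n. cin1 (e i y) (e j y)=(if i=j then 1 else 0))"

lemma fp_ap: "fp n e y x=(\<Sum>i<n. cin1 x (e i y) *C e i y)"
 by (simp add: fp_def bsl)

lemma clin_0 [simp]: "clin1 0"
 and clin_id [simp]: "clin1 idb"
 and clin_add: "clin1 S==>clin1 T==>clin1 (S+T)"
 and clin_df: "clin1 S==>clin1 T==>clin1 (S - T)"
 and clin_sR: "clin1 S==>clin1 (r *R S)"
 and clin_o: "clin1 S==>clin1 T==>clin1 (S oL T)"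
 by (simp_all add: cld bbs scaleC_add_right sC_df_r sC_sR)

lemma clin_sum: "(!!i. i:I==>clin1 (T i))==>clin1 (\<Sum>i\<in>I. T i)"
 by (induction I rule: infinite_finite_induct) (auto intro: clin_add)

lemma sadj_0 [simp]: "sadj1 0"
 and sadj_id [simp]: "sadj1 idb"
 and sadj_add: "sadj1 S==>sadj1 T==>sadj1 (S+T)"
 and sadj_df: "sadj1 S==>sadj1 T==>sadj1 (S - T)"
 and sadj_sR: "sadj1 S==>sadj1 (r *R S)"
 by (simp_all add: sad bbs cal cin_add_r cin_df_l
   cin_df_r cin_sR_l cin_sR_r)

lemma sadj_sum: "(!!i. i:I==>sadj1 (T i))==>sadj1 (\<Sum>i\<in>I. T i)"
 by (induction I rule: infinite_finite_induct) (auto intro: sadj_add)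

lemma sadj_tens [simp]: "sadj1 (tens v v)"
 by (simp add: sad csl cin_sC_r muco) (metis cico)

lemma fp_linear [simp]: "clin1 (fp n e y)" "sadj1 (fp n e y)"
 unfolding fp_def by (intro clin_sum sadj_sum clin_tens sadj_tens)+

lemma fp_frame:
 assumes "frame Y m e" "y:tsp1 Y" "i < m" "n<=m"
 shows "fp n e y (e i y)=(if i < n then e i y else 0)"
proof -
 have "fp n e y (e i y)=(\<Sum>j<n. if j=i then e i y else 0)"
  unfolding fp_ap using assms by (intro suco) (auto simp: frame_def)
 then show ?thesis by simp
qed

lemma cm_fp: "frame Y m e==>n<=m==>cmap Y eucl1 (fp n e)"
 unfolding fp_def[abs_def] by (intro cm_sum cm_tens) (auto simp: frame_def)

lemma fp_0 [simp]: "fp 0 e y=0"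
 by (simp add: fp_def)

lemma PB_lpr: "clin1 T==>v~=0==>T oL lpr1 v=lpr1 v<->T v=v"
 by (metis babc bleq clinD lpr_ap lpr_self)

lemma o_lpr_0: "clin1 T==>v~=0==>T oL lpr1 v=0<->T v=0"
 by (metis babc bleq clinD lpr_ap lpr_self sC_zero_r zero_blinfun.rep_eq)

lemma Sub_eq_iff: "sg:Sub X U n<->sg:Sing X n&sg ` Dl n \<subseteq> U"
 by (auto simp: Sing_def sss)

lemma Sub_cong: "tsp1 X Int U=tsp1 X Int V==>Sub X U=Sub X V"
 by (metis subtopology_restrict)

lemma Sub_tsp: "tsp1 X \<subseteq> U==>Sub X U=Sing X"
 by (simp add: subtopology_superset)

definition opr :: "('h::complex_hilbert op)=>bool" where
 "opr p<->clin1 p&sadj1 p&p oL p=p"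

lemma opr_idem: "opr p==>p (p x)=p x"
 unfolding opr_def by (metis babc)

lemma opr_fp:
 assumes "frame Y m e" "y:tsp1 Y" "n<=m"
 shows "opr (fp n e y)"
proof -
 have "fp n e y (fp n e y x) = fp n e y x" for x
  unfolding fp_ap[of n e y x] blinfun.sum_right
  using fp_frame[OF assms(1,2)] assms(3) by (intro suco refl) (simp add: clinD[OF fp_linear(1)])
 then have "fp n e y oL fp n e y = fp n e y" by (intro bleq) simp
 then show ?thesis by (simp add: opr_def)
qed

text \<open>Adding a unit vector field \<open>w\<close> to a bundle with projections \<open>p\<close>: the projective bundle is covered
 by a neighbourhood \<open>V\<close> of the smaller projective bundle, a complex line bundle over it, and by the
 neighbourhood \<open>Z\<close> of the section given by \<open>w\<close>, the complement of the zero section.\<close>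

locale add_line =
 fixes Y :: "'y topology" and p :: "'y=>'h::complex_hilbert op" and w :: "'y=>'h"
 assumes cp: "cmap Y eucl1 p" and lin_p [simp]: "!!y. clin1 (p y)" "!!y. sadj1 (p y)"
  and pp: "!!y. y:tsp1 Y==>p y oL p y=p y"
  and cw: "cmap Y eucl1 w"
  and pw: "!!y. y:tsp1 Y==>cin1 (w y) (w y)=1" "!!y. y:tsp1 Y==>p y (w y)=0"

begin

definition p' where "p' y=p y+tens (w y) (w y)"

abbreviation "P' == PB Y p'"

definition A0 where "A0={(y, l). p y oL l=l}"

definition Z where "Z={(y, l). bapp l (w y)~=0}"

definition V where "V={(y, l). p y oL l~=0}"

lemma lin_p' [simp]: "clin1 (p' y)"
 by (simp add: p'_def clin_add clin_tens)

lemma p'_eq: "p' y x=p y x + cin1 x (w y) *C w y"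
 by (simp add: p'_def blinfun.add_left)

lemma p_idem: "y:tsp1 Y==>p y (p y x)=p y x"
 using pp by (metis babc)

lemma cin_pw: "y:tsp1 Y==>cin1 (p y x) (w y)=0"
 using lin_p(2)[of y] pw(2)[of y] by (simp add: sad)

lemma p'p: "y:tsp1 Y==>p' y (p y x)=p y x"
 by (simp add: p'_eq p_idem cin_pw)

lemma p'w: "y:tsp1 Y==>p' y (w y)=w y"
 by (simp add: p'_eq pw)

lemma P'_E:
 assumes "(y, l):tsp1 P'"
 obtains v where "y:tsp1 Y" "norm v=1" "v~=0" "l=lpr1 v" "p' y v=v" "l:PH"
  "v=p y v + cin1 v (w y) *C w y"
proof -
 from assms have l: "y:tsp1 Y" "l:PH" "p' y oL l=l" by (auto simp: tsp_PB)
 obtain v where v: "norm v=1" "l=lpr1 v" using l(2) by (metis PH_E)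
 have "v~=0" using v by auto
 then have "p' y v=v" using l(3) PB_lpr[OF lin_p'] v by metis
 then show ?thesis using that v l `v~=0` p'_eq[of y v] by metis
qed

lemma P'_I: "y:tsp1 Y==>v~=0==>p' y v=v==>(y, lpr1 v):tsp1 P'"
 using PB_lpr[OF lin_p', of v y] by (simp add: tsp_PB lpr_PH)

lemma Z_iff: "v~=0==>(y, lpr1 v):Z<->cin1 v (w y)~=0"
 by (simp add: Z_def lpr_ap_eq_0)

lemma V_iff: "v~=0==>(y, lpr1 v):V<->p y v~=0"
 by (simp add: V_def o_lpr_0)

lemma A0_iff: "v~=0==>(y, lpr1 v):A0<->p y v=v"
 by (simp add: A0_def PB_lpr)

lemma VZ: "tsp1 P' \<subseteq> V Un Z"
proof
 fix x assume "x:tsp1 P'"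
 then obtain y v where "x=(y, lpr1 v)" "v~=0" "v=p y v + cin1 v (w y) *C w y"
  by (metis P'_E surj_pair)
 then show "x:V Un Z" using Z_iff[of v y] V_iff[of v y] by auto
qed

lemma c_fst: "cmap Y X f==>cmap P' X (%x. f (fst x))"
 using cmc[OF cm_PB_fst, of Y X f p'] by (simp add: o_def)

lemma mp_fst: "maps fst (Sub P' U) (Sing Y)"
proof -
 have "maps fst (Sub P' U) (Sub Y UNIV)" by (rule mp_Sub[OF cm_PB_fst]) simp
 then show ?thesis by simp
qed

lemma openin_V: "openin P' (tsp1 P' Int V)" and openin_Z: "openin P' (tsp1 P' Int Z)"
proof -
 have "cmap P' eucl1 (%x. p (fst x) oL snd x)"
  by (rule cm_o[OF c_fst[OF cp] cm_PB_snd'])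
 from ocmp[OF this, of "- {0}"]
 show "openin P' (tsp1 P' Int V)" by (simp add: V_def open_Compl Int_def spde)
 have "cmap P' eucl1 (%x. bapp (snd x) (w (fst x)))"
  by (rule cm_ap[OF cm_PB_snd' c_fst[OF cw]])
 from ocmp[OF this, of "- {0}"]
 show "openin P' (tsp1 P' Int Z)" by (simp add: Z_def open_Compl Int_def spde)
qed

lemma PB_p: "PB Y p=sbt1 P' A0"
proof -
 have "tsp1 (prt Y PSp1) Int {(y, l). p y oL l=l}
   = tsp1 (prt Y PSp1) Int ({(y, l). p' y oL l=l} Int A0)"
  using p'p by (auto simp: A0_def) (metis babc bleq)
 from arg_cong[OF this, of "sbt1 (prt Y PSp1)"] show ?thesis
  by (simp only: PB_def subtopology_subtopology subtopology_restrict)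
qed

subsubsection \<open>The neighbourhood of the section\<close>

text \<open>Segments from \<open>sec (w y) l\<close> to \<open>w y\<close>, inside the affine
  hyperplane of vectors with inner product 1 with \<open>w y\<close>, deform Z to the section s. The
  conclusion is the Leray-Hirsch property of Z over Y with the single generator 1.\<close>

lemma Z_rtr:
 assumes a: "eqn (Sing Y) (cd a) 0" and ps: "eqn (Sub P' Z) (cd ps) (pb fst a)"
 obtains b tt where "eqn (Sing Y) a (cd b)" "eqn (Sub P' Z) ps (pb fst b + cd tt)"
proof -
 define s where "s y=(y, lpr1 (w y))" for y
 have en: "w y~=0" if "y:tsp1 Y" for y using pw(1)[OF that] by auto
 have cs: "cmap Y P' s"
  unfolding s_def cm_PB using en
  by (auto simp: PB_lpr p'w intro!: cm_lpr cw)
 have ms: "maps s (Sing Y) (Sub P' Z)"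
 proof -
  have "s ` (tsp1 Y Int UNIV) \<subseteq> Z" by (auto simp: s_def Z_iff en pw)
  from mp_Sub[OF cs this] show ?thesis by simp
 qed
 define H where "H t x=(fst x, lpr1 ((1 - t) *R sec (w (fst x)) (snd x)+t *R w (fst x)))" for t :: real and x
 let ?I = "topo {0..1::real}"
 have sZ: "cin1 (sec (w y) l) (w y)=1" "p' y (sec (w y) l)=sec (w y) l" "y:tsp1 Y"
  "lpr1 (sec (w y) l)=l"
  if x: "(y, l):tsp1 P'" "(y, l):Z" for y l
 proof -
  have l: "l:PH" "p' y oL l=l" "y:tsp1 Y" using x by (auto simp: tsp_PB)
  have nz: "l (w y)~=0" using x(2) by (simp add: Z_def)
  show "cin1 (sec (w y) l) (w y)=1" "y:tsp1 Y" "lpr1 (sec (w y) l)=l"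
   using sec[OF l(1) nz] l by auto
  show "p' y (sec (w y) l)=sec (w y) l"
   using sec(4)[OF l(1) nz] l(2) by (metis babc)
 qed
 have Hc: "cin1 ((1 - t) *R sec (w y) l+t *R w y) (w y)=1" if "(y, l):tsp1 P'" "(y, l):Z" for y l t
  using sZ[OF that] pw(1)[of y] by (simp add: cal cin_sR_l)
 have Hn: "(1 - t) *R sec (w y) l+t *R w y~=0" if "(y, l):tsp1 P'" "(y, l):Z" for y l t
  using Hc[OF that, of t] by auto
 have cH: "cmap (prt ?I (sbt1 P' Z)) (sbt1 P' Z) (%(t, x). H t x)"
 proof -
  let ?X = "prt ?I (sbt1 P' Z)"
  have cx: "cmap ?X W (%x. f (snd x))" if "cmap P' W f" for W and f
   by (rule cm_snd[OF cmfs[OF that]])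
  have ce': "cmap ?X eucl1 (%x. w (fst (snd x)))"
   by (rule cx[OF c_fst[OF cw]])
  have cs': "cmap ?X eucl1 (%x. sec (w (fst (snd x))) (snd (snd x)))"
   by (rule cm_sec[OF ce' cx[OF cm_PB_snd']]) (auto simp: Z_def)
  have "cmap ?X PSp1 (%x. lpr1 ((1 - fst x) *R sec (w (fst (snd x))) (snd (snd x)) + fst x *R w (fst (snd x))))"
   by (rule cm_lpr[OF cm_add[OF cm_sR[OF cm_df[OF cm_cst cm_fst] cs'] cm_sR[OF cm_fst ce']]])
    (use Hn in auto)
  then have "cmap ?X P' (%x. (fst (snd x), lpr1 ((1 - fst x) *R sec (w (fst (snd x))) (snd (snd x)) + fst x *R w (fst (snd x)))))"
   unfolding cm_PB
   using Hn sZ by (auto intro!: cx[OF cm_PB_fst] simp: PB_lpr bbs p'w)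
  then show ?thesis
   unfolding cmis H_def spde
   using Hn Hc by (auto simp: Z_iff)
 qed
 have pbs: "pb s (pb fst x)=pb (%y. y) x" for x :: "'y tc"
  by (simp add: pb_pb s_def o_def)
 have i: "eqn (Sing Y) (pb (%y. y) x) x" for x
  by (rule pb_id_on) simp
 define b where "b=pb s ps"
 have b: "eqn (Sing Y) a (cd b)"
  using mp_eqn[OF ms ps] i[of a] by (simp add: b_def pb_cd pbs eqn_def)
 have mf: "maps fst (Sub P' Z) (Sing Y)"
  by (rule mp_fst)
 define ps0 where "ps0=ps - pb fst b"
 have c0: "eqn (Sub P' Z) (cd ps0) 0"
  using ps mp_eqn[OF mf b] by (simp add: ps0_def cd_df pb_cd eqn_def)
 have "eqn (Sub P' Z) (pb (H 1) ps0) (pb (H 0) ps0 + cd (hop H ps0))"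
  by (rule hty_cl[OF cH c0])
 moreover have "eqn (Sub P' Z) (pb (H 0) ps0) ps0"
  by (rule pb_id_on) (auto simp: H_def sZ)
 moreover have "eqn (Sub P' Z) (pb (H 1) ps0) 0"
 proof -
  have "H 1=s \<circ> fst" by (auto simp: H_def s_def)
  then have "pb (H 1) ps0=pb fst (pb s ps0)" by (simp add: pb_pb)
  moreover have "eqn (Sing Y) (pb s ps0) 0"
   using i[of b] by (simp add: ps0_def pb_df pbs b_def[symmetric] eqn_def)
  ultimately show ?thesis using mp_eqn[OF mf, of "pb s ps0" 0] by simp
 qed
 ultimately have "eqn (Sub P' Z) ps0 (cd (- hop H ps0))"
  by (simp add: cd_um eqn_def eq_neg_iff_add_eq_0)
 then have "eqn (Sub P' Z) ps (pb fst b + cd (- hop H ps0))"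
  by (simp add: ps0_def eqn_def diff_eq_eq add.commute)
 with b show ?thesis by (rule that)
qed

subsubsection \<open>The neighbourhood of the smaller projective bundle\<close>

text \<open>Shrinks the component along w and keeps the one in the range of p: lines in V stay in V,
  and at t = 1 they lie in the smaller projective bundle.\<close>

definition T where "T t y=(1 - t) *R idb+t *R p y" for t :: real

definition K where "K t x=(fst x, act (T t (fst x)) (snd x))" for t x

lemma T_linear [simp]: "clin1 (T t y)" "sadj1 (T t y)"
 unfolding T_def by (intro clin_add clin_sR sadj_add sadj_sR; simp)+

lemma K_V:
 assumes x: "(y, l):tsp1 P'" "(y, l):V"
 obtains v where "y:tsp1 Y" "v~=0" "l=lpr1 v" "p y v~=0" "p' y v=v"
  "!!t. T t y v~=0" "!!t. act (T t y) l=lpr1 (T t y v)" "!!t. T t y oL l~=0" "!!t. p y (T t y v)=p y v"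
  "!!t. p' y (T t y v)=T t y v"
proof -
 obtain v where v: "y:tsp1 Y" "norm v=1" "v~=0" "l=lpr1 v" "p' y v=v"
  using P'_E[OF x(1)] by metis
 have pv: "p y v~=0" using V_iff[OF v(3)] x(2) v(4) by simp
 have pT: "p y (T t y v)=p y v" for t
  using p_idem[OF v(1)] by (simp add: T_def bbs flip: scaleR_left.add)
 have Tn: "T t y v~=0" for t using pT[of t] pv by force
 have "p' y (T t y v)=T t y v" for t
  using v p'p[OF v(1), of v] by (simp add: T_def bbs)
 then show ?thesis
  using v pv pT Tn by (intro that[of v]) (simp_all add: act_lpr o_lpr_0)
qed

lemma cK: "cmap (prt (topo {0..1}) (sbt1 P' V)) (sbt1 P' V) (%(t, x). K t x)"
proof -
 let ?X = "prt (topo {0..1::real}) (sbt1 P' V)"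
 have cx: "cmap ?X W (%x. f (snd x))" if "cmap P' W f" for W and f
  by (rule cm_snd[OF cmfs[OF that]])
 have cT: "cmap ?X eucl1 (%x. T (fst x) (fst (snd x)))"
  unfolding T_def
  by (rule cm_add[OF cm_sR[OF cm_df[OF cm_cst cm_fst] cm_cst] cm_sR[OF cm_fst cx[OF c_fst[OF cp]]]])
 have "cmap ?X PSp1 (%x. act (T (fst x) (fst (snd x))) (snd (snd x)))"
 proof (rule cm_act[OF cT cx[OF cm_PB_snd']])
  fix x assume "x:tsp1 ?X"
  then have x: "(fst (snd x), snd (snd x)):tsp1 P'" "(fst (snd x), snd (snd x)):V" by auto
  obtain v where "T (fst x) (fst (snd x)) oL snd (snd x)~=0" using K_V[OF x] by metis
  then show "clin1 (T (fst x) (fst (snd x)))&sadj1 (T (fst x) (fst (snd x))) &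
    snd (snd x):PH&T (fst x) (fst (snd x)) oL snd (snd x)~=0"
   using x(1) by (simp add: tsp_PB spde)
 qed
 moreover have K: "p' y oL act (T t y) l=act (T t y) l" "(y, act (T t y) l):V"
  if yl: "(y, l):tsp1 P'" "(y, l):V" for t y l
 proof -
  obtain v where v: "T t y v~=0" "act (T t y) l=lpr1 (T t y v)" "p y (T t y v)=p y v" "p y v~=0"
    "p' y (T t y v)=T t y v"
   using K_V[OF yl] by metis
  then show "p' y oL act (T t y) l=act (T t y) l" "(y, act (T t y) l):V"
   by (auto simp: PB_lpr V_iff)
 qed
 ultimately have "cmap ?X P' (%x. (fst (snd x), act (T (fst x) (fst (snd x))) (snd (snd x))))"
  unfolding cm_PB by (auto intro!: cx[OF cm_PB_fst])
 then show ?thesis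
  unfolding cmis K_def spde using K(2) by auto
qed

lemma V_xct:
 assumes ps: "eqn (Sub P' V) (cd ps) 0" "eqn (Sub P' A0) ps (cd tt)"
 shows "EX tt. eqn (Sub P' V) ps (cd tt)"
proof -
 have "eqn (Sub P' V) (pb (K 1) ps) (pb (K 0) ps + cd (hop K ps))"
  by (rule hty_cl[OF cK ps(1)])
 moreover have "eqn (Sub P' V) (pb (K 0) ps) ps"
 proof (rule pb_id_on)
  fix x assume "x:tsp1 (sbt1 P' V)"
  then have x: "(fst x, snd x):tsp1 P'" "(fst x, snd x):V" by auto
  obtain v where "snd x=lpr1 v" "act (T 0 (fst x)) (snd x)=lpr1 (T 0 (fst x) v)"
   using K_V[OF x] by metis
  then show "K 0 x=x" by (simp add: K_def T_def prod_eq_iff)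
 qed
 moreover have "eqn (Sub P' V) (pb (K 1) ps) (cd (pb (K 1) tt))"
 proof -
  have "maps (K 1) (Sub P' V) (Sub P' A0)"
  proof (rule mp_Sing)
   have "cmap (sbt1 P' V) (prt (topo {0..1}) (sbt1 P' V)) (%x. (1::real, x))"
    by (simp add: cmp o_def)
   from cmc[OF this cK]
   have "cmap (sbt1 P' V) P' (K 1)" by (simp add: o_def cmis)
   moreover have "K 1 x:A0" if "x:tsp1 (sbt1 P' V)" for x
   proof -
    have x: "(fst x, snd x):tsp1 P'" "(fst x, snd x):V" using that by auto
    obtain v where v: "act (T 1 (fst x)) (snd x)=lpr1 (T 1 (fst x) v)" "T 1 (fst x) v~=0" "fst x:tsp1 Y"
     using K_V[OF x] by metis
    have "p (fst x) (T 1 (fst x) v)=T 1 (fst x) v" using p_idem[OF v(3)] by (simp add: T_def)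
    then show ?thesis using A0_iff[OF v(2)] by (simp add: K_def v(1))
   qed
   ultimately show "cmap (sbt1 P' V) (sbt1 P' A0) (K 1)"
    by (auto simp: cmis)
  qed
  from mp_eqn[OF this ps(2)] show ?thesis
   by (simp add: pb_cd)
 qed
 ultimately have "eqn (Sub P' V) ps (cd (pb (K 1) tt - hop K ps))"
  by (simp add: cd_df eqn_def eq_diff_eq)
 then show ?thesis by blast
qed

lemma V_rtr:
 assumes L: "LH (Sing Y) (Sing (PB Y p)) bot fst n (cpow et)" and et: "eqn (Sub P' V) (cd et) 0"
 shows "LH (Sing Y) (Sub P' V) bot fst n (cpow et)"
proof (rule LH_hty[where g = id and ?T0.0 = "Sub P' A0" and ?pj0.0 = fst])
 have "tsp1 P' Int A0 \<subseteq> V"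
 proof
  fix x assume x: "x:tsp1 P' Int A0"
  obtain y l where yl: "x=(y, l)" by (cases x)
  then obtain v where "v~=0" "l=lpr1 v" using P'_E x by (metis IntD1)
  then show "x:V" using x yl A0_iff[of v y] V_iff[of v y] by auto
 qed
 then show m: "maps id (Sub P' A0) (Sub P' V)"
  using mp_Sub[of P' P' id A0 V] by auto
 show "maps fst (Sub P' V) (Sing Y)"
  by (rule mp_fst)
 show "eqn (Sub P' V) (cd (cpow et j)) 0" for j
  by (rule cd_cpow[OF et]) simp
 have i: "eqn (Sub P' A0) (pb id x) x" for x by (rule pb_id_on) simp
 show "LH (Sing Y) (Sub P' A0) bot fst n (%j. pb id (cpow et j))"
  using L unfolding PB_p
  by (rule LH_change[where h="%_. 0", rotated -1])
   (use mp_fst i in auto)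
 show "EX tt. eqn (Sub P' V) ps (cd tt)"
  if "eqn (Sub P' V) (cd ps) 0" "eqn (Sub P' A0) (pb id ps) (cd tt)" for ps tt
  by (rule V_xct[OF that(1), of tt]) (use that(2) i[of ps] in "simp add: eqn_def")
qed (auto simp: pb_pb)

end

context add_line

begin

text \<open>The hyperplane cocycle, changed by a coboundary so as to vanish on Z, where
  \<open>sec\<close> lifts lines to vectors. It is a Thom cocycle for the line bundle V over the
  smaller projective bundle.\<close>

definition et where "et=pb snd hyp - cd (pick (Sub P' Z) (liftc (%x. sec (w (fst x)) (snd x))) 0)"

lemma cm_sec_fst:
 assumes "cmap Y eucl1 f" "!!y l. (y, l):tsp1 P'==>(y, l):U==>bapp l (f y)~=0"
 shows "cmap (sbt1 P' U) eucl1 (%x. sec (f (fst x)) (snd x))"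
 using assms(2) by (intro cm_sec cmfs c_fst assms(1) cm_PB_snd') auto

lemma sec_P':
 assumes "(y, l):tsp1 P'" "bapp l (u)~=0"
 shows "cin1 (sec (u) l) (u)=1" "lpr1 (sec (u) l)=l" "sec (u) l~=0" 
  "l (sec (u) l)=sec (u) l" "p' y (sec (u) l)=sec (u) l" "y:tsp1 Y"
proof -
 have l: "l:PH" "p' y oL l=l" "y:tsp1 Y" using assms(1) by (auto simp: tsp_PB)
 note s = sec[OF l(1) assms(2)]
 show "cin1 (sec (u) l) (u)=1" "lpr1 (sec (u) l)=l" "sec (u) l~=0" 
  "l (sec (u) l)=sec (u) l" "y:tsp1 Y" by (fact s)+ (fact l)
 show "p' y (sec (u) l)=sec (u) l" using s(4) l(2) by (metis babc)
qed

lemma et_closed: "eqn (Sing P') (cd et) 0"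
 using mp_eqn[OF mp_Sing[OF cm_PB_snd] hyp_closed] by (simp add: et_def cd_df cd_cd pb_cd)

lemma et_Z: "eqn (Sub P' Z) et 0"
proof -
 let ?s = "%x. sec (w (fst x)) (snd x)"
 have s: "eqn (Sub P' Z) (pb (%x. lpr1 (?s x)) hyp) (cd (liftc ?s))"
  by (rule hyp_lift[OF cm_sec_fst[OF cw]]) (auto simp: Z_def sec_P')
 moreover have "eqn (Sub P' Z) (pb (%x. lpr1 (?s x)) hyp) (pb snd hyp)"
  by (rule pb_cong) (auto simp: Z_def sec_P')
 moreover have "eqn (Sub P' Z) (cd (pick (Sub P' Z) (liftc ?s) 0)) (cd (liftc ?s))"
  by (rule eq_cd[OF pick_in fcl_Sing])
 ultimately show ?thesis by (simp add: et_def eqn_def)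
qed

end

section \<open>Thom isomorphism and induction on the rank for framed bundles\<close>

locale rank_step =
 fixes Y :: "'y topology" and n :: nat and e :: "nat=>'y=>'h::complex_hilbert"
 assumes frame: "frame Y (Suc n) e"

begin

lemma ce: "i<=n==>cmap Y eucl1 (e i)"
 using frame by (auto simp: frame_def)

lemma oe: "y:tsp1 Y==>i<=n==>j<=n==>cin1 (e i y) (e j y)=(if i=j then 1 else 0)"
 using frame by (auto simp: frame_def)

end

sublocale rank_step \<subseteq> add_line Y "fp n e" "e n"
proof unfold_locales
 show "cmap Y eucl1 (fp n e)" by (rule cm_fp[OF frame]) simp
 show "cmap Y eucl1 (e n)" by (rule ce) simp
 fix y assume y: "y:tsp1 Y"
 show "cin1 (e n y) (e n y)=1" using oe[OF y, of n n] by simp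
 show "fp n e y (e n y)=0" using fp_frame[OF frame y, of n n] by simp
 show "fp n e y oL fp n e y = fp n e y" using opr_fp[OF frame y, of n] by (simp add: opr_def)
qed simp_all

context rank_step

begin

abbreviation "p == fp n e"

lemma cin_p: "y:tsp1 Y==>i < n==>cin1 (p y x) (e i y) = cin1 x (e i y)"
 using lin_p(2)[of y] fp_frame[OF frame, of y i n] by (simp add: sad)

text \<open>Open unions of fibres of the line bundle V. In such a set the coordinate along
  \<open>e n\<close> can be set to any value, as \<open>complex_coordinate\<close> demands; and
  these sets are closed under unions and intersections, as \<open>LH_fin_cover\<close>
  demands.\<close>

definition sat :: "('y \<times> ('h op)) set=>bool" where
 "sat U<->openin (sbt1 P' V) U &
  (ALL y v c. (y, lpr1 v):U-->v~=0-->p y v~=0-->(y, lpr1 (v + c *C e n y)):U)"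

text \<open>The lift \<open>s\<close> normalises the coordinate along \<open>e i\<close> to 1, and z
  is then the coordinate along \<open>e n\<close>. Off the zero section, normalising the coordinate
  along \<open>e n\<close> instead gives a lift s' with s = z s'.\<close>

lemma sat_local_Thom:
 assumes U: "sat U" "!!y l. (y, l):U==>bapp l (e i y)~=0" and i: "i < n"
 shows "TH (Sub P' U) (Sub P' (U Int Z)) et"
proof -
 define M where "M=sbt1 P' U"
 define s where "s x=sec (e i (fst x)) (snd x)" for x
 define z where "z x = cin1 (s x) (e n (fst x))" for x
 define G where "G c x=(fst x, lpr1 (s x+(c - z x) *C e n (fst x)))" for c x
 have M: "tsp1 M=U" "U \<subseteq> tsp1 P'"
  using U(1) openin_subset unfolding sat_def M_def by fastforce+
 have sx: "fst x:tsp1 Y" "cin1 (s x) (e i (fst x))=1" "lpr1 (s x)=snd x" "s x~=0"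
  "p' (fst x) (s x)=s x" "p (fst x) (s x)~=0" "bapp (snd x) (e i (fst x))~=0"
  if x: "x:U" for x
 proof -
  have "(fst x, snd x):tsp1 P'" "bapp (snd x) (e i (fst x))~=0"
   using U(2)[of "fst x" "snd x"] x M by auto
  note s = sec_P'[OF this]
  show "fst x:tsp1 Y" "cin1 (s x) (e i (fst x))=1" "lpr1 (s x)=snd x" "s x~=0"
   "p' (fst x) (s x)=s x" "bapp (snd x) (e i (fst x))~=0" using s U(2)[of "fst x" "snd x"] x by (auto simp: s_def)
  then show "p (fst x) (s x)~=0" using cin_p[of "fst x" i "s x"] i by auto
 qed
 have ci: "cin1 (s x + c *C e n (fst x)) (e i (fst x))=1"
  "cin1 (s x + c *C e n (fst x)) (e n (fst x))=z x + c"
  "s x + c *C e n (fst x)~=0" if x: "x:U" for x c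
 proof -
  show "cin1 (s x + c *C e n (fst x)) (e i (fst x))=1" "cin1 (s x + c *C e n (fst x)) (e n (fst x))=z x + c"
   using sx[OF x] oe[of "fst x" n i] oe[of "fst x" n n] i by (simp_all add: cal csl z_def)
  then show "s x + c *C e n (fst x)~=0" by auto
 qed
 have sG: "s (fst x, lpr1 (s x + c *C e n (fst x)))=s x + c *C e n (fst x)" if x: "x:U" for x c
  using sec_lpr[OF ci(1)[OF x]] by (simp add: s_def)
 have GU: "(fst x, lpr1 (s x + c *C e n (fst x))):U" if x: "x:U" for x c
  using U(1) sx[OF x] x unfolding sat_def by (metis prod.collapse)
 have cs: "cmap M eucl1 s"
  unfolding M_def s_def by (rule cm_sec_fst[OF ce]) (use i U(2) in auto)
 have cx: "cmap M W f" if "cmap P' W f" for W and f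
  unfolding M_def by (rule cmfs[OF that])
 have cz: "cmap M eucl1 z"
  unfolding z_def by (rule cm_cin[OF cs cx[OF c_fst[OF ce]]]) simp
 let ?X = "prt eucl1 M :: (complex \<times> _) topology"
 have cG': "cmap ?X eucl1 (%w. s (snd w)+(fst w - z (snd w)) *C e n (fst (snd w)))"
  by (rule cm_add[OF cm_snd[OF cs] cm_sC[OF cm_df[OF cmf cm_snd[OF cz]] cm_snd[OF cx[OF c_fst[OF cw]]]]])
 have cG: "cmap ?X M (%(c, m). G c m)"
 proof -
  have "cmap ?X PSp1 (%w. lpr1 (s (snd w)+(fst w - z (snd w)) *C e n (fst (snd w))))"
   by (rule cm_lpr[OF cG']) (use ci(3) M in auto)
  then have "cmap ?X P' (%w. (fst (snd w), lpr1 (s (snd w)+(fst w - z (snd w)) *C e n (fst (snd w)))))"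
   unfolding cm_PB using GU M
   by (auto intro!: cm_snd[OF cx[OF cm_PB_fst]] simp: tsp_PB)
  then show ?thesis
   unfolding M_def cmis G_def spde
   using GU M by (auto simp: M_def[symmetric])
 qed
 interpret complex_coordinate M z G
 proof
  show "cmap M eucl1 z" by (rule cz)
  show "cmap ?X M (%(c, m). G c m)" by (rule cG)
  fix m c c' assume "m:tsp1 M"
  then have m: "m:U" by (simp add: M)
  have zG: "z (G c m) = c" for c using sG[OF m, of "c - z m"] ci(2)[OF m, of "c - z m"] by (simp add: z_def G_def)
  show "z (G c m) = c" by (rule zG)
  show "G (z m) m=m" using sx[OF m] by (simp add: G_def prod_eq_iff)
  show "G c (G c' m)=G c m"
   using sG[OF m, of "c' - z m"] zG[of c']
   by (simp add: G_def flip: scaleC_add_left add.assoc) (simp add: add.assoc flip: scaleC_add_left)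
 qed
 have Zz: "x:Z<->z x~=0" if "x:U" for x
  using sx[OF that] Z_iff[of "s x" "fst x"] by (simp add: z_def)
 have MZ: "Sub M nz=Sub P' (U Int Z)"
  unfolding M_def Sub_Sub using Zz by (intro Sub_cong) auto
 have "TH (Sing M) (Sub M nz) et"
 proof (rule local_Thom_hyp[where s=s and s'="%x. sec (e n (fst x)) (snd x)"])
  have "U Int nz=U Int Z" using Zz by auto
  then have nzP: "sbt1 M nz=sbt1 P' (U Int Z)" by (simp add: M_def subtopology_subtopology)
  show "cmap (sbt1 M nz) eucl1 (%x. sec (e n (fst x)) (snd x))"
   unfolding nzP by (rule cm_sec_fst[OF cw]) (auto simp: Z_def)
  show "s m=z m *C sec (e n (fst m)) (snd m)" if m: "m:tsp1 M" "z m~=0" for m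
  proof -
   have m': "m:U" using m M by simp
   then have "(fst m, snd m):tsp1 P'" "bapp (snd m) (e n (fst m))~=0"
    using Zz[OF m'] m M(2) by (auto simp: Z_def spde)
   note t = sec_P'[OF this]
   obtain c where c: "s m = c *C sec (e n (fst m)) (snd m)"
    using lpr_eqD(1)[OF sx(4)[OF m'] t(3)] sx(3)[OF m'] t(2) by auto
   have "z m = c" using t(1) by (simp add: z_def c csl)
   then show ?thesis using c by simp
  qed
  have "eqn (Sing M) (pb snd hyp) (pb (%m. lpr1 (s m)) hyp)"
   by (rule pb_cong) (auto simp: M sx)
  moreover have "eqn (Sing M) (pick (Sub P' Z) x 0) (pick (Sub M nz) x 0)" for x
   unfolding MZ by (auto simp: eqn_def pick_def M_def Sub_eq_iff)
  then have "eqn (Sing M) (cd (pick (Sub P' Z) x 0)) (cd (pick (Sub M nz) x 0))" for x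
   by (rule eq_cd[OF _ fcl_Sing])
  ultimately show "eqn (Sing M) et (pb (%m. lpr1 (s m)) hyp - cd (pick (Sub M nz) (liftc (%x. sec (e n (fst x)) (snd x))) 0))"
   by (simp add: et_def eqn_def)
 qed (use cs sx M in auto)
 then show ?thesis unfolding MZ by (simp add: M_def)
qed

text \<open>The charts \<open>W i\<close> with i < n cover V, because a vector with p v ~= 0 has a
  nonzero inner product with one of the first n frame vectors.\<close>

lemma V_Thom: "TH (Sub P' V) (Sub P' (V Int Z)) et"
proof -
 let ?P = "sbt1 P' V"
 define W where "W i={x:tsp1 ?P. bapp (snd x) (e i (fst x))~=0}" for i
 have satW: "sat (W i)" if i: "i < n" for i
 proof -
  have "cmap ?P eucl1 (%x. bapp (snd x) (e i (fst x)))"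
   by (rule cmfs[OF cm_ap[OF cm_PB_snd' c_fst[OF ce]]]) (use i in simp)
  from ocmp[OF this, of "- {0}"]
  have "openin ?P (W i)" by (simp add: W_def open_Compl)
  moreover have "(y, lpr1 (v + c *C e n y)):W i" if v: "(y, lpr1 v):W i" "v~=0" "p y v~=0" for y v c
  proof -
   have y: "y:tsp1 Y" and vi: "cin1 v (e i y)~=0" and p'v: "p' y v=v"
    using v PB_lpr[OF lin_p' v(2), of y] by (auto simp: W_def tsp_PB lpr_ap_eq_0)
   have "p y (v + c *C e n y)=p y v"
    using clinD[OF fp_linear(1), of n e y c "e n y"] pw(2)[OF y] by (simp add: blinfun.add_right)
   moreover have "cin1 (v + c *C e n y) (e i y) = cin1 v (e i y)"
    using oe[OF y, of n i] i by (simp add: cal csl)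
   moreover have "p' y (v + c *C e n y)=v + c *C e n y"
    using clinD[OF lin_p', of y c "e n y"] p'w[OF y] p'v by (simp add: blinfun.add_right)
   moreover have "v + c *C e n y~=0" using v(3) calculation(1) by force
   ultimately show ?thesis
    using P'_I[OF y, of "v + c *C e n y"] V_iff[of "v + c *C e n y" y] vi v(3) by (simp add: W_def lpr_ap_eq_0)
  qed
  ultimately show ?thesis by (auto simp: sat_def)
 qed
 have cov: "tsp1 ?P \<subseteq> (\<Union>i\<in>{..<n}. W i)"
 proof
  fix x assume x: "x:tsp1 ?P"
  then have xx: "(fst x, snd x):tsp1 P'" "(fst x, snd x):V" by auto
  obtain v where v: "snd x=lpr1 v" "v~=0" using P'_E[OF xx(1)] by metis
  have "p (fst x) v~=0" using xx(2) V_iff[OF v(2), of "fst x"] v(1) by simp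
  then obtain i where "i < n" "cin1 v (e i (fst x))~=0"
   unfolding fp_ap by (metis (no_types, lifting) lessThan_iff sC_zero_l sum.neutral)
  then show "x:(\<Union>i\<in>{..<n}. W i)" using x v by (auto simp: W_def lpr_ap_eq_0)
 qed
 have "LHo ?P ?P Z id 1 (%_. et) (tsp1 ?P)"
 proof (rule LH_fin_cover[where S = sat and W = W and I = "{..<n}"])
  show "eqn (Sing ?P) (cd et) 0" by (rule eq_Sub[OF et_closed])
  show "eqn (Sub ?P Z) et 0"
   unfolding Sub_Sub by (rule eq_Sub_mono[OF et_Z]) auto
  show "sat U==>openin ?P U" for U by (simp add: sat_def)
  show "sat U==>sat W==>sat (U Int W)" "sat U==>sat W==>sat (U Un W)" for U W
   by (auto simp: sat_def openin_Int openin_Un)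
  show "sat {}" by (simp add: sat_def)
  show "sat (tsp1 ?P)"
   unfolding sat_def
  proof (intro conjI allI impI)
   fix y v c assume v: "(y, lpr1 v):tsp1 ?P" "v~=0" "p y v~=0"
   then obtain i where "(y, lpr1 v):W i" "i < n" using cov by blast
   with satW[of i] v show "(y, lpr1 (v + c *C e n y)):tsp1 ?P" by (auto simp: sat_def W_def)
  qed (rule openin_topspace)
  show "LHo ?P ?P Z id 1 (%_. et) U" if U: "i:{..<n}" "sat U" "U \<subseteq> W i" for i U
  proof -
   have UV: "U \<subseteq> tsp1 P'" "U \<subseteq> V" using U(3) by (auto simp: W_def)
   have "TH (Sub P' U) (Sub P' (U Int Z)) et"
    by (rule sat_local_Thom[of U i]) (use U in "auto simp: W_def")
   moreover have "{q:tsp1 ?P. id q:U}=U" using UV by auto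
   moreover have "V Int U=U" "V Int (U Int Z)=U Int Z" using UV by auto
   ultimately show ?thesis
    unfolding LHo_def by (simp add: TH_LH[OF fcl_Sing] Sub_Sub)
  qed
 qed (use satW cov in auto)
 moreover have "Sub ?P (tsp1 ?P)=Sub P' V" "Sub ?P (tsp1 ?P Int Z)=Sub P' (V Int Z)"
  unfolding Sub_Sub by (auto intro!: Sub_cong)
 moreover have "{q:tsp1 ?P. id q:tsp1 ?P}=tsp1 ?P" by auto
 ultimately show ?thesis
  by (simp only: LHo_def TH_LH[OF fcl_Sing])
qed

end

context rank_step

begin

text \<open>Leray-Hirsch for the smaller bundle followed by the Thom isomorphism gives the powers 1
  to n of \<open>et\<close> as generators on V relative to its part in Z. Excision, in the form of
  \<open>LH_ext\<close> with \<open>sm_xct\<close>, carries this to P' relative to Z. The generator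
  1 is split off by first solving on Z with \<open>Z_rtr\<close>. Finally \<open>et\<close> is
  exchanged for the cohomologous hyperplane class.\<close>

lemma LH_step:
 assumes L: "LH (Sing Y) (Sing (PB Y p)) bot fst n (cpow (pb snd hyp))"
 shows "LH (Sing Y) (Sing (PB Y (fp (Suc n) e))) bot fst (Suc n) (cpow (pb snd hyp))"
proof -
 define q where "q=pick (Sub P' Z) (liftc (%x. sec (e n (fst x)) (snd x))) 0"
 have h: "eqn (Sing P') (cd (pb snd hyp)) 0"
  using mp_eqn[OF mp_Sing[OF cm_PB_snd] hyp_closed] by (simp add: pb_cd)
 have hq: "et=pb snd hyp + cd (- q)" by (simp add: et_def q_def cd_um)
 have etV: "eqn (Sub P' V) (cd et) 0" by (rule eq_Sub[OF et_closed])
 have V0: "Sub P' (V Int Z)<=Sub P' V" by (rule Sub_mono) simp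
 have "LH (Sing Y) (Sing (PB Y p)) bot fst n (cpow et)"
  by (rule LH_change_cpow[OF _ _ _ _ _ L, where tt="-q"])
   (use mp_fst eq_Sub[OF h] in "auto simp: PB_p hq")
 from LH_Thom[OF _ _ _ mp_fst V0 cd_cpow[OF etV] eq_Sub_mono[OF et_Z] etV V_rtr[OF this etV] V_Thom]
 have L1: "LH (Sing Y) (Sub P' V) (Sub P' (V Int Z)) fst n (%j. cpow et (Suc j))" by simp
 have L2: "LH (Sing Y) (Sing P') (Sub P' Z) fst n (%j. cpow et (Suc j))"
 proof (rule LH_ext[OF _ _ _ _ _ _ _ _ _ _ _ _ _ _ _ L1])
  show "maps fst (Sing P') (Sing Y)" by (rule mp_Sing[OF cm_PB_fst])
  show "eqn (Sing P') (cd (cpow et (Suc j))) 0" for j by (rule cd_cpow[OF et_closed]) simp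
  show "eqn (Sub P' Z) (cpow et (Suc j)) 0" for j by (simp add: eq_cup0_r[OF et_Z])
  show "EX tt. eqn (Sing Y) ze (cd tt)&eqn (Sing Y) tt 0" if "eqn (Sing Y) ze 0" for ze
   using that by (auto intro!: exI[of _ 0])
  show "EX tt. eqn (Sing P') ze (cd tt)&eqn (Sub P' Z) tt 0"
   if z: "eqn (Sing P') (cd ze) 0" "eqn (Sub P' V) ze 0" "eqn (Sub P' Z) ze 0" for ze
  proof (rule sm_xct[of "{tsp1 P' Int V, tsp1 P' Int Z}" P' ze])
   have "Sub P' (tsp1 P' Int V)=Sub P' V" "Sub P' (tsp1 P' Int Z)=Sub P' Z"
    by (auto intro!: Sub_cong)
   then show "eqn (small P' {tsp1 P' Int V, tsp1 P' Int Z}) ze 0"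
    using z by (simp add: sm_pair eq_sup)
   show "tsp1 P' \<subseteq> \<Union> {tsp1 P' Int V, tsp1 P' Int Z}" using VZ by auto
  qed (use openin_V openin_Z z in blast)+
 qed (auto simp: mp_fst Sub_inf Int_commute Sub_le[THEN le_funD] Sub_le)
 have "LH (Sing Y) (Sing P') bot fst (Suc n) (cpow et)"
  unfolding LH_def
 proof (intro allI impI, elim conjE)
  fix a ps
  assume a: "ALL j<Suc n. eqn (Sing Y) (cd (a j)) 0" and ps: "eqn (Sing P') (cd ps) (lin fst (Suc n) (cpow et) a)"
  have lS: "eqn (Sing P') (lin fst (Suc n) (cpow et) b) (pb fst (b 0)+lin fst n (%j. cpow et (Suc j)) (%j. b (Suc j)))" for b
   unfolding lin_def sum.lessThan_Suc_shift
   using cup_un[of "Sing P'" "pb fst (b 0)"] by (simp add: eqn_def)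
  have lZ: "eqn (Sub P' Z) (lin fst n (%j. cpow et (Suc j)) b) 0" for b
   unfolding lin_def by (intro eq_sum0) (simp add: eq_cup0_r[OF eq_cup0_r[OF et_Z]])
  have "eqn (Sub P' Z) (cd ps) (pb fst (a 0))"
   using eq_Sub[OF ps] eq_Sub[OF lS[of a]] lZ[of "%j. a (Suc j)"] by (simp add: eqn_def)
  from Z_rtr[OF _ this] obtain b0 tt0
   where b0: "eqn (Sing Y) (a 0) (cd b0)" and tt0: "eqn (Sub P' Z) ps (pb fst b0 + cd tt0)"
   using a by blast
  define tt1 where "tt1=pick (Sub P' Z) tt0 0"
  define ps1 where "ps1=ps - pb fst b0 - cd tt1"
  have "eqn (Sub P' Z) (cd tt1) (cd tt0)" unfolding tt1_def by (rule eq_cd[OF pick_in fcl_Sing])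
  then have z: "eqn (Sub P' Z) ps1 0" using tt0 by (simp add: ps1_def eqn_def)
  have "eqn (Sing P') (pb fst (a 0)) (pb fst (cd b0))"
   by (rule mp_eqn[OF mp_Sing[OF cm_PB_fst] b0])
  then have d: "eqn (Sing P') (cd ps1) (lin fst n (%j. cpow et (Suc j)) (%j. a (Suc j)))"
   using ps lS[of a] by (simp add: ps1_def cd_df cd_cd pb_cd eqn_def)
  obtain b tt where b: "!!j. j < n==>eqn (Sing Y) (a (Suc j)) (cd (b j))"
   and tt: "eqn (Sing P') ps1 (lin fst n (%j. cpow et (Suc j)) b + cd tt)"
   by (rule LHD[OF L2 _ z d]) (use a in auto)
  have "eqn (Sing P') ps (lin fst (Suc n) (cpow et) (case_nat b0 b) + cd (tt1+tt))"
   using tt lS[of "case_nat b0 b"] by (simp add: ps1_def cd_add eqn_def alsi)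
  moreover have "ALL j<Suc n. eqn (Sing Y) (a j) (cd (case_nat b0 b j))"
   using b b0 by (auto split: nat.split)
  ultimately show "EX b tt. (ALL j<Suc n. eqn (Sing Y) (a j) (cd (b j)))&eqn bot tt 0
    & eqn (Sing P') ps (lin fst (Suc n) (cpow et) b + cd tt)" by auto
 qed
 moreover have "fp (Suc n) e=p'" by (simp add: fp_def p'_def fei)
 ultimately show ?thesis
  apply (simp only:)
  by (rule LH_change_cpow[OF _ _ _ et_closed, rotated -1, where tt=q])
   (auto simp: mp_Sing[OF cm_PB_fst] hq cd_um)
qed

end

lemma frame_le: "frame Y m e==>n<=m==>frame Y n e"
 by (auto simp: frame_def)

lemma zero_PH: "(0 :: 'h::complex_hilbert op) ~: PH"
proof
 assume "(0 :: 'h op):PH"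
 then obtain v :: 'h where v: "norm v=1" "0=lpr1 v" by (elim PH_E)
 have "v=0" using lpr_self[of v] unfolding v(2)[symmetric] by simp
 then show False using v by simp
qed

theorem frame_LH: "frame Y n e==>LH (Sing Y) (Sing (PB Y (fp n e))) bot fst n (cpow (pb snd hyp))"
proof (induction n)
 case 0
 have "tsp1 (PB Y (fp 0 e))={}"
  using zero_PH by (auto simp: tsp_PB)
 then have "Sing (PB Y (fp 0 e))=bot"
  by (metis Sub_empty Sub_tsp subset_refl)
 then show ?case unfolding LH_def by simp
next
 case (Suc n)
 interpret rank_step Y n e by unfold_locales (rule Suc.prems)
 show ?case by (rule LH_step[OF Suc.IH[OF frame_le[OF Suc.prems]]]) simp
qed

section \<open>Vector bundles given by projections\<close>

definition vbundle :: "'x topology=>('x=>'h::complex_hilbert op)=>bool" where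
 "vbundle X p<->cmap X eucl1 p &
  (ALL x:tsp1 X. opr (p x)&fdim (range (bapp (p x))))"

text \<open>Since \<open>p = p oL p\<close>, the norm is at most its square.\<close>

lemma opr_small: "opr p==>norm p < 1==>p=0"
 using norm_blinfun_compose[of p p] by (auto simp: opr_def mult_le_cancel_left1)

lemma opr_minus_fp:
 assumes "frame Y n e" "y:tsp1 Y" "opr p" "!!i. i < n==>p (e i y)=e i y"
 shows "opr (p - fp n e y)"
proof -
 have a: "p (fp n e y x) = fp n e y x" for x
  unfolding fp_ap blinfun.sum_right using assms(3,4) by (intro suco) (auto simp: opr_def clinD)
 have i: "fp n e y (fp n e y x) = fp n e y x" for x
  by (rule opr_idem[OF opr_fp[OF assms(1,2)]]) simp
 have c: "fp n e y (p x) = fp n e y x" for x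
  unfolding fp_ap using assms(3,4) by (intro suco refl) (simp add: opr_def sad)
 have "(p - fp n e y) oL (p - fp n e y)=p - fp n e y"
  using opr_idem[OF assms(3)] a i c by (intro bleq) (simp add: bbs)
 then show ?thesis
  using assms(3) unfolding opr_def by (simp add: clin_df sadj_df)
qed

text \<open>The frame vectors and their multiples by i are orthonormal over the reals, which
  accounts for the factor 2.\<close>

lemma frame_dim:
 assumes "frame Y n e" "y:tsp1 Y"
 shows "dim (range (fp n e y))=2 * n"
  "finite T==>(!!i. i < n==>e i y:span T)==>n <= card T"
proof -
 have o: "i < n==>j < n==>cin1 (e i y) (e j y)=(if i=j then 1 else 0)" for i j
  using assms by (auto simp: frame_def)
 define f where "f k=(if k < n then e k y else \<i> *C e (k - n) y)" for k
 have f: "inner (f k) (f l)=(if k=l then 1 else 0)" if "k < 2 * n" "l < 2 * n" for k l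
 proof -
  have "cin1 (f k) (f l)=(if k=l then 1 else if k=l+n then \<i> else if l=k+n then - \<i> else 0)"
   using that o[of "if k < n then k else k - n" "if l < n then l else l - n"]
   by (auto simp: f_def csl cin_sC_r)
  then show ?thesis by (simp add: Re_cinner[symmetric])
 qed
 have inj: "inj_on f {..<2 * n}" using f by (metis inj_onI lessThan_iff zero_neq_one)
 have ind: "independent (f ` {..<2 * n})"
 proof (rule pairwise_orthogonal_independent)
  show "pairwise orthogonal (f ` {..<2 * n})" using f by (auto simp: pairwise_def orthogonal_def)
  show "0 ~: f ` {..<2 * n}"
  proof
   assume "0:f ` {..<2 * n}"
   then obtain k where "k < 2 * n" "f k=0" by auto
   then show False using f[of k k] by simp
  qed
 qed
 show "dim (range (fp n e y))=2 * n"
 proof (rule dim_unique[of "f ` {..<2*n}"])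
  have fp: "fp n e y (e i y)=e i y" if "i < n" for i using fp_frame[OF assms that] that by auto
  have "f k = fp n e y (f k)" if "k < 2 * n" for k
   using fp[of k] fp[of "k - n"] that clinD[OF fp_linear(1), of n e y \<i>] by (auto simp: f_def)
  then show "f ` {..<2 * n} \<subseteq> range (fp n e y)" by blast
  show "range (fp n e y) \<subseteq> span (f ` {..<2 * n})"
  proof clarify
   fix x
   have s: "f k:span (f ` {..<2 * n})" if "k < 2 * n" for k using that by (auto intro: span_base)
   have "c *C e i y:span (f ` {..<2 * n})" if "i < n" for i c
   proof -
    have "c *C e i y = Re c *R f i+Im c *R f (i+n)"
     using that complex_eq[of c] by (simp add: f_def scsc flip: sor scaleC_add_left) (simp add: muco)
    then show ?thesis using s[of i] s[of "i+n"] that by (auto intro!: span_add span_scale)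
   qed
   then show "fp n e y x:span (f ` {..<2 * n})"
    unfolding fp_ap by (intro span_sum) auto
  qed
 qed (use ind inj in "auto simp: card_image")
 assume T: "finite T" "!!i. i < n==>e i y:span T"
 have "inj_on (%k. e k y) {..<n}" using inj by (auto simp: inj_on_def f_def)
 moreover have "independent ((%k. e k y) ` {..<n})"
 proof (rule independent_mono[OF ind])
  have "(%k. e k y) ` {..<n} = f ` {..<n}" by (auto simp: f_def)
  then show "(%k. e k y) ` {..<n} \<subseteq> f ` {..<2 * n}" by auto
 qed
 ultimately show "n <= card T"
  using independent_span_bound[OF T(1), of "(%k. e k y) ` {..<n}"] T(2) by (auto simp: card_image)
qed

text \<open>Gram-Schmidt in families. If the projection \<open>p - fp m e\<close> is 0 at x0, its
  norm is less than 1 nearby and it vanishes there by \<open>opr_small\<close>. Otherwise a further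
  vector field is split off; this ends because the length of a frame at x0 is bounded by the size of
  a finite spanning set.\<close>

theorem bdl_local_frame:
 assumes b: "vbundle X p" and x0: "x0:tsp1 X"
 obtains n U e where "openin X U" "x0:U" "frame (sbt1 X U) n e" "!!y. y:U==>p y = fp n e y"
proof -
 have p: "cmap X eucl1 p" "!!y. y:tsp1 X==>opr (p y)"
  and fin: "fdim (range (bapp (p x0)))"
  using b x0 by (auto simp: vbundle_def)
 define fr where "fr U n e<->openin X U&x0:U&frame (sbt1 X U) n e&(ALL y:U. ALL i<n. p y (e i y)=e i y)" for U n e
 have cs: "cmap (sbt1 X U) eucl1 (%y. p y - fp n e y)" if "fr U n e" for U n e
  using that cm_df[OF cmfs[OF p(1)] cm_fp[of "sbt1 X U" n e n]] by (simp add: fr_def)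
 have step: "(EX U n e. fr U n e&(ALL y:U. p y = fp n e y)) | (EX U e. fr U m e)" for m
 proof (induction m)
  case 0
  have "fr (tsp1 X) 0 (%_ _. 0)" using x0 by (auto simp: fr_def frame_def)
  then show ?case by blast
 next
  case (Suc m)
  { fix U e assume fr: "fr U m e"
   then have U: "openin X U" "x0:U" "frame (sbt1 X U) m e" "!!y i. y:U==>i < m==>p y (e i y)=e i y"
    by (auto simp: fr_def)
   have UX: "tsp1 (sbt1 X U)=U" "U \<subseteq> tsp1 X" using openin_subset[OF U(1)] by auto
   define q where "q y=p y - fp m e y" for y
   have q: "opr (q y)" if "y:U" for y
    unfolding q_def by (rule opr_minus_fp[OF U(3)]) (use that UX p U in auto)
   have cq: "cmap (sbt1 X U) eucl1 q" unfolding q_def by (rule cs[OF fr])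
   have op: "openin X {y:U. f y:S}" if "cmap (sbt1 X U) eucl1 f" "open S" for f and S :: "'c::topological_space set"
   proof -
    have "openin (sbt1 X U) {y:U. f y:S}"
     using ocmp[OF that(1), of S] that(2) unfolding UX(1) by simp
    then show ?thesis using U(1) by (simp add: openin_open_subtopology)
   qed
   have "(EX U n e. fr U n e&(ALL y:U. p y = fp n e y)) | (EX U e. fr U (Suc m) e)"
   proof (cases "q x0=0")
    case True
    define U' where "U'={y:U. q y:ball 0 1}"
    have "openin X U'" unfolding U'_def by (rule op[OF cq]) simp
    moreover have "frame (sbt1 X U') m e"
     using U(3) by (auto simp: frame_def U'_def intro: continuous_map_from_subtopology_mono)
    moreover have "p y = fp m e y" if "y:U'" for y
     using opr_small[OF q[of y]] that by (auto simp: U'_def q_def)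
    moreover have "x0:U'" "ALL y:U'. ALL i<m. p y (e i y)=e i y" using True U by (auto simp: U'_def)
    ultimately have "fr U' m e&(ALL y:U'. p y = fp m e y)" by (simp add: fr_def)
    then show ?thesis by blast
   next
    case False
    then obtain v where v: "q x0 v~=0" by (metis bleq zero_blinfun.rep_eq)
    have cqv: "cmap (sbt1 X U) eucl1 (%y. q y v)" by (rule cm_ap[OF cq cm_cst])
    define U' where "U'={y:U. q y v : - {0}}"
    have oU': "openin X U'" unfolding U'_def by (rule op[OF cqv]) (simp add: open_Compl)
    define e' where "e' i=(if i < m then e i else (%y. (1 / norm (q y v)) *R q y v))" for i
    have U'U: "sbt1 X U'=sbt1 (sbt1 X U) U'" by (simp add: subtopology_subtopology U'_def Int_absorb1)
    have pe: "p y (q y v)=q y v" "i < m==>cin1 (q y v) (e i y)=0" if y: "y:U'" for y i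
    proof -
     have yU: "y:U" "opr (p y)" "y:tsp1 (sbt1 X U)" using y UX p by (auto simp: U'_def)
     have "fp m e y (e i y)=e i y" if "i < m" for i using fp_frame[OF U(3) yU(3) that] that by auto
     moreover have "sadj1 (q y)" using q[OF yU(1)] by (simp add: opr_def)
     ultimately show "i < m==>cin1 (q y v) (e i y)=0"
      using U(4)[OF yU(1)] by (auto simp: sad q_def bbs)
     have "p y (fp m e y v) = fp m e y v"
      unfolding fp_ap blinfun.sum_right using yU U(4)[OF yU(1)] by (intro suco) (auto simp: opr_def clinD)
     then show "p y (q y v)=q y v" using opr_idem[OF yU(2)] by (simp add: q_def bbs)
    qed
    have n: "cin1 (r *R w) (r *R w)=1" if "w~=0" "r=1 / norm w" for r and w :: 'b
     using that cin_self[of w] by (simp add: cin_sR_l cin_sR_r pes)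
    have "frame (sbt1 X U') (Suc m) e'"
     unfolding frame_def
    proof (intro conjI allI impI ballI)
     have "cmap (sbt1 X U') eucl1 (%y. (%w. (1 / norm w) *R w) (q y v))"
      unfolding U'U
      by (rule cm_comp_on[OF cmfs[OF cqv], where S="- {0}"])
       (auto simp: U'_def intro!: continuous_intros)
     then show "cmap (sbt1 X U') eucl1 (e' i)" if "i < Suc m" for i
      using that U(3) unfolding U'U by (auto simp: e'_def frame_def intro: cmfs)
     fix y i j assume y: "y:tsp1 (sbt1 X U')" "i < Suc m" "j < Suc m"
     then have y': "y:U'" "y:tsp1 (sbt1 X U)" "q y v~=0" by (auto simp: U'_def)
     have "cin1 (e i y) (q y v)=0" if "i < m" for i
      using pe(2)[OF y'(1) that] by (metis cico complex_cnj_zero)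
     then show "cin1 (e' i y) (e' j y)=(if i=j then 1 else 0)"
      using pe(2)[OF y'(1)] n[OF y'(3)] U(3) y'(2) y
      by (auto simp: e'_def frame_def cin_sR_l cin_sR_r less_Suc_eq)
    qed
    moreover have "ALL y:U'. ALL i<Suc m. p y (e' i y)=e' i y"
     using pe(1) U(4) by (auto simp: e'_def U'_def blinfun.scaleR_right)
    ultimately have "fr U' (Suc m) e'" using oU' U(2) v by (auto simp: fr_def U'_def)
    then show ?thesis by blast
   qed }
  then show ?case using Suc.IH by blast
 qed
 have "EX U n e. fr U n e&(ALL y:U. p y = fp n e y)"
 proof (rule ccontr)
  obtain T0 where T0: "finite T0" "range (p x0) \<subseteq> span T0" using fin by (auto simp: finite_dimensional_def)
  assume "~ ?thesis"
  with step[of "Suc (card T0)"] obtain U e where "fr U (Suc (card T0)) e" by blast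
  then have U: "frame (sbt1 X U) (Suc (card T0)) e" "x0:U" "!!i. i < Suc (card T0)==>e i x0=p x0 (e i x0)"
   by (auto simp: fr_def)
  have "Suc (card T0) <= card T0"
   by (rule frame_dim(2)[OF U(1) _ T0(1)]) (use x0 U T0(2) in auto)
  then show False by simp
 qed
 then show ?thesis using that unfolding fr_def by blast
qed

section \<open>Chern classes of total cochains\<close>

definition coh :: "'a simps=>'a tc=>'a tc=>bool" where
 "coh T a b<->(EX tt. eqn T a (b + cd tt))"

lemma coh_eqn: "eqn T a b==>coh T a b"
 unfolding coh_def by (intro exI[of _ 0]) simp

lemma coh_refl [simp]: "coh T a a"
 by (simp add: coh_eqn)

lemma coh_cd: "coh T (cd tt) 0"
 unfolding coh_def by (intro exI[of _ tt]) simp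

lemma coh_sym: "coh T a b==>coh T b a"
 unfolding coh_def by (elim exE, rule_tac x = "-tt" in exI) (simp add: eqn_def cd_um)

lemma coh_trans: "coh T a b==>coh T b c==>coh T a c"
 unfolding coh_def by (elim exE, rule_tac x = "tt+tta" in exI) (simp add: eqn_def cd_add alsi)

lemma coh_add: "coh T a b==>coh T c d==>coh T (a + c) (b+d)"
 unfolding coh_def by (elim exE, rule_tac x = "tt+tta" in exI) (simp add: eqn_def cd_add alsi)

lemma coh_um: "coh T a b==>coh T (- a) (- b)"
 unfolding coh_def by (elim exE, rule_tac x = "- tt" in exI) (simp add: eqn_def cd_um alsi)

lemma coh_df: "coh T a b==>coh T c d==>coh T (a - c) (b - d)"
 using coh_add[OF _ coh_um, of T a b c d] by simp

lemma coh_pb: "maps f T R==>coh R a b==>coh T (pb f a) (pb f b)"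
 unfolding coh_def by (metis mp_eqn pb_add pb_cd)

lemma coh_closed: "coh T a b==>fclosed T==>eqn T (cd a) 0<->eqn T (cd b) 0"
 unfolding coh_def by (elim exE, drule (1) eq_cd) (simp add: cd_add cd_cd eqn_def)

lemma coh_cup_l:
 assumes T: "fclosed T" and c: "eqn T (cd c) 0" and ab: "coh T a b"
 shows "coh T (a \<smile> c) (b \<smile> c)"
proof -
 obtain tt where "eqn T a (b + cd tt)" using ab by (auto simp: coh_def)
 from eq_cup[OF this eq_refl T, of c] eq_cup0_r[OF c T, of "ci tt"]
 have "eqn T (a \<smile> c) ((b \<smile> c) + cd (tt \<smile> c))" by (simp add: cup_add_l cd_cup eqn_def)
 then show ?thesis by (auto simp: coh_def)
qed

lemma coh_cup_r:
 assumes T: "fclosed T" and c: "eqn T (cd c) 0" and ab: "coh T a b"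
 shows "coh T (c \<smile> a) (c \<smile> b)"
proof -
 obtain tt where "eqn T a (b + cd tt)" using ab by (auto simp: coh_def)
 moreover have "eqn T (cd (ci c)) 0" using c by (simp add: cd_ci eqn_def ci_def)
 ultimately have "eqn T (c \<smile> a) ((c \<smile> b) + cd (ci c \<smile> tt))"
  using eq_cup[OF eq_refl `eqn T a (b + cd tt)` T, of c] eq_cup0_l[of T "cd (ci c)" tt] T
  by (simp add: cup_add_r cd_cup eqn_def)
 then show ?thesis by (auto simp: coh_def)
qed

lemma sbt_eq: "tsp1 X Int U=tsp1 X Int V==>sbt1 X U=sbt1 X V"
 by (metis subtopology_restrict)

lemma frame_sbt: "frame (sbt1 X W) n e==>U \<subseteq> W==>frame (sbt1 X U) n e"
 by (auto simp: frame_def intro: continuous_map_from_subtopology_mono)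

abbreviation "ctp == pb snd hyp"

definition chsum :: "nat=>(nat=>'x tc)=>('x \<times> ('h::complex_hilbert op)) tc" where
 "chsum n c=(\<Sum>i\<le>n. pb fst (c i) \<smile> cpow ctp (n - i))"

definition chern :: "'x topology=>('x=>'h::complex_hilbert op)=>nat=>(nat=>'x tc)=>bool" where
 "chern X p n c<->coh (Sing X) (c 0) un&(ALL i. eqn (Sing X) (cd (c i)) 0) &
  (ALL i>n. coh (Sing X) (c i) 0)&coh (Sing (PB X p)) (chsum n c) 0"

lemma mp_PB_fst: "maps fst (Sing (PB X p)) (Sing X)"
 by (rule mp_Sing[OF cm_PB_fst])

lemma ctp_closed: "eqn (Sing (PB X p)) (cd ctp) 0"
 using mp_eqn[OF mp_Sing[OF cm_PB_snd] hyp_closed] by (simp add: pb_cd)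

lemma cpow_closed: "eqn (Sing (PB X p)) (cd (cpow ctp j)) 0"
 by (rule cd_cpow[OF ctp_closed fcl_Sing])

text \<open>Isolates the leading term and indexes the others by the power of the hyperplane class,
  as \<open>lin\<close> does.\<close>

lemma chsum_eq: "chsum n c=(pb fst (c 0) \<smile> cpow ctp n)+lin fst n (cpow ctp) (%j. c (n - j))"
proof -
 let ?g = "%i. pb fst (c i) \<smile> cpow ctp (n - i)"
 have "(\<Sum>i<n. ?g (Suc i))=(\<Sum>j<n. ?g (Suc (n - Suc j)))" by (rule sum.nat_diff_reindex[symmetric])
 also have "... = (\<Sum>j<n. pb fst (c (n - j)) \<smile> cpow ctp j)"
  by (intro suco) (auto simp: Suc_diff_Suc)
 finally show ?thesis by (simp add: chsum_def sum.atMost_shift lin_def)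
qed

lemma PB_cong: "(!!x. x:tsp1 X==>p x=q x)==>PB X p=PB X q"
 unfolding PB_def by (rule sbt_eq) auto

lemma chn_cong: "(!!x. x:tsp1 X==>p x=q x)==>chern X p n c<->chern X q n c"
 unfolding chern_def by (simp add: PB_cong[of X p q])

definition rank :: "'x topology=>('x=>'h::complex_hilbert op)=>nat=>bool" where
 "rank X p n<->vbundle X p&(ALL x:tsp1 X. dim (range (bapp (p x)))=2 * n)"

lemma PB_sbt: "PB (sbt1 X U) p=sbt1 (PB X p) {x:tsp1 (PB X p). fst x:U}"
proof -
 have "PB (sbt1 X U) p=sbt1 (prt X PSp1) (fst -` U Int {(y, l). p y oL l=l})"
  unfolding PB_def prod_topology_subtopology(1) subtopology_subtopology by (rule sbt_eq) auto
 also have "... = sbt1 (PB X p) (fst -` U)" by (simp add: PB_def subtopology_subtopology Int_commute)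
 also have "... = sbt1 (PB X p) (tsp1 (PB X p) Int fst -` U)" by (rule sbt_eq) auto
 finally show ?thesis by (simp add: vimage_def Int_def)
qed

theorem bdl_LH:
 assumes X: "cspc X" and p: "rank X p n"
 shows "LH (Sing X) (Sing (PB X p)) bot fst n (cpow ctp)"
proof -
 have vb: "vbundle X p" using p by (simp add: rank_def)
 have "EX U e. openin X U&x:U&frame (sbt1 X U) n e&(ALL y:U. p y = fp n e y)"
  if x: "x:tsp1 X" for x
 proof (rule bdl_local_frame[OF vb x])
  fix m U e assume U: "openin X U" "x:U" "frame (sbt1 X U) m e" "!!y. y:U==>p y = fp m e y"
  then have "dim (range (bapp (p x)))=2 * m" using frame_dim(1)[OF U(3), of x] x by simp
  then have "m=n" using p x by (simp add: rank_def)
  then show ?thesis using U by blast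
 qed
 then obtain W e where W: "!!x. x:tsp1 X==>openin X (W x)&x:W x&frame (sbt1 X (W x)) n (e x)&(ALL y:W x. p y = fp n (e x) y)"
  by metis
 have "EX I. finite I&I \<subseteq> tsp1 X&tsp1 X \<subseteq> (\<Union>x\<in>I. W x)"
 proof -
  have "(ALL U:W ` tsp1 X. openin X U)&tsp1 X \<subseteq> \<Union>(W ` tsp1 X)" using W by blast
  then obtain FF where "finite FF" "FF \<subseteq> W ` tsp1 X" "tsp1 X \<subseteq> \<Union>FF"
   using X unfolding compact_space_alt by metis
  then show ?thesis by (metis finite_subset_image)
 qed
 then obtain I where I: "finite I" "I \<subseteq> tsp1 X" "tsp1 X \<subseteq> (\<Union>x\<in>I. W x)" by blast
 have "LHo X (PB X p) {} fst n (cpow ctp) (tsp1 X)"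
 proof (rule LH_fin_cover[where S = "openin X" and W = W and I = I])
  show "LHo X (PB X p) {} fst n (cpow ctp) U" if U: "x:I" "openin X U" "U \<subseteq> W x" for x U
  proof -
   have "frame (sbt1 X U) n (e x)"
    using W[of x] U I by (intro frame_sbt[OF _ U(3)]) auto
   from frame_LH[OF this] have "LH (Sub X U) (Sing (PB (sbt1 X U) p)) bot fst n (cpow ctp)"
    using PB_cong[of "sbt1 X U" p "fp n (e x)"] W[of x] U I by (auto simp: subset_iff)
   then show ?thesis by (simp add: LHo_def PB_sbt Sub_empty)
  qed
 qed (use I W cm_PB_fst cpow_closed in "auto simp: Sub_empty")
 moreover have "Sub (PB X p) {x:tsp1 (PB X p). fst x:tsp1 X}=Sing (PB X p)"
  by (rule Sub_tsp) (auto simp: tsp_PB)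
 ultimately show ?thesis by (simp only: LHo_def Sub_empty Int_empty_right subtopology_topspace)
qed

text \<open>Surjectivity in Leray-Hirsch writes the n-th power of the hyperplane class in terms of
  lower powers; up to sign the coefficients are the Chern classes.\<close>

theorem chn_ex:
 fixes p :: "'x=>'h::complex_hilbert op"
 assumes X: "cspc X" and p: "rank X p n"
 obtains c where "chern X p n c"
proof -
 obtain b tt where b: "!!j. j < n==>eqn (Sing X) 0 (cd (b j))"
   and tt: "eqn (Sing (PB X p)) (cpow ctp n) (lin fst n (cpow ctp) b + cd tt)"
  by (rule LHD[OF bdl_LH[OF assms], where a = "%_. 0" and ps = "cpow ctp n"])
   (use cpow_closed in "auto simp: lin_def")
 define c where "c i=(if i=0 then un else if i<=n then - b (n - i) else 0)" for i
 have "lin fst n (cpow ctp) (%j. c (n - j)) = - lin fst n (cpow ctp) b"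
  unfolding lin_def sum_negf[symmetric] by (intro suco) (auto simp: c_def pb_um cup_um_l)
 then have "(chsum n c :: ('x \<times> ('h op)) tc)=(pb fst un \<smile> cpow ctp n) - lin fst n (cpow ctp) b"
  by (simp add: chsum_eq c_def)
 then have "eqn (Sing (PB X p)) (chsum n c) (0 + cd tt)"
  using tt un_cup[OF fcl_Sing, of "PB X p" "cpow ctp n"] by (simp add: eqn_def)
 then have "chern X p n c"
  using b unfolding chern_def coh_def[of "Sing (PB X p)"] by (auto simp: c_def cd_um eqn_def)
 then show ?thesis by (rule that)
qed

text \<open>The top terms of the two Chern relations agree up to exact terms, so their difference is
  a relation between lower powers, and injectivity in Leray-Hirsch makes its coefficients
  exact.\<close>

theorem chn_uq:
 fixes p :: "'x=>'h::complex_hilbert op"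
 assumes X: "cspc X" and p: "rank X p n" and c: "chern X p n c" and c': "chern X p n c'"
 shows "coh (Sing X) (c i) (c' i)"
proof -
 let ?P = "Sing (PB X p)"
 have l: "(chsum n c :: ('x \<times> ('h op)) tc) - chsum n c'=(pb fst (c 0 - c' 0) \<smile> cpow ctp n)+lin fst n (cpow ctp) (%j. c (n - j) - c' (n - j))"
  by (simp add: chsum_eq lin_def pb_df cup_df_l sum_subtractf alsi)
 have c0: "coh (Sing X) (c 0 - c' 0) 0"
  using coh_df[of "Sing X" "c 0" un "c' 0" un] c c' by (simp add: chern_def)
 have "coh ?P (pb fst (c 0 - c' 0) \<smile> cpow ctp n) 0"
  using coh_cup_l[OF fcl_Sing cpow_closed coh_pb[OF mp_PB_fst c0]] by simp
 moreover have "coh ?P (chsum n c - chsum n c') 0"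
  using coh_df[of ?P "chsum n c" 0 "chsum n c'" 0] c c' by (simp add: chern_def)
 ultimately have "coh ?P (lin fst n (cpow ctp) (%j. c (n - j) - c' (n - j))) 0"
  using coh_df[of ?P "chsum n c - chsum n c'" 0 "pb fst (c 0 - c' 0) \<smile> cpow ctp n" 0] by (simp add: l)
 then obtain ps where ps: "eqn ?P (lin fst n (cpow ctp) (%j. c (n - j) - c' (n - j))) (cd ps)"
  by (auto simp: coh_def)
 obtain b where b: "!!j. j < n==>eqn (Sing X) (c (n - j) - c' (n - j)) (cd (b j))"
  by (rule LHD[OF bdl_LH[OF X p] _ _ eq_sym[OF ps]])
   (use c c' in "auto simp: chern_def cd_df eqn_def")
 consider "i=0" | "i > n" | "0 < i" "i<=n" by linarith
 then show ?thesis
 proof cases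
  case 1 then show ?thesis using coh_add[OF c0 coh_refl, of "c' 0"] by simp
 next
  case 2 then show ?thesis using coh_trans[OF _ coh_sym] c c' unfolding chern_def by blast
 next
  case 3
  then show ?thesis using b[of "n - i"] unfolding coh_def by (intro exI[of _ "b (n - i)"]) (auto simp: eqn_def diff_eq_eq add.commute)
 qed
qed

lemma chn_pull:
 fixes p :: "'x=>'h::complex_hilbert op"
 assumes f: "cmap X' X f" and c: "chern X p n c"
 shows "chern X' (%x. p (f x)) n (%i. pb f (c i))"
proof -
 let ?f = "map_prod f (%l. l) :: _ \<times> ('h op)=>_"
 note m = mp_Sing[OF f]
 have "cmap (PB X' (%x. p (f x))) (PB X p) (%x. (f (fst x), snd x))"
  using cmc[OF cm_PB_fst f] cm_PB_snd
  by (auto simp: cm_PB o_def tsp_PB)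
 then have F: "maps ?f (Sing (PB X' (%x. p (f x)))) (Sing (PB X p))"
  by (intro mp_Sing) (simp add: map_prod_def spde)
 have o: "fst \<circ> ?f = f \<circ> fst" "snd \<circ> ?f=snd" by auto
 have "pb ?f (chsum n c) = chsum n (%i. pb f (c i))"
  unfolding chsum_def pb_sum pb_cup pb_cpow pb_pb o by simp
 then show ?thesis
  using c coh_pb[OF m, of "c 0" un] coh_pb[OF m, of _ 0] coh_pb[OF F, of "chsum n c" 0] mp_eqn[OF m, of _ 0]
  unfolding chern_def pb_cd[symmetric] by auto
qed

context add_line

begin

text \<open>As \<open>c (Suc n)\<close> is exact, the Chern sum for p' is that for p times the
  hyperplane class. The first factor is exact on the smaller projective bundle, hence on V; the
  second, replaced by \<open>et\<close>, vanishes on Z. So the product is exact by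
  \<open>sm_xct\<close>.\<close>

theorem chn_stab:
 assumes c: "chern Y p n c"
 shows "chern Y p' (Suc n) c"
proof -
 define h :: "('y \<times> ('h op)) tc" where "h = ctp"
 define al :: "('y \<times> ('h op)) tc" where "al = chsum n c"
 have cc: "eqn (Sing P') (cd (pb fst (c i))) 0" for i
  using mp_eqn[OF mp_PB_fst[of Y p'], of "cd (c i)" 0] c by (simp add: chern_def pb_cd)
 have cl: "eqn T (cd (x \<smile> y)) 0" if "fclosed T" "eqn T (cd x) 0" "eqn T (cd y) 0" for T and x y :: "'c tc"
  using eq_cup0_l[OF that(2,1), of y] eq_cup0_r[OF that(3,1), of "ci x"] by (simp add: cd_cup eqn_def)
 have al: "eqn (Sing P') (cd al) 0"
  unfolding al_def chsum_def cd_sum by (intro eq_sum0 cl fcl_Sing cc cpow_closed)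
 obtain tt0 where "eqn (Sub P' A0) al (cd tt0)"
  using c by (auto simp: chern_def coh_def al_def PB_p)
 from V_xct[OF eq_Sub[OF al] this] obtain tt where tt: "eqn (Sub P' V) al (cd tt)" by blast
 define ttV where "ttV=pick (Sub P' V) tt 0"
 have "eqn (Sub P' V) (cd ttV) (cd tt)" unfolding ttV_def by (rule eq_cd[OF pick_in fcl_Sing])
 then have alV: "eqn (Sub P' V) (al - cd ttV) 0" using tt by (simp add: eqn_def)
 have "coh (Sing P') ((al - cd ttV) \<smile> et) 0"
 proof (rule sm_xct[of "{tsp1 P' Int V, tsp1 P' Int Z}" P' "(al - cd ttV) \<smile> et"])
  have "Sub P' (tsp1 P' Int V)=Sub P' V" "Sub P' (tsp1 P' Int Z)=Sub P' Z"
   by (auto intro!: Sub_cong)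
  then show "eqn (small P' {tsp1 P' Int V, tsp1 P' Int Z}) ((al - cd ttV) \<smile> et) 0"
   using eq_cup0_l[OF alV] eq_cup0_r[OF et_Z] by (simp add: sm_pair eq_sup)
  show "tsp1 P' \<subseteq> \<Union> {tsp1 P' Int V, tsp1 P' Int Z}" using VZ by auto
  show "eqn (Sing P') (cd ((al - cd ttV) \<smile> et)) 0"
   by (rule cl) (use al et_closed in "auto simp: cd_df cd_cd")
 qed (use openin_V openin_Z in "auto simp: coh_def")
 moreover have "coh (Sing P') (al \<smile> h) ((al - cd ttV) \<smile> et)"
 proof (rule coh_trans)
  have "coh (Sing P') h et" unfolding coh_def h_def et_def by (intro exI) (auto simp: eqn_def)
  then show "coh (Sing P') (al \<smile> h) (al \<smile> et)" by (intro coh_cup_r al fcl_Sing)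
  have "coh (Sing P') (al - 0) (al - cd ttV)" by (intro coh_df coh_refl coh_sym[OF coh_cd])
  then show "coh (Sing P') (al \<smile> et) ((al - cd ttV) \<smile> et)"
   by (intro coh_cup_l et_closed fcl_Sing) simp
 qed
 ultimately have "coh (Sing P') (al \<smile> h) 0" by (rule coh_trans[rotated])
 moreover have "coh (Sing P') (pb fst (c (Suc n))) (pb fst 0)"
  by (rule coh_pb[OF mp_PB_fst]) (use c in "simp add: chern_def")
 then have "coh (Sing P') (pb fst (c (Suc n)) \<smile> un) 0"
  using coh_cup_l[OF fcl_Sing, of P' un "pb fst (c (Suc n))" 0] by simp
 ultimately have "coh (Sing P') ((al \<smile> h)+(pb fst (c (Suc n)) \<smile> un)) 0"
  using coh_add[of "Sing P'" "al \<smile> h" 0] by simp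
 moreover have "chsum (Suc n) c=(al \<smile> h)+(pb fst (c (Suc n)) \<smile> un)"
  unfolding chsum_def al_def h_def cup_sum_l sas
  by (auto simp: Suc_diff_le cup_assoc intro!: suco)
 ultimately show ?thesis using c by (simp add: chern_def)
qed

end

section \<open>Second cohomology of infinite-dimensional projective space\<close>

definition onf :: "nat=>(nat=>'h::complex_hilbert)=>bool" where
 "onf n e<->(ALL i<n. ALL j<n. cin1 (e i) (e j)=(if i=j then 1 else 0))"

definition fproj :: "nat=>(nat=>'h::complex_hilbert)=>'h op" where
 "fproj n e=(\<Sum>i<n. tens (e i) (e i))"

lemma fproj_fp: "fproj n e = fp n (%i _. e i) y"
 by (simp add: fproj_def fp_def)

lemma frame_onf: "onf n e==>frame Y n (%i _. e i)"
 by (auto simp: onf_def frame_def)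

lemma fproj:
 assumes "onf n e"
 shows "opr (fproj n e)" "i < n==>fproj n e (e i)=e i"
 using opr_fp[OF frame_onf[OF assms, of "discrete_topology {()}"], of "()" n]
  fp_frame[OF frame_onf[OF assms, of "discrete_topology {()}"], of "()" i n] by (auto simp: fproj_fp[of n e "()"])

lemma fproj_linear [simp]: "clin1 (fproj n e)" "sadj1 (fproj n e)"
 unfolding fproj_fp[of n e "()"] by simp_all

lemma opr_cin: "opr p==>cin1 (p x) y = cin1 x (p y)"
 by (simp add: opr_def sad)

lemma opr_orth: "opr p==>cin1 (x - p x) (p y)=0"
 using opr_cin[of p x "p y"] opr_idem[of p y] by (simp add: cin_df_l)

lemma fproj_fin: "fdim (range (fproj n e))"
proof -
 let ?T = "e ` {..<n} Un (%i. \<i> *C e i) ` {..<n}"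
 have "c *C e i:span ?T" if "i < n" for c i
 proof -
  have "c *C e i = Re c *R e i+Im c *R \<i> *C e i"
   using complex_eq[of c] by (simp add: scsc flip: sor scaleC_add_left) (simp add: muco)
  moreover have "e i:span ?T" "\<i> *C e i:span ?T" using that by (auto intro: span_base)
  ultimately show ?thesis by (simp only: span_add span_scale)
 qed
 then have "range (fproj n e) \<subseteq> span ?T"
  by (auto simp: fproj_def bsl intro!: span_sum)
 then show ?thesis by (auto simp: finite_dimensional_def intro!: exI[of _ ?T])
qed

text \<open>Gram-Schmidt: w is the normalised component of v orthogonal to the span of the given
  vectors.\<close>

lemma onf_ext:
 assumes e: "onf n e" and v: "fproj n e v~=v"
 obtains w where "onf (Suc n) (e(n := w))" "fproj (Suc n) (e(n := w)) v=v" "fproj n e w=0" "norm w=1"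
  "!!x. fproj (Suc n) (e(n := w)) x = fproj n e x + cin1 x w *C w"
proof -
 define p where "p = fproj n e"
 have p: "opr p" using fproj[OF e] by (simp add: p_def)
 define w where "w=(1 / norm (v - p v)) *R (v - p v)"
 have nz: "v - p v~=0" using v by (simp add: p_def)
 have w1: "norm w=1" "cin1 w w=1" using nz by (simp_all add: w_def cin_self)
 have pw: "p w=0" using opr_idem[OF p] by (simp add: w_def bbs)
 have we: "cin1 w (e i)=0" "cin1 (e i) w=0" if "i < n" for i
 proof -
  show "cin1 w (e i)=0" using opr_cin[OF p, of w "e i"] fproj(2)[OF e that] pw by (simp add: p_def)
  then show "cin1 (e i) w=0" by (metis cico complex_cnj_zero)
 qed
 have on: "onf (Suc n) (e(n := w))" using e we w1 by (auto simp: onf_def less_Suc_eq)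
 have ext: "fproj (Suc n) (e(n := w)) x=p x + cin1 x w *C w" for x
  by (simp add: fproj_def p_def bsl blinfun.add_left)
 have "cin1 v w = cin1 (v - p v) w"
  using opr_cin[OF p, of v w] pw by (simp add: cin_df_l)
 also have "... = of_real (norm (v - p v))"
  using nz by (simp add: w_def cin_sR_r cin_self pes)
 finally have "fproj (Suc n) (e(n := w)) v=v"
  using nz by (simp add: ext sor) (simp add: w_def)
 with that[of w] on ext pw w1 show ?thesis by (simp add: p_def)
qed

lemma onf_fin_set:
 assumes "finite S"
 obtains n e where "onf n e" "!!v. v:S==>fproj n e v=v"
proof -
 have "EX n e. onf n e&(ALL v:S. fproj n e v=v)"
  using assms
 proof (induction S)
  case empty
  then show ?case by (auto simp: onf_def intro: exI[of _ 0])
 next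
  case (insert v S)
  then obtain n e where e: "onf n e" "ALL v:S. fproj n e v=v" by blast
  show ?case
  proof (cases "fproj n e v=v")
   case False
   obtain w where w: "onf (Suc n) (e(n := w))" "fproj (Suc n) (e(n := w)) v=v" "fproj n e w=0"
    "!!x. fproj (Suc n) (e(n := w)) x = fproj n e x + cin1 x w *C w"
    using onf_ext[OF e(1) False] by metis
   have "cin1 x w=0" if "x:S" for x
    using opr_cin[OF fproj(1)[OF e(1)], of x w] e(2) that w(3) by simp
   then have "onf (Suc n) (e(n := w))&(ALL v:insert v S. fproj (Suc n) (e(n := w)) v=v)"
    using w(1,2) e(2) by (simp add: w(4) del: fun_upd_apply)
   then show ?thesis by blast
  qed (use e in blast)
 qed
 then show ?thesis using that by blast
qed

lemma onf_orthogonal: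
 assumes "~ fdim (UNIV :: 'h::complex_hilbert set)" "onf n (e :: nat=>'h)"
 obtains w where "onf (Suc n) (e(n := w))" "fproj n e w=0" "norm w=1"
proof -
 have "range (fproj n e)~=UNIV" using assms(1) fproj_fin[of n e] by metis
 then obtain v where "fproj n e v~=v" by (metis surj_def)
 from onf_ext[OF assms(2) this] that show ?thesis by metis
qed

text \<open>Finitely many lines come within distance 1/2 of every line of K, and a line orthogonal
  to their span has distance at least 1 from each of them.\<close>

lemma cpt_lines:
 assumes K: "compact K" "K \<subseteq> PH" and S: "finite S"
 obtains n e where "onf n e" "!!v. v:S==>fproj n e v=v" "!!v. v~=0==>lpr1 v:K==>fproj n e v~=0"
proof -
 obtain k where k: "finite k" "k \<subseteq> K" "K \<subseteq> (\<Union>x\<in>k. ball x (1/2))"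
  by (rule compactE_image[OF K(1), of K "%x. ball x (1/2)"]) auto
 define u :: "_=>'a" where "u l=(SOME v. norm v=1&l=lpr1 v)" for l
 have u: "norm (u l)=1&l=lpr1 (u l)" if "l:PH" for l
  unfolding u_def by (rule someI_ex, rule PH_E[OF that]) blast
 have "finite (S Un u ` k)" using k S by simp
 from onf_fin_set[OF this] obtain n e where e: "onf n e" "!!v. v:S Un u ` k==>fproj n e v=v" by metis
 have "fproj n e v~=0" if v: "v~=0" "lpr1 v:K" for v
 proof
  assume "fproj n e v=0"
  obtain l where l: "l:k" "dist l (lpr1 v) < 1/2" using k(3) v by auto
  then have ul: "norm (u l)=1" "l=lpr1 (u l)" "fproj n e (u l)=u l" using u e(2) k K by (auto intro: subsetD)
  have "cin1 (u l) v=0"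
   using opr_cin[OF fproj(1)[OF e(1)], of "u l" v] ul(3) `fproj n e v=0` by simp
  then have "lpr1 v (u l)=0"
   using lpr_ap_eq_0[OF v(1), of "u l"] by (metis cico complex_cnj_zero)
  moreover have "l (u l)=u l" using ul(2) lpr_self[of "u l"] by metis
  ultimately have "u l=(l - lpr1 v) (u l)" by (simp add: bdl1)
  then have "norm (u l)<=norm (l - lpr1 v) * norm (u l)" by (metis norm_blinfun)
  then show False using l(2) ul(1) by (simp add: dist_norm)
 qed
 with that e show ?thesis by blast
qed

lemma ev_cong: "(!!sg. sg:pmk c==>fi n sg=ps n sg)==>ev fi n c=ev ps n c"
 unfolding ev_def by (intro suco) auto

lemma cpow_degree: "(!!n sg. n~=2==>et n sg=0)==>n~=2 * j==>cpow et j n sg=0"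
proof (induction j arbitrary: n sg)
 case (Suc j)
 have "cpow et j p x * et (n - p) y=0" if "p<=n" for p x y
  using Suc.IH[OF Suc.prems(1), of p x] Suc.prems(1)[of "n - p" y] Suc.prems(2) that by fastforce
 then show ?case unfolding cpow.simps cupt_def by (intro sum.neutral) auto
qed (simp add: un_def)

lemma ctp_degree: "n~=2==>ctp n sg=0"
 by (simp add: pb_def hyp_def)

lemma simplex_face_rest: "sg:Sing X 2==>cd fi 2 sg=fi 1 (sface1 2 0 sg) - fi 1 (sface1 2 1 sg)+fi 1 (sface1 2 2 sg)"
 by (simp add: cd_def n2e2)

text \<open>By Leray-Hirsch over a point, in degree two a closed cochain is
  \<open>be + m * hyp\<close> up to a coboundary. The constant \<open>be\<close> is itself a
  coboundary, and m is read off on a projective line, where \<open>fi0\<close> makes it 0.\<close>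

lemma fin_prj_xct:
 fixes u v :: "'h::complex_hilbert"
 assumes e: "onf n e" and fi: "eqn (Sing PSp1) (cd fi) 0"
  and uv: "norm u=1" "norm v=1" "cin1 u v=0" "fproj n e u=u" "fproj n e v=v"
  and fi0: "fi 2 (lsx1 u v)=fi 2 (restrict (%_. lpr1 v) (Dl 2))"
 obtains tt where "!!sg. sg:Sing (PB (discrete_topology {()}) (%_. fproj n e)) 2==>pb snd fi 2 sg = cd tt 2 sg"
proof -
 define Y where "Y=discrete_topology {()}"
 define P where "P=PB Y (%_. fproj n e)"
 have fpp: "(%y. fproj n e) = fp n (%i _. e i)" by (simp add: fproj_fp fei)
 have L: "LH (Sing Y) (Sing P) bot fst n (cpow ctp)"
  using frame_LH[OF frame_onf[OF e, of Y]] by (simp add: P_def fpp)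
 have "eqn (Sing P) (cd (pb snd fi)) 0"
  using mp_eqn[OF mp_Sing[OF cm_PB_snd] fi] by (simp add: pb_cd P_def)
 then obtain b tt where tt: "eqn (Sing P) (pb snd fi) (lin fst n (cpow ctp) b + cd tt)"
  using LHD[OF L, of "%_. 0" "pb snd fi"] by (simp add: lin_def) blast
 define be where "be=(if n=0 then 0 else b 0 2 (restrict (%_. ()) (Dl 2)))"
 define m where "m=(if n<=1 then 0 else b 1 0 (restrict (%_. ()) (Dl 0)))"
 have pt: "pb fst x k sg=x k (restrict (%_. ()) (Dl k))" for x k and sg :: "_=>unit \<times> ('h op)"
  by (simp add: pb_def smd o_def)
 have lin2: "lin fst n (cpow ctp) b 2 sg=be+m * ctp 2 sg" if sg: "sg:Sing P 2" for sg
 proof -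
  let ?t = "%j. (pb fst (b j) \<smile> cpow ctp j) 2 sg"
  have j0: "?t 0=b 0 2 (restrict (%_. ()) (Dl 2))"
   using cup_un[OF fcl_Sing, of P "pb fst (b 0)"] sg by (simp add: eqn_def pt)
  have cp1: "eqn (Sing P) (pb fst (b 1) \<smile> cpow ctp 1) (pb fst (b 1) \<smile> ctp)"
   using eq_cup[OF eq_refl un_cup[OF fcl_Sing, of P ctp] fcl_Sing, of "pb fst (b 1)"] by simp
  have "bfc 0 2 sg=sg"
   using sg by (auto simp: back_face_def Sing_def ssd extensional_restrict)
  then have "(pb fst (b 1) \<smile> ctp) 2 sg=b 1 0 (restrict (%_. ()) (Dl 0)) * ctp 2 sg"
   by (simp add: cupt_def n2e2 pt ctp_degree)
  then have j1: "?t 1=b 1 0 (restrict (%_. ()) (Dl 0)) * ctp 2 sg" using cp1 sg by (simp add: eqn_def)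
  have j2: "?t j=0" if "j >= 2" for j
   unfolding cupt_def by (intro sum.neutral ballI) (use that in "auto simp: cpow_degree[OF ctp_degree]")
  have "lin fst n (cpow ctp) b 2 sg=(\<Sum>j<n. ?t j)"
   unfolding lin_def by (induction n) auto
  also have "... = (\<Sum>j\<in>{..<n} Int {0, 1}. ?t j)"
   by (rule sum.mono_neutral_right) (auto intro!: j2)
  also have "{..<n} Int {0, 1}=(if n=0 then {} else if n<=1 then {0} else {0, 1})" by auto
  also have "(\<Sum>j\<in>.... ?t j)=be+m * ctp 2 sg" using j0 j1 by (simp add: be_def m_def)
  finally show ?thesis .
 qed
 define j where "j ta=restrict (%x. ((), ta x)) (Dl 2)" for ta :: "(nat=>real)=>'h op"
 have j: "j ta:Sing P 2" "smap1 2 snd (j ta)=ta"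
  if ta: "ta:Sing PSp1 2" "!!x. x:Dl 2==>fproj n e oL ta x=ta x" for ta
 proof -
  have c: "cmap (sbt1 (powertop_real UNIV) (Dl 2)) PSp1 ta" and "ta:extensional (Dl 2)"
   using ta(1) by (auto simp: Sing_def ssd)
  from c have "cmap (sbt1 (powertop_real UNIV) (Dl 2)) P (%x. ((), ta x))"
   unfolding P_def cm_PB using ta(2) by (auto simp: Y_def)
  then have "cmap (sbt1 (powertop_real UNIV) (Dl 2)) P (j ta)"
   by (rule continuous_map_eq) (simp add: j_def)
  then show "j ta:Sing P 2" by (simp add: Sing_def ssd j_def)
  show "smap1 2 snd (j ta)=ta"
   using `ta:extensional (Dl 2)` by (auto simp: smd j_def fei extensional_def)
 qed
 note ls = hyp_lsx[OF uv(1-3)]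
 have fa: "fproj n e (a *C u+b *C v)=a *C u+b *C v" for a b
  using uv by (simp add: blinfun.add_right clinD[OF fproj_linear(1)])
 have v0: "v~=0" using uv by auto
 have "fproj n e oL lsx1 u v x=lsx1 u v x" if "x:Dl 2" for x
  using ls(5)[OF that] fa PB_lpr[OF fproj_linear(1)] by metis
 note j1 = j[OF ls(2) this]
 have j2: "j (restrict (%_. lpr1 v) (Dl 2)):Sing P 2"
   "smap1 2 snd (j (restrict (%_. lpr1 v) (Dl 2)))=restrict (%_. lpr1 v) (Dl 2)"
  by (rule j[OF ls(3)]; use uv v0 PB_lpr[OF fproj_linear(1)] in auto)+
 have eq: "fi 2 ta=be+m * hyp 2 ta + cd tt 2 (j ta)" if "j ta:Sing P 2" "smap1 2 snd (j ta)=ta" for ta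
  using tt[unfolded eqn_def, rule_format, OF that(1)] lin2[OF that(1)] that by (simp add: pb_def)
 have "sface1 2 k (j ta)=restrict (%x. ((), sface1 2 k ta x)) (Dl 1)" if "k<=2" for k ta
  using stx_face[of k 1] that by (auto simp: sfd j_def fei n2e2)
 \<comment> \<open>The two simplices have the same faces, so \<open>cd tt\<close> cannot tell them
   apart; the values of \<open>fi\<close> on them then differ by m.\<close>
 then have "cd tt 2 (j (lsx1 u v)) = cd tt 2 (j (restrict (%_. lpr1 v) (Dl 2)))"
  using ls(4) by (auto simp: cd_def intro!: suco)
 then have "m=0" using eq[OF j1] eq[OF j2] fi0 ls(1) by (simp add: right_diff_distrib[symmetric] alsi)
 \<comment> \<open>On a 2-simplex the constant 1-cochain \<open>be\<close> has coboundary be - be +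
   be.\<close>
 define f :: "(unit \<times> ('h op)) tc" where "f k sg=(if k=1 then be else 0)" for k sg
 have "cd (tt + f) 2 sg=pb snd fi 2 sg" if "sg:Sing P 2" for sg
  using tt lin2[OF that] that `m=0` by (simp add: cd_add eqn_def) (simp add: cd_def f_def n2e2)
 then show ?thesis using that[of "tt + f"] by (simp add: P_def Y_def)
qed

lemma cpt_simplex_image: "sg:Sing (topo S) n==>compact (sg ` Dl n)"
 by (auto simp: Sing_def ssx_eucl intro: compact_continuous_image)

text \<open>The image of the cycle is compact, so some finite-dimensional subspace is orthogonal to
  none of its lines. The operators \<open>T t\<close> deform the cycle into the projective space of
  that subspace, where \<open>fi\<close> is exact in degree two by
  \<open>fin_prj_xct\<close>.\<close>

lemma closed_zero_on_cycles:
 fixes fi :: "('h::complex_hilbert op) tc"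
 assumes inf: "~ fdim (UNIV :: 'h set)" and fi: "eqn (Sing PSp1) (cd fi) 0"
  and fi0: "!!u v. norm u=1==>norm v=1==>cin1 u v=0==>fi 2 (lsx1 u v)=fi 2 (restrict (%_. lpr1 v) (Dl 2))"
  and z: "schain 2 PSp1 z" "bdry1 2 z=0"
 shows "ev fi 2 z=0"
proof -
 define K where "K=(\<Union>sg\<in>pmk z. sg ` Dl 2)"
 have zS: "sg:Sing PSp1 2" if "sg:pmk z" for sg
  using z(1) that by (auto simp: singular_chain_def Sing_def)
 have K: "compact K" "K \<subseteq> PH"
  unfolding K_def using zS
  by (auto intro!: compact_UN cpt_simplex_image[of _ PH] simp: PSp_eq) (auto simp: Sing_def ssx_eucl PSp_eq image_subset_iff)
 obtain u v :: 'h where uv: "norm u=1" "norm v=1" "cin1 u v=0"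
 proof -
  obtain u :: 'h where u: "onf 1 ((%_. 0)(0 := u))" "norm u=1"
   using onf_orthogonal[OF inf, of 0 "%_. 0"] by (auto simp: onf_def)
  obtain v where "onf (Suc 1) (((%_. 0)(0 := u))(1 := v))" "norm v=1"
   using onf_orthogonal[OF inf u(1)] by metis
  moreover have "cin1 (f 0) (f 1)=0" if "onf (Suc 1) f" for f :: "nat=>'h" using that by (auto simp: onf_def)
  ultimately have "cin1 u v=0" by fastforce
  then show ?thesis using that u(2) `norm v=1` by blast
 qed
 obtain n e where e: "onf n e" "fproj n e u=u" "fproj n e v=v"
   "!!v. v~=0==>lpr1 v:K==>fproj n e v~=0"
  using cpt_lines[OF K, of "{u, v}"] by (metis finite.emptyI finite.insertI insertI1 insertI2)
 define p where "p = fproj n e"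
 have p: "opr p" using fproj(1)[OF e(1)] by (simp add: p_def)
 obtain tt where tt: "!!sg. sg:Sing (PB (discrete_topology {()}) (%_. p)) 2==>pb snd fi 2 sg = cd tt 2 sg"
  unfolding p_def using fin_prj_xct[OF e(1) fi uv e(2,3) fi0[OF uv]] by metis
 define Kt where "Kt=sbt1 PSp1 K"
 have zK: "ssx1 2 Kt sg" if "sg:pmk z" for sg
  using zS[OF that] that by (auto simp: Kt_def sss Sing_def K_def)
 define T where "T t=(1 - t) *R idb+t *R p" for t :: real
 have T: "clin1 (T t)" "sadj1 (T t)" for t
  using p unfolding T_def opr_def by (auto intro!: clin_add clin_sR sadj_add sadj_sR)
 have Tl: "EX w. w~=0&l=lpr1 w&T t w~=0&p w~=0" if l: "l:PH" "l:K" for l t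
 proof -
  obtain w where w: "norm w=1" "l=lpr1 w" using PH_E[OF l(1)] by metis
  then have "w~=0" by auto
  then have pw: "p w~=0" using e(4)[of w] l(2) w by (simp add: p_def)
  have "p (T t w)=p w" using opr_idem[OF p] by (simp add: T_def bbs flip: scaleR_left.add)
  then show ?thesis using w pw by (intro exI[of _ w]) auto
 qed
 have cT: "cmap (prt (topo {0..1}) Kt) PSp1 (%(t, l). act (T t) l)"
  unfolding spde
 proof (rule cm_act)
  let ?X = "prt (topo {0..1::real}) Kt"
  show "cmap ?X eucl1 (%x. T (fst x))"
   unfolding T_def by (intro cm_add cm_sR cm_df cm_cst cm_fst)
  show "cmap ?X eucl1 snd"
   using cm_snd[of Kt euclidean "%x. x"] by (simp add: Kt_def PSp_eq cmfs)
  fix x assume "x:tsp1 ?X"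
  then have x: "snd x:PH" "snd x:K" by (auto simp: Kt_def PSp_eq)
  obtain w where "w~=0" "snd x=lpr1 w" "T (fst x) w~=0" using Tl[OF x, of "fst x"] by blast
  then show "clin1 (T (fst x))&sadj1 (T (fst x))&snd x:PH&T (fst x) oL snd x~=0"
   using T x o_lpr_0[OF T(1)] by auto
 qed
 from hty_cl[OF this fi] have h: "eqn (Sing Kt) (pb (act (T 1)) fi) (pb (act (T 0)) fi + cd (hop (%t. act (T t)) fi))" .
 have "eqn (Sing Kt) (pb (act (T 0)) fi) fi"
 proof (rule pb_id_on)
  fix l assume "l:tsp1 Kt"
  then have l: "l:PH" "l:K" by (auto simp: Kt_def PSp_eq)
  obtain w where w: "l=lpr1 w" "T 0 w~=0" using Tl[OF l, of 0] by blast
  show "act (T 0) l=l" using act_lpr[OF T w(2)] by (simp add: w(1)) (simp add: T_def)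
 qed
 with h have h': "eqn (Sing Kt) (pb (act (T 1)) fi) (fi + cd (hop (%t. act (T t)) fi))" by (simp add: eqn_def)
 let ?j = "%l. ((), act (T 1) l)"
 have j: "cmap Kt (PB (discrete_topology {()}) (%_. p)) ?j"
  unfolding cm_PB
 proof (intro conjI ballI)
  have "cmap Kt (prt (topo {0..1}) Kt) (%l. (1::real, l))"
   by (simp add: cmp o_def)
  from cmc[OF this cT] show "cmap Kt PSp1 (act (T 1))" by (simp add: o_def)
  fix l assume "l:tsp1 Kt"
  then have l: "l:PH" "l:K" by (auto simp: Kt_def PSp_eq)
  obtain w where w: "w~=0" "l=lpr1 w" "p w~=0" using Tl[OF l, of 0] by blast
  have "act (T 1) l=lpr1 (p w)" using act_lpr[OF T, of 1 w] w by (simp add: T_def)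
  then show "p oL act (T 1) l=act (T 1) l"
   using PB_lpr[of p "p w"] w(3) opr_idem[OF p] p by (simp add: opr_def)
 qed simp_all
 have "ev fi 2 z+ev (cd (hop (%t. act (T t)) fi)) 2 z=ev (pb (act (T 1)) fi) 2 z"
  using h' zK unfolding eqn_def Sing_def ev_def sum.distrib[symmetric] distrib_left[symmetric]
  by (intro suco) auto
 also have "pb (act (T 1)) fi=pb ?j (pb snd fi)" by (simp add: pb_pb o_def)
 also have "ev (pb ?j (pb snd fi)) 2 z=ev (cd (pb ?j tt)) 2 z"
  unfolding pb_cd[symmetric]
  by (rule ev_cong) (use tt zK Sing_map[OF j] in "simp add: pb_def[of ?j] Sing_def")
 finally show ?thesis using ev_cd[of _ 1 z] z(2) by (simp add: n2e2)
qed

lemma sface_1: "sg:Sing X 1==>sface1 (Suc 0) k sg=restrict (%_. sg (vx (if 0 < k then 0 else 1))) (Dl 0)"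
proof -
 have "x=vx 0" if "x:Dl 0" for x
  using that by (auto simp: standard_simplex_0 vx_def fei)
 then have "restrict f (Dl 0)=restrict (%_. f (vx 0)) (Dl 0)" for f :: "_=>'a"
  by (intro restrict_ext) metis
 from this[of "sg \<circ> xface1 k"] show ?thesis by (simp add: sfd xface_vx)
qed

text \<open>Vanishing of the first homology with coherent choices: \<open>ga l\<close> is a fixed
  path from the line of b to l, and e together with the paths at its two ends bounds. The loop is
  lifted to nonzero vectors and contracted there; infinite dimension supplies a direction w in which
  to contract.\<close>

lemma edge_filling:
 assumes inf: "~ fdim (UNIV :: 'h::complex_hilbert set)"
 obtains ga where "!!e :: (nat=>real)=>'h op. e:Sing PSp1 1 ==>
  EX c. schain 2 PSp1 c&bdry1 2 c = frof e + frof (ga (e (vx 0))) - frof (ga (e (vx 1)))"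
proof -
 obtain b :: 'h where b: "norm b=1"
  using onf_orthogonal[OF inf, of 0 "%_. 0"] by (auto simp: onf_def)
 \<comment> \<open>A representative whose real inner product with b is nonnegative: the segment from
   b to it then avoids 0.\<close>
 have "EX v. v~=0&lpr1 v=l&inner b v >= 0" if l: "l:PH" for l
 proof -
  obtain v where v: "norm v=1" "l=lpr1 v" using PH_E[OF l] by metis
  then have "v~=0" by auto
  show ?thesis
   using v `v~=0` lpr_sR[of "-1" v] by (cases "inner b v >= 0") (auto intro: exI[of _ v] exI[of _ "-v"])
 qed
 then obtain pk where pk: "!!l. l:PH==>pk l~=0&lpr1 (pk l)=l&inner b (pk l) >= 0" by metis
 define GA where "GA l x=x 0 *R b+x 1 *R pk l" for l and x :: "nat=>real"
 define ga where "ga l=restrict (%x. lpr1 (GA l x)) (Dl 1)" for l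
 have co: "cont_on S (%x :: nat=>real. x j)" for S j
  by (rule continuous_on_subset[OF continuous_on_product_coordinates subset_UNIV])
 have GA0: "GA l x~=0" if l: "l:PH" and x: "x:Dl 1" for l x
 proof
  assume 0: "GA l x=0"
  have x01: "x 0+x 1=1" "x 0 >= 0" "x 1 >= 0" using stx_sum[OF x] x by (auto simp: ssd1)
  have "inner b (GA l x)=x 0+x 1 * inner b (pk l)" using b by (simp add: GA_def inner_add_right norm_eq_1)
  moreover have "x 1 * inner b (pk l) >= 0" using x01 pk[OF l] by simp
  ultimately have "x 0=0" using 0 x01 by simp
  then show False using 0 x01 pk[OF l] by (simp add: GA_def)
 qed
 have "EX c. schain 2 PSp1 c&bdry1 2 c = frof e + frof (ga (e (vx 0))) - frof (ga (e (vx 1)))"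
  if e: "e:Sing PSp1 1" for e
 proof -
  define L where "L=thl 1 e"
  have L: "isl 1 e L" using thl[OF e] by (simp add: L_def)
  have ePH: "e x:PH" if "x:Dl 1" for x
   using e that by (auto simp: Sing_def ssx_eucl PSp_eq image_subset_iff)
  define l0 l1 where "l0=e (vx 0)" and "l1=e (vx 1)"
  have l: "l0:PH" "l1:PH" using ePH by (auto simp: l0_def l1_def)
  define al be where "al=ratio (L (vx 0)) (pk l0)" and "be=ratio (L (vx 1)) (pk l1)"
  have al: "al~=0" "L (vx 0)=al *C pk l0" and be: "be~=0" "L (vx 1)=be *C pk l1"
   using ratio[of "L (vx 0)" "pk l0"] ratio[of "L (vx 1)" "pk l1"] L pk l by (auto simp: al_def be_def isl_def l0_def l1_def)
  \<comment> \<open>The lift is rescaled by an exponential interpolating the logarithms of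
    \<open>al\<close> and \<open>be\<close>, so that it ends in the chosen vectors and the three
    lifted paths close up.\<close>
  define L' where "L' x=exp (- (of_real (x 0) * Ln al + of_real (x 1) * Ln be)) *C L x" for x
  have L'0: "L' (vx 0)=pk l0" "L' (vx 1)=pk l1"
   using al be by (simp_all add: L'_def vx_def exp_minus scsc)
  have cL: "cont_on (Dl 1) L'"
   unfolding L'_def using L by (intro bbco[OF bbl_sC] continuous_intros co) (simp add: isl_def)
  have L'n: "L' x~=0" "lpr1 (L' x)=e x" if "x:Dl 1" for x
   using L that by (auto simp: L'_def isl_def lpr_sC)
  define H0 :: "'h topology" where "H0=topo (- {0})"
  define A where "A f=restrict f (Dl 1)" for f :: "(nat=>real)=>'h"
  have cGA: "cont_on (Dl 1) (GA l)" for l unfolding GA_def by (intro continuous_intros co)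
  define C where "C = L' ` Dl 1 Un GA l0 ` Dl 1 Un GA l1 ` Dl 1"
  have C: "compact C" "0 ~: C"
   unfolding C_def using cL cGA L'n GA0 l by (auto intro!: compact_Un compact_continuous_image)
  have "compact (lpr1 ` C)" "lpr1 ` C \<subseteq> PH"
   using C by (auto intro!: compact_continuous_image con_lpr lpr_PH)
  from cpt_lines[OF this, of "{}"] obtain n g where g: "onf n g" "!!x. x:C==>fproj n g x~=0"
   using C(2) by (metis finite.emptyI imageI)
  obtain w where w: "fproj n g w=0" "norm w=1" using onf_orthogonal[OF inf g(1)] by metis
  \<comment> \<open>Segments contract S to w: a nonzero \<open>fproj n g x\<close> stays nonzero
    until w is reached, and otherwise the inner product with w stays positive.\<close>
  define S where "S={x. fproj n g x~=0 | inner x w > 0}"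
  have S0: "S \<subseteq> - {0}" and CS: "C \<subseteq> S" and wS: "w:S" using g(2) w by (auto simp: S_def norm_eq_1)
  have As: "A f:Sing (topo S) 1" if "cont_on (Dl 1) f" "f ` Dl 1 \<subseteq> C" for f
   using that CS by (auto simp: Sing_def ssx_eucl A_def cong: continuous_on_cong)
  define z where "z = frof (A L') + frof (A (GA l0)) - frof (A (GA l1))"
  have S3: "A L':Sing (topo S) 1" "A (GA l0):Sing (topo S) 1" "A (GA l1):Sing (topo S) 1"
   by (rule As; use cL cGA in "auto simp: C_def")+
  have zc: "schain 1 (topo S) z"
   unfolding z_def using S3 by (intro singular_chain_diff singular_chain_add) (auto simp: singular_chain_of Sing_def)
  have zb: "bdry1 1 z=0"
   using S3 by (simp add: z_def chain_boundary_diff chain_boundary_add chain_boundary_of sface_1)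
    (simp add: A_def GA_def vx_def L'0[unfolded vx_def, simplified])
  have hom: "homotopic_with (%h. h:{} \<rightarrow> {}) (topo S) (topo S) id (%_. w)"
   unfolding homotopic_with_def
  proof (intro exI conjI)
   have "(1 - t) *R x+t *R w:S" if "t:{0..1}" "x:S" for t x
   proof (cases "t=1 | fproj n g x~=0")
    case True
    then show ?thesis using wS w(1) by (cases "t=1") (auto simp: S_def bbs)
   next
    case False
    then have "inner x w > 0" "t < 1" using that by (auto simp: S_def)
    then have "inner ((1 - t) *R x+t *R w) w > 0"
     using that w(2) by (simp add: inner_add_left norm_eq_1 add_pos_nonneg)
    then show ?thesis by (simp add: S_def)
   qed
   moreover have "cmap (prt (topo {0..1::real}) (topo S)) eucl1 (%x. (1 - fst x) *R snd x + fst x *R w)"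
    by (intro cm_add cm_sR cm_df cm_cst cm_fst cm_snd) simp
   ultimately show "cmap (prt (topo {0..1}) (topo S)) (topo S) (%x. (1 - fst x) *R snd x + fst x *R w)"
    by (auto simp: cmis)
  qed auto
  have "singular_relcycle 1 (topo S) {} z" using zc zb by (simp add: singular_relcycle)
  from homotopic_imp_homologous_rel_chain_maps[OF hom this] obtain d where
   d: "schain 2 (topo S) d" "bdry1 2 d = chain_map 1 id z - chain_map 1 (%_. w) z"
   by (auto simp: homologous_rel_def singular_relboundary n2e2 singular_chain_empty)
  \<comment> \<open>The contraction leaves the constant edge at w, which is the boundary of the
    constant 2-simplex.\<close>
  define k where "k m=restrict (%_. w) (Dl m)" for m
  have k: "k m:Sing (topo S) m" for m using wS by (auto simp: k_def Sing_def ssx_eucl)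
  have "smap1 1 (%_. w) f=k 1" for f :: "(nat=>real)=>'h" by (simp add: smd k_def o_def)
  then have kz: "chain_map 1 (%_. w) z = frof (k 1)" by (simp add: z_def chain_map_diff chain_map_add)
  have "sface1 2 i (k 2)=k 1" if "i<=2" for i
   using stx_face[of i 1] that by (auto simp: sfd k_def fei n2e2)
  then have kb: "bdry1 2 (frof (k 2)) = frof (k 1)"
   by (simp add: chain_boundary_of n2e2)
  have db: "schain 2 (topo S) (d + frof (k 2))" "bdry1 2 (d + frof (k 2))=z"
   using d k[of 2] kz kb chain_map_id_gen[OF zc, of id] by (auto simp: chain_boundary_add singular_chain_add singular_chain_of Sing_def)
  have q: "cmap (topo S) PSp1 lpr1"
   using S0 by (auto simp: PSp_eq intro!: lpr_PH con_lpr)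
  have "smap1 1 lpr1 (A L')=e"
   using L'n e by (auto simp: smd A_def fei Sing_def ssd extensional_def)
  moreover have "smap1 1 lpr1 (A (GA l))=ga l" for l by (auto simp: smd A_def ga_def)
  ultimately have "chain_map 1 lpr1 z = frof e + frof (ga l0) - frof (ga l1)"
   by (simp add: z_def chain_map_diff chain_map_add)
  moreover have "bdry1 2 (chain_map 2 lpr1 (d + frof (k 2))) = chain_map 1 lpr1 z"
   using chain_boundary_chain_map[OF db(1), of line_proj] db(2) by simp
  moreover have "schain 2 PSp1 (chain_map 2 lpr1 (d + frof (k 2)))"
   by (rule singular_chain_chain_map[OF db(1) q])
  ultimately show ?thesis by (auto simp: l0_def l1_def)
 qed
 then show ?thesis by (rule that)
qed

text \<open>The primitive evaluates \<open>fi\<close> on the filling of an edge. The fillings of the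
  faces of a 2-simplex, with their signs, minus the simplex form a cycle because the paths
  \<open>ga\<close> cancel, and \<open>fi\<close> vanishes on cycles.\<close>

theorem hyp_uq:
 fixes fi :: "('h::complex_hilbert op) tc"
 assumes inf: "~ fdim (UNIV :: 'h set)" and fi: "eqn (Sing PSp1) (cd fi) 0"
  and fi0: "!!u v. norm u=1==>norm v=1==>cin1 u v=0==>fi 2 (lsx1 u v)=fi 2 (restrict (%_. lpr1 v) (Dl 2))"
 obtains et where "!!sg. sg:Sing PSp1 2==>fi 2 sg = cd et 2 sg"
proof -
 obtain ga c where c: "!!e :: (nat=>real)=>'h op. e:Sing PSp1 1 ==>
  schain 2 PSp1 (c e)&bdry1 2 (c e) = frof e + frof (ga (e (vx 0))) - frof (ga (e (vx 1)))"
  using edge_filling[OF inf] by metis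
 define et :: "('h op) tc" where "et k e=ev fi 2 (c e)" for k e
 have "fi 2 sg = cd et 2 sg" if sg: "sg:Sing PSp1 2" for sg
 proof -
  define f where "f k=sface1 2 k sg" for k
  have f: "f k:Sing PSp1 1" if "k<=2" for k
   using singular_simplex_singular_face[of 2 proj_space sg k] sg that by (simp add: f_def Sing_def)
  have v: "f k (vx i)=sg (vx (if i < k then i else Suc i))" if "i<=1" for k i
   using that by (simp add: f_def sfd xface_vx)
  define z where "z = c (f 0) - c (f 1) + c (f 2) - frof sg"
  have "schain 2 PSp1 z"
   unfolding z_def using c f sg by (intro singular_chain_diff singular_chain_add) (auto simp: singular_chain_of Sing_def)
  moreover have "bdry1 2 z=0"
   using c[OF f[of 0]] c[OF f[of 1]] c[OF f[of 2]]
   by (simp add: z_def chain_boundary_diff chain_boundary_add chain_boundary_of v) (simp add: f_def n2e2)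
  ultimately have "ev fi 2 z=0" using closed_zero_on_cycles[OF inf fi fi0, of z] by blast
  then show ?thesis by (simp add: z_def ev_df ev_add simplex_face_rest[OF sg] et_def f_def)
 qed
 then show ?thesis by (rule that)
qed

section \<open>Cohomology classes\<close>

definition clat :: "nat=>'a topology=>'a tc=>bool" where
 "clat n X fi<->(ALL sg:Sing X (Suc n). cd fi (Suc n) sg=0)"

definition cohn :: "nat=>'a topology=>'a tc=>'a tc=>bool" where
 "cohn n X fi ps<->(EX tt. ALL sg:Sing X n. fi n sg=ps n sg + cd tt n sg)"

text \<open>The passage to the homogeneous cochains of the definitions: the component of degree n,
  cut off outside the singular simplices.\<close>

definition tr :: "nat=>'a topology=>'a tc=>'a cochain" where
 "tr n X fi sg=(if ssx1 n X sg then fi n sg else 0)"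

definition cl :: "nat=>'a topology=>'a tc=>'a cochain set" where
 "cl n X fi = coh_class n X (tr n X fi)"

definition deg :: "nat=>'a tc=>'a tc" where
 "deg m fi n sg=(if n=m then fi n sg else 0)"

lemma deg_add: "deg m (fi+ps)=deg m fi+deg m ps"
 by (intro ext) (simp add: deg_def)

lemma deg_0: "deg m 0=0"
 by (intro ext) (simp add: deg_def)

lemma deg_deg [simp]: "deg m (deg m fi)=deg m fi"
 by (intro ext) (simp add: deg_def)

lemma cd_deg: "cd (deg m fi)=deg (Suc m) (cd fi)"
proof (intro ext)
 show "cd (deg m fi) n sg=deg (Suc m) (cd fi) n sg" for n sg
  by (cases n) (auto simp: deg_def cd_def)
qed

lemma deg_cd: "deg m (cd tt) = cd (if m=0 then 0 else deg (m - 1) tt)"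
 by (cases m) (auto simp: cd_deg deg_def cd_def intro!: ext)

lemma pb_deg: "pb f (deg m fi)=deg m (pb f fi)"
 by (intro ext) (simp add: deg_def pb_def)

lemma deg_cup: "deg p fi \<smile> deg q ps=deg (p+q) (fi \<smile> deg q ps)"
proof (intro ext)
 fix n sg
 have "(fi \<smile> deg q ps) (p+q) sg=(deg p fi \<smile> deg q ps) (p+q) sg"
  unfolding cupt_def by (intro suco) (auto simp: deg_def)
 moreover have "(deg p fi \<smile> deg q ps) n sg=0" if "n~=p+q"
  unfolding cupt_def by (intro sum.neutral) (use that in "auto simp: deg_def")
 ultimately show "(deg p fi \<smile> deg q ps) n sg=deg (p+q) (fi \<smile> deg q ps) n sg"
  by (simp add: deg_def)
qed

lemma eq_deg: "eqn T fi ps==>eqn T (deg m fi) (deg m ps)"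
 by (auto simp: eqn_def deg_def)

lemma coh_deg: "coh T fi ps==>coh T (deg m fi) (deg m ps)"
 unfolding coh_def by (metis deg_add deg_cd eq_deg)

lemma cohn_coh: "cohn n X fi ps<->coh (Sing X) (deg n fi) (deg n ps)"
proof
 assume "cohn n X fi ps"
 then obtain tt where "ALL sg:Sing X n. fi n sg=ps n sg + cd tt n sg" by (auto simp: cohn_def)
 then have "eqn (Sing X) (deg n fi) (deg n ps+deg n (cd tt))" by (auto simp: eqn_def deg_def)
 then show "coh (Sing X) (deg n fi) (deg n ps)" unfolding deg_cd coh_def by blast
qed (fastforce simp: coh_def cohn_def eqn_def deg_def)

lemma clat_deg: "clat n X fi<->eqn (Sing X) (cd (deg n fi)) 0"
 by (auto simp: clat_def cd_deg eqn_def deg_def)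

lemma eq_clat: "eqn (Sing X) (cd fi) 0==>clat n X fi"
 by (simp add: clat_def eqn_def)

lemma clat_cohn: "cohn n X fi ps==>clat n X fi<->clat n X ps"
 unfolding clat_deg cohn_coh by (rule coh_closed) simp_all

lemma coboundary_tr: "coboundary n X (tr n X fi)=tr (Suc n) X (cd fi)"
 using singular_simplex_singular_face[of "Suc n" X]
 by (auto simp: coboundary_def tr_def cd_def fei intro!: suco)

lemma tr_tc: "ps:cochains n X==>tr n X (%m. ps)=ps"
 by (auto simp: tr_def cochains_def)

lemma tr_cochains: "tr n X fi:cochains n X"
 by (simp add: tr_def cochains_def)

lemma coboundaries_eq: "coboundaries n X={tr n X (cd tt) | tt. True}"
proof (cases n)
 case 0
 have "tr 0 X (cd tt)=(%_. 0)" for tt by (auto simp: tr_def cd_def)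
 then show ?thesis using 0 by (simp add: coboundaries_def)
next
 case (Suc m)
 show ?thesis
 proof
  show "coboundaries n X \<subseteq> {tr n X (cd tt) | tt. True}"
  proof
   fix c assume "c:coboundaries n X"
   then obtain ps where "ps:cochains m X" "c = coboundary m X ps" by (auto simp: Suc coboundaries_def)
   then show "c:{tr n X (cd tt) | tt. True}"
    using coboundary_tr[of m X "%_. ps"] tr_tc[of ps m X] by (auto simp: Suc)
  qed
  show "{tr n X (cd tt) | tt. True} \<subseteq> coboundaries n X"
   using tr_cochains by (auto simp: Suc coboundaries_def simp flip: coboundary_tr)
 qed
qed

lemma tr_carrier: "tr n X fi:carrier (cocycle_group n X)<->clat n X fi"
 unfolding cocycle_group_def by (simp add: tr_cochains coboundary_tr) (auto simp: tr_def clat_def Sing_def fei)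

lemma cl_raw: "cl n X fi={tr n X (cd tt+fi) | tt. True}"
proof -
 have "tr n X (cd tt) \<otimes>\<^bsub>cocycle_group n X\<^esub> tr n X fi=tr n X (cd tt+fi)" for tt
  by (auto simp: cocycle_group_def tr_def)
 then show ?thesis by (auto simp: cl_def coh_class_def r_coset_def coboundaries_eq)
qed

lemma cl_eq: "cl n X fi={tr n X ps | ps. cohn n X ps fi}"
proof -
 have "cl n X fi={tr n X (cd tt+fi) | tt. True}" by (rule cl_raw)
 also have "... = {tr n X ps | ps. cohn n X ps fi}"
  by (auto simp: cohn_def tr_def fei Sing_def add.commute) 
 finally show ?thesis .
qed

lemma tr_eq_iff: "tr n X fi=tr n X ps<->(ALL sg:Sing X n. fi n sg=ps n sg)"
 by (auto simp: tr_def fei Sing_def)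

lemma cohn_refl: "cohn n X fi fi"
 by (simp add: cohn_coh)

lemma cl_cong: "cohn n X fi ps<->cl n X fi = cl n X ps"
proof
 assume *: "cohn n X fi ps"
 show "cl n X fi = cl n X ps"
  unfolding cl_eq cohn_coh using * coh_trans coh_sym unfolding cohn_coh by blast
next
 assume "cl n X fi = cl n X ps"
 then have "tr n X fi:cl n X ps" using cohn_refl cl_eq by fastforce
 then obtain wm where "tr n X fi=tr n X wm" "cohn n X wm ps" by (auto simp: cl_eq)
 then show "cohn n X fi ps" by (simp add: tr_eq_iff cohn_def)
qed

lemma UN_cst: "S~={}==>(!!x. x:S==>f x = c)==>(\<Union>x\<in>S. f x) = c"
 by auto

lemma cl_nonempty: "cl n X fi~={}"
 unfolding cl_eq using cohn_refl by blast

lemma cl_carrier: "carrier (cohG n X)={cl n X fi | fi. clat n X fi}"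
proof -
 have "carrier (cohG n X) = coh_class n X ` carrier (cocycle_group n X)"
  by (auto simp: cohomology_group_def FactGroup_def RCOSETS_def coh_class_def)
 also have "... = {cl n X fi | fi. clat n X fi}"
 proof (intro equalityI subsetI)
  fix c assume "c:coh_class n X ` carrier (cocycle_group n X)"
  then obtain ps where "c = coh_class n X ps" "ps:carrier (cocycle_group n X)" by blast
  moreover from this(2) have "tr n X (%m. ps)=ps" by (intro tr_tc) (simp add: cocycle_group_def)
  ultimately show "c:{cl n X fi | fi. clat n X fi}" using tr_carrier by (metis (mono_tags, lifting) cl_def mem_Collect_eq)
 qed (auto simp: cl_def tr_carrier intro!: imageI)
 finally show ?thesis .
qed

lemma cl_one: "\<one>\<^bsub>cohG n X\<^esub> = cl n X 0"
 by (simp add: cohomology_group_def FactGroup_def cl_raw coboundaries_eq)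

lemma cl_mult:
 assumes "clat n X fi" "clat n X ps"
 shows "cl n X fi \<otimes>\<^bsub>cohG n X\<^esub> cl n X ps = cl n X (fi+ps)"
proof -
 interpret comm_group "cocycle_group n X" by (rule comm_group_cocycle_group)
 have N: "coboundaries n X \<lhd> cocycle_group n X"
  using subgroup_coboundaries normal_iff_subgroup by blast
 have "tr n X fi \<otimes>\<^bsub>cocycle_group n X\<^esub> tr n X ps=tr n X (fi+ps)"
  by (auto simp: cocycle_group_def tr_def)
 then show ?thesis
  using normal.rcos_sum[OF N tr_carrier[THEN iffD2, OF assms(1)] tr_carrier[THEN iffD2, OF assms(2)]]
  by (simp add: cohomology_group_def FactGroup_def cl_def coh_class_def)
qed

lemma clat_add: "clat n X fi==>clat n X ps==>clat n X (fi+ps)"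
 by (simp add: clat_def cd_add)

lemma clat_0: "clat n X 0"
 by (simp add: clat_def)

lemma cl_finprod:
 assumes "finite I" "!!i. i:I==>clat n X (f i)"
 shows "(\<Otimes>\<^bsub>cohG n X\<^esub>i\<in>I. cl n X (f i)) = cl n X (\<Sum>i\<in>I. f i)"
proof -
 interpret comm_group "cohG n X" by (rule comm_group_cohomology_group)
 have c: "clat n X (\<Sum>i\<in>J. f i)" if "J \<subseteq> I" for J
  using finite_subset[OF that assms(1)] that
  by (induction J rule: finite_induct) (auto intro: clat_add assms(2) clat_0)
 have "finite J==>J \<subseteq> I==>(\<Otimes>\<^bsub>cohG n X\<^esub>i\<in>J. cl n X (f i)) = cl n X (\<Sum>i\<in>J. f i)" for J
 proof (induction J rule: finite_induct)
  case (insert i J)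
  then show ?case using assms(2) c[of J]
   by (subst finprod_insert) (auto simp: cl_carrier cl_mult)
 qed (simp add: cl_one)
 then show ?thesis using assms(1) by simp
qed

lemma cl_pull:
 assumes f: "cmap X Y f"
 shows "coh_pull n X f (cl n Y fi) = cl n X (pb f fi)"
proof -
 have "coh_class n X (cochain_pull n X f (tr n Y ps)) = cl n X (pb f ps)" for ps
  using Sing_map[OF f] by (auto simp: cl_def cochain_pull_def tr_def pb_def Sing_def intro!: arg_cong[where f = "coh_class n X"])
 moreover have "cl n X (pb f ps) = cl n X (pb f fi)" if "cohn n Y ps fi" for ps
  using coh_pb[OF mp_Sing[OF f]] that unfolding cl_cong[symmetric] cohn_coh pb_deg[symmetric] by blast
 ultimately show ?thesis
  unfolding coh_pull_def by (intro UN_cst cl_nonempty) (auto simp: cl_eq[of n Y])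
qed

lemma tr_cup: "cochain_cup p q X (tr p X fi) (tr q X ps)=tr (p+q) X (deg p fi \<smile> deg q ps)"
proof -
 have "ffc p sg:Sing X p&bfc p q sg:Sing X q" if "sg:Sing X (p+q)" for sg
  using fcl_Sing[of X] that unfolding fclosed_def by (metis add_diff_cancel_left' le_add1)
 moreover have "(deg p fi \<smile> deg q ps) (p+q) sg=fi p (ffc p sg) * ps q (bfc p q sg)" for sg
 proof -
  have "(deg p fi \<smile> deg q ps) (p+q) sg=(\<Sum>k\<le>p+q. if k=p then fi p (ffc p sg) * ps q (bfc p q sg) else 0)"
   unfolding cupt_def by (intro suco) (auto simp: deg_def)
  then show ?thesis by simp
 qed
 ultimately show ?thesis by (auto simp: cochain_cup_def tr_def Sing_def fei)
qed

lemma cl_cup: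
 assumes "clat p X fi" "clat q X ps"
 shows "cup p q X (cl p X fi) (cl q X ps) = cl (p+q) X (deg p fi \<smile> deg q ps)"
proof -
 have "cl (p+q) X (deg p fi' \<smile> deg q ps') = cl (p+q) X (deg p fi \<smile> deg q ps)" if "cohn p X fi' fi" "cohn q X ps' ps" for fi' ps'
 proof -
  have "eqn (Sing X) (cd (deg q ps')) 0" using clat_cohn[OF that(2)] assms by (simp add: clat_deg)
  from coh_trans[OF coh_cup_l[OF fcl_Sing this that(1)[unfolded cohn_coh]]
    coh_cup_r[OF fcl_Sing assms(1)[unfolded clat_deg] that(2)[unfolded cohn_coh]]]
  show ?thesis by (simp add: cohn_coh coh_deg flip: cl_cong)
 qed
 moreover have "coh_class (p+q) X (cochain_cup p q X (tr p X fi') (tr q X ps')) = cl (p+q) X (deg p fi' \<smile> deg q ps')" for fi' ps'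
  by (simp add: tr_cup cl_def)
 ultimately show ?thesis
  unfolding cup_def by (intro UN_cst cl_nonempty) (auto simp: cl_eq[of p] cl_eq[of q])
qed

lemma unit_cl: "unit_class X = cl 0 X un"
 by (simp add: unit_class_def cl_def tr_def[abs_def] un_def cong: if_cong)

lemma deg_un: "deg 0 un=un"
 by (intro ext) (simp add: deg_def un_def)

lemma deg_cpow: "deg 2 et=et==>deg (2 * j) (cpow et j) = cpow et j"
proof (induction j)
 case (Suc j)
 then show ?case using deg_cup[of "2 * j" "cpow et j" 2 et] by (simp add: alsi)
qed (simp add: deg_un)

lemma cl_cpow:
 assumes "deg 2 et=et" "eqn (Sing X) (cd et) 0"
 shows "cup_power 2 X (cl 2 X et) j = cl (2 * j) X (cpow et j)"
proof (induction j)
 case (Suc j)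
 have "clat (2 * j) X (cpow et j)" "clat 2 X et"
  using cd_cpow[OF assms(2) fcl_Sing] assms(2) by (auto intro: eq_clat)
 moreover have "2 * Suc j=2 * j+2" by simp
 ultimately show ?case
  unfolding cup_power.simps Suc.IH by (simp only: cl_cup deg_cpow[OF assms(1)] assms(1) cpow.simps)
qed (simp add: unit_cl)

lemma hyp_deg: "deg 2 hyp=hyp" "deg 2 ctp = ctp"
 by (auto simp: deg_def hyp_def pb_def intro!: ext)

text \<open>Existence is \<open>hyp_lsx\<close>. For uniqueness, the difference of a candidate and
  \<open>hyp\<close> takes equal values on \<open>lsx1 u v\<close> and on the constant simplex, so
  \<open>hyp_uq\<close> makes it exact.\<close>

lemma hyperplane_class_eq:
 assumes inf: "~ fdim (UNIV :: 'h::complex_hilbert set)"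
 shows "(hyperplane_class :: ('h op) cochain set) = cl 2 PSp1 hyp"
proof -
 let ?P = "%fi :: ('h op) tc. ALL u v. norm u=1&norm v=1&cin1 u v=0 -->
  fi 2 (lsx1 u v) - fi 2 (restrict (%_. lpr1 v) (Dl 2))=1"
 have ls: "tr 2 PSp1 fi (lsx1 u v)=fi 2 (lsx1 u v)"
  "tr 2 PSp1 fi (restrict (%_. lpr1 v) (Dl 2))=fi 2 (restrict (%_. lpr1 v) (Dl 2))"
  "cd fi 2 (lsx1 u v) = cd fi 2 (restrict (%_. lpr1 v) (Dl 2))"
  if "norm u=1&norm v=1&cin1 u v=0" for fi and u v :: 'h
  using hyp_lsx[of u v] that by (auto simp: tr_def Sing_def cd_def intro!: suco)
 have P: "(ALL u v. norm u=1&norm v=1&cin1 u v=0 -->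
   (ALL ps:cl 2 PSp1 fi. ps (lsx1 u v) - ps (restrict (%_. lpr1 v) (Dl 2))=1))<->?P fi"
  for fi :: "('h op) tc"
 proof -
  \<comment> \<open>A coboundary takes the same value on the two simplices, as they have the same
    faces; so the condition depends on the class only.\<close>
  have D: "ps 2 (lsx1 u v) - ps 2 (restrict (%_. lpr1 v) (Dl 2))=fi 2 (lsx1 u v) - fi 2 (restrict (%_. lpr1 v) (Dl 2))"
   if uv: "norm u=1&norm v=1&cin1 u v=0" and co: "cohn 2 PSp1 ps fi" for ps and u v :: 'h
  proof -
   obtain tt where "ALL sg:Sing PSp1 2. ps 2 sg=fi 2 sg + cd tt 2 sg" using co by (auto simp: cohn_def)
   then show ?thesis using ls(3)[OF uv] hyp_lsx(2,3)[of u v] uv by simp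
  qed
  have val: "ps (lsx1 u v) - ps (restrict (%_. lpr1 v) (Dl 2))=fi 2 (lsx1 u v) - fi 2 (restrict (%_. lpr1 v) (Dl 2))"
   if uv: "norm u=1&norm v=1&cin1 u v=0" and "ps:cl 2 PSp1 fi" for ps and u v :: 'h
   using that(2) D[OF uv] ls(1,2)[OF uv] by (auto simp: cl_eq)
  show ?thesis
  proof (intro iff_allI imp_cong refl)
   fix u v :: 'h assume uv: "norm u=1&norm v=1&cin1 u v=0"
   show "(ALL ps:cl 2 PSp1 fi. ps (lsx1 u v) - ps (restrict (%_. lpr1 v) (Dl 2))=1) <->
     fi 2 (lsx1 u v) - fi 2 (restrict (%_. lpr1 v) (Dl 2))=1"
    using val[OF uv] cl_nonempty[of 2 proj_space fi] by (simp add: ex_in_conv[symmetric] del: ex_in_conv)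
  qed
 qed
 show ?thesis
  unfolding hyperplane_class_def
 proof (rule the_equality)
  have h: "?P hyp" by (intro allI impI, elim conjE) (rule hyp_lsx(1))
  have "cl 2 PSp1 (hyp :: ('h op) tc):carrier (cohG 2 PSp1)"
   unfolding cl_carrier using eq_clat[OF hyp_closed] by auto
  note x = conjI[OF this iffD2[OF P[of hyp] h]]
  from x show "cl 2 PSp1 (hyp :: ('h op) tc):carrier (cohG 2 PSp1) &
  (ALL u v :: 'h. norm u=1&norm v=1&cin1 u v=0 -->
   (ALL fi:cl 2 PSp1 hyp. fi (lsx1 u v) - fi (restrict (%_. lpr1 v) (Dl 2))=1))" .
  fix c :: "('h op) cochain set"
  assume c: "c:carrier (cohG 2 PSp1) &
  (ALL u v. norm u=1&norm v=1&cin1 u v=0 -->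
   (ALL fi:c. fi (lsx1 u v) - fi (restrict (%_. lpr1 v) (Dl 2))=1))"
  then obtain fi where fi: "c = cl 2 PSp1 fi" "clat 2 PSp1 fi" by (auto simp: cl_carrier)
  have 1: "?P fi" by (rule iffD1[OF P[of fi] conjunct2[OF c[unfolded fi(1)]]])
  have "(deg 2 fi - hyp) 2 (lsx1 u v)=(deg 2 fi - hyp) 2 (restrict (%_. lpr1 v) (Dl 2))"
   if uv: "norm u=1" "norm v=1" "cin1 u v=0" for u v
  proof -
   have "fi 2 (lsx1 u v) - fi 2 (restrict (%_. lpr1 v) (Dl 2))=1" using 1 uv by blast
   then show ?thesis using hyp_lsx(1)[OF uv] by (simp add: deg_def)
  qed
  moreover have "eqn (Sing PSp1) (cd (deg 2 fi - hyp)) 0"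
   using fi(2) hyp_closed by (simp add: clat_deg cd_df eqn_def)
  ultimately obtain et where "!!sg. sg:Sing PSp1 2==>(deg 2 fi - hyp) 2 sg = cd et 2 sg"
   using hyp_uq[OF inf, of "deg 2 fi - hyp"] by blast
  then have "cohn 2 PSp1 fi hyp" by (auto simp: cohn_def deg_def diff_eq_eq add.commute intro!: exI[of _ et])
  then show "c = cl 2 PSp1 hyp" using fi(1) cl_cong by blast
 qed
qed

section \<open>Chern classes of bundles\<close>

lemma chn_deg:
 fixes p :: "'x=>'h::complex_hilbert op"
 assumes "chern X p n c"
 shows "chern X p n (%i. deg (2 * i) (c i))"
proof -
 have "deg (2 * i) (pb fst (c i)) \<smile> cpow ctp (n - i)=deg (2 * n) (pb fst (c i) \<smile> cpow ctp (n - i))" if "i<=n" for i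
  using deg_cup[of "2 * i" "pb fst (c i)" "2*(n - i)" "cpow ctp (n - i)"] that
  by (simp add: deg_cpow[OF hyp_deg(2)] flip: distrib_left)
 then have "(chsum n (%i. deg (2 * i) (c i)) :: ('x \<times> ('h op)) tc)=(\<Sum>i\<le>n. deg (2 * n) (pb fst (c i) \<smile> cpow ctp (n - i)))"
  by (auto simp: chsum_def pb_deg intro: suco)
 also have "... = deg (2 * n) (chsum n c)"
  unfolding chsum_def
  by (rule sum_comp_morphism[of "deg (2 * n)", unfolded o_def]) (simp_all add: deg_add deg_0)
 finally have "coh (Sing (PB X p)) (chsum n (%i. deg (2 * i) (c i))) 0"
  using assms coh_deg[of "Sing (PB X p)" "chsum n c" 0 "2 * n"] by (simp add: chern_def deg_0)
 moreover have "coh (Sing X) (deg (2 * i) (c i)) 0" if "i > n" for i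
  using assms that coh_deg[of "Sing X" "c i" 0 "2 * i"] by (simp add: chern_def deg_0)
 moreover have "coh (Sing X) (deg 0 (c 0)) un"
  using assms coh_deg[of "Sing X" "c 0" un 0] by (simp add: chern_def deg_un)
 moreover have "eqn (Sing X) (cd (deg (2 * i) (c i))) 0" for i
  using assms eq_clat[of X "c i"] by (simp add: chern_def clat_deg)
 ultimately show ?thesis by (simp add: chern_def)
qed

text \<open>As the rank is n everywhere, the parts of other ranks are empty, and the conditions on
  them in \<open>are_chern_classes\<close> hold in trivial groups.\<close>

lemma rank_part_eq:
 assumes p: "rank X p n" and E: "!!x. x:tsp1 X==>E x=range (bapp (p x))"
 shows "rank_part X E m=(if m=n then X else sbt1 X {})"
  "proj_bundle X E m=(if m=n then PB X p else sbt1 (PB X p) {})"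
proof -
 have d: "dim (E x)=2 * n" if "x:tsp1 X" for x using p that by (simp add: rank_def E)
 have "rank_part X E m=sbt1 X (if m=n then tsp1 X else {})"
  unfolding rank_part_def by (rule sbt_eq) (use d in auto)
 then show r: "rank_part X E m=(if m=n then X else sbt1 X {})" by simp
 have "range (bapp l) \<subseteq> E x<->p x oL l=l" if "x:tsp1 X" for x l
 proof -
  have "p x (p x y)=p x y" for y using p that by (auto simp: rank_def vbundle_def intro: opr_idem)
  then have "p x z=z<->z:range (p x)" for z by (auto intro: range_eqI[of z "p x" z])
  moreover have "p x oL l=l<->(ALL y. p x (l y)=l y)"
   by (auto intro!: bleq) (simp flip: babc)
  ultimately show ?thesis unfolding E[OF that] by auto
 qed
 then have "sbt1 (prt X PSp1) {(x, l). range (bapp l) \<subseteq> E x}=PB X p"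
  unfolding PB_def by (intro sbt_eq) auto
 moreover have "proj_bundle X E m=sbt1 (PB X p) {}" if "m~=n"
  using that r by (simp add: proj_bundle_def prod_topology_subtopology subtopology_subtopology)
 ultimately show "proj_bundle X E m=(if m=n then PB X p else sbt1 (PB X p) {})"
  using r by (simp add: proj_bundle_def)
qed

lemma cl_empty: "tsp1 X={}==>cl m X fi=\<one>\<^bsub>cohG m X\<^esub>"
 unfolding cl_one cl_cong[symmetric] cohn_def by (simp add: Sing_trivial)

lemma are_chn_classes_cl:
 fixes p :: "'x=>'h::complex_hilbert op"
 assumes inf: "~ fdim (UNIV :: 'h set)" and p: "rank X p n"
  and E: "!!x. x:tsp1 X==>E x=range (bapp (p x))"
  and c: "!!i. eqn (Sing X) (cd (c i)) 0" "!!i. deg (2 * i) (c i) = c i"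
 shows "are_chern_classes X E (%i. cl (2 * i) X (c i))<->chern X p n c"
proof -
 have unit: "cl 0 X (c 0)=unit_class X<->coh (Sing X) (c 0) un"
  using c(2)[of 0] by (simp add: unit_cl deg_un cohn_coh flip: cl_cong)
 have closed: "cl (2 * i) X (c i):carrier (cohG (2 * i) X)" for i
  unfolding cl_carrier using eq_clat[OF c(1)] by blast
 have e: "tsp1 (sbt1 X {})={}" "tsp1 (sbt1 (PB X p) {})={}" by auto
 have hi: "coh_pull (2 * i) (rank_part X E m) id (cl (2 * i) X (c i))=\<one>\<^bsub>cohG (2 * i) (rank_part X E m)\<^esub>
   <-> (m=n-->coh (Sing X) (c i) 0)" for i m
 proof (cases "m=n")
  case True
  have "cl (2 * i) X (pb id (c i)) = cl (2 * i) X (c i)"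
   unfolding cl_cong[symmetric] cohn_coh using pb_id_on[of X id "c i"] by (intro coh_deg coh_eqn) auto
  then have "coh_pull (2 * i) X id (cl (2 * i) X (c i)) = cl (2 * i) X (c i)"
   by (simp only: cl_pull[OF continuous_map_id])
  then show ?thesis using True c(2) by (simp add: rank_part_eq[OF p E] cl_one cohn_coh deg_0 flip: cl_cong)
 next
  case False
  have "cmap (sbt1 X {}) X id" by (simp add: cmfs)
  then show ?thesis using False by (simp add: rank_part_eq[OF p E] cl_pull cl_empty)
 qed
 have sum: "(let P=proj_bundle X E m in
    (\<Otimes>\<^bsub>cohG (2 * m) P\<^esub>i\<in>{..m}.
      cup (2 * i) (2*(m - i)) P (coh_pull (2 * i) P fst (cl (2 * i) X (c i)))
       (cup_power 2 P (coh_pull 2 P snd hyperplane_class) (m - i)))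
    = \<one>\<^bsub>cohG (2 * m) P\<^esub>)<->(m=n-->coh (Sing (PB X p)) (chsum n c) 0)" for m
 proof -
  define P where "P=proj_bundle X E m"
  have P: "P=(if m=n then PB X p else sbt1 (PB X p) {})" by (simp add: P_def rank_part_eq[OF p E])
  then have f: "cmap P X fst" "cmap P PSp1 snd"
   by (auto intro: cmfs cm_PB_fst cm_PB_snd)
  have ctp: "eqn (Sing P) (cd ctp) 0" using mp_eqn[OF mp_Sing[OF f(2)] hyp_closed] by (simp add: pb_cd)
  have pc: "eqn (Sing P) (cd (pb fst (c i))) 0" for i
   using mp_eqn[OF mp_Sing[OF f(1)] c(1)[of i]] by (simp add: pb_cd)
  let ?t = "%i. pb fst (c i) \<smile> cpow ctp (m - i)"
  have tcl: "eqn (Sing P) (cd (?t i)) 0" for i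
   using eq_cup0_l[OF pc fcl_Sing] eq_cup0_r[OF cd_cpow[OF ctp fcl_Sing] fcl_Sing]
   by (simp add: cd_cup eqn_def)
  have dt: "?t i=deg (2 * m) (?t i)" if "i<=m" for i
   using deg_cup[of "2 * i" "pb fst (c i)" "2*(m - i)" "cpow ctp (m - i)"] that c(2)[of i]
   by (simp add: deg_cpow[OF hyp_deg(2)] pb_deg[symmetric] flip: distrib_left)
  have t: "cup (2 * i) (2*(m - i)) P (coh_pull (2 * i) P fst (cl (2 * i) X (c i)))
       (cup_power 2 P (coh_pull 2 P snd hyperplane_class) (m - i)) = cl (2 * m) P (?t i)" if "i<=m" for i
  proof -
   have "clat (2 * i) P (pb fst (c i))" "clat (2*(m - i)) P (cpow ctp (m - i))"
    by (intro eq_clat pc cd_cpow[OF ctp fcl_Sing])+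
   from cl_cup[OF this] show ?thesis
    using that c(2)[of i] by (simp add: hyperplane_class_eq[OF inf] cl_pull[OF f(1)] cl_pull[OF f(2)]
     cl_cpow[OF hyp_deg(2) ctp] deg_cpow[OF hyp_deg(2)] pb_deg[symmetric] flip: distrib_left)
  qed
  interpret comm_group "cohG (2 * m) P" by (rule comm_group_cohomology_group)
  have "(\<Otimes>\<^bsub>cohG (2 * m) P\<^esub>i\<in>{..m}. cup (2 * i) (2*(m - i)) P (coh_pull (2 * i) P fst (cl (2 * i) X (c i)))
       (cup_power 2 P (coh_pull 2 P snd hyperplane_class) (m - i)))=(\<Otimes>\<^bsub>cohG (2 * m) P\<^esub>i\<in>{..m}. cl (2 * m) P (?t i))"
   by (rule finprod_cong') (use t in "auto simp: cl_carrier intro!: eq_clat tcl")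
  also have "... = cl (2 * m) P (chsum m c)"
   unfolding chsum_def by (rule cl_finprod) (auto intro: eq_clat tcl)
  finally have "?thesis<->(cl (2 * m) P (chsum m c) = cl (2 * m) P 0<->(m=n-->coh (Sing (PB X p)) (chsum n c) 0))"
   by (simp add: P_def Let_def cl_one)
  moreover have "deg (2 * m) (chsum m c :: ('x \<times> ('h op)) tc) = chsum m c"
  proof -
   have "deg (2 * m) (chsum m c :: ('x \<times> ('h op)) tc)=(\<Sum>i\<le>m. deg (2 * m) (?t i))"
    unfolding chsum_def by (rule sum_comp_morphism[of "deg (2 * m)", unfolded o_def, symmetric]) (simp_all add: deg_add deg_0)
   also have "... = chsum m c"
    unfolding chsum_def by (rule suco[OF refl], rule dt[symmetric]) simp
   finally show ?thesis .
  qed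
  ultimately show ?thesis
   by (auto simp: P cohn_coh deg_0 Sing_trivial coh_def[of bot] simp flip: cl_cong)
 qed
 show ?thesis
  unfolding are_chern_classes_def chern_def sum hi using unit closed c(1) by auto
qed

text \<open>Any sequence meeting the description in \<open>chern_bundle\<close> has homogeneous
  representatives satisfying \<open>chern\<close>, and \<open>chn_uq\<close> compares them with
  those of c.\<close>

theorem chn_bdl_eq:
 fixes p :: "'x=>'h::complex_hilbert op"
 assumes inf: "~ fdim (UNIV :: 'h set)" and X: "cspc X" and p: "rank X p n"
  and E: "!!x. x:tsp1 X==>E x=range (bapp (p x))" and c: "chern X p n c"
 shows "chern_bundle X E i = cl (2 * i) X (c i)"
proof -
 have cl: "eqn (Sing X) (cd (deg (2 * i) (c i))) 0" for i
  using chn_deg[OF c] by (simp add: chern_def)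
 have "chern_bundle X E=(%i. cl (2 * i) X (deg (2 * i) (c i)))"
  unfolding chern_bundle_def
 proof (rule the_equality)
  show "are_chern_classes X E (%i. cl (2 * i) X (deg (2 * i) (c i)))"
   using are_chn_classes_cl[OF inf p E cl] chn_deg[OF c] by simp
  fix d assume d: "are_chern_classes X E d"
  then have "EX fi. d i = cl (2 * i) X fi&clat (2 * i) X fi" for i
   unfolding are_chern_classes_def cl_carrier by blast
  then obtain fi where fi: "!!i. d i = cl (2 * i) X (fi i)" "!!i. clat (2 * i) X (fi i)" by metis
  have dfi: "d i = cl (2 * i) X (deg (2 * i) (fi i))" for i
   unfolding fi(1) cl_cong[symmetric] cohn_coh by simp
  then have "d=(%i. cl (2 * i) X (deg (2 * i) (fi i)))" by blast
  then have "chern X p n (%i. deg (2 * i) (fi i))"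
   using d are_chn_classes_cl[OF inf p E, of "%i. deg (2 * i) (fi i)"] fi(2) by (simp add: clat_deg)
  from chn_uq[OF X p this chn_deg[OF c]]
  have "cl (2 * i) X (deg (2 * i) (fi i)) = cl (2 * i) X (deg (2 * i) (c i))" for i
   unfolding cl_cong[symmetric] cohn_coh by simp
  then show "d=(%i. cl (2 * i) X (deg (2 * i) (c i)))" using dfi by (intro ext) (simp only:)
 qed
 moreover have "cl (2 * i) X (deg (2 * i) (c i)) = cl (2 * i) X (c i)"
  unfolding cl_cong[symmetric] cohn_coh by simp
 ultimately show ?thesis by simp
qed

section \<open>Operators on Hilbert space\<close>

lemma cin_eq_0_iff: "cin1 x x=0<->x=(0 :: 'h::complex_hilbert)"
 by (simp add: cin_self)

lemma inner_cin: "inner x y = Re (cin1 x y)"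
 by (simp add: Re_cinner)

lemma pyth:
 assumes "cin1 a b=0"
 shows "(norm (a+b))\<^sup>2=(norm a)\<^sup>2+(norm b)\<^sup>2" "norm a<=norm (a+b)" "norm b<=norm (a+b)"
proof -
 show 1: "(norm (a+b))\<^sup>2=(norm a)\<^sup>2+(norm b)\<^sup>2"
  using assms by (intro norm_add_Pythagorean) (simp add: orthogonal_def inner_cin)
 show "norm a<=norm (a+b)" "norm b<=norm (a+b)"
  by (rule power2_le_imp_le, simp add: 1, simp)+
qed

lemma norm_df_sq: "(norm (v - c *R w))\<^sup>2=(norm v)\<^sup>2 - 2 * c * inner w v + c\<^sup>2*(norm w)\<^sup>2" for v w :: "'h::real_inner"
 by (simp add: power2_norm_eq_inner inner_diff_left inner_diff_right inner_commute) (simp add: pes)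

text \<open>A minimising sequence is Cauchy by the parallelogram law; at the minimum, moving along v
  by the optimal step t cannot decrease the distance, which forces orthogonality.\<close>

lemma closest_point_ex:
 fixes x :: "'h::complex_hilbert"
 assumes S: "closed S" "subspace S"
 obtains y where "y:S" "!!s. s:S==>inner (x - y) s=0"
proof -
 define I where "I=Inf ((%s. (norm (x - s))\<^sup>2) ` S)"
 have S0: "0:S" using S(2) by (rule subspace_0)
 have I: "I<=(norm (x - s))\<^sup>2" if "s:S" for s
  unfolding I_def by (rule cInf_lower) (use that in "auto intro: bdd_belowI[of _ 0]")
 have "EX s:S. (norm (x - s))\<^sup>2 < I+1 / Suc n" for n
  using cInf_lessD[of "(%s. (norm (x - s))\<^sup>2) ` S" "I+1 / Suc n"] S0 by (auto simp: I_def)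
 then obtain s where s: "!!n. s n:S" "!!n. (norm (x - s n))\<^sup>2 < I+1 / Suc n" by metis
 have par: "(norm (s m - s n))\<^sup>2<=2 / Suc m+2 / Suc n" for m n
 proof -
  have "(1 / 2) *R (s m+s n):S" using s(1) S(2) by (intro subspace_scale subspace_add)
  from I[OF this] have "4 * I<=(norm (2 *R x - (s m+s n)))\<^sup>2"
   using pmd[of 2 "norm (x - (1 / 2) *R (s m+s n))" 2] norm_scaleR[of 2 "x - (1 / 2) *R (s m+s n)"]
   by (simp add: scaleR_diff_right)
  also have "... = 2*(norm (x - s m))\<^sup>2+2*(norm (x - s n))\<^sup>2 - (norm (s m - s n))\<^sup>2"
   by (simp add: power2_norm_eq_inner inner_add_left inner_add_right inner_diff_left inner_diff_right inner_commute)
  finally show ?thesis using s(2)[of m] s(2)[of n] by (simp add: alsi)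
 qed
 have "Cauchy s"
 proof (rule CauchyI)
  fix ep :: real assume "ep > 0"
  then obtain M where M: "4 / Suc M < ep\<^sup>2"
   using nat_approx_posE[of "ep\<^sup>2 / 4"] by (auto simp: field_simps)
  show "EX M. ALL m>=M. ALL n>=M. norm (s m - s n) < ep"
  proof (intro exI[of _ M] allI impI)
   fix m n assume "m >= M" "n >= M"
   then have "2 / Suc m+2 / Suc n<=2 / Suc M+2 / Suc M" by (intro add_mono divide_left_mono) auto
   also have "... = 4 / Suc M" by (simp flip: add_divide_distrib)
   also note M
   finally have "(norm (s m - s n))\<^sup>2 < ep\<^sup>2" using par[of m n] by linarith
   then show "norm (s m - s n) < ep" using `ep > 0` by (simp add: power2_less_imp_less)
  qed
 qed
 then obtain y where y: "s \<longlonglongrightarrow> y" using Cauchy_convergent convergent_def by blast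
 have yS: "y:S" using closed_sequentially[OF S(1) s(1) y] .
 have l1: "(%n. I+1 / Suc n) \<longlonglongrightarrow> I+0"
  by (intro tendsto_intros LIMSEQ_Suc lim_inverse_n[unfolded inverse_eq_divide])
 have l2: "(%n. (norm (x - s n))\<^sup>2) \<longlonglongrightarrow> (norm (x - y))\<^sup>2" by (intro tendsto_intros y)
 have "(norm (x - y))\<^sup>2<=I+0"
  by (rule LIMSEQ_le[OF l2 l1]) (use s(2) in "auto intro: less_imp_le")
 then have min: "(norm (x - y))\<^sup>2<=I" by simp
 have "inner (x - y) v=0" if v: "v:S" for v
 proof (cases "v=0")
  case False
  define t where "t=inner (x - y) v / (norm v)\<^sup>2"
  have "y+t *R v:S" using v yS S(2) by (intro subspace_scale subspace_add)
  from order_trans[OF min I[OF this]]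
  have "(norm (x - y))\<^sup>2<=(norm ((x - y) - t *R v))\<^sup>2" by (simp only: diff_diff_eq)
  also note norm_df_sq
  also have "(norm (x - y))\<^sup>2 - 2 * t * inner v (x - y)+t\<^sup>2*(norm v)\<^sup>2=(norm (x - y))\<^sup>2 - (inner (x - y) v)\<^sup>2 / (norm v)\<^sup>2"
   using False by (simp add: t_def pes field_simps inner_commute[of v])
  finally have "(inner (x - y) v)\<^sup>2 / (norm v)\<^sup>2<=0" by simp
  then show ?thesis using False by (simp add: divide_le_0_iff)
 qed simp
 with yS show ?thesis by (rule that)
qed

text \<open>Real orthogonality to s and to i s together is complex orthogonality. The closest point
  is characterised by it, and this uniqueness makes P linear.\<close>

lemma proj_ex:
 fixes S :: "'h::complex_hilbert set"
 assumes S: "closed S" "complex_subspace S"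
 obtains p where "opr p" "range (bapp p)=S"
proof -
 have ss: "subspace S" "!!c x. x:S==>c *C x:S" using S(2) by (auto simp: csd)
 have "EX y. y:S&(ALL s:S. cin1 (x - y) s=0)" for x
 proof -
  obtain y where y: "y:S" "!!s. s:S==>inner (x - y) s=0" by (rule closest_point_ex[OF S(1) ss(1), of x]) blast
  have "cin1 (x - y) s=0" if "s:S" for s
   using y(2)[OF that] y(2)[OF ss(2)[OF that, of \<i>]] by (simp add: inner_cin cin_sC_r cei)
  with y(1) show ?thesis by blast
 qed
 then obtain P where P: "!!x. P x:S" "!!x s. s:S==>cin1 (x - P x) s=0" by metis
 have uniq: "P x=y" if "y:S" "!!s. s:S==>cin1 (x - y) s=0" for x y
 proof -
  have "cin1 (y - P x) (y - P x) = cin1 (x - P x) (y - P x) - cin1 (x - y) (y - P x)"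
   by (simp add: cin_df_l)
  also have "... = 0" using P that subspace_diff[OF ss(1)] by simp
  finally show ?thesis by (simp add: cin_eq_0_iff)
 qed
 have add: "P (x+y)=P x+P y" for x y
  by (rule uniq) (simp_all add: P subspace_add[OF ss(1)] add_diff_add cal)
 have cscale: "P (c *C x) = c *C P x" for c x
  by (rule uniq) (simp_all add: P ss(2) csl flip: sC_df_r)
 have le: "norm (P x)<=norm x" for x using pyth(3)[OF P(2)[OF P(1)], of x x] by simp
 have bl: "bounded_linear P"
 proof (rule bounded_linear_intro[where K = 1])
  show "P (r *R x)=r *R P x" for r x using cscale[of "of_real r" x] by (simp only: sor)
 qed (simp_all add: add le)
 define p where "p=Blinfun P"
 have p [simp]: "bapp p=P" by (simp add: p_def bounded_linear_Blinfun_apply[OF bl])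
 have fixP: "P y=y" if "y:S" for y by (rule uniq) (use that in simp_all)
 have "cin1 (P x) y = cin1 x (P y)" for x y
  using P(2)[OF P(1), of x y] P(2)[OF P(1), of y x] cico[of y "P x"] cico[of "P y" "P x"]
  by (simp add: cin_df_l)
 then have "opr p"
  unfolding opr_def cld sad
  using cscale fixP P(1) by (auto intro!: bleq)
 moreover have "range P=S" using P(1) fixP by (metis image_subset_iff rangeI subsetI subset_antisym)
 ultimately show ?thesis using that by simp
qed

text \<open>Riesz representation: the functional sending x to \<open>cin1 (F x) y\<close> is
  represented by a multiple of a vector orthogonal to its kernel.\<close>

lemma cin_adj:
 assumes F: "clin1 F"
 shows "cin1 (F x) y = cin1 x (adj F y)" "cin1 (adj F x) y = cin1 x (F y)" "clin1 (adj F)"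
  "norm (adj F)<=norm F" "!!G. (!!x y. cin1 (F x) y = cin1 x (bapp G y))==>adj F=G"
proof -
 have "EX w. ALL x. cin1 (F x) y = cin1 x w" for y
 proof (cases "ALL x. cin1 (F x) y=0")
  case False
  define N where "N={x. cin1 (F x) y=0}"
  have "closed N" unfolding N_def by (intro closed_Collect_eq continuous_intros bbco[OF bbl_cin])
  moreover have "complex_subspace N"
   unfolding N_def csd subspace_def
   by (simp add: bbs cal cin_sR_l clinD[OF F] csl)
  ultimately obtain p where p: "opr p" "range (bapp p)=N" by (rule proj_ex)
  obtain u where u: "u ~: N" using False by (auto simp: N_def)
  define v where "v=u - p u"
  define fi where "fi x = cin1 (F x) y" for x
  have v0: "v~=0" using u p(2) by (metis eq_iff_diff_eq_0 rangeI v_def)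
  have "fi x * cin1 v v=fi v * cin1 x v" for x
  proof -
   have "fi x *C v - fi v *C x:N"
    by (simp add: N_def fi_def bdr clinD[OF F] cin_df_l csl)
   then obtain t where t: "fi x *C v - fi v *C x=p t" using p(2) by (metis imageE)
   have "cin1 v (p t)=0" unfolding v_def by (rule opr_orth[OF p(1)])
   then have "cin1 (fi x *C v - fi v *C x) v=0" unfolding t by (metis cico complex_cnj_zero)
   then show ?thesis by (simp add: cin_df_l csl)
  qed
  then have "fi x = cin1 x (cnj (fi v / cin1 v v) *C v)" for x
   using v0 by (simp add: cin_sC_r cin_eq_0_iff field_simps)
  then show ?thesis unfolding fi_def by blast
 qed (auto intro: exI[of _ 0])
 then obtain G where G: "!!x y. cin1 (F x) y = cin1 x (G y)" by metis
 have ext: "a=b" if "!!x. cin1 x a = cin1 x b" for a b :: 'a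
  using that[of "a - b"] cin_eq_0_iff[of "a - b"] by (simp add: cin_df_r)
 have le: "norm (G y)<=norm y * norm F" for y
 proof -
  have "(norm (G y))\<^sup>2=inner (F (G y)) y" by (simp add: power2_norm_eq_inner inner_cin G)
  also have "... <= norm (F (G y)) * norm y" by (rule norm_cauchy_schwarz)
  also have "... <= (norm F * norm (G y)) * norm y" by (intro mrm norm_blinfun) simp
  finally show ?thesis by (cases "G y=0") (simp_all add: pes mult_ac)
 qed
 have c: "G (c *C y) = c *C G y" for c y by (rule ext) (simp add: cin_sC_r flip: G)
 have "bounded_linear G"
 proof (rule bounded_linear_intro[OF _ _ le])
  show "G (r *R y)=r *R G y" for r y using c[of "of_real r" y] by (simp only: sor)
  show "G (y+z)=G y+G z" for y z by (rule ext) (simp add: cin_add_r flip: G)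
 qed
 then have B: "bapp (Blinfun G)=G" by (simp add: bounded_linear_Blinfun_apply)
 have "adj F=Blinfun G"
  unfolding adj_def
 proof (rule the_equality)
  fix G' assume "ALL x y. cin1 (F x) y = cin1 x (bapp G' y)"
  then show "G'=Blinfun G" using G by (intro bleq ext) (simp add: B)
 qed (simp add: G B)
 then have a: "bapp (adj F)=G" using B by simp
 show "cin1 (F x) y = cin1 x (adj F y)" by (simp add: a G)
 then show "cin1 (adj F x) y = cin1 x (F y)" by (metis a G cico)
 show "clin1 (adj F)" using c by (simp add: cld a)
 show "norm (adj F)<=norm F" by (rule norm_blinfun_bound) (use le in "simp_all add: a muco")
 show "adj F=G'" if "!!x y. cin1 (F x) y = cin1 x (bapp G' y)" for G'
  by (intro bleq ext) (simp add: a that flip: G)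
qed

text \<open>Lax-Milgram by Banach's fixed point theorem: with \<open>c = de / M^2\<close> the map v
  - c (S v - y) contracts by the factor r, and its fixed point solves the equation.\<close>

lemma coercive_surj:
 fixes S :: "'h::complex_hilbert op"
 assumes de: "de > 0" "!!v. de * (norm v)\<^sup>2<=inner (S v) v"
 shows "EX v. S v=y"
proof -
 \<comment> \<open>M dominates both \<open>norm S\<close> and \<open>de\<close>; the latter keeps
   the expression under the root in r nonnegative.\<close>
 define M where "M=norm S+de"
 define c where "c=de / M\<^sup>2"
 have M: "M > 0" "norm S<=M" "de<=M" using de(1) by (auto simp: M_def add_nonneg_pos)
 define r where "r=sqrt (1 - de\<^sup>2 / M\<^sup>2)"
 have r2: "0<=1 - de\<^sup>2 / M\<^sup>2" "1 - de\<^sup>2 / M\<^sup>2 < 1" using M de(1) by (auto simp: power_mono)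
 have con: "norm (v - c *R S v)<=r * norm v" for v
 proof -
  have "norm (S v)<=M * norm v" using norm_blinfun[of S v] M(2) by (meson mrm norm_ge_zero order_trans)
  then have "(norm (S v))\<^sup>2<=M\<^sup>2*(norm v)\<^sup>2" by (metis norm_ge_zero power_mono pmd)
  then have "c\<^sup>2*(norm (S v))\<^sup>2 <= c * de * (norm v)\<^sup>2"
   using mult_left_mono[of "(norm (S v))\<^sup>2" "M\<^sup>2*(norm v)\<^sup>2" "c\<^sup>2"] M by (simp add: c_def pes field_simps)
  moreover have "2 * c * (de * (norm v)\<^sup>2)<=2 * c * inner (S v) v"
   using de M by (intro mult_left_mono) (auto simp: c_def)
  ultimately have "(norm (v - c *R S v))\<^sup>2<=(1 - c * de)*(norm v)\<^sup>2"
   unfolding norm_df_sq by (simp add: alsi)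
  also have "... = (r * norm v)\<^sup>2" using r2 by (simp add: pmd r_def c_def pes)
  finally show ?thesis by (rule power2_le_imp_le) (use r2 in "simp add: r_def")
 qed
 have "EX! v:UNIV. v - c *R (S v - y)=v"
 proof (rule Banach_fix[of UNIV r])
  show "dist (v - c *R (S v - y)) (w - c *R (S w - y))<=r * dist v w" for v w
   using con[of "v - w"] by (simp add: dist_norm bdr alsi)
  show "0<=r" "r < 1" using r2 de(1) M by (auto simp: r_def real_sqrt_lt_1_iff)
 qed (auto simp: complete_UNIV)
 then obtain v where "c *R (S v - y)=0" by auto
 then show ?thesis using de(1) M by (auto simp: c_def)
qed

lemma opr_norm: "opr p==>norm (p x)<=norm x" "opr p==>norm (x - p x)<=norm x"
 using pyth(2,3)[OF opr_orth, of p x x] by simp_all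

text \<open>S is a finite net for the relatively compact image of the unit ball; a projection fixing
  S moves a point of that image by at most its distance to S.\<close>

lemma cpt_ops_approx:
 assumes K: "K:coop" and ep: "ep > 0"
 obtains S where "finite S" "!!p x. opr p==>(!!s. s:S==>p s=s)==>norm (K x - p (K x))<=ep * norm x"
proof -
 have "compact (closure (bapp K ` cball 0 1))" using K by (simp add: compact_ops_def)
 then obtain S where S: "finite S" "closure (bapp K ` cball 0 1) \<subseteq> (\<Union>s\<in>S. ball s ep)"
  by (rule compactE_image[of _ _ "%s. ball s ep"]) (use ep in auto)
 have "norm (K x - p (K x))<=ep * norm x" if p: "opr p" "!!s. s:S==>p s=s" for p x
 proof (cases "x=0")
  case False
  let ?u = "(1 / norm x) *R x"
  have "?u:cball 0 1" using False by simp
  then have "K ?u:(\<Union>s\<in>S. ball s ep)" using S(2) closure_subset by (metis image_eqI subset_iff)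
  then obtain s where s: "s:S" "norm (K ?u - s) < ep" by (auto simp: dist_norm norm_minus_commute)
  have "norm (K ?u - p (K ?u))=norm ((K ?u - s) - p (K ?u - s))" using p(2)[OF s(1)] by (simp add: bdr)
  also have "... <= ep" using opr_norm(2)[OF p(1)] s(2) by (meson less_imp_le order_trans)
  finally have "norm ((1 / norm x) *R (K x - p (K x)))<=ep" by (simp only: blinfun.scaleR_right scaleR_diff_right)
  then show ?thesis using False by (simp add: pos_divide_le_eq)
 qed simp
 with S(1) that show ?thesis by blast
qed

definition fib :: "('h::complex_hilbert op)=>nat=>(nat=>'h)=>'h set" where
 "fib F n e={u. fproj n e (F u)=F u}"

definition pr :: "('h::complex_hilbert op)=>nat=>(nat=>'h)=>'h op" where
 "pr F n e=(SOME p. opr p&range (bapp p) = fib F n e)"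

text \<open>A quantitative form of \<open>range F + W = UNIV\<close>, for W the range of
  \<open>fproj n e\<close>: the adjoint is bounded below on the complement of W. In this form the
  condition visibly survives perturbations (\<open>low_near\<close>); \<open>surj_low\<close> and
  \<open>low_surj\<close> relate the two.\<close>

definition low :: "('h::complex_hilbert op)=>nat=>(nat=>'h)=>real=>bool" where
 "low F n e de<->de > 0&(ALL v. fproj n e v=0-->de * (norm v)\<^sup>2<=(norm (adj F v))\<^sup>2)"

lemma pr:
 assumes F: "clin1 F"
 shows "opr (pr F n e)" "range (pr F n e) = fib F n e"
proof -
 have "closed (fib F n e)" unfolding fib_def by (intro closed_Collect_eq continuous_intros)
 moreover have "complex_subspace (fib F n e)"
  by (simp add: fib_def csd subspace_def bbs clinD[OF F] clinD[OF fproj_linear(1)])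
 ultimately have "EX p. opr p&range (bapp p) = fib F n e" using proj_ex by metis
 then have "opr (pr F n e)&range (pr F n e) = fib F n e" unfolding pr_def by (rule someI_ex)
 then show "opr (pr F n e)" "range (pr F n e) = fib F n e" by auto
qed

lemma opr_rg: "opr p==>p x=x<->x:range p"
 by (metis opr_idem rangeE rangeI)

lemma opr_uq:
 assumes "opr p" "opr q" "range (bapp p)=range (bapp q)"
 shows "p=q"
proof (rule bleq)
 fix x
 have 1: "q (p y)=p y" "p (q y)=q y" for y using assms opr_rg by (metis rangeI)+
 have "cin1 (p x - q x) z=0" for z
  using opr_cin[OF assms(1)] opr_cin[OF assms(2)] 1 by (metis cin_df_l right_minus_eq)
 from this[of "p x - q x"] show "p x=q x" by (simp add: cin_eq_0_iff)
qed

text \<open>This is \<open>adj F (1 - P) F\<close> with P the projection \<open>fproj n e\<close>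
  (see \<open>Dop_ap\<close>), and its kernel is \<open>fib F n e\<close>. In the expanded form it
  is norm continuous as soon as \<open>adj F oL F\<close> is norm continuous and
  \<open>adj F\<close> strongly continuous.\<close>

definition Dop :: "('h::complex_hilbert op)=>nat=>(nat=>'h)=>'h op" where
 "Dop F n e=(adj F oL F) - (\<Sum>i<n. tens (adj F (e i)) (adj F (e i)))"

lemma Dop_ap: "clin1 F==>Dop F n e v=adj F (F v - fproj n e (F v))"
 by (simp add: Dop_def fproj_def bsl bbs cin_adj(1) clinD[OF cin_adj(3)])

lemma cin_Dop:
 assumes "clin1 F" "onf n e"
 shows "cin1 (Dop F n e v) v = of_real ((norm (F v - fproj n e (F v)))\<^sup>2)"
proof -
 let ?y = "F v - fproj n e (F v)"
 have "cin1 ?y ?y = cin1 ?y (F v)"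
  by (simp only: cin_df_r[of ?y] opr_orth[OF fproj(1)[OF assms(2)]] diff_zero)
 then show ?thesis by (simp only: Dop_ap[OF assms(1)] cin_adj(2)[OF assms(1)]) (simp add: cin_self)
qed

text \<open>\<open>coercive_surj\<close> for S = (1 - P) F (adj F) (1 - P) + P: the last summand
  makes S coercive on the whole space, and applying P to the equation shows that P w = 0.\<close>

lemma coercive_low:
 assumes F: "clin1 F" and e: "onf n e" and lo: "low F n e de"
 obtains w where "fproj n e w=0" "F (adj F w) - fproj n e (F (adj F w))=y - fproj n e y"
proof -
 let ?P = "fproj n e"
 note P = fproj(1)[OF e]
 define S where "S=((idb - ?P) oL F oL adj F oL (idb - ?P))+?P"
 have S: "S v=F (adj F (v - ?P v)) - ?P (F (adj F (v - ?P v)))+?P v" for v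
  by (simp add: S_def bbs)
 have "min de 1*(norm v)\<^sup>2<=inner (S v) v" for v
 proof -
  have n: "(norm v)\<^sup>2=(norm (v - ?P v))\<^sup>2+(norm (?P v))\<^sup>2"
   using pyth(1)[OF opr_orth[OF P], of v v] by simp
  have "cin1 (S v) v = cin1 (adj F (v - ?P v)) (adj F (v - ?P v)) + cin1 (?P v) (?P v)"
  proof -
   let ?A = "F (adj F (v - ?P v))"
   have "cin1 (?A - ?P ?A) v = cin1 ?A (v - ?P v)"
    by (simp only: cin_df_l cin_df_r opr_cin[OF P])
   moreover have "cin1 (?P v) v = cin1 (?P v) (?P v)"
    by (simp only: opr_cin[OF P] opr_idem[OF P])
   ultimately show ?thesis by (simp only: S cal cin_adj(1)[OF F])
  qed
  then have "inner (S v) v=(norm (adj F (v - ?P v)))\<^sup>2+(norm (?P v))\<^sup>2"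
   by (simp add: inner_cin cin_self)
  moreover have "de * (norm (v - ?P v))\<^sup>2<=(norm (adj F (v - ?P v)))\<^sup>2"
  proof -
   have "?P (v - ?P v)=0" using opr_idem[OF P] by (simp add: bdr)
   then show ?thesis using lo unfolding low_def by blast
  qed
  moreover have "min de 1*(norm (v - ?P v))\<^sup>2<=de * (norm (v - ?P v))\<^sup>2" "min de 1*(norm (?P v))\<^sup>2<=1*(norm (?P v))\<^sup>2"
   by (intro mrm; simp)+
  ultimately show ?thesis by (simp add: n distrib_left)
 qed
 with coercive_surj[of "min de 1" S "y - ?P y"] lo obtain w where w: "S w=y - ?P y" by (auto simp: low_def)
 have "?P (S w)=?P w" using opr_idem[OF P] by (simp add: S bbs)
 then have "?P w=0" using opr_idem[OF P] by (simp add: w bdr)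
 with w that show ?thesis by (simp add: S)
qed

text \<open>The spectral gap of \<open>Dop\<close> above its kernel. A vector v orthogonal to the
  kernel has the form \<open>adj F w\<close> with P w = 0, which converts the lower bound for the
  adjoint into one for (1 - P) F v.\<close>

lemma gap:
 assumes F: "clin1 F" and e: "onf n e" and lo: "low F n e de" and v: "pr F n e v=0"
 shows "de * norm v<=norm (Dop F n e v)"
proof -
 let ?P = "fproj n e"
 note P = fproj(1)[OF e] and p = pr[OF F, of n e]
 obtain w where w: "?P w=0" "F (adj F w) - ?P (F (adj F w))=F v - ?P (F v)"
  using coercive_low[OF F e lo] by metis
 have Qw: "cin1 (x - ?P x) w = cin1 x w" for x using opr_cin[OF P, of x w] w(1) by (simp add: cin_df_l)
 define u where "u=v - adj F w"
 have u: "?P (F u)=F u" using w(2) by (simp add: u_def bdr alsi)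
 then have "pr F n e u=u" using opr_rg[OF p(1)] p(2) by (auto simp: fib_def)
 then have "cin1 v u=0" using opr_cin[OF p(1), of v u] v by simp
 moreover have "cin1 (adj F w) u=0" using opr_cin[OF P, of w "F u"] w(1) u by (simp add: cin_adj(1,2)[OF F])
 ultimately have "cin1 u u=0" by (simp add: u_def cin_df_l)
 then have vw: "v=adj F w" by (simp add: cin_eq_0_iff u_def)
 define y where "y=F v - ?P (F v)"
 have "(norm v)\<^sup>2=inner y w"
  using Qw[of "F v"] by (simp add: power2_norm_eq_inner inner_cin y_def) (simp add: vw cin_adj(1,2)[OF F])
 also have "... <= norm y * norm w" by (rule norm_cauchy_schwarz)
 finally have 1: "(norm v)\<^sup>2<=norm y * norm w" .
 have d: "de > 0" "de * (norm w)\<^sup>2<=(norm v)\<^sup>2" using lo w(1) by (auto simp: low_def vw)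
 have "((norm v)\<^sup>2)\<^sup>2 * de<=(norm y)\<^sup>2*(de * (norm w)\<^sup>2)"
  using power_mono[OF 1, of 2] d(1) by (simp add: pmd mult_ac)
 also have "... <= (norm y)\<^sup>2*(norm v)\<^sup>2" by (intro mult_left_mono d) simp
 finally have "de * (norm v)\<^sup>2<=(norm y)\<^sup>2" by (cases "v=0") (simp_all add: pes mult_ac)
 also have "(norm y)\<^sup>2=inner (Dop F n e v) v" by (simp add: inner_cin cin_Dop[OF F e] y_def)
 also have "... <= norm (Dop F n e v) * norm v" by (rule norm_cauchy_schwarz)
 finally show ?thesis by (cases "v=0") (simp_all add: pes mult_ac)
qed

text \<open>The gap bounds the part of one kernel orthogonal to the other. One such bound is used
  directly; self-adjointness turns the other into a bound for z, and the difference of the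
  projections is composed of the two.\<close>

lemma pr_df:
 assumes F: "clin1 F" "low F n e de" and G: "clin1 G" "low G n e de" and e: "onf n e"
 shows "norm (pr F n e - pr G n e)<=2 / de * norm (Dop F n e - Dop G n e)"
proof -
 have "de > 0" using F(2) by (simp add: low_def)
 define et where "et=norm (Dop F n e - Dop G n e) / de"
 have D0: "Dop F n e (pr F n e x)=0" if "clin1 F" for F :: "'a op" and x
  using pr(2)[OF that, of n e] Dop_ap[OF that] by (auto simp: fib_def) (metis (mono_tags, lifting) blinfun.zero_right diff_self mem_Collect_eq rangeI)
 have half: "norm (pr G n e x - pr F n e (pr G n e x))<=norm (Dop F n e - Dop G n e) / de * norm (pr G n e x)"
  if F: "clin1 F" "low F n e de" and G: "clin1 G" for F G x
 proof -
  let ?v = "pr G n e x - pr F n e (pr G n e x)"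
  have "pr F n e ?v=0" using opr_idem[OF pr(1)[OF F(1)]] by (simp add: bdr)
  from gap[OF F(1) e F(2) this] have "de * norm ?v<=norm (Dop F n e ?v)" .
  also have "Dop F n e ?v=(Dop F n e - Dop G n e) (pr G n e x)" by (simp add: bbs D0 F(1) G)
  also have "norm ... <= norm (Dop F n e - Dop G n e) * norm (pr G n e x)" by (rule norm_blinfun)
  finally show ?thesis using `de > 0` by (simp add: field_simps)
 qed
 have "norm ((pr F n e - pr G n e) u)<=2 * et * norm u" for u
 proof -
  let ?p = "pr F n e" and ?q = "pr G n e"
  note p = pr(1)[OF F(1), of n e] and q = pr(1)[OF G(1), of n e]
  have 1: "norm (?q u - ?p (?q u))<=et * norm u"
   using half[OF F G(1), of u] opr_norm(1)[OF q, of u] mult_left_mono[of "norm (?q u)" "norm u" et] `de > 0` by (simp add: et_def)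
  define z where "z=?p (u - ?q u)"
  have "(norm z)\<^sup>2=inner (z - ?q z) u"
   using opr_idem[OF p, of "u - ?q u"] opr_cin[OF p, of z "u - ?q u"] opr_cin[OF q, of z u]
   by (simp add: power2_norm_eq_inner inner_cin z_def cin_df_l cin_df_r)
  also have "... <= norm (z - ?q z) * norm u" by (rule norm_cauchy_schwarz)
  also have "... <= et * norm z * norm u"
   using half[OF G F(1), of "u - ?q u"] by (intro mrm) (simp_all add: z_def et_def norm_minus_commute)
  finally have "norm z * norm z<=norm z * (et * norm u)" by (simp add: pes mult_ac)
  moreover have "et >= 0" using `de > 0` by (simp add: et_def)
  ultimately have 2: "norm z<=et * norm u"
by (cases "z=0") auto
  have "(?p - ?q) u=z - (?q u - ?p (?q u))" by (simp add: z_def bbs)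
  then show ?thesis using norm_triangle_ineq4[of z "?q u - ?p (?q u)"] 1 2 by simp
 qed
 then show ?thesis using norm_blinfun_bound[of "2 * et" "pr F n e - pr G n e"] `de > 0` by (simp add: et_def)
qed

text \<open>For u in the fibre, \<open>adj F (F u)\<close> lies in the span of the vectors
  \<open>adj F (e i)\<close>, and u differs from it by a compact operator applied to u. So a
  projection adapted to these vectors and to a net for the compact operator is injective on the
  fibre.\<close>

lemma fib_fin:
 assumes F: "clin1 F" and b: "(adj F oL F) - idb:coop"
 shows "fdim (fib F n e)"
proof -
 let ?b = "(adj F oL F) - idb"
 obtain S where S: "finite S" "!!p x. opr p==>(!!s. s:S==>p s=s)==>norm (?b x - p (?b x))<=1/2 * norm x"
  by (rule cpt_ops_approx[OF b, of "1/2"]) auto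
 have "finite (S Un (%i. adj F (e i)) ` {..<n})" using S(1) by simp
 then obtain m g where g: "onf m g" "!!v. v:S Un (%i. adj F (e i)) ` {..<n}==>fproj m g v=v" using onf_fin_set[of "S Un (%i. adj F (e i)) ` {..<n}"] by metis
 let ?P = "fproj m g"
 note P = fproj(1)[OF g(1)]
 have inj: "u=0" if u: "u:fib F n e" "?P u=0" for u
 proof -
  define a where "a=adj F (fproj n e (F u))"
  have "a=(\<Sum>i<n. cin1 (F u) (e i) *C adj F (e i))"
   by (simp add: a_def fproj_def bsl blinfun.sum_right clinD[OF cin_adj(3)[OF F]])
  then have "?P a=a" using g(2) by (simp add: blinfun.sum_right clinD[OF fproj_linear(1)])
  moreover have bu: "?b u=a - u" using u(1) by (simp add: a_def fib_def bdl1)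
  ultimately have "norm u<=1/2 * norm u" using S(2)[OF P, of u] g(2) u(2) by (simp add: bu bdr)
  then show ?thesis by simp
 qed
 have sub: "subspace (fib F n e)" by (simp add: fib_def subspace_def bbs)
 obtain T where T: "finite T" "range ?P \<subseteq> span T" using fproj_fin[of m g] by (auto simp: finite_dimensional_def)
 obtain B where B: "B \<subseteq> fib F n e" "independent B" "fib F n e \<subseteq> span B" by (rule basis_exists) auto
 have injP: "inj_on ?P (span B)"
 proof (rule inj_onI)
  fix x y assume "x:span B" "y:span B" "?P x=?P y"
  then have "x - y:fib F n e" "?P (x - y)=0"
   using span_minimal[OF B(1) sub] subspace_diff[OF sub] by (auto simp: bdr)
  then show "x=y" using inj by fastforce
 qed
 have lin: "linear ?P" by (rule bounded_linear.linear[OF bblr])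
 have "independent (?P ` B)" by (rule linear_independent_injective_image[OF lin B(2) injP])
 then have "finite (?P ` B)" using independent_span_bound[OF T(1)] T(2) by (metis image_subset_iff rangeI subsetD subsetI)
 then have "finite B" using inj_on_subset[OF injP span_superset] finite_imageD by blast
 then show ?thesis using B(3) by (auto simp: finite_dimensional_def)
qed

section \<open>Index bundles of Fredholm families\<close>

text \<open>The continuity that Atiyah-Singer loops of maps to \<open>Fred_tilde\<close> retain:
  strong for the operators and their adjoints, in norm for the compact parts. It makes
  \<open>Dop\<close> norm continuous.\<close>

definition fam :: "'x topology=>('x=>'h::complex_hilbert op)=>bool" where
 "fam X f<->(ALL x:tsp1 X. clin1 (f x) &
   (f x oL adj (f x)) - idb:coop&(adj (f x) oL f x) - idb:coop) &
  (ALL v. cmap X eucl1 (%x. f x v)&cmap X eucl1 (%x. adj (f x) v)) &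
  cmap X eucl1 (%x. (f x oL adj (f x)) - idb) &
  cmap X eucl1 (%x. (adj (f x) oL f x) - idb)"

lemma fam_pull:
 assumes f: "fam X f" and g: "cmap X' X g"
 shows "fam X' (%x. f (g x))"
proof -
 have c: "cmap X' Z (%x. h (g x))" if "cmap X Z h" for h and Z :: "'z topology"
  using cmc[OF g that] by (simp add: o_def)
 have m: "g x:tsp1 X" if "x:tsp1 X'" for x using g that by (auto simp: cmd)
 show ?thesis
  unfolding fam_def
 proof (intro conjI allI ballI)
  show "cmap X' eucl1 (%x. f (g x) v)" "cmap X' eucl1 (%x. adj (f (g x)) v)" for v
   by (rule c[of euclidean "%x. f x v"] c[of euclidean "%x. adj (f x) v"]; use f in "simp add: fam_def")+
  show "cmap X' eucl1 (%x. (f (g x) oL adj (f (g x))) - idb)"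
   by (rule c) (use f in "simp add: fam_def")
  show "cmap X' eucl1 (%x. (adj (f (g x)) oL f (g x)) - idb)"
   by (rule c) (use f in "simp add: fam_def")
 qed (use f m in "auto simp: fam_def")
qed

lemma cm_metricI:
 assumes "!!x ep. x:tsp1 X==>ep > 0==>EX U. openin X U&x:U&(ALL y:U. dist (h y) (h x) < ep)"
 shows "cmap X eucl1 (h :: 'a=>'b::metric_space)"
 unfolding cmd
proof (intro conjI allI impI)
 fix S :: "'b set" assume "openin eucl1 S"
 then have S: "open S" by simp
 show "openin X {x:tsp1 X. h x:S}"
 proof (subst openin_subopen, intro ballI)
  fix x assume x: "x:{x:tsp1 X. h x:S}"
  then obtain ep where ep: "ep > 0" "ALL z. dist z (h x) < ep-->z:S" using S by (auto simp: open_dist)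
  have "x:tsp1 X" using x by simp
  from assms[OF this ep(1)] obtain U where U: "openin X U" "x:U" "ALL y:U. dist (h y) (h x) < ep" by metis
  have "U \<subseteq> {x:tsp1 X. h x:S}" using ep(2) openin_subset[OF U(1)] U(3) by auto
  with U show "EX T. openin X T&x:T&T \<subseteq> {x:tsp1 X. h x:S}" by metis
 qed
qed simp

lemma cm_metricD:
 fixes h :: "'a=>'b::metric_space"
 assumes "cmap X eucl1 h"
 shows "openin X {y:tsp1 X. dist (h y) z < ep}"
 using ocmp[OF assms, of "ball z ep"] by (simp add: dist_commute)

lemma norm_adj_sq:
 assumes "clin1 F"
 shows "(norm (adj F v))\<^sup>2=(norm v)\<^sup>2+inner (((F oL adj F) - idb) v) v"
proof -
 have "cin1 (adj F v) (adj F v) = cin1 (F (adj F v)) v" by (simp only: cin_adj(1)[OF assms])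
 then show ?thesis by (simp add: power2_norm_eq_inner bdl1 inner_diff_left) (simp add: inner_cin)
qed

lemma inner_op_bound: "\<bar>inner (T v) v\<bar><=norm T * (norm v)\<^sup>2" for T :: "'h::real_inner \<Rightarrow>\<^sub>L 'h"
 using Cauchy_Schwarz_ineq2[of "T v" v] mrm[OF norm_blinfun[of T v], of "norm v"]
 by (simp add: pes mult_ac)

text \<open>By \<open>norm_adj_sq\<close> the norm of the adjoint on a vector is governed by the
  compact part of \<open>F oL adj F\<close>, which is norm continuous in families.\<close>

lemma low_near:
 assumes "low F n e de" "clin1 F" "clin1 G"
  and "norm (((G oL adj G) - idb) - ((F oL adj F) - idb))<=de / 2"
 shows "low G n e (de / 2)"
 unfolding low_def
proof (intro conjI allI impI)
 fix v assume v: "fproj n e v=0"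
 let ?A = "((G oL adj G) - idb) - ((F oL adj F) - idb)"
 have "\<bar>inner (?A v) v\<bar><=de / 2*(norm v)\<^sup>2"
  using inner_op_bound[of ?A v] assms(4) by (meson mrm order_trans zero_le_power2)
 moreover have "(norm (adj G v))\<^sup>2=(norm (adj F v))\<^sup>2+inner (?A v) v"
  unfolding norm_adj_sq[OF assms(2)] norm_adj_sq[OF assms(3)] by (simp add: bdl1 inner_diff_left)
 moreover have "de * (norm v)\<^sup>2<=(norm (adj F v))\<^sup>2" using assms(1) v by (auto simp: low_def)
 ultimately show "de / 2*(norm v)\<^sup>2<=(norm (adj G v))\<^sup>2" by (simp add: abs_le_iff)
qed (use assms(1) in "simp add: low_def")

lemma low_mono:
 assumes "low F n e de" "onf n e" "onf m g" "!!i. i < n==>fproj m g (e i)=e i"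
 shows "low F m g de"
proof -
 have "fproj n e v=0" if "fproj m g v=0" for v
 proof -
  have "cin1 v (e i)=0" if "i < n" for i
   using opr_cin[OF fproj(1)[OF assms(3)], of v "e i"] assms(4)[OF that] `fproj m g v=0` by simp
  then show ?thesis by (simp add: fproj_def bsl)
 qed
 then show ?thesis using assms(1) by (auto simp: low_def)
qed

definition adm :: "'x topology=>('x=>'h::complex_hilbert op)=>nat=>(nat=>'h)=>bool" where
 "adm X f n e<->onf n e&(ALL x:tsp1 X. EX de. low (f x) n e de)"

text \<open>At one point, a net for the compact part gives a W with lower bound 1/2, and the bound
  1/4 persists nearby. By compactness finitely many such W suffice, and they are contained in
  one.\<close>

lemma adm_ex:
 assumes X: "cspc X" and f: "fam X f"
 obtains n e where "adm X f n e"
proof -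
 let ?a = "%x. (f x oL adj (f x)) - idb"
 have "EX U m g. openin X U&x:U&onf m g&(ALL y:U. low (f y) m g (1/4))" if x: "x:tsp1 X" for x
 proof -
  have cl: "clin1 (f y)" "?a y:coop" if "y:tsp1 X" for y using f that by (auto simp: fam_def)
  obtain S where S: "finite S" "!!p v. opr p==>(!!s. s:S==>p s=s)==>norm (?a x v - p (?a x v))<=1/2 * norm v"
   by (rule cpt_ops_approx[OF cl(2)[OF x], of "1/2"]) auto
  obtain m g where g: "onf m g" "!!v. v:S==>fproj m g v=v" using onf_fin_set[OF S(1)] by metis
  note P = fproj(1)[OF g(1)]
  have "low (f x) m g (1/2)"
   unfolding low_def
  proof (intro conjI allI impI)
   fix v assume v: "fproj m g v=0"
   let ?w = "?a x v - fproj m g (?a x v)"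
   have "inner (?a x v) v=inner ?w v"
    using opr_cin[OF P, of "?a x v" v] v by (simp add: inner_cin cin_df_l)
   moreover have "norm ?w * norm v<=1/2 * norm v * norm v" by (intro mrm S(2)[OF P g(2)]) auto
   ultimately have "\<bar>inner (?a x v) v\<bar><=1/2*(norm v)\<^sup>2"
    using Cauchy_Schwarz_ineq2[of ?w v] by (simp add: pes)
   then show "1/2*(norm v)\<^sup>2<=(norm (adj (f x) v))\<^sup>2" unfolding norm_adj_sq[OF cl(1)[OF x]] by (simp add: abs_le_iff)
  qed simp
  then have "low (f y) m g (1/4)" if "y:tsp1 X" "dist (?a y) (?a x) < 1/4" for y
   using low_near[of "f x" m g "1/2" "f y"] cl that x by (simp add: dist_norm)
  then show ?thesis
   using cm_metricD[of X ?a "?a x" "1/4"] f x g(1) unfolding fam_def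
   by (intro exI[of _ "{y:tsp1 X. dist (?a y) (?a x) < 1/4}"] exI[of _ m] exI[of _ g]) auto
 qed
 then obtain U m g where U: "!!x. x:tsp1 X==>openin X (U x)&x:U x&onf (m x) (g x)&(ALL y:U x. low (f y) (m x) (g x) (1/4))"
  by metis
 have "(ALL V:U ` tsp1 X. openin X V)&tsp1 X \<subseteq> \<Union>(U ` tsp1 X)" using U by blast
 then obtain FF where "finite FF" "FF \<subseteq> U ` tsp1 X" "tsp1 X \<subseteq> \<Union>FF"
  using X unfolding compact_space_alt by metis
 then obtain I where I: "finite I" "I \<subseteq> tsp1 X" "tsp1 X \<subseteq> (\<Union>x\<in>I. U x)" by (metis finite_subset_image)
 have "finite (\<Union>x\<in>I. g x ` {..<m x})" using I by auto
 then obtain n e where e: "onf n e" "!!v. v:(\<Union>x\<in>I. g x ` {..<m x})==>fproj n e v=v" using onf_fin_set by metis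
 have "EX de. low (f y) n e de" if y: "y:tsp1 X" for y
 proof -
  obtain x where x: "x:I" "y:U x" using I y by auto
  then have "low (f y) (m x) (g x) (1/4)" "onf (m x) (g x)" using U I by auto
  then have "low (f y) n e (1/4)" by (rule low_mono[OF _ _ e(1)]) (use e(2) x in auto)
  then show ?thesis ..
 qed
 then have "adm X f n e" using e(1) by (simp add: adm_def)
 then show ?thesis by (rule that)
qed

text \<open>Near a point all operators share the lower bound \<open>de / 2\<close>, so
  \<open>pr_df\<close> controls the projections by the norm continuous \<open>Dop\<close>.\<close>

lemma pr_vb:
 assumes f: "fam X f" and a: "adm X f n e"
 shows "vbundle X (%x. pr (f x) n e)"
proof -
 have cl: "clin1 (f x)" "(adj (f x) oL f x) - idb:coop" if "x:tsp1 X" for x using f that by (auto simp: fam_def)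
 have e: "onf n e" using a by (simp add: adm_def)
 let ?a = "%x. (f x oL adj (f x)) - idb"
 have "cmap X eucl1 (%x. ((adj (f x) oL f x) - idb)+idb - (\<Sum>i<n. tens (adj (f x) (e i)) (adj (f x) (e i))))"
  by (rule cm_df[OF cm_add[OF _ cm_cst] cm_sum[OF cm_tens]]) (use f in "auto simp: fam_def")
 then have cD: "cmap X eucl1 (%x. Dop (f x) n e)" by (simp add: Dop_def)
 have "cmap X eucl1 (%x. pr (f x) n e)"
 proof (rule cm_metricI)
  fix x and ep :: real assume x: "x:tsp1 X" and ep: "ep > 0"
  obtain de where de: "low (f x) n e de" using a x by (auto simp: adm_def)
  then have d0: "de > 0" by (simp add: low_def)
  define U where "U={y:tsp1 X. dist (?a y) (?a x) < de / 2} Int {y:tsp1 X. dist (Dop (f y) n e) (Dop (f x) n e) < ep * de / 4}"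
  have "openin X U" unfolding U_def using f by (intro openin_Int cm_metricD cD) (auto simp: fam_def)
  moreover have "x:U" using x ep d0 by (simp add: U_def)
  moreover have "dist (pr (f y) n e) (pr (f x) n e) < ep" if y: "y:U" for y
  proof -
   have yX: "y:tsp1 X" and ya: "norm (?a y - ?a x) < de / 2" and yD: "norm (Dop (f y) n e - Dop (f x) n e) < ep * de / 4"
    using y unfolding U_def dist_norm by blast+
   have lo: "low (f x) n e (de / 2)" by (rule low_near[OF de]) (use cl x d0 in auto)
   have "low (f y) n e (de / 2)"
    by (rule low_near[OF de cl(1)[OF x] cl(1)[OF yX]]) (use ya in simp)
   from pr_df[OF cl(1)[OF yX] this cl(1)[OF x] lo e] have "norm (pr (f y) n e - pr (f x) n e)<=2 / (de / 2) * norm (Dop (f y) n e - Dop (f x) n e)" .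
   also have "... < 2 / (de / 2)*(ep * de / 4)" using yD d0 by (intro mult_strict_left_mono) auto
   also have "... = ep" using d0 by simp
   finally show ?thesis by (simp add: dist_norm)
  qed
  ultimately show "EX U. openin X U&x:U&(ALL y:U. dist (pr (f y) n e) (pr (f x) n e) < ep)" by blast
 qed
 then show ?thesis unfolding vbundle_def using pr[OF cl(1), of _ n e] fib_fin[OF cl, of _ n e] by auto
qed

lemma rank_ex:
 assumes X: "connected_space X" and p: "vbundle X p"
 obtains r where "rank X p r"
proof (cases "tsp1 X={}")
 case False
 then obtain x0 where x0: "x0:tsp1 X" by blast
 let ?d = "%x. dim (range (bapp (p x)))"
 have loc: "EX U m. openin X U&x:U&(ALL y:U. ?d y=2 * m)" if x: "x:tsp1 X" for x
 proof (rule bdl_local_frame[OF p x])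
  fix m U e assume U: "openin X U" "x:U" "frame (sbt1 X U) m e" "!!y. y:U==>p y = fp m e y"
  have "?d y=2 * m" if "y:U" for y
   using frame_dim(1)[OF U(3), of y] U(4)[OF that] that openin_subset[OF U(1)] by auto
  then show ?thesis using U by blast
 qed
 define S where "S={x:tsp1 X. ?d x=?d x0}"
 have op: "openin X {x:tsp1 X. Q (?d x)}" for Q
 proof (subst openin_subopen, intro ballI)
  fix x assume x: "x:{x:tsp1 X. Q (?d x)}"
  then obtain U m where U: "openin X U" "x:U" "ALL y:U. ?d y=2 * m" using loc[of x] by auto
  then have "U \<subseteq> {x:tsp1 X. Q (?d x)}" using x openin_subset[OF U(1)] by auto
  with U show "EX T. openin X T&x:T&T \<subseteq> {x:tsp1 X. Q (?d x)}" by metis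
 qed
 have "openin X S" unfolding S_def by (rule op)
 moreover have "tsp1 X - S={x:tsp1 X. ?d x~=?d x0}" by (auto simp: S_def)
 then have "openin X (tsp1 X - S)" using op[of "%d. d~=?d x0"] by simp
 then have "closedin X S" by (simp add: closedin_def S_def)
 ultimately have "S=tsp1 X" using X x0 unfolding connected_space_clopen_in by (auto simp: S_def)
 moreover obtain m where "?d x0=2 * m" using loc[OF x0] by blast
 ultimately have "rank X p m" using p by (auto simp: rank_def S_def)
 then show ?thesis by (rule that)
qed (use p that in "auto simp: rank_def")

text \<open>Stabilisation by one vector at a time, for a property Q that survives each step. The
  subspace A records that nothing outside it is added, which lets the two chains in
  \<open>chf_uq\<close> end in the same subspace.\<close>

lemma onf_chain:
 assumes S: "finite S" and e: "onf n e" "Q n e" and A: "complex_subspace A" "S \<subseteq> A" "!!i. i < n==>e i:A"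
  and step: "!!n e w. onf n e==>Q n e==>onf (Suc n) (e(n := w))==>fproj n e w=0==>norm w=1==>Q (Suc n) (e(n := w))"
 shows "EX m g. onf m g&Q m g&(ALL v:S Un e ` {..<n}. fproj m g v=v)&(ALL i<m. g i:A)"
proof -
 have ss: "subspace A" "!!c x. x:A==>c *C x:A" using A by (auto simp: csd)
 show ?thesis
  using S A(2)
 proof (induction S)
  case empty
  then show ?case using e A(3) fproj(2)[OF e(1)] by (intro exI[of _ n] exI[of _ e]) auto
 next
  case (insert v S)
  then obtain m g where g: "onf m g" "Q m g" "ALL v:S Un e ` {..<n}. fproj m g v=v" "ALL i<m. g i:A" by blast
  show ?case
  proof (cases "fproj m g v=v")
   case False
   obtain w where w: "onf (Suc m) (g(m := w))" "fproj (Suc m) (g(m := w)) v=v" "fproj m g w=0" "norm w=1"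
    "!!x. fproj (Suc m) (g(m := w)) x = fproj m g x + cin1 x w *C w"
    using onf_ext[OF g(1) False] by metis
   have c0: "cin1 v w~=0" using w(2) False unfolding w(5) by auto
   have "fproj m g v:A" using g(4) by (auto simp: fproj_def bsl intro!: subspace_sum[OF ss(1)] ss(2))
   then have "(1 / cin1 v w) *C (v - fproj m g v):A" using insert.prems by (auto intro!: ss(2) subspace_diff[OF ss(1)])
   moreover have "v - fproj m g v = cin1 v w *C w" using w(2) unfolding w(5) by (simp add: diff_eq_eq add.commute)
   ultimately have "w:A" using c0 by (simp add: scsc)
   have "fproj (Suc m) (g(m := w)) x=x" if "fproj m g x=x" for x
    using opr_cin[OF fproj(1)[OF g(1)], of x w] that w(3) by (simp add: w(5))
   then have "onf (Suc m) (g(m := w))&Q (Suc m) (g(m := w))&(ALL v:insert v S Un e ` {..<n}. fproj (Suc m) (g(m := w)) v=v)&(ALL i<Suc m. (g(m := w)) i:A)"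
    using w(1,2) g step[OF g(1,2) w(1,3,4)] `w:A` by (auto simp: less_Suc_eq)
   then show ?thesis by blast
  qed (use g in blast)
 qed
qed

lemma fin_sbsp_onf:
 assumes W: "complex_subspace W" "fdim W"
 obtains n e where "onf n e" "range (fproj n e)=W"
proof -
 have ss: "subspace W" "!!c x. x:W==>c *C x:W" using W by (auto simp: csd)
 obtain T where T: "finite T" "W \<subseteq> span T" using W(2) by (auto simp: finite_dimensional_def)
 obtain B where B: "B \<subseteq> W" "independent B" "W \<subseteq> span B" by (rule basis_exists) auto
 have "finite B" using independent_span_bound[OF T(1) B(2)] B(1) T(2) by auto
 from onf_chain[OF this, of 0 "%_. 0" "%_ _. True" W] W(1) B(1)
 have "EX n e. onf n e&(ALL v:B. fproj n e v=v)&(ALL i<n. e i:W)" by (simp add: onf_def)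
 then obtain n e where e: "onf n e" "!!v. v:B==>fproj n e v=v" "!!i. i < n==>e i:W" by metis
 have "range (fproj n e) \<subseteq> W"
  using e(3) by (auto simp: fproj_def bsl intro!: subspace_sum[OF ss(1)] ss(2))
 moreover have "span B \<subseteq> range (fproj n e)"
  by (rule span_minimal) (use e(2) in "auto intro: range_eqI[OF sym] linear_subspace_image[OF bounded_linear.linear[OF bblr]]")
 ultimately show ?thesis using that[OF e(1)] B(3) by auto
qed

lemma fproj_dim: "onf n e==>dim (range (fproj n e))=2 * n"
 using frame_dim(1)[OF frame_onf[of n e "discrete_topology {()}"], of "()"] by (simp flip: fproj_fp)

lemma opr_sub:
 assumes p: "opr p" "opr q" "range (bapp p) \<subseteq> range q"
 shows "opr (q - p)" "p (q x)=p x" "q (p x)=p x"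
proof -
 show qp: "q (p x)=p x" for x using p opr_rg[OF p(2)] by blast
 show pq: "p (q x)=p x" for x
 proof -
  have "cin1 (p (q x) - p x) z=0" for z
   by (simp only: cin_df_l opr_cin[OF p(1)] opr_cin[OF p(2)] qp diff_self)
  from this[of "p (q x) - p x"] show ?thesis by (simp add: cin_eq_0_iff)
 qed
 have "(q - p) oL (q - p)=q - p"
  using opr_idem[OF p(1)] opr_idem[OF p(2)] by (intro bleq) (simp add: bbs pq qp)
 then show "opr (q - p)" using p by (simp add: opr_def clin_df sadj_df)
qed

definition chf :: "'x topology=>('x=>'h::complex_hilbert op)=>(nat=>'x tc)=>nat=>(nat=>'h)=>bool" where
 "chf X f c n e<->adm X f n e&(EX r. rank X (%x. pr (f x) n e) r&chern X (%x. pr (f x) n e) r c)"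

text \<open>On the orthogonal complement of the old fibre in the new one, g represents the
  functional sending y to \<open>cin1 (F y) w\<close>. It is not 0 since F hits w modulo W, and its
  kernel is 0 since a vector of the new fibre with no component of F y along w lies in the old
  fibre. So the complement is the line of g.\<close>

lemma pr_ext:
 assumes F: "clin1 F" and lo: "low F n e de" and e: "onf n e" "onf (Suc n) (e(n := w))" "fproj n e w=0" "norm w=1"
 defines "p == pr F n e" and "q == pr F (Suc n) (e(n := w))"
 defines "g == (q - p) (adj F w)"
 shows "g~=0" "p g=0" "q x=p x + cin1 x ((1 / norm g) *R g) *C (1 / norm g) *R g"
proof -
 have P': "fproj (Suc n) (e(n := w)) x = fproj n e x + cin1 x w *C w" for x
  by (simp add: fproj_def bsl blinfun.add_left)
 note P = fproj(1)[OF e(1)]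
 have ww: "cin1 w w=1" using e(4) by (simp add: cin_self)
 have Pw: "cin1 (fproj n e x) w=0" for x using opr_cin[OF P, of x w] e(3) by simp
 have p: "opr p" "range p = fib F n e" and q: "opr q" "range q = fib F (Suc n) (e(n := w))"
  unfolding p_def q_def by (rule pr[OF F])+
 have pf: "p y=y<->fproj n e (F y)=F y" and qf: "q y=y<->fproj (Suc n) (e(n := w)) (F y)=F y" for y
  using opr_rg[OF p(1)] opr_rg[OF q(1)] p(2) q(2) by (auto simp: fib_def)
 have "q (p x)=p x" for x
  using pf[of "p x"] qf[of "p x"] opr_idem[OF p(1)] Pw[of "F (p x)"] by (simp add: P')
 then have "range p \<subseteq> range q" by (metis image_subsetI rangeI)
 note qp = opr_sub[OF p(1) q(1) this]
 have yg: "cin1 y g = cin1 (F ((q - p) y)) w" for y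
  using opr_cin[OF qp(1), of y "adj F w"] by (simp add: g_def cin_adj(1)[OF F])
 obtain z where z: "F (adj F z) - fproj n e (F (adj F z))=w - fproj n e w" using coercive_low[OF F e(1) lo] by metis
 define u where "u=adj F z"
 have Fu: "F u=w + fproj n e (F u)" using z e(3) by (simp add: u_def diff_eq_eq)
 have Fw: "cin1 (F u) w=1" by (subst Fu) (simp add: cal ww Pw)
 then have "q u=u" unfolding qf P' using Fu by (simp add: add.commute)
 moreover have "cin1 (F (p u)) w=0" using pf[of "p u"] opr_idem[OF p(1), of u] Pw[of "F (p u)"] by simp
 ultimately have "cin1 u g=1" using Fw by (simp add: yg bbs cin_df_l)
 then show g0: "g~=0" by auto
 show "p g=0" using opr_idem[OF p(1)] by (simp add: g_def bbs qp)
 have zero: "y=0" if y: "(q - p) y=y" "cin1 y g=0" for y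
 proof -
  have "q y=y" "p y=0"
   using y(1) qp(2,3) opr_idem[OF q(1)] opr_idem[OF p(1)] by (metis bdl1 bdr eq_iff_diff_eq_0)+
  moreover have "cin1 (F y) w=0" using y by (simp add: yg)
  ultimately have "fproj n e (F y)=F y" using qf[of y] by (simp add: P')
  then show ?thesis using pf[of y] `p y=0` by simp
 qed
 let ?y = "(q - p) x - (cin1 x g / cin1 g g) *C g"
 have gg: "(q - p) g=g" "(q - p) ((q - p) x)=(q - p) x" unfolding g_def by (rule opr_idem[OF qp(1)])+
 have "(q - p) ?y=?y"
  using clinD[of "q - p"] qp(1) gg by (simp add: bdr[of "q - p"] opr_def)
 moreover have "cin1 ?y g=0"
  using opr_cin[OF qp(1), of x g] gg(1) g0 by (simp add: cin_df_l csl cin_eq_0_iff)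
 ultimately have "?y=0" by (rule zero)
 then have "q x=p x+(cin1 x g / cin1 g g) *C g" by (simp add: bdl1 diff_eq_eq add.commute)
 moreover have "cin1 x ((1 / norm g) *R g) *C (1 / norm g) *R g=(cin1 x g / cin1 g g) *C g"
  by (simp only: sor[symmetric]) (simp add: cin_sC_r cin_self scsc pes)
 ultimately show "q x=p x + cin1 x ((1 / norm g) *R g) *C (1 / norm g) *R g" by simp
qed

text \<open>Enlarging W by one vector adds the trivial line bundle spanned by the unit vector field
  v to the index bundle, and \<open>chn_stab\<close> says that the Chern cochains stay the
  same.\<close>

lemma chf_step:
 assumes f: "fam X f" and c: "chf X f c n e" and e: "onf n e" "onf (Suc n) (e(n := w))" "fproj n e w=0" "norm w=1"
 shows "chf X f c (Suc n) (e(n := w))"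
proof -
 let ?e = "e(n := w)"
 obtain r where r: "rank X (%x. pr (f x) n e) r" "chern X (%x. pr (f x) n e) r c" and a: "adm X f n e" using c by (auto simp: chf_def)
 have a': "adm X f (Suc n) ?e"
  unfolding adm_def
 proof (intro conjI e(2) ballI)
  fix x assume "x:tsp1 X"
  then obtain de where "low (f x) n e de" using a by (auto simp: adm_def)
  then have "low (f x) (Suc n) ?e de"
   by (rule low_mono[OF _ e(1,2)]) (use fproj(2)[OF e(2)] in "metis fun_upd_other less_SucI less_irrefl")
  then show "EX de. low (f x) (Suc n) ?e de" ..
 qed
 note vb = pr_vb[OF f a] and vb' = pr_vb[OF f a']
 \<comment> \<open>The value 0 off X is there because \<open>add_line\<close> asks for linear
   self-adjoint operators at every argument.\<close>
 define p where "p x=(if x:tsp1 X then pr (f x) n e else 0)" for x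
 define g where "g x=(pr (f x) (Suc n) ?e - pr (f x) n e) (adj (f x) w)" for x
 define v where "v x=(1 / norm (g x)) *R g x" for x
 have ext: "g x~=0" "p x (g x)=0" "pr (f x) (Suc n) ?e y=p x y + cin1 y (v x) *C v x" if x: "x:tsp1 X" for x y
 proof -
  obtain de where "low (f x) n e de" using a x by (auto simp: adm_def)
  from pr_ext[OF _ this e] f x show "g x~=0" "p x (g x)=0" "pr (f x) (Suc n) ?e y=p x y + cin1 y (v x) *C v x"
   by (simp_all add: fam_def g_def p_def v_def)
 qed
 have cg: "cmap X eucl1 g"
  unfolding g_def by (rule cm_ap[OF cm_df]) (use vb vb' f in "auto simp: vbundle_def fam_def")
 interpret L: add_line X p v
 proof unfold_locales
  show "cmap X eucl1 p"
   by (rule continuous_map_eq[of X _ "%x. pr (f x) n e"]) (use vb in "auto simp: vbundle_def p_def")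
  show "cmap X eucl1 v"
  proof -
   have "cmap X eucl1 (%x. (%w. (1 / norm w) *R w) (g x))"
    by (rule cm_comp_on[OF cg, where S = "- {0}"]) (use ext(1) in "auto intro!: continuous_intros")
   then show ?thesis by (simp add: v_def[abs_def])
  qed
  show "clin1 (p y)" "sadj1 (p y)" for y
   using pr(1)[of "f y" n e] f by (auto simp: p_def fam_def opr_def)
  fix y assume y: "y:tsp1 X"
  show "p y oL p y=p y" using pr(1)[of "f y" n e] f y by (auto simp: p_def fam_def opr_def)
  show "cin1 (v y) (v y)=1" using ext(1)[OF y] by (simp add: v_def cin_sR_l cin_sR_r cin_self pes)
  show "p y (v y)=0" using ext(2)[OF y] by (simp add: v_def blinfun.scaleR_right)
 qed
 have p': "L.p' x=pr (f x) (Suc n) ?e" if "x:tsp1 X" for x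
  by (rule bleq) (simp add: L.p'_eq ext(3)[OF that])
 have "chern X L.p' (Suc r) c"
  using L.chn_stab r(2) chn_cong[of X p "%x. pr (f x) n e"] by (simp add: p_def)
 then have "chern X (%x. pr (f x) (Suc n) ?e) (Suc r) c" using chn_cong[of X L.p' "%x. pr (f x) (Suc n) ?e"] p' by simp
 moreover have "dim (range (pr (f x) (Suc n) ?e))=2 * Suc r" if x: "x:tsp1 X" for x
 proof -
  have op: "opr (p x)" "fdim (range (p x))" "dim (range (p x))=2 * r"
   using vb r(1) x by (auto simp: vbundle_def rank_def p_def)
  have "complex_subspace (range (p x))"
   using op(1) unfolding csd opr_def cld
   by (auto intro!: linear_subspace_image[OF bounded_linear.linear[OF bblr]]) (metis rangeI)
  then obtain m h where h: "onf m h" "range (fproj m h)=range (p x)" using fin_sbsp_onf op(2) by metis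
  have ph: "p x = fproj m h" using opr_uq[OF op(1) fproj(1)[OF h(1)]] h(2) by simp
  have m: "m=r" using fproj_dim[OF h(1)] op(3) by (simp add: ph)
  have vh: "cin1 (h i) (v x)=0" if "i < m" for i
   using opr_cin[OF op(1), of "h i" "v x"] fproj(2)[OF h(1) that] L.pw(2)[OF x] by (simp add: ph)
  then have vh': "cin1 (v x) (h i)=0" if "i < m" for i using that by (metis cico complex_cnj_zero)
  have on: "onf (Suc m) (h(m := v x))" using h(1) vh vh' L.pw(1)[OF x] by (auto simp: onf_def less_Suc_eq)
  have "pr (f x) (Suc n) ?e = fproj (Suc m) (h(m := v x))"
   by (rule bleq) (simp add: ext(3)[OF x] ph fproj_def bsl blinfun.add_left)
  then show ?thesis using fproj_dim[OF on] m by (simp only:)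
 qed
 then have "rank X (%x. pr (f x) (Suc n) ?e) (Suc r)" using vb' by (simp add: rank_def)
 ultimately show ?thesis using a' unfolding chf_def by blast
qed

lemma rank_uq: "rank X p r==>rank X p s==>tsp1 X~={}==>r=s"
 unfolding rank_def by force

text \<open>The first chain of stabilisations enlarges the first subspace until it contains the
  second; the second chain enlarges the second one inside the result until both agree. Then
  \<open>chn_uq\<close> applies.\<close>

lemma chf_uq:
 assumes X: "cspc X" and f: "fam X f" and c: "chf X f c n1 e1" "chf X f c' n2 e2"
 shows "coh (Sing X) (c i) (c' i)"
proof (cases "tsp1 X={}")
 case True
 then show ?thesis by (simp add: Sing_trivial coh_def)
next
 case False
 have e: "onf n1 e1" "onf n2 e2" using c by (auto simp: chf_def adm_def)
 have step: "onf n e==>chf X f c n e==>onf (Suc n) (e(n := w))==>fproj n e w=0==>norm w=1==>chf X f c (Suc n) (e(n := w))" for c n e w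
  by (rule chf_step[OF f])
 have U: "complex_subspace (UNIV :: 'b set)" by (simp add: csd)
 have fin: "finite (e2 ` {..<n2})" by simp
 obtain m g where g: "onf m g" "chf X f c m g" "ALL v:e2 ` {..<n2} Un e1 ` {..<n1}. fproj m g v=v"
  using onf_chain[OF fin e(1) c(1) U subset_UNIV UNIV_I step] by blast
 have A: "complex_subspace (range (fproj m g))"
  using fproj_linear(1)[of m g] unfolding csd cld
  by (auto intro!: linear_subspace_image[OF bounded_linear.linear[OF bblr]]) (metis rangeI)
 have e2: "e2 i:range (fproj m g)" if "i < n2" for i using g(3) that by (metis UnI1 imageI lessThan_iff rangeI)
 have gi: "g ` {..<m} \<subseteq> range (fproj m g)" using fproj(2)[OF g(1)] by (metis image_subsetI lessThan_iff rangeI)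
 have fin: "finite (g ` {..<m})" by simp
 obtain m' g' where g': "onf m' g'" "chf X f c' m' g'" "ALL v:g ` {..<m} Un e2 ` {..<n2}. fproj m' g' v=v" "ALL i<m'. g' i:range (fproj m g)"
  using onf_chain[OF fin e(2) c(2) A gi e2 step] by blast
 have "fproj m g (fproj m' g' x) = fproj m' g' x" for x
 proof -
  have "fproj m g (g' i)=g' i" if "i < m'" for i using g'(4) that opr_rg[OF fproj(1)[OF g(1)]] by blast
  then show ?thesis
  unfolding fproj_def[of m' g'] bsl blinfun.sum_right by (intro suco) (auto simp: clinD[OF fproj_linear(1)])
 qed
 moreover have "fproj m' g' (fproj m g x) = fproj m g x" for x
  using g'(3) unfolding fproj_def[of m g] bsl blinfun.sum_right by (intro suco) (auto simp: clinD[OF fproj_linear(1)])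
 ultimately have "range (fproj m g)=range (fproj m' g')" by (metis (no_types) image_subset_iff rangeI subset_antisym)
 then have "fproj m g = fproj m' g'" using opr_uq fproj(1) g(1) g'(1) by metis
 then have p: "pr F m g=pr F m' g'" for F by (simp add: pr_def fib_def)
 obtain r r' where r: "rank X (%x. pr (f x) m g) r" "chern X (%x. pr (f x) m g) r c"
  "rank X (%x. pr (f x) m g) r'" "chern X (%x. pr (f x) m g) r' c'"
  using g(2) g'(2) by (auto simp: chf_def p)
 then show ?thesis using chn_uq[OF X r(1,2), of c' i] rank_uq[OF r(1,3) False] by simp
qed

definition ch where "ch X f c<->(EX n e. chf X f c n e)"

lemma ch_uq: "cspc X==>fam X f==>ch X f c==>ch X f c'==>coh (Sing X) (c i) (c' i)"
 unfolding ch_def using chf_uq by blast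

lemma chf_ex:
 assumes "cspc X" "connected_space X" "fam X f" "adm X f n e"
 obtains c where "chf X f c n e"
 using rank_ex[OF assms(2) pr_vb[OF assms(3,4)]] chn_ex[OF assms(1)] assms(4) unfolding chf_def by metis

lemma ch_ex:
 assumes "cspc X" "connected_space X" "fam X f"
 obtains c where "ch X f c"
 using adm_ex[OF assms(1,3)] chf_ex[OF assms] unfolding ch_def by metis

lemma rank_pull:
 assumes p: "rank X p r" and g: "cmap X' X g"
 shows "rank X' (%x. p (g x)) r"
proof -
 have "cmap X' eucl1 (p \<circ> g)" by (rule cmc[OF g]) (use p in "simp add: rank_def vbundle_def")
 moreover have "g x:tsp1 X" if "x:tsp1 X'" for x using g that by (auto simp: cmd)
 ultimately show ?thesis using p by (auto simp: rank_def vbundle_def o_def)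
qed

lemma ch_pull:
 assumes c: "ch X f c" and g: "cmap X' X g"
 shows "ch X' (%x. f (g x)) (%i. pb g (c i))"
proof -
 obtain n e r where c: "adm X f n e" "rank X (%x. pr (f x) n e) r" "chern X (%x. pr (f x) n e) r c"
  using assms by (auto simp: ch_def chf_def)
 have "adm X' (%x. f (g x)) n e" using c(1) g by (auto simp: adm_def cmd)
 then show ?thesis using rank_pull[OF c(2) g] chn_pull[OF g c(3)] unfolding ch_def chf_def by blast
qed

text \<open>The Chern cochains of the family over the cylinder restrict to those of both ends, and
  the two inclusions of X are homotopic.\<close>

lemma ch_hty:
 assumes X: "cspc X" "connected_space X" and h: "fam (prt (topo {0..1::real}) X) h"
  and c: "ch X (%x. h (0, x)) c" "ch X (%x. h (1, x)) c'"
 shows "coh (Sing X) (c i) (c' i)"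
proof -
 let ?I = "prt (topo {0..1::real}) X"
 have I: "cspc ?I" "connected_space ?I"
  using X by (simp_all add: compact_space_prod_topology compact_space_subtopology connected_space_prod_topology connected_space_subtopology)
 obtain C where C: "ch ?I h C" by (rule ch_ex[OF I h])
 have i: "cmap X ?I (Pair t)" if "t:{0..1}" for t
  using that by (simp add: cmp o_def)
 have 1: "coh (Sing X) (c'' i) (pb (Pair t) (C i))" if t: "t:{0..1}" and "ch X (%x. h (t, x)) c''" for t c''
  by (rule ch_uq[OF X(1) fam_pull[OF h i[OF t]] that(2) ch_pull[OF C i[OF t]]])
 have "eqn (Sing ?I) (cd (C i)) 0" using C by (auto simp: ch_def chf_def chern_def)
 moreover have "cmap ?I ?I (%(t, x). Pair t x)" by simp
 ultimately have "eqn (Sing X) (pb (Pair 1) (C i)) (pb (Pair 0) (C i) + cd (hop Pair (C i)))" by (intro hty_cl)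
 then have "coh (Sing X) (pb (Pair 1) (C i)) (pb (Pair 0) (C i))" unfolding coh_def by blast
 from coh_trans[OF 1[OF _ c(1)] coh_trans[OF coh_sym[OF this] coh_sym[OF 1[OF _ c(2)]]]] show ?thesis by simp
qed

text \<open>W = 0 is admissible and the index bundle is 0; its projective bundle is empty, so the
  Chern relation holds with total class 1.\<close>

lemma ch_invertible:
 assumes f: "fam X f" and inj: "!!x v. x:tsp1 X==>f x v=0==>v=0"
  and lo: "!!x. x:tsp1 X==>EX de>0. ALL v. de * (norm v)\<^sup>2<=(norm (adj (f x) v))\<^sup>2"
 shows "ch X f (%i. if i=0 then un else 0)"
proof -
 let ?e = "%_. 0 :: 'b" and ?c = "%i :: nat. if i=0 then un else 0"
 have a: "adm X f 0 ?e" 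
  unfolding adm_def
 proof (intro conjI ballI)
  fix x assume "x:tsp1 X"
  from lo[OF this] show "EX de. low (f x) 0 ?e de" unfolding low_def by blast
 qed (simp add: onf_def)
 have r: "range (pr (f x) 0 ?e)={0}" if x: "x:tsp1 X" for x
 proof -
  have "fib (f x) 0 ?e={0}" using inj[OF x] by (auto simp: fib_def fproj_def)
  then show ?thesis using pr(2)[of "f x" 0 ?e] f x by (simp add: fam_def)
 qed
 have p0: "pr (f x) 0 ?e=0" if "x:tsp1 X" for x
  using r[OF that] by (intro bleq) (metis rangeI singletonD zero_blinfun.rep_eq)
 have "rank X (%x. pr (f x) 0 ?e) 0" using pr_vb[OF f a] r dim_unique[of "{}" "{0 :: 'b}" 0] by (simp add: rank_def independent_empty)
 moreover have "tsp1 (PB X (%x. pr (f x) 0 ?e))={}" using p0 zero_PH by (auto simp: tsp_PB)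
 then have "chern X (%x. pr (f x) 0 ?e) 0 ?c" by (simp add: chern_def Sing_trivial coh_def[of bot] eqn_def[of _ "cd _"])
 ultimately show ?thesis using a by (auto simp: ch_def chf_def)
qed

text \<open>Otherwise there are unit vectors orthogonal to W on which the adjoint tends to 0.
  Compactness of \<open>F oL adj F\<close> minus 1 provides a limit, a unit vector killed by the
  adjoint and orthogonal to W, hence orthogonal to everything.\<close>

lemma surj_low:
 assumes F: "clin1 F" and a: "(F oL adj F) - idb:coop" and e: "onf n e"
  and sum: "{u+w |u w. u:range (bapp F)&w:range (fproj n e)}=UNIV"
 shows "EX de. low F n e de"
proof (rule ccontr)
 let ?a = "(F oL adj F) - idb" and ?P = "fproj n e"
 note P = fproj(1)[OF e]
 assume no: "~ ?thesis"
 have "EX v. ?P v=0&norm v=1&norm (adj F v)<=1 / real (Suc k)" for k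
 proof -
  have "~ low F n e ((1 / real (Suc k))\<^sup>2)" using no by blast
  then obtain v where v: "?P v=0" "(norm (adj F v))\<^sup>2 < (1 / real (Suc k))\<^sup>2*(norm v)\<^sup>2" by (auto simp: low_def not_le)
  then have "v~=0" by auto
  have "norm (adj F v) < 1 / real (Suc k) * norm v"
   using v(2) by (intro power2_less_imp_less[of "norm (adj F v)"]) (simp_all add: pmd power_divide)
  then show ?thesis using v(1) `v~=0`
   by (intro exI[of _ "(1 / norm v) *R v"]) (simp add: blinfun.scaleR_right field_simps)
 qed
 then obtain v where v: "!!k. ?P (v k)=0" "!!k. norm (v k)=1" "!!k. norm (adj F (v k))<=1 / real (Suc k)" by metis
 have Fv: "(%k. adj F (v k)) \<longlonglongrightarrow> 0"
  by (rule Lim_null_comparison[OF always_eventually LIMSEQ_Suc[OF lim_inverse_n[unfolded inverse_eq_divide]]]) (use v(3) in auto)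
 have "compact (closure (bapp ?a ` cball 0 1))" using a by (simp add: compact_ops_def)
 moreover have "?a (v k):closure (bapp ?a ` cball 0 1)" for k
  using v(2)[of k] by (intro subsetD[OF closure_subset] imageI) simp
 ultimately obtain y s where s: "strict_mono s" "(%k. ?a (v (s k))) \<longlonglongrightarrow> y"
  unfolding compact_def by (auto simp: o_def dest!: spec[of _ "%k. ?a (v k)"])
 have "(%k. F (adj F (v (s k))) - ?a (v (s k))) \<longlonglongrightarrow> F 0 - y"
  by (intro tendsto_diff s(2) blinfun.tendsto tendsto_const LIMSEQ_subseq_LIMSEQ[OF Fv s(1), unfolded o_def])
 then have vz: "(%k. v (s k)) \<longlonglongrightarrow> - y" by (simp add: bdl1)
 have "norm (- y)=1" by (rule LIMSEQ_unique[OF tendsto_norm[OF vz]]) (simp add: v(2))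
 moreover have "?P (- y)=0"
  by (rule LIMSEQ_unique[OF blinfun.tendsto[OF tendsto_const vz]]) (simp add: v(1))
 moreover have Fz: "adj F (- y)=0"
  by (rule LIMSEQ_unique[OF blinfun.tendsto[OF tendsto_const vz] LIMSEQ_subseq_LIMSEQ[OF Fv s(1), unfolded o_def]])
 moreover have "- y:{u+w |u w. u:range (bapp F)&w:range (fproj n e)}" by (simp only: sum UNIV_I)
 then obtain u w where uw: "- y=F u + fproj n e w" by auto
 have "cin1 (- y) (F u + fproj n e w) = cin1 (adj F (- y)) u + cin1 (?P (- y)) w"
  by (simp only: cin_add_r cin_adj(2)[OF F] opr_cin[OF P])
 then have "cin1 (- y) (- y) = cin1 (adj F (- y)) u + cin1 (?P (- y)) w" by (simp only: uw[symmetric])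
 ultimately show False by (simp add: cin_self)
qed

lemma low_surj:
 assumes F: "clin1 F" and e: "onf n e" and lo: "low F n e de"
 shows "{u+w |u w. u:range (bapp F)&w:range (fproj n e)}=UNIV"
proof -
 have "EX u w. y=F u + fproj n e w" for y
 proof -
  obtain w where "F (adj F w) - fproj n e (F (adj F w))=y - fproj n e y" using coercive_low[OF F e lo] by metis
  then have "y=F (adj F w) + fproj n e (y - F (adj F w))" by (simp add: bdr alsi)
  then show ?thesis by blast
 qed
 then show ?thesis by blast
qed

lemma Fred0_fam:
 assumes f: "cmap X (topo Fred0) f"
 shows "fam X f"
proof -
 have c: "cmap X eucl1 f" and F: "!!x. x:tsp1 X==>f x:Fred0"
  using f by (auto simp: cmis)
 have cl: "clin1 (f x)" if "x:tsp1 X" for x using F[OF that] by (simp add: Fred0_def fredholm_def)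
 have d: "dist (adj G) (adj H)<=dist G H" if "clin1 G" "clin1 H" for G H :: "'b op"
 proof -
  have "adj (G - H)=adj G - adj H"
   by (rule cin_adj(5)) (use that in "simp_all add: clin_df bdl1 cin_df_l cin_df_r cin_adj(1)")
  then show ?thesis using cin_adj(4)[OF clin_df[OF that]] by (simp add: dist_norm)
 qed
 have ca: "cmap X eucl1 (%x. adj (f x))"
 proof (rule cm_metricI)
  fix x and ep :: real assume x: "x:tsp1 X" "ep > 0"
  have "ALL y:{y:tsp1 X. dist (f y) (f x) < ep}. dist (adj (f y)) (adj (f x)) < ep"
   using d cl x(1) by (auto intro: le_less_trans)
  then show "EX U. openin X U&x:U&(ALL y:U. dist (adj (f y)) (adj (f x)) < ep)"
   using cm_metricD[OF c] x by (intro exI[of _ "{y:tsp1 X. dist (f y) (f x) < ep}"]) auto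
 qed
 show ?thesis
  unfolding fam_def using F cl
  by (auto simp: Fred0_def intro!: cm_ap[OF c cm_cst] cm_ap[OF ca cm_cst] cm_df[OF cm_o[OF c ca] cm_cst] cm_df[OF cm_o[OF ca c] cm_cst])
qed

text \<open>All index bundles of all maps in the class give the same value: their subspaces W are
  admissible by \<open>surj_low\<close>, and a homotopy in \<open>Fred0\<close> is a family over the
  cylinder, to which \<open>ch_hty\<close> applies.\<close>

theorem chn_K0_eq:
 fixes f :: "'x=>'h::complex_hilbert op"
 assumes inf: "~ fdim (UNIV :: 'h set)" and X: "cspc X" "connected_space X"
  and f: "f:K0_class X x0 f" and c: "ch X f c"
 shows "chern_K0 X i (K0_class X x0 f) = cl (2 * i) X (c i)"
proof -
 have hom: "EX k. fam (prt (topo {0..1::real}) X) k&(%x. k (0, x)) = f&(%x. k (1, x))=g"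
  if "g:K0_class X x0 f" for g
 proof -
  from that obtain k where "cmap (prt (topo {0..1::real}) X) (topo Fred0) k" "ALL x. k (0, x) = f x" "ALL x. k (1, x)=g x"
   by (auto simp: K0_class_def homotopic_with_def)
  then show ?thesis using Fred0_fam by blast
 qed
 have ff: "fam X g" if g: "g:K0_class X x0 f" for g
 proof -
  have "homotopic_with (%h. invertible_op (h x0)) X (topo Fred0) f g" using g by (simp add: K0_class_def)
  from homotopic_with_imp_continuous_maps[OF this] show ?thesis using Fred0_fam by blast
 qed
 have val: "chern_bundle X E i = cl (2 * i) X (c i)"
  if g: "g:K0_class X x0 f" and a: "adm X g n e" and E: "!!x. x:tsp1 X==>E x = fib (g x) n e" for g n e E
 proof -
  obtain c' where c': "chf X g c' n e" by (rule chf_ex[OF X ff[OF g] a])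
  then obtain r where r: "rank X (%x. pr (g x) n e) r" "chern X (%x. pr (g x) n e) r c'" by (auto simp: chf_def)
  have "chern_bundle X E i = cl (2 * i) X (c' i)"
  proof (rule chn_bdl_eq[OF inf X(1) r(1) _ r(2)])
   show "E x=range (pr (g x) n e)" if "x:tsp1 X" for x using E[OF that] pr(2)[of "g x" n e] ff[OF g] that by (simp add: fam_def)
  qed
  moreover obtain k where k: "fam (prt (topo {0..1::real}) X) k" "(%x. k (0, x)) = f" "(%x. k (1, x))=g"
   using hom[OF g] by blast
  have "coh (Sing X) (c i) (c' i)"
   by (rule ch_hty[OF X k(1)]) (use c c' in "auto simp: k ch_def")
  then have "cl (2 * i) X (c i) = cl (2 * i) X (c' i)" unfolding cl_cong[symmetric] cohn_coh by (rule coh_deg)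
  ultimately show ?thesis by simp
 qed
 have lin: "clin1 (g x)" "(g x oL adj (g x)) - idb:coop" if "g:K0_class X x0 f" "x:tsp1 X" for g x
  using ff[OF that(1)] that(2) by (auto simp: fam_def)
 show ?thesis
  unfolding chern_K0_def
 proof (rule the_equality)
  obtain n e where a: "adm X f n e" by (rule adm_ex[OF X(1) ff[OF f]])
  then have e: "onf n e" by (simp add: adm_def)
  have "complex_subspace (range (fproj n e))"
   using fproj_linear(1)[of n e] unfolding csd cld
   by (auto intro!: linear_subspace_image[OF bounded_linear.linear[OF bblr]]) (metis rangeI)
  moreover have "{u+w |u w. u:range (bapp (f x))&w:range (fproj n e)}=UNIV" if x: "x:tsp1 X" for x
  proof -
   obtain de where "low (f x) n e de" using a x by (auto simp: adm_def)
   then show ?thesis by (rule low_surj[OF lin(1)[OF f x] e])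
  qed
  ultimately have "is_index_bundle X f (%x. f x -` range (fproj n e)) (range (fproj n e))"
   using fproj_fin by (simp add: is_index_bundle_def)
  moreover have "chern_bundle X (%x. f x -` range (fproj n e)) i = cl (2 * i) X (c i)"
   by (rule val[OF f a]) (use opr_rg[OF fproj(1)[OF e]] in "auto simp: fib_def")
  ultimately show "EX f:K0_class X x0 f. EX E W. is_index_bundle X f E W&cl (2 * i) X (c i) = chern_bundle X E i"
   using f by metis
  fix d assume "EX f:K0_class X x0 f. EX E W. is_index_bundle X f E W&d = chern_bundle X E i"
  then obtain g E W where g: "g:K0_class X x0 f" and W: "is_index_bundle X g E W" and d: "d = chern_bundle X E i" by blast
  obtain n e where e: "onf n e" "range (fproj n e)=W"
   by (rule fin_sbsp_onf[of W]) (use W in "auto simp: is_index_bundle_def")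
  have "adm X g n e"
   unfolding adm_def using e(1) surj_low[OF lin[OF g] e(1)] W by (simp add: e(2) is_index_bundle_def)
  moreover have "E x = fib (g x) n e" if "x:tsp1 X" for x
   using W that opr_rg[OF fproj(1)[OF e(1)]] by (auto simp: is_index_bundle_def fib_def e(2))
  ultimately show "d = cl (2 * i) X (c i)" using val[OF g] d by blast
 qed
qed

section \<open>The Atiyah-Singer loop of a self-adjoint family\<close>

text \<open>What continuity into \<open>Fred_tilde\<close> provides
  (\<open>sfam_Fred_tilde\<close>), in a form that passes to pullbacks and to the shifted families
  of \<open>sfam_shift\<close>.\<close>

definition sfam :: "'x topology=>('x=>'h::complex_hilbert op)=>bool" where
 "sfam Y M<->(ALL y:tsp1 Y. clin1 (M y)&sadj1 (M y)&(M y oL M y) - idb:coop) &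
  (ALL v. cmap Y eucl1 (%y. M y v))&cmap Y eucl1 (%y. (M y oL M y) - idb)"

lemma sfam_pull:
 assumes M: "sfam Y M" and g: "cmap Y' Y g"
 shows "sfam Y' (%y. M (g y))"
proof -
 have c: "cmap Y' eucl1 (%x. h (g x))" if "cmap Y eucl1 h" for h :: "_=>'z::topological_space"
  using cmc[OF g that] by (simp add: o_def)
 have m: "g x:tsp1 Y" if "x:tsp1 Y'" for x using g that by (auto simp: cmd)
 have "cmap Y' eucl1 (%y. M (g y) v)" for v by (rule c[of "%y. M y v"]) (use M in "simp add: sfam_def")
 moreover have "cmap Y' eucl1 (%y. (M (g y) oL M (g y)) - idb)" by (rule c) (use M in "simp add: sfam_def")
 ultimately show ?thesis using M m by (auto simp: sfam_def)
qed

lemma sfam_Fred_tilde: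
 assumes M: "cmap Y Fred_tilde M"
 shows "sfam Y M"
proof -
 have T: "cmap (prt Fred_tilde eucl1) eucl1 (%(F :: 'b op, v). F v)"
   "cmap Fred_tilde (topo coop) (%F :: 'b op. (F oL F) - idb)"
  using makes_continuous_Fred_tilde by (auto simp: makes_continuous_def)
 have "cmap Y (prt Fred_tilde eucl1) (%y. (M y, v))" for v
  using M by (simp add: continuous_map_paired)
 from cmc[OF this T(1)] have 1: "cmap Y eucl1 (%y. M y v)" for v by (simp add: o_def)
 have 2: "cmap Y (topo coop) (%y. (M y oL M y) - idb)"
  using cmc[OF M T(2)] by (simp add: o_def)
 have "M y:Fred1" if "y:tsp1 Y" for y using M that topspace_Fred_tilde by (auto simp: cmd)
 then show ?thesis using 1 2 unfolding sfam_def cmis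
  by (auto simp: Fred1_def Fred0_def fredholm_def image_subset_iff)
qed

lemma sC_op_ap [simp]: "bapp (scaleC_op c F) x = c *C F x"
proof -
 have "bounded_linear (%x. c *C F x)"
  by (intro bounded_linear_compose[OF _ bblr] bounded_bilinear.bounded_linear_right[OF bbl_sC])
 then show ?thesis by (simp add: scaleC_op_def bounded_linear_Blinfun_apply)
qed

lemma cpt_opsI:
 assumes "clin1 K" "bapp K ` cball 0 1 \<subseteq> C" "compact C"
 shows "K:coop"
proof -
 have "closure (bapp K ` cball 0 1) \<subseteq> C" by (rule closure_minimal[OF assms(2) compact_imp_closed[OF assms(3)]])
 then have "compact (closure (bapp K ` cball 0 1))" using closed_Int_compact[OF closed_closure assms(3), of "bapp K ` cball 0 1"] by (simp add: Int_absorb2)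
 then show ?thesis using assms(1) by (simp add: compact_ops_def)
qed

lemma cpt_opsD:
 assumes "K:coop"
 shows "clin1 K" "compact (closure (bapp K ` cball 0 1))" "norm x<=1==>K x:closure (bapp K ` cball 0 1)"
proof -
 show "norm x<=1==>K x:closure (bapp K ` cball 0 1)" by (rule subsetD[OF closure_subset]) simp
qed (use assms in "simp_all add: compact_ops_def")

lemma cpt_ops_o: "K:coop==>clin1 T==>T oL K:coop"
 by (rule cpt_opsI[where C = "bapp T ` closure (bapp K ` cball 0 1)"])
  (use cpt_opsD[of K] in "auto intro!: clin_o compact_continuous_image continuous_intros simp: dist_norm")

lemma cpt_ops_add: "K:coop==>L:coop==>K + L:coop"
 by (rule cpt_opsI[where C = "{x+y |x y. x:closure (bapp K ` cball 0 1)&y:closure (bapp L ` cball 0 1)}"])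
  (use cpt_opsD[of K] cpt_opsD[of L] in "auto 0 5 intro!: clin_add compact_sums simp: blinfun.add_left")

lemma cpt_ops_sR: "K:coop==>r *R K:coop"
 by (rule cpt_opsI[where C = "(%x. r *R x) ` closure (bapp K ` cball 0 1)"])
  (use cpt_opsD[of K] in "auto intro!: clin_sR compact_scaling simp: bsl1")

abbreviation "unitI == topo {0..1::real}"

abbreviation "S1 == topo (sphere 0 1 :: complex set)"

section \<open>Topology of the smash product of the circle with B_+\<close>

lemma plus_tsp: "tsp1 (plt B)=insert None (Some ` tsp1 B)"
proof -
 have "{b:tsp1 B. Some b:insert None (Some ` tsp1 B)}=tsp1 B" by auto
 then have "openin (plt B) (insert None (Some ` tsp1 B))"
  by (simp only: openin_plus_topology openin_topspace subset_refl simp_thms)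
 then have "insert None (Some ` tsp1 B) \<subseteq> tsp1 (plt B)" by (rule openin_subset)
 moreover have "tsp1 (plt B) \<subseteq> insert None (Some ` tsp1 B)"
  using openin_topspace[of "plt B"] unfolding openin_plus_topology by (rule conjunct1)
 ultimately show ?thesis by (rule antisym[rotated])
qed

lemma cm_Some: "cmap B (plt B) Some"
 by (auto simp: cmd plus_tsp openin_plus_topology)

lemma quo_sma: "quotient_map (prt S1 (plt B)) (SSP B) (smash_map 1 None)"
 and sma_tsp: "tsp1 (SSP B)=smash_map 1 None ` (sphere 0 1 \<times> tsp1 (plt B))"
proof -
 let ?q = "smash_map (1 :: complex) (None :: 'a option)" and ?X = "prt S1 (plt B)"
 have "{x:tsp1 ?X. ?q x:?q ` tsp1 ?X}=tsp1 ?X" by auto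
 then have "openin (SSP B) (?q ` tsp1 ?X)"
  by (simp add: S1_smash_def smash_def openin_quotient_topology del: topspace_prod_topology)
 then show t: "tsp1 (SSP B)=?q ` (sphere 0 1 \<times> tsp1 (plt B))"
  using openin_subset[of "SSP B"] openin_topspace[of "SSP B"]
  unfolding S1_smash_def smash_def openin_quotient_topology by (intro antisym) simp_all
 show "quotient_map ?X (SSP B) ?q"
  unfolding quotient_map_def using t by (auto simp: S1_smash_def smash_def openin_quotient_topology)
qed

text \<open>The interval is locally compact, so its product with the quotient map onto the smash
  product is again a quotient map; and the added base point is isolated in B_+, so it can be treated
  separately.\<close>

lemma cont_sma:
 assumes A: "cmap (prt unitI (prt S1 K)) Z (%x. fi (fst x, smash_map 1 None (fst (snd x), Some (snd (snd x)))))"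
  and N: "cmap unitI Z (%t. fi (t, None))"
 shows "cmap (prt unitI (SSP K)) Z fi"
proof -
 have lc: "locally_compact_space unitI" "Hausdorff_space unitI"
  by (simp_all add: Hausdorff_space_subtopology compact_imp_locally_compact_space compact_space_subtopology)
 have Q: "quotient_map (prt unitI (prt S1 (plt K))) (prt unitI (SSP K)) (%(t, x). (t, smash_map 1 None x))"
  by (rule quotient_map_prod_right[OF lc(1) _ quo_sma]) (use lc in simp)
 let ?Y = "prt unitI (prt S1 (plt K))"
 have "cmap ?Y Z (fi \<circ> (%(t, x). (t, smash_map 1 None x)))"
  unfolding cmd
 proof (intro conjI allI impI)
  have m: "fi (t, smash_map 1 None (z, y)):tsp1 Z" if tzy: "t:{0..1}" "z:sphere 0 1" "y:tsp1 (plt K)" for t z y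
     proof (cases "z=1 | y=None")
   case True
   then show ?thesis using that(1) continuous_map_image_subset_topspace[OF N] by (auto simp: smash_map_def)
  next
   case False
   then obtain b where "y=Some b" "b:tsp1 K" using tzy(3) by (auto simp: plus_tsp)
   then show ?thesis using tzy(1,2) funcset_mem[OF continuous_map_funspace[OF A], of "(t, z, b)"] by simp
  qed
  then show "fi \<circ> (%(t, x). (t, smash_map 1 None x)):tsp1 ?Y \<rightarrow> tsp1 Z" by auto
  fix U assume U: "openin Z U"
  define V where "V={x:tsp1 (prt unitI (prt S1 K)). fi (fst x, smash_map 1 None (fst (snd x), Some (snd (snd x)))):U}"
  have V: "openin (prt unitI (prt S1 K)) V" unfolding V_def by (rule ocmp[OF A U])
  define T where "T={t:tsp1 unitI. fi (t, None):U}"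
  have T: "openin unitI T" unfolding T_def by (rule ocmp[OF N U])
  show "openin ?Y {x:tsp1 ?Y. (fi \<circ> (%(t, x). (t, smash_map 1 None x))) x:U}"
  proof (subst openin_subopen, intro ballI)
   fix x assume x: "x:{x:tsp1 ?Y. (fi \<circ> (%(t, x). (t, smash_map 1 None x))) x:U}"
   obtain t z y where xe: "x=(t, z, y)" by (cases x)
   then have tz: "t:{0..1}" "z:sphere 0 1" "y:tsp1 (plt K)" "fi (t, smash_map 1 None (z, y)):U" using x by auto
   show "EX W. openin ?Y W&x:W&W \<subseteq> {x:tsp1 ?Y. (fi \<circ> (%(t, x). (t, smash_map 1 None x))) x:U}"
   proof (cases y)
    case None
    have "openin ?Y (T \<times> tsp1 S1 \<times> {None})"
     using T by (simp add: openin_prod_Times_iff openin_plus_topology)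
    moreover have "T \<times> tsp1 S1 \<times> {None} \<subseteq> {x:tsp1 ?Y. (fi \<circ> (%(t, x). (t, smash_map 1 None x))) x:U}"
     by (auto simp: T_def smash_map_def plus_tsp)
    ultimately show ?thesis using tz None by (intro exI[of _ "T \<times> tsp1 S1 \<times> {None}"]) (auto simp: xe T_def smash_map_def)
   next
    case (Some b)
    then have "(t, z, b):V" using tz by (auto simp: V_def plus_tsp)
    then obtain T' W where W: "openin unitI T'" "t:T'" "openin (prt S1 K) W" "(z, b):W" "T' \<times> W \<subseteq> V"
     using V unfolding openin_prod_topology_alt[of unitI] by meson
    then obtain Z' B' where B: "openin S1 Z'" "z:Z'" "openin K B'" "b:B'" "Z' \<times> B' \<subseteq> W"
     unfolding openin_prod_topology_alt by meson
    have "{c:tsp1 K. Some c:Some ` B'}=B'" using openin_subset[OF B(3)] by auto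
    then have "openin ?Y (T' \<times> Z' \<times> Some ` B')"
     using W B openin_subset[OF B(3)] by (auto simp: openin_prod_Times_iff openin_plus_topology)
    moreover have "T' \<times> Z' \<times> Some ` B' \<subseteq> {x:tsp1 ?Y. (fi \<circ> (%(t, x). (t, smash_map 1 None x))) x:U}"
    proof
     fix x assume "x:T' \<times> Z' \<times> Some ` B'"
     then obtain t' z' b' where "x=(t', z', Some b')" "t':T'" "z':Z'" "b':B'" by blast
     moreover from this have "(t', z', b'):V" using W B by blast
     ultimately show "x:{x:tsp1 ?Y. (fi \<circ> (%(t, x). (t, smash_map 1 None x))) x:U}"
      by (auto simp: V_def plus_tsp)
    qed
    ultimately show ?thesis using W B Some by (intro exI[of _ "T' \<times> Z' \<times> Some ` B'"]) (auto simp: xe)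
   qed
  qed
 qed
 then show ?thesis by (rule continuous_compose_quotient_map[OF Q])
qed

lemma sma_cpt: assumes K: "cspc K" shows "cspc (SSP K)"
proof -
 have "compactin (plt K) (Some ` tsp1 K)" using image_compactin[OF _ cm_Some] K by (simp add: compact_space_def)
 then have "compactin (plt K) (insert None (Some ` tsp1 K))"
  using compactin_Un[of "plt K" "{None}"] by (simp add: plus_tsp)
 then have "cspc (plt K)" by (simp add: compact_space_def plus_tsp)
 moreover have "cspc S1" by (simp add: compact_space_subtopology)
 ultimately have "cspc (prt S1 (plt K))" by (simp add: compact_space_prod_topology)
 then show ?thesis by (metis compact_space_def image_compactin quotient_imp_continuous_map quotient_imp_surjective_map quo_sma)
qed

text \<open>The space is a union of images of the circle, all containing the base point.
  Connectedness makes the rank of the index bundle constant.\<close>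

lemma sma_cnd: "connected_space (SSP K)"
proof -
 let ?q = "smash_map (1 :: complex) (None :: 'a option)"
 define CC where "CC=(%y. ?q ` (sphere 0 1 \<times> {y})) ` tsp1 (plt K)"
 have cq: "cmap (prt S1 (plt K)) (SSP K) ?q" by (rule quotient_imp_continuous_map[OF quo_sma])
 have "connectedin (SSP K) C" if C: "C:CC" for C
 proof -
  obtain y where y: "y:tsp1 (plt K)" "C=?q ` (sphere 0 1 \<times> {y})" using C unfolding CC_def by blast
  have "connected (sphere 0 1 :: complex set)" by (rule connected_sphere) simp
  then have "connectedin S1 (sphere 0 1)" by (simp add: connectedin_subtopology)
  then have "connectedin (prt S1 (plt K)) (sphere 0 1 \<times> {y})" using y(1) by (simp add: connectedin_Times)
  then show ?thesis unfolding y(2) by (rule connectedin_continuous_map_image[OF cq])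
 qed
 moreover have "None:\<Inter>CC" by (force simp: CC_def smash_map_def)
 ultimately have "connectedin (SSP K) (\<Union>CC)" by (intro connectedin_Union) auto
 moreover have "\<Union>CC=tsp1 (SSP K)" by (auto simp: CC_def sma_tsp)
 ultimately show ?thesis by (simp add: connectedin_topspace)
qed

lemma cm_via_sma:
 assumes "cmap (prt S1 K) Z (%x. fi (smash_map 1 None (fst x, Some (snd x))))" "fi None:tsp1 Z"
 shows "cmap (SSP K) Z fi"
proof -
 have 1: "cmap (prt unitI (SSP K)) Z (%x. fi (snd x))"
  by (rule cont_sma) (use cm_snd[OF assms(1)] assms(2) in simp_all)
 have "cmap (SSP K) (prt unitI (SSP K)) (%x. (0, x))"
  by (simp add: cmp o_def)
 from cmc[OF this 1] show ?thesis by (simp add: o_def)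
qed

lemma sma_inclusion: "cmap (SSP (sbt1 B K)) (SSP B) (%x. x)"
proof (rule cm_via_sma)
 have "cmap (prt S1 (sbt1 B K)) (prt S1 (plt B)) (%x. (fst x, Some (snd x)))"
  using cmc[OF cmfs[OF continuous_map_id] cm_Some, of B K]
  by (simp add: cmp o_def cmf cm_snd)
 from cmc[OF this quotient_imp_continuous_map[OF quo_sma]]
 show "cmap (prt S1 (sbt1 B K)) (SSP B) (%x. smash_map 1 None (fst x, Some (snd x)))" by (simp add: o_def)
qed (force simp: sma_tsp plus_tsp smash_map_def)

lemma sma_cases:
 assumes "x:tsp1 (SSP K)"
 obtains "x=None" | z b where "x=Some (z, Some b)" "cmod z=1" "b:tsp1 K"
 using assms by (auto simp: sma_tsp plus_tsp smash_map_def split: if_splits)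

text \<open>With \<open>be\<close> it joins both halves of the Atiyah-Singer loop in the formula
  \<open>ze z\<close> + i \<open>be z\<close> A: on the upper half these are the real and the
  imaginary part of z, on the lower half z and 0.\<close>

definition ze :: "complex=>complex" where "ze z = Complex (Re z) (- max 0 (- Im z))"

definition be :: "complex=>real" where "be z=max 0 (Im z)"

lemma zebe: "cmod z=1==>(cmod (ze z))\<^sup>2+(be z)\<^sup>2=1" "cofr (be z) * cnj (ze z) = of_real (be z) * ze z"
 using cmod_power2[of z] by (auto simp: ze_def be_def max_def cmod_power2 cei)

lemma AS_ap:
 "bapp (ASg A (Some (z, Some b))) v=ze z *C v+(\<i> * of_real (be z)) *C A b v" "ASg A None=idb"
proof -
 show "bapp (ASg A (Some (z, Some b))) v=ze z *C v+(\<i> * of_real (be z)) *C A b v"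
 proof (cases "Im z >= 0")
  case True
  then have "ze z = of_real (Re z)" "be z=Im z" by (auto simp: ze_def be_def cei)
  then show ?thesis using True by (simp add: atiyah_singer_def blinfun.add_left bsl1 sor)
 next
  case False
  then have "ze z=z" "be z=0" by (auto simp: ze_def be_def cei)
  then show ?thesis using False by (simp add: atiyah_singer_def)
 qed
qed (simp add: atiyah_singer_def)

lemma AS_sma: "ASg A (smash_map 1 None (z, Some b))=ASg A (Some (z, Some b))"
proof (cases "z=1")
 case True
 have "ze 1=1" "be 1=0" by (simp_all add: ze_def be_def cei)
 then have "ASg A (Some (1, Some b))=idb" by (intro bleq) (simp add: AS_ap)
 then show ?thesis using True by (simp add: smash_map_def AS_ap(2))
qed (simp add: smash_map_def)

text \<open>\<open>ze z\<close> is real wherever \<open>be z\<close> is not 0, so the mixed terms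
  cancel, and since the squares of their moduli add up to 1 only a multiple of
  \<open>A^2 - 1\<close> is left. Hence norm continuity of \<open>A^2 - 1\<close> carries over to
  the loop.\<close>

lemma AS_facts:
 fixes A :: "'b=>'h::complex_hilbert op"
 assumes A: "clin1 (A b)" "sadj1 (A b)" and z: "cmod z=1"
 defines "F == ASg A (Some (z, Some b))"
 shows "clin1 F" "bapp (adj F) v = cnj (ze z) *C v - (\<i> * of_real (be z)) *C A b v"
  "(F oL adj F) - idb=(be z)\<^sup>2 *R ((A b oL A b) - idb)" "(adj F oL F) - idb=(be z)\<^sup>2 *R ((A b oL A b) - idb)"
proof -
 note cA = clinD[OF A(1)]
 show F: "clin1 F" by (simp add: cld F_def AS_ap cA scaleC_add_right scsc muco)
 define G where "G=scaleC_op (cnj (ze z)) idb - scaleC_op (\<i> * of_real (be z)) (A b)"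
 have G: "G v = cnj (ze z) *C v - (\<i> * of_real (be z)) *C A b v" for v by (simp add: G_def bdl1)
 have "cin1 (F x) y = cin1 x (G y)" for x y
  using A(2) by (simp add: F_def AS_ap G cal cin_df_r csl cin_sC_r sad)
 then have a: "adj F=G" by (rule cin_adj(5)[OF F])
 show "bapp (adj F) v = cnj (ze z) *C v - (\<i> * of_real (be z)) *C A b v" for v by (simp add: a G)
 have zb: "ze z * cnj (ze z) = of_real (1 - (be z)\<^sup>2)"
  using zebe(1)[OF z] by (metis add_diff_cancel_right' complex_norm_square)
 have cr: "\<i> * of_real (be z) * cnj (ze z)=\<i> * of_real (be z) * ze z" using zebe(2)[of z] by (simp add: mult.assoc)
 let ?c = "\<i> * cofr (be z)"
 have cc: "?c * ?c = of_real (- (be z)\<^sup>2)" by (simp add: pes cei)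
 have "F (G v)=(ze z * cnj (ze z)) *C v - (?c * ze z) *C A b v+((?c * cnj (ze z)) *C A b v - (?c * ?c) *C A b (A b v))" for v
  by (simp add: F_def AS_ap G bdr cA sC_df_r scsc mult_ac)
 then have "F (G v) - v=(be z)\<^sup>2 *R (A b (A b v) - v)" for v
  unfolding zb cc cr sor by (simp add: alsi)
 then show "(F oL adj F) - idb=(be z)\<^sup>2 *R ((A b oL A b) - idb)"
  unfolding a by (intro bleq) (simp add: bdl1 bsl1)
 have "G (F v)=(ze z * cnj (ze z)) *C v+(?c * cnj (ze z)) *C A b v - ((?c * ze z) *C A b v+(?c * ?c) *C A b (A b v))" for v
  by (simp add: F_def AS_ap G blinfun.add_right cA scaleC_add_right scsc mult_ac)
 then have "G (F v) - v=(be z)\<^sup>2 *R (A b (A b v) - v)" for v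
  unfolding zb cc cr sor by (simp add: alsi)
 then show "(adj F oL F) - idb=(be z)\<^sup>2 *R ((A b oL A b) - idb)"
  unfolding a by (intro bleq) (simp add: bdl1 bsl1)
qed

lemma id_o: "idb oL idb=idb"
 by (rule bleq) simp

lemma adj_id: "adj idb=(idb :: 'h::complex_hilbert op)"
 by (rule cin_adj(5)) simp_all

theorem AS_fam:
 fixes M :: "real \<times> 'b=>'h::complex_hilbert op"
 assumes M: "sfam (prt unitI K) M"
 shows "fam (prt unitI (SSP K)) (%x. ASg (%b. M (fst x, b)) (snd x))"
proof -
 let ?Y = "prt unitI (prt S1 K)"
 let ?f = "%x. ASg (%b. M (fst x, b)) (snd x)"
 have lin: "clin1 (M (t, b))" "sadj1 (M (t, b))" "(M (t, b) oL M (t, b)) - idb:coop" if "t:{0..1}" "b:tsp1 K" for t b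
  using M that by (auto simp: sfam_def)
 have g: "cmap ?Y (prt unitI K) (%x. (fst x, snd (snd x)))"
  by (simp add: cmp o_def cmf cm_snd[OF cms])
 have cM: "cmap ?Y eucl1 (%x. h (M (fst x, snd (snd x))))" if "cmap (prt unitI K) eucl1 (%y. h (M y))"
  for h :: "_=>'z::topological_space"
  using cmc[OF g that] by (simp add: o_def)
 have cz: "cmap ?Y eucl1 (%x. h (fst (snd x)))" if "cont_on UNIV h" for h :: "complex=>'z::topological_space"
 proof -
  have "cmap ?Y eucl1 (%x. fst (snd x))" using cm_snd[OF cm_fst, of unitI "sphere 0 1" K] by simp
  from cm_comp_on[OF this _ that] show ?thesis by simp
 qed
 have cze: "cont_on UNIV ze" "cont_on UNIV (%z. cnj (ze z))" "cont_on UNIV be"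
  unfolding ze_def be_def Complex_eq by (intro continuous_intros)+
 let ?s = "%x. smash_map 1 None (fst (snd x), Some (snd (snd x)))"
 note ap = AS_sma AS_ap(1)
 have facts: "adj (?f (fst x, ?s x)) v = cnj (ze (fst (snd x))) *C v - (\<i> * of_real (be (fst (snd x)))) *C M (fst x, snd (snd x)) v"
  "(?f (fst x, ?s x) oL adj (?f (fst x, ?s x))) - idb=(be (fst (snd x)))\<^sup>2 *R ((M (fst x, snd (snd x)) oL M (fst x, snd (snd x))) - idb)"
  "(adj (?f (fst x, ?s x)) oL ?f (fst x, ?s x)) - idb=(be (fst (snd x)))\<^sup>2 *R ((M (fst x, snd (snd x)) oL M (fst x, snd (snd x))) - idb)"
  if x: "x:tsp1 ?Y" for x v
 proof -
  have x': "fst x:{0..1}" "cmod (fst (snd x))=1" "snd (snd x):tsp1 K" using x by auto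
  note AS = AS_facts[where A = "%b. M (fst x, b)", OF lin(1,2)[OF x'(1,3)] x'(2)]
  show "adj (?f (fst x, ?s x)) v = cnj (ze (fst (snd x))) *C v - (\<i> * of_real (be (fst (snd x)))) *C M (fst x, snd (snd x)) v"
   "(?f (fst x, ?s x) oL adj (?f (fst x, ?s x))) - idb=(be (fst (snd x)))\<^sup>2 *R ((M (fst x, snd (snd x)) oL M (fst x, snd (snd x))) - idb)"
   "(adj (?f (fst x, ?s x)) oL ?f (fst x, ?s x)) - idb=(be (fst (snd x)))\<^sup>2 *R ((M (fst x, snd (snd x)) oL M (fst x, snd (snd x))) - idb)"
   unfolding fst_conv snd_conv AS_sma by (rule AS)+
 qed
 note facts = facts[unfolded fst_conv snd_conv]
 have cMv: "cmap ?Y eucl1 (%x. M (fst x, snd (snd x)) v)" for v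
  by (rule cM[of "%F. bapp F v"]) (use M in "simp add: sfam_def")
 have k: "cmap ?Y eucl1 (%x. (be (fst (snd x)))\<^sup>2 *R ((M (fst x, snd (snd x)) oL M (fst x, snd (snd x))) - idb))"
  by (rule cm_sR[OF cz[of "%z. (be z)\<^sup>2"] cM[of "%F. (F oL F) - idb"]]) (use M cze(3) in "auto simp: sfam_def intro!: continuous_intros")
 have cib: "cmap ?Y eucl1 (%x. \<i> * cofr (be (fst (snd x))))"
  by (rule cz) (intro continuous_intros cze)
 have 1: "cmap ?Y eucl1 (%x. ?f (fst x, ?s x) v)" for v
  unfolding fst_conv snd_conv ap by (rule cm_add[OF cm_sC[OF cz[OF cze(1)] cm_cst] cm_sC[OF cib cMv]])
 have 2: "cmap ?Y eucl1 (%x. adj (?f (fst x, ?s x)) v)" for v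
  by (rule continuous_map_eq[OF cm_df[OF cm_sC[OF cz[OF cze(2)] cm_cst[of _ v]] cm_sC[OF cib cMv[of v]]]]) (simp only: facts fst_conv snd_conv)
 show ?thesis
  unfolding fam_def
 proof (intro conjI allI ballI)
  fix x assume x: "x:tsp1 (prt unitI (SSP K))"
  then have x': "fst x:{0..1}" "snd x:tsp1 (SSP K)" by auto
  have "0:(coop :: ('h op) set)" by (rule cpt_opsI[where C = "{0}"]) auto
  then have "clin1 (?f x)&(?f x oL adj (?f x)) - idb:coop&(adj (?f x) oL ?f x) - idb:coop"
  proof (rule_tac sma_cases[OF x'(2)], goal_cases)
   case (2 z b)
   note AS = AS_facts[where A = "%b. M (fst x, b)", OF lin(1,2)[OF x'(1) 2(4)] 2(3)]
   show ?case using AS(1,3,4) cpt_ops_sR[OF lin(3)[OF x'(1) 2(4)]] by (simp add: 2(2))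
  qed (simp_all add: AS_ap(2) adj_id id_o)
  then show "clin1 (?f x)" "(?f x oL adj (?f x)) - idb:coop" "(adj (?f x) oL ?f x) - idb:coop" by auto
 next
  fix v
  show "cmap (prt unitI (SSP K)) eucl1 (%x. ?f x v)"
   by (rule cont_sma) (use 1 in "simp_all add: AS_ap(2)")
  show "cmap (prt unitI (SSP K)) eucl1 (%x. adj (?f x) v)"
   by (rule cont_sma) (use 2 in "simp_all add: AS_ap(2)")
 next
  show "cmap (prt unitI (SSP K)) eucl1 (%x. (?f x oL adj (?f x)) - idb)"
   by (rule cont_sma, rule continuous_map_eq[OF k]) (simp_all only: facts snd_conv fst_conv AS_ap(2) continuous_map_const topspace_euclidean UNIV_I disj_commute simp_thms)
  show "cmap (prt unitI (SSP K)) eucl1 (%x. (adj (?f x) oL ?f x) - idb)"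
   by (rule cont_sma, rule continuous_map_eq[OF k]) (simp_all only: facts snd_conv fst_conv AS_ap(2) continuous_map_const topspace_euclidean UNIV_I disj_commute simp_thms)
 qed
qed

section \<open>Deforming self-adjoint families to invertible ones\<close>

abbreviation "dfc F == (F oL F) - idb"

lemma sfam_bound:
 assumes F: "sfam B F" "cspc B"
 obtains N where "N >= 1" "!!b. b:tsp1 B==>norm (F b)<=N"
proof -
 have "cmap B eucl1 (%b. dfc (F b))" using F(1) by (simp add: sfam_def)
 from image_compactin[OF _ this, of "tsp1 B"] have "compact ((%b. dfc (F b)) ` tsp1 B)" using F(2) by (simp add: compact_space_def)
 from compact_imp_bounded[OF this, unfolded bounded_iff] obtain m where
  m': "ALL y:(%b. dfc (F b)) ` tsp1 B. norm y<=m" by (rule exE)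
 note m = bspec[OF m' imageI]
 have "norm (F b)<=\<bar>m\<bar>+1" if b: "b:tsp1 B" for b
 proof -
  have "(norm (F b))\<^sup>2<=norm (F b oL F b)" using F(1) b by (intro norm_self_adjoint_le) (simp add: sfam_def)
  also have "... <= norm (dfc (F b))+norm (idb :: 'b op)" using norm_triangle_sub[of "F b oL F b" id_blinfun] by simp
  also have "... <= (\<bar>m\<bar>+1)*1" using m[OF b] norm_blinfun_id_le[where 'a = 'b] by simp
  also have "... <= (\<bar>m\<bar>+1)\<^sup>2" unfolding pes by (rule mult_left_mono) simp_all
  finally show ?thesis by (rule power2_le_imp_le) simp
 qed
 then show ?thesis by (intro that[of "\<bar>m\<bar>+1"]) auto
qed

text \<open>Strong convergence of bounded operators is uniform on the relatively compact image of the unit ball under \<open>F\<^sup>2 - 1\<close>.\<close>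

lemma sfam_cube:
 assumes F: "sfam B F" and N: "N >= 1" "!!b. b:tsp1 B==>norm (F b)<=N"
 shows "cmap B eucl1 (%b. F b oL dfc (F b))"
proof (rule cm_metricI)
 fix b0 and ep :: real assume b0: "b0:tsp1 B" and ep: "ep > 0"
 \<comment> \<open>The error will be at most 3 N + 1 times \<open>et\<close>: N for the change of
   \<open>dfc\<close>, 2 N for the part outside the span of the \<open>e i\<close>, and 1 for the
   finitely many vectors \<open>e i\<close>.\<close>
 define et where "et=ep / (3 * N+2)"
 have et: "et > 0" "(3 * N+1) * et < ep" using ep N(1) by (simp_all add: et_def field_simps)
 let ?k = "%b. dfc (F b)"
 have k0: "?k b0:coop" using F b0 by (simp add: sfam_def)
 obtain S where S: "finite S" "!!p x. opr p==>(!!s. s:S==>p s=s)==>norm (?k b0 x - p (?k b0 x))<=et * norm x"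
  using cpt_ops_approx[OF k0 et(1)] by metis
 obtain n e where e: "onf n e" "!!v. v:S==>fproj n e v=v" using onf_fin_set[OF S(1)] by metis
 have e1: "norm (e i)=1" if "i < n" for i using e(1) that unfolding onf_def by (simp add: norm_eq_1 inner_cin)
 let ?P = "fproj n e"
 have P: "norm (?k b0 x - ?P (?k b0 x))<=et * norm x" for x using S(2)[OF fproj(1)[OF e(1)]] e(2) by blast
 define h where "h b=(\<Sum>i<n. norm (F b (e i) - F b0 (e i)))" for b
 have Fv: "cmap B eucl1 (%b. F b v)" for v using F by (simp add: sfam_def)
 have ch: "cmap B eucl1 h" unfolding h_def[abs_def] by (intro cm_sum cm_norm cm_df Fv cm_cst)
 have ck: "cmap B eucl1 ?k" using F by (simp add: sfam_def)
 let ?U = "{b:tsp1 B. dist (?k b) (?k b0) < et} Int {b:tsp1 B. dist (h b) 0 < et / (norm (?k b0)+1)}"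
 have "dist (F b oL ?k b) (F b0 oL ?k b0) < ep" if b: "b:?U" for b
 proof -
  have bB: "b:tsp1 B" and d: "norm (?k b - ?k b0) < et" and hb: "\<bar>h b\<bar> < et / (norm (?k b0)+1)" using b by (auto simp: dist_norm)
  have h0: "h b >= 0" by (simp add: h_def sum_nonneg)
  have hb: "norm (?k b0) * h b<=et"
  proof -
   have "norm (?k b0) * h b<=(norm (?k b0)+1) * h b" using h0 by (intro mrm) auto
   also have "... <= et" using hb h0 by (simp add: pos_less_divide_eq add_nonneg_pos muco)
   finally show ?thesis .
  qed
  have lin: "clin1 (F b)" "clin1 (F b0)" using F bB b0 by (auto simp: sfam_def)
  have "norm ((F b oL ?k b) - (F b0 oL ?k b0))<=(3 * N+1) * et"
  proof (rule norm_blinfun_bound)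
   fix x
   let ?y = "?k b0 x"
   let ?D = "F b - F b0"
   have D: "norm (?D z)<=2 * N * norm z" for z
   proof -
    have "norm ?D<=2 * N" using norm_triangle_ineq4[of "F b" "F b0"] N(2)[OF bB] N(2)[OF b0] by linarith
    then show ?thesis by (meson mrm norm_blinfun norm_ge_zero order_trans)
   qed
   have "?D (?P ?y)=(\<Sum>i<n. cin1 ?y (e i) *C (F b (e i) - F b0 (e i)))"
    by (simp add: fproj_def bdl1 bsl blinfun.sum_right clinD[OF lin(1)] clinD[OF lin(2)] sC_df_r sum_subtractf)
   also have "norm ... <= (\<Sum>i<n. norm ?y * norm (F b (e i) - F b0 (e i)))"
   proof (rule sum_norm_le)
    fix i assume "i:{..<n}"
    then have "cmod (cin1 ?y (e i))<=norm ?y" using cmod_cin_le[of ?y "e i"] e1[of i] by simp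
    then show "norm (cin1 ?y (e i) *C (F b (e i) - F b0 (e i)))<=norm ?y * norm (F b (e i) - F b0 (e i))"
     unfolding norm_sC by (rule mrm) simp
   qed
   also have "... = norm ?y * h b" by (simp add: h_def sum_distrib_left)
   also have "... <= norm (?k b0) * norm x * h b" by (rule mrm[OF norm_blinfun h0])
   also have "... <= et * norm x" using mrm[OF hb norm_ge_zero[of x]] by (simp add: mult_ac)
   finally have 3: "norm (?D (?P ?y))<=et * norm x" .
   have 2: "norm (?D (?y - ?P ?y))<=2 * N * (et * norm x)" using D[of "?y - ?P ?y"] P[of x] N(1) mult_left_mono[OF P[of x], of "2 * N"] by linarith
   have "norm (F b ((?k b - ?k b0) x))<=N * (et * norm x)"
    using norm_blinfun[of "F b"] norm_blinfun[of "?k b - ?k b0" x] d N(2)[OF bB] N(1)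
    by (meson less_imp_le mult_mono mrm norm_ge_zero order_trans zero_le_one)
   moreover have "((F b oL ?k b) - (F b0 oL ?k b0)) x=F b ((?k b - ?k b0) x)+?D (?y - ?P ?y)+?D (?P ?y)"
    by (simp add: bbs)
   moreover have "norm (a + c+d')<=norm a+norm c+norm d'" for a c d' :: 'b by (meson add_right_mono norm_triangle_ineq order_trans)
   ultimately have "norm (((F b oL ?k b) - (F b0 oL ?k b0)) x)<=N * (et * norm x)+2 * N * (et * norm x)+et * norm x"
    using 2 3 by (smt (verit))
   then show "norm (((F b oL ?k b) - (F b0 oL ?k b0)) x)<=(3 * N+1) * et * norm x" by (simp add: alsi)
  qed (use N(1) et(1) in simp)
  then show ?thesis using et(2) by (simp add: dist_norm)
 qed
 moreover have "openin B ?U" by (intro openin_Int cm_metricD ck ch)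
 moreover have "b0:?U" using b0 et(1) by (simp add: h_def add_nonneg_pos)
 ultimately show "EX U. openin B U&b0:U&(ALL b:U. dist (F b oL ?k b) (F b0 oL ?k b0) < ep)" by blast
qed

text \<open>Each term has the compact factor \<open>dfc F\<close>, so the shifted operator again
  squares to 1 modulo compact operators. Norm continuity of the mixed term is the content of
  \<open>sfam_cube\<close>.\<close>

lemma dfc_shift:
 "dfc (F+r *R dfc F)=dfc F+(2 * r) *R (F oL dfc F)+(r * r) *R (dfc F oL dfc F)"
 by (rule bleq) (simp add: bbs alsi scaleR_2 flip: scaleR_scaleR)

lemma dfc_adj: "sadj1 F==>sadj1 (dfc F)" "clin1 F==>clin1 (dfc F)"
 by (simp_all add: sad cld bdl1 cin_df_l cin_df_r sC_df_r)

lemma sfam_shift: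
 assumes F: "sfam B F" and N: "N >= 1" "!!b. b:tsp1 B==>norm (F b)<=N"
 shows "sfam (prt unitI B) (%x. F (snd x)+(fst x * a) *R dfc (F (snd x)))"
proof -
 let ?I = "prt unitI B"
 have c: "cmap ?I eucl1 (%x. h (snd x))" if "cmap B eucl1 h" for h :: "_=>'z::topological_space"
  using that by (rule cm_snd)
 have cr: "cmap ?I eucl1 (%x. fst x * a)"
  by (rule cm_comp_on[of _ fst UNIV "%t. t * a", OF continuous_map_into_fulltopology[OF cmf]]) (auto intro!: continuous_intros)
 have Fp: "cmap B eucl1 (%b. F b v)" "cmap B eucl1 (%b. dfc (F b))" for v using F by (auto simp: sfam_def)
 have "cmap B eucl1 (%b. dfc (F b) v)" for v by (rule cm_ap[OF Fp(2) cm_cst])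
 note cv = c[OF this]
 note ck = c[OF Fp(2)]
 have cr2: "cmap ?I eucl1 (%x. 2*(fst x * a))" "cmap ?I eucl1 (%x. fst x * a * (fst x * a))"
  by (rule cm_comp_on[OF cr, where S = UNIV]; auto intro!: continuous_intros)+
 show ?thesis
  unfolding sfam_def dfc_shift
 proof (intro conjI ballI allI)
  fix x assume "x:tsp1 ?I"
  then have x: "clin1 (F (snd x))" "sadj1 (F (snd x))" "dfc (F (snd x)):coop" using F by (auto simp: sfam_def)
  show "clin1 (F (snd x)+(fst x * a) *R dfc (F (snd x)))" by (intro clin_add clin_sR dfc_adj x)
  show "sadj1 (F (snd x)+(fst x * a) *R dfc (F (snd x)))" by (intro sadj_add sadj_sR dfc_adj x)
  show "dfc (F (snd x))+(2*(fst x * a)) *R (F (snd x) oL dfc (F (snd x)))+(fst x * a * (fst x * a)) *R (dfc (F (snd x)) oL dfc (F (snd x))):coop"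
   by (rule cpt_ops_add[OF cpt_ops_add[OF x(3) cpt_ops_sR[OF cpt_ops_o[OF x(3,1)]]] cpt_ops_sR[OF cpt_ops_o[OF x(3) dfc_adj(2)[OF x(1)]]]])
 next
  show "cmap ?I eucl1 (%x. (F (snd x)+(fst x * a) *R dfc (F (snd x))) v)" for v
   unfolding blinfun.add_left bsl1 by (rule cm_add[OF c[OF Fp(1)] cm_sR[OF cr cv]])
  show "cmap ?I eucl1 (%x. dfc (F (snd x))+(2*(fst x * a)) *R (F (snd x) oL dfc (F (snd x)))+(fst x * a * (fst x * a)) *R (dfc (F (snd x)) oL dfc (F (snd x))))"
   by (rule cm_add[OF cm_add[OF ck cm_sR[OF cr2(1) c[OF sfam_cube[OF F N]]]] cm_sR[OF cr2(2) cm_o[OF ck ck]]])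
 qed
qed

text \<open>With \<open>a = \<lambda> / (1 - \<lambda>\<^sup>2)\<close>, the operator \<open>F + a (F\<^sup>2 - 1) = a (F - \<lambda>) (F + 1 / \<lambda>)\<close> is invertible
 as soon as \<open>F - \<lambda>\<close> is and \<open>\<lambda>\<close> is small.\<close>

lemma shift_bounded_below:
 assumes F: "clin1 F" "norm F<=N" and l: "0 < l" "l < 1" "l * N < 1" and inv: "cofr l ~: spec F"
 obtains de where "de > 0" "!!v. de * norm v<=norm ((F+(l / (1 - l\<^sup>2)) *R dfc F) v)"
proof -
 define a where "a=l / (1 - l\<^sup>2)"
 have l2: "l\<^sup>2 < 1" using l by (simp add: pes) (metis mult_strict_mono' less_imp_le mult_1 not_less)
 \<comment> \<open>The second equation says that F has coefficient 1 in a (F - l) (F + 1 /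
   l).\<close>
 have a: "a > 0" "a * (1 / l - l)=1" using l l2 by (simp_all add: a_def field_simps pes)
 have sc: "scaleC_op (of_real l) idb=l *R (idb :: 'a op)" by (rule bleq) (simp add: sor bsl1)
 obtain G where G: "G oL (F - l *R idb)=idb" using inv by (auto simp: spec_def invertible_op_def sc)
 define d where "d=1 / (norm G+1)"
 have d: "d > 0" by (simp add: d_def add_nonneg_pos)
 have 1: "d * norm v<=norm (F v - l *R v)" for v
 proof -
  have "v=G (F v - l *R v)" using arg_cong[OF G, of "%T. T v"] by (simp add: bdl1 bsl1)
  then have "norm v<=norm G * norm (F v - l *R v)" using norm_blinfun[of G "F v - l *R v"] by simp
  also have "... <= (norm G+1) * norm (F v - l *R v)" by (intro mrm) auto
  finally show ?thesis by (simp add: d_def pos_divide_le_eq add_nonneg_pos muco)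
 qed
 \<comment> \<open>The second factor F + 1 / l is bounded below because
   \<open>norm F <= N < 1 / l\<close>.\<close>
 have N1: "1 / l - N > 0" using l by (simp add: field_simps)
 have 2: "(1 / l - N) * norm v<=norm (F v+(1 / l) *R v)" for v
 proof -
  have "norm (F v)<=N * norm v" using norm_blinfun[of F v] F(2) by (meson mrm norm_ge_zero order_trans)
  moreover have "norm ((1 / l) *R v)=1 / l * norm v" using l by simp
  moreover have "norm ((1 / l) *R v)<=norm (F v+(1 / l) *R v)+norm (F v)" using norm_triangle_ineq4[of "F v+(1 / l) *R v" "F v"] by simp
  ultimately show ?thesis by (simp only: left_diff_distrib)
 qed
 have "(F+a *R dfc F) v=a *R (F (F v+(1 / l) *R v) - l *R (F v+(1 / l) *R v))" for v
 proof -
  have "F v=(a * (1 / l - l)) *R F v" by (simp only: a(2) scaleR_one)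
  then show ?thesis using l by (simp add: bbs alsi)
 qed
 moreover have "(a * d * (1 / l - N)) * norm v<=norm (a *R (F (F v+(1 / l) *R v) - l *R (F v+(1 / l) *R v)))" for v
 proof -
  have "d * ((1 / l - N) * norm v)<=norm (F (F v+(1 / l) *R v) - l *R (F v+(1 / l) *R v))"
   using mult_left_mono[OF 2[of v], of d] 1 d by (meson less_imp_le order_trans)
  from mult_left_mono[OF this, of a] show ?thesis using a(1) by (simp add: mult.assoc)
 qed
 ultimately have 3: "(a * d * (1 / l - N)) * norm v<=norm ((F+a *R dfc F) v)" for v by (simp only:)
 show ?thesis by (rule that[of "a * d * (1 / l - N)"]) (use a(1) d N1 3 in "simp_all only: a_def mult_pos_pos")
qed

text \<open>Pigeonhole: the k + 1 distinct numbers \<open>l j\<close> with j <= k cannot all be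
  spectral values in the given interval. The lower bound is tested on the square \<open>Q j\<close>
  of the shifted operator, which is norm continuous, while the operator itself is only strongly so.
  \<open>K j\<close> is the closed set on which \<open>Q j\<close> has the common lower bound
  d.\<close>

lemma spectral_cover:
 fixes F :: "'b=>'h::complex_hilbert op"
 assumes F: "sfam B F" and B: "cspc B" and N: "N >= 1" "!!b. b:tsp1 B==>norm (F b)<=N" and ep: "0 < ep" "ep < 1"
  and sp: "!!b. b:tsp1 B==>finite (spec (F b) Int cofr ` {-ep<..<ep})&card (spec (F b) Int cofr ` {-ep<..<ep})<=k"
 obtains a V K where "!!j. openin B (V j)" "!!j. closedin B (K j)" "!!j. V j \<subseteq> K j" "tsp1 B=(\<Union>j\<le>k. V j)"
  "!!j b. b:K j==>EX de>0. ALL v. de * norm v<=norm ((F b+a j *R dfc (F b)) v)"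
proof -
 \<comment> \<open>The bound 1 / (N + 1) yields \<open>l j * N < 1\<close>, as
   \<open>shift_bounded_below\<close> asks; dividing by j + 2 makes the \<open>l j\<close> distinct
   and strictly smaller than \<open>mu\<close>.\<close>
 define mu where "mu=min ep (1 / (N+1))"
 have mu: "0 < mu" "mu<=ep" "mu * N < 1" using ep N(1) by (auto simp: mu_def min_def field_simps)
 define l where "l j=mu / (real j+2)" for j :: nat
 have l: "0 < l j" "l j < ep" "l j * N < 1" for j
 proof -
  have "l j < mu" "0 < l j" using mu(1) by (auto simp: l_def field_simps add_pos_nonneg)
  moreover from this(1) have "l j * N < mu * N" using N(1) by simp
  ultimately show "0 < l j" "l j < ep" "l j * N < 1" using mu by auto
 qed
 have il: "inj l" using mu(1) by (auto simp: inj_def l_def field_simps)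
 define a where "a j=l j / (1 - (l j)\<^sup>2)" for j
 define G where "G j b=F b+a j *R dfc (F b)" for j b
 define Q where "Q j b=(G j b oL G j b)" for j b
 have cQ: "cmap B eucl1 (Q j)" for j
 proof -
  have "cmap B (prt unitI B) (%b. (1, b))" by (simp add: cmp o_def)
  from sfam_pull[OF sfam_shift[OF F N] this] have "sfam B (G j)" by (simp add: G_def[abs_def])
  from cm_add[OF this[unfolded sfam_def, THEN conjunct2, THEN conjunct2] cm_cst[of _ id_blinfun]] show ?thesis by (simp add: Q_def[abs_def])
 qed
 have "EX j<=k. EX de>0. ALL v. de * norm v<=norm (Q j b v)" if b: "b:tsp1 B" for b
 proof -
  have "EX j<=k. cofr (l j) ~: spec (F b)"
  proof (rule ccontr)
   assume "~ ?thesis"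
   then have "(%j. cofr (l j)) ` {..k} \<subseteq> spec (F b) Int cofr ` {-ep<..<ep}" using l order.strict_trans[OF _ l(1), of "-ep"] ep(1) by (auto intro!: imageI)
   then have "card ((%j. cofr (l j)) ` {..k})<=k" using sp[OF b] card_mono by (meson order_trans)
   moreover have "inj_on (%j. cofr (l j)) {..k}" using il by (auto simp: inj_def inj_on_def)
   ultimately show False by (simp add: card_image)
  qed
  then obtain j where j: "j<=k" "cofr (l j) ~: spec (F b)" by blast
  have "clin1 (F b)" "l j < 1" using F b l(2)[of j] ep by (auto simp: sfam_def)
  then obtain de where de: "de > 0" "!!v. de * norm v<=norm (G j b v)"
   using shift_bounded_below[OF _ N(2)[OF b] l(1) _ l(3) j(2)] unfolding G_def a_def by metis
  have "de * de * norm v<=norm (Q j b v)" for v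
   using order_trans[OF mult_left_mono[OF de(2)[of v], of de] de(2)[of "G j b v"]] de(1) by (simp add: Q_def mult.assoc)
  then show ?thesis using j(1) de(1) by (meson mult_pos_pos)
 qed
 then obtain j de where jde: "!!b. b:tsp1 B==>j b<=k&de b > 0&(ALL v. de b * norm v<=norm (Q (j b) b v))" by metis
 define U where "U b={c:tsp1 B. dist (Q (j b) c) (Q (j b) b) < de b / 2}" for b
 have U: "openin B (U b)" for b unfolding U_def by (rule cm_metricD[OF cQ])
 have Ub: "de b / 2 * norm v<=norm (Q (j b) c v)" if "b:tsp1 B" "c:U b" for b c v
 proof -
  have "norm (Q (j b) c - Q (j b) b)<=de b / 2" using that(2) by (simp add: U_def dist_norm)
  then have "norm ((Q (j b) c - Q (j b) b) v)<=de b / 2 * norm v" by (meson mrm norm_blinfun norm_ge_zero order_trans)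
  moreover have "norm (Q (j b) b v)<=norm (Q (j b) c v)+norm ((Q (j b) c - Q (j b) b) v)"
   using norm_triangle_ineq4[of "Q (j b) c v" "(Q (j b) c - Q (j b) b) v"] by (simp add: bdl1)
  moreover have "de b * norm v<=norm (Q (j b) b v)" using jde[OF that(1)] by blast
  ultimately show ?thesis by simp
 qed
 have self: "b:U b" if "b:tsp1 B" for b using that jde[OF that] by (simp add: U_def)
 have "EX FF. finite FF&FF \<subseteq> U ` tsp1 B&tsp1 B \<subseteq> \<Union>FF"
  using B[unfolded compact_space_def compactin_def, THEN conjunct2, rule_format, of "U ` tsp1 B"] U self by blast
 then obtain T where T: "finite T" "T \<subseteq> tsp1 B" "tsp1 B \<subseteq> (\<Union>b\<in>T. U b)" by (metis finite_subset_image)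
 define d where "d=Min (insert 1 ((%b. de b / 2) ` T))"
 have d: "d > 0" "b:T==>d<=de b / 2" for b
 proof -
  show "d > 0" using T jde by (auto simp: d_def)
  show "b:T==>d<=de b / 2" unfolding d_def by (rule Min_le) (use T(1) in auto)
 qed
 define V where "V i=(\<Union>b\<in>{b:T. j b=i}. U b)" for i
 define K where "K i={c:tsp1 B. ALL v. d * norm v<=norm (Q i c v)}" for i
 have "\<Inter>((%v. {c:tsp1 B. norm (Q i c v) \<in> {d * norm v..}}) ` UNIV)=K i" for i by (auto simp: K_def)
 moreover have "closedin B {c:tsp1 B. norm (Q i c v):{d * norm v..}}" for i v
  by (rule closedin_continuous_map_preimage[OF cm_norm[OF cm_ap[OF cQ cm_cst]]]) simp
 ultimately have 2: "closedin B (K i)" for i by (metis (no_types, lifting) UNIV_not_empty closedin_INT)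
 have 1: "openin B (V i)" for i unfolding V_def using U by blast
 have 3: "V i \<subseteq> K i" for i
 proof
  fix c assume "c:V i"
  then obtain b where b: "b:T" "j b=i" "c:U b" by (auto simp: V_def)
  then have "d * norm v<=norm (Q i c v)" for v
   using Ub[of b c v] d(2)[OF b(1)] T(2) mrm[OF d(2)[OF b(1)], of "norm v"] by (auto intro: order_trans)
  then show "c:K i" using b(3) by (simp add: K_def U_def)
 qed
 have 4: "tsp1 B=(\<Union>i\<le>k. V i)"
 proof
  show "tsp1 B \<subseteq> (\<Union>i\<le>k. V i)"
  proof
   fix b assume "b:tsp1 B"
   then obtain t where "t:T" "b:U t" using T(3) by blast
   moreover from this have "j t<=k" using T(2) jde by blast
   ultimately show "b:(\<Union>i\<le>k. V i)" by (auto simp: V_def)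
  qed
 qed (use 1 openin_subset in blast)
 have 5: "EX de>0. ALL v. de * norm v<=norm (G i c v)" if "c:K i" for i c
 proof (intro exI conjI allI)
  fix v
  have "d * norm v<=norm (G i c (G i c v))" using that by (simp add: K_def Q_def)
  also have "... <= (norm (G i c)+1) * norm (G i c v)" using norm_blinfun[of "G i c" "G i c v"] by (simp add: distrib_right add_increasing2)
  finally show "d / (norm (G i c)+1) * norm v<=norm (G i c v)" by (simp add: pos_divide_le_eq add_nonneg_pos muco)
 qed (use d(1) in "simp add: add_nonneg_pos")
 show ?thesis by (rule that[of V K a, OF 1 2 3 4 5[unfolded G_def]])
qed

text \<open>\<open>cin1 v (A v)\<close> is real, so the real inner product of the two summands is a
  multiple of \<open>b * Im z\<close> and Pythagoras applies.\<close>

lemma norm_twist: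
 assumes A: "sadj1 A" and b: "b * Im z=0"
 shows "(norm (z *C v+(\<i> * cofr b) *C A v))\<^sup>2=(cmod z)\<^sup>2*(norm v)\<^sup>2+b\<^sup>2*(norm (A v))\<^sup>2"
proof -
 have "cin1 v (A v) = cnj (cin1 v (A v))" by (rule trans[OF cico]) (simp only: A[unfolded sad, rule_format])
 then have r: "Im (cin1 v (A v))=0" by (simp add: cei)
 have "inner (z *C v) ((\<i> * cofr b) *C A v)=b * Im z * Re (cin1 v (A v))"
  unfolding inner_cin csl cin_sC_r by (simp add: r)
 then have "(norm (z *C v+(\<i> * cofr b) *C A v))\<^sup>2=(norm (z *C v))\<^sup>2+(norm ((\<i> * cofr b) *C A v))\<^sup>2"
  using b by (simp add: power2_norm_eq_inner inner_add_left inner_add_right inner_commute)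
 then show ?thesis by (simp add: norm_sC norm_mult pmd)
qed

lemma AS_fam1:
 assumes M: "sfam K M"
 shows "fam (SSP K) (ASg M)"
proof -
 have "sfam (prt unitI K) (%x. M (snd x))" by (rule sfam_pull[OF M cms])
 from fam_pull[OF AS_fam[OF this], of "SSP K" "%x. (0, x)"] show ?thesis by (simp add: cmp o_def)
qed

text \<open>The weights of \<open>norm v\<close> and \<open>norm (M b v)\<close> in
  \<open>norm_twist\<close> add up to 1, so a lower bound for \<open>M b\<close> gives one along the
  whole loop; the adjoint has the same form.\<close>

lemma AS_invertible:
 assumes M: "sfam K M" and lo: "!!b. b:tsp1 K==>EX de>0. ALL v. de * norm v<=norm (M b v)"
 shows "ch (SSP K) (ASg M) (%i. if i=0 then un else 0)"
proof -
 have *: "EX de>0. ALL v. de * (norm v)\<^sup>2<=(norm (ASg M x v))\<^sup>2&de * (norm v)\<^sup>2<=(norm (adj (ASg M x) v))\<^sup>2"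
  if x: "x:tsp1 (SSP K)" for x
  using x
 proof (rule sma_cases)
  assume "x=None"
  then show ?thesis by (intro exI[of _ 1]) (simp add: AS_ap(2) adj_id)
 next
  fix z b assume x: "x=Some (z, Some b)" and z: "cmod z=1" and b: "b:tsp1 K"
  obtain de where de: "de > 0" "!!v. de * norm v<=norm (M b v)" using lo[OF b] by blast
  have A: "clin1 (M b)" "sadj1 (M b)" using M b by (auto simp: sfam_def)
  have im: "be z * Im (ze z)=0" by (simp add: ze_def be_def max_def)
  have le: "min 1 (de\<^sup>2)*(norm v)\<^sup>2<=(cmod (ze z))\<^sup>2*(norm v)\<^sup>2+(be z)\<^sup>2*(norm (M b v))\<^sup>2" for v
  proof -
   have "min 1 (de\<^sup>2)*(norm v)\<^sup>2<=(norm v)\<^sup>2" by (rule mult_left_le_one_le) (auto simp: de(1))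
   moreover have "min 1 (de\<^sup>2)*(norm v)\<^sup>2<=de\<^sup>2*(norm v)\<^sup>2" by (rule mrm) auto
   then have "min 1 (de\<^sup>2)*(norm v)\<^sup>2<=(norm (M b v))\<^sup>2"
    using power_mono[OF de(2)[of v], of 2] de(1) by (simp add: pmd)
   ultimately have "(cmod (ze z))\<^sup>2*(min 1 (de\<^sup>2)*(norm v)\<^sup>2)+(be z)\<^sup>2*(min 1 (de\<^sup>2)*(norm v)\<^sup>2)<=(cmod (ze z))\<^sup>2*(norm v)\<^sup>2+(be z)\<^sup>2*(norm (M b v))\<^sup>2"
    by (intro add_mono mult_left_mono) auto
   then show ?thesis by (simp only: zebe(1)[OF z] mult_1 flip: distrib_right)
  qed
  have 1: "(norm (ASg M x v))\<^sup>2=(cmod (ze z))\<^sup>2*(norm v)\<^sup>2+(be z)\<^sup>2*(norm (M b v))\<^sup>2" for v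
   unfolding x AS_ap by (rule norm_twist[OF A(2) im])
  have 2: "(norm (adj (ASg M x) v))\<^sup>2=(cmod (ze z))\<^sup>2*(norm v)\<^sup>2+(be z)\<^sup>2*(norm (M b v))\<^sup>2" for v
   unfolding x AS_facts(2)[where A = M, OF A z] using norm_twist[OF A(2), of "- be z" "cnj (ze z)" v] im by (simp add: sC_minus_l)
  show ?thesis unfolding 1 2 using de(1) le by (intro exI[of _ "min 1 (de\<^sup>2)"]) auto
 qed
 show ?thesis
 proof (rule ch_invertible[OF AS_fam1[OF M]])
  fix x v assume x: "x:tsp1 (SSP K)" and v: "ASg M x v=0"
  from *[OF x] obtain de where "de > 0" "de * (norm v)\<^sup>2<=(norm (ASg M x v))\<^sup>2" by blast
  then show "v=0" using v by (simp add: mult_le_0_iff)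
 next
  fix x assume "x:tsp1 (SSP K)"
  from *[OF this] show "EX de>0. ALL v. de * (norm v)\<^sup>2<=(norm (adj (ASg M x) v))\<^sup>2" by blast
 qed
qed

text \<open>The cochains c belong to the loop of A. Over K the given homotopy relates them to the
  loop of F, and the shift relates this one to a loop of invertible operators, whose Chern cochains
  are known from \<open>AS_invertible\<close>.\<close>

theorem chn_vanish:
 fixes F :: "'b=>'h::complex_hilbert op"
 assumes B: "cspc B" and hom: "homotopic_with (%_. True) B Fred_tilde F A" and c: "ch (SSP B) (ASg A) c"
  and K: "closedin B K" and N: "N >= 1" "!!b. b:tsp1 B==>norm (F b)<=N"
  and lo: "!!b. b:K==>EX de>0. ALL v. de * norm v<=norm ((F b+a *R dfc (F b)) v)" and i: "i > 0"
 shows "coh (Sing (SSP (sbt1 B K))) (pb (%x. x) (c i)) 0"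
proof -
 let ?K = "sbt1 B K"
 let ?X = "SSP ?K"
 have cK: "cspc ?K" using B K by (simp add: closedin_compact_space compact_space_subtopology)
 note X = sma_cpt[OF cK] sma_cnd[of ?K]
 obtain h where h: "cmap (prt unitI B) Fred_tilde h" "!!x. h (0, x)=F x" "!!x. h (1, x)=A x"
  using hom unfolding homotopic_with_def by blast
 have g: "cmap (prt unitI ?K) (prt unitI B) (%x. x)"
  by (simp add: cmp o_def cmf continuous_map_into_fulltopology[OF cms])
 have F: "sfam B F" using homotopic_with_imp_continuous_maps[OF hom] sfam_Fred_tilde by blast
 let ?h = "%x. ASg (%b. h (fst x, b)) (snd x)"
 have fh: "fam (prt unitI ?X) ?h"
  by (rule AS_fam) (use sfam_pull[OF sfam_Fred_tilde[OF h(1)] g] in simp)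
 let ?G = "%x. F (snd x)+(fst x * a) *R dfc (F (snd x))"
 have G: "sfam (prt unitI ?K) ?G" using sfam_pull[OF sfam_shift[OF F N] g] by simp
 let ?g = "%x. ASg (%b. ?G (fst x, b)) (snd x)"
 have fg: "fam (prt unitI ?X) ?g" by (rule AS_fam[OF G])
 have FK: "sfam ?K F" by (rule sfam_pull[OF F, of _ "%x. x", simplified]) (simp add: cmfs)
 obtain c1 where c1: "ch ?X (ASg F) c1" by (rule ch_ex[OF X AS_fam1[OF FK]])
 have "coh (Sing ?X) (c1 i) (pb (%x. x) (c i))"
  by (rule ch_hty[OF X fh]) (use c1 ch_pull[OF c sma_inclusion] in "simp_all add: h")
 moreover have "coh (Sing ?X) (c1 i) (if i=0 then un else 0)"
 proof (rule ch_hty[OF X fg, where c = c1 and c' = "%i. if i=0 then un else 0"])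
  show "ch ?X (%x. ?g (0, x)) c1" using c1 by simp
  have "cmap ?K (prt unitI ?K) (%b. (1, b))" by (simp add: cmp o_def)
  from sfam_pull[OF G this] have "sfam ?K (%b. F b+a *R dfc (F b))" by simp
  then have "ch ?X (ASg (%b. F b+a *R dfc (F b))) (%i. if i=0 then un else 0)"
   by (rule AS_invertible) (rule lo, simp)
  then show "ch ?X (%x. ?g (1, x)) (%i. if i=0 then un else 0)" by simp
 qed
 then have "coh (Sing ?X) (c1 i) 0" using i by simp
 ultimately show ?thesis by (rule coh_trans[OF coh_sym])
qed

section \<open>Suspension and cup products\<close>

text \<open>A simplex of even dimension m has an odd number of faces, so for constant simplices a
  constant cochain of degree m - 1 is a primitive. This serves to make cocycles vanish at the base
  point.\<close>

lemma const_xct: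
 assumes "deg m fi=fi" "even m" "m > 0"
 shows "coh T (pb (%_. c) fi) 0"
proof -
 define v where "v=fi m (restrict (%_. c) (Dl m))"
 define tt :: "'b tc" where "tt n sg=(if n=m - 1 then v else 0)" for n sg
 have s: "(\<Sum>k\<le>n. (-1) ^ k * v)=(if even n then v else 0)" for n :: nat by (induction n) auto
 have "fi n sg=0" if "n~=m" for n sg using fun_cong[OF fun_cong[OF assms(1)], of n sg] that by (simp add: deg_def)
 then have "pb (%_. c) fi n sg = cd tt n sg" for n sg
  using assms(2,3) s[of m] by (cases "n=m") (auto simp: pb_def cd_def tt_def smd o_def v_def)
 then have "pb (%_. c) fi = cd tt" by (intro ext)
 then show ?thesis by (simp add: coh_cd)
qed

lemma const_Sub: "eqn (Sub X {c}) (pb (%_. c) fi) fi"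
 by (rule pb_id_on) simp

lemma deg_df: "deg m (fi - ps)=deg m fi - deg m ps"
 by (intro ext) (simp add: deg_def)

lemma eq_homogeneous: "deg n fi=fi==>deg n ps=ps==>eqn T fi ps<->(ALL sg:T n. fi n sg=ps n sg)"
 unfolding eqn_def by (metis deg_def)

definition sq :: "real \<times> 'b option=>(complex \<times> 'b option) option" where
 "sq=(%(t, y). smash_map 1 None (cis (2 * pi * t), y))"

abbreviation "ssp B == prt unitI (plt B)"

lemma cm_sq: "cmap (ssp B) (SSP B) sq"
proof -
 have "cmap (ssp B) eucl1 (%x. cis (2 * pi * fst x))"
  by (rule cm_comp_on[OF cm_fst, where S = UNIV]) (auto intro!: continuous_intros)
 then have "cmap (ssp B) (prt S1 (plt B)) (%x. (cis (2 * pi * fst x), snd x))"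
  by (auto simp: cmp o_def cmis cms)
 from cmc[OF this quotient_imp_continuous_map[OF quo_sma]] show ?thesis by (simp add: sq_def o_def spde)
qed

abbreviation "sbase == {(t :: real, y). t=0 | y=None}"

lemma sq_base: "x:sbase==>sq x=None" "sq (1, y)=None"
 by (auto simp: sq_def smash_map_def)

lemma None_sma: "None:tsp1 (SSP B)"
 by (force simp: sma_tsp plus_tsp smash_map_def)

text \<open>The pairs over which the union in \<open>suspension_iso\<close> runs, as homogeneous
  total cochains; \<open>susp_iff\<close> is the translation.\<close>

definition susp :: "'b topology=>nat=>(complex \<times> 'b option) option tc=>(real \<times> 'b option) tc=>(complex \<times> 'b option) option tc=>bool" where
 "susp B n c PH0 XI<->deg n PH0=PH0&deg (Suc n) XI=XI&coh (Sing (SSP B)) XI (deg (Suc n) c) &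
  eqn (Sub (SSP B) {None}) XI 0&eqn (Sub (ssp B) sbase) PH0 0&eqn (Sing (ssp B)) (cd PH0) (pb sq XI)"

lemma susp_iff:
 assumes "deg n PH0=PH0" "deg (Suc n) XI=XI"
 shows "susp B n c PH0 XI<->tr (Suc n) (SSP B) XI:cl (Suc n) (SSP B) c &
  vanishes_on (Suc n) (SSP B) {None} (tr (Suc n) (SSP B) XI) &
  vanishes_on n (ssp B) sbase (tr n (ssp B) PH0) &
  coboundary n (ssp B) (tr n (ssp B) PH0) = cochain_pull (Suc n) (ssp B) sq (tr (Suc n) (SSP B) XI)"
proof -
 let ?X = "SSP B" and ?I = "ssp B"
 have v: "vanishes_on m Y S (tr m Y fi)<->eqn (Sub Y S) fi 0" if "deg m fi=fi" for m S and Y :: "'z topology" and fi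
  unfolding vanishes_on_def eq_homogeneous[OF that deg_0] by (auto simp: tr_def Sing_def sss)
 have "cohn (Suc n) ?X XI ps" if "tr (Suc n) ?X XI=tr (Suc n) ?X ps" for ps
  unfolding cohn_def using that tr_eq_iff[of "Suc n" ?X XI ps] by (intro exI[of _ 0]) simp
 then have "tr (Suc n) ?X XI:cl (Suc n) ?X c<->cohn (Suc n) ?X XI c"
  unfolding cl_eq using coh_trans unfolding cohn_coh by blast
 then have 1: "tr (Suc n) ?X XI:cl (Suc n) ?X c<->coh (Sing ?X) XI (deg (Suc n) c)" by (simp add: cohn_coh assms)
 have "cochain_pull (Suc n) ?I sq (tr (Suc n) ?X XI)=tr (Suc n) ?I (pb sq XI)"
  using Sing_map[OF cm_sq, of _ B "Suc n"] by (auto simp: cochain_pull_def tr_def pb_def Sing_def)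
 then have 2: "coboundary n ?I (tr n ?I PH0) = cochain_pull (Suc n) ?I sq (tr (Suc n) ?X XI)<->eqn (Sing ?I) (cd PH0) (pb sq XI)"
  unfolding coboundary_tr by (subst eq_homogeneous[where n = "Suc n"]) (simp_all add: assms tr_eq_iff flip: cd_deg pb_deg)
 show ?thesis unfolding susp_def 1 2 v[OF assms(1)] v[OF assms(2)] using assms by blast
qed

lemma suspension_iso_eq:
 "suspension_iso (plt B) None n (cl (Suc n) (SSP B) c)=\<Union> {cl n (plt B) (pb (Pair 1) PH0) | PH0 XI. susp B n c PH0 XI}"
proof -
 let ?X = "SSP B" and ?I = "ssp B" and ?Y = "plt B"
 have j: "cmap ?Y ?I (Pair 1)" by (simp add: cmp o_def)
 have e: "coh_class n ?Y (cochain_pull n ?Y (Pair 1) (tr n ?I PH0)) = cl n ?Y (pb (Pair 1) PH0)" for PH0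
  using Sing_map[OF j] by (auto simp: cl_def cochain_pull_def tr_def pb_def Sing_def intro!: arg_cong[where f = "coh_class n ?Y"])
 have td: "tr m Z (deg m fi)=tr m Z fi" for m fi and Z :: "'z topology" by (simp add: tr_eq_iff deg_def)
 have "(EX fi xi. S = coh_class n ?Y (cochain_pull n ?Y (Pair 1) fi)&xi:cl (Suc n) ?X c&vanishes_on (Suc n) ?X {None} xi&fi:cochains n ?I &
   vanishes_on n ?I sbase fi&coboundary n ?I fi = cochain_pull (Suc n) ?I sq xi) <->
  (EX PH0 XI. S = cl n ?Y (pb (Pair 1) PH0)&susp B n c PH0 XI)" (is "?L<->?R") for S
 proof
  assume ?L
  then obtain fi xi where *: "S = coh_class n ?Y (cochain_pull n ?Y (Pair 1) fi)" "xi:cl (Suc n) ?X c" "vanishes_on (Suc n) ?X {None} xi" "fi:cochains n ?I"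
   "vanishes_on n ?I sbase fi" "coboundary n ?I fi = cochain_pull (Suc n) ?I sq xi" by blast
  obtain XI0 where "xi=tr (Suc n) ?X XI0" using *(2) unfolding cl_eq by blast
  then have x: "tr (Suc n) ?X (deg (Suc n) XI0)=xi" by (simp add: td)
  have p: "tr n ?I (deg n (%_. fi))=fi" using *(4) by (simp add: td tr_tc)
  have "susp B n c (deg n (%_. fi)) (deg (Suc n) XI0)" using * by (subst susp_iff) (simp_all add: x p)
  moreover have "S = cl n ?Y (pb (Pair 1) (deg n (%_. fi)))" using e[of "deg n (%_. fi)"] by (simp add: *(1) p)
  ultimately show ?R by blast
 next
  assume ?R
  then obtain PH0 XI where *: "S = cl n ?Y (pb (Pair 1) PH0)" "susp B n c PH0 XI" by blast
  then have "deg n PH0=PH0" "deg (Suc n) XI=XI" by (simp_all add: susp_def)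
  from *(2)[unfolded susp_iff[OF this]] show ?L unfolding *(1) e[symmetric] using tr_cochains by blast
 qed
 then show ?thesis unfolding suspension_iso_def Let_def sq_def[symmetric] by (intro arg_cong[where f = Union] Collect_cong)
qed

text \<open>A union over all pairs: \<open>susp_xct\<close> applies to each of them, and
  \<open>vset\<close> keeps track of the union as a whole.\<close>

lemma c_odd_eq:
 assumes i: "i > 0" and c: "chern_K0 (SSP B) i \<kappa> = cl (2 * i) (SSP B) c"
 shows "c_odd B i \<kappa>=\<Union> {cl (2 * i - 1) B (pb (%b. (1, Some b)) PH0) | PH0 XI. susp B (2 * i - 1) c PH0 XI}"
proof -
 let ?n = "2 * i - 1"
 have n: "2 * i=Suc ?n" using i by simp
 have "c_odd B i \<kappa> = coh_pull ?n B Some (\<Union> {cl ?n (plt B) (pb (Pair 1) PH0) | PH0 XI. susp B ?n c PH0 XI})"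
  unfolding c_odd_def c by (subst (2) n) (simp only: suspension_iso_eq)
 also have "... = \<Union> {coh_pull ?n B Some (cl ?n (plt B) (pb (Pair 1) PH0)) | PH0 XI. susp B ?n c PH0 XI}"
  unfolding coh_pull_def by blast
 finally show ?thesis by (simp add: cl_pull[OF cm_Some] pb_pb o_def)
qed

lemma mp_None: "cmap Y (SSP B) f==>(!!y. y:tsp1 Y==>f y=None)==>maps f (Sing Y) (Sub (SSP B) {None})"
 by (rule mp_Sing) (auto simp: cmis)

lemma cm_end: "cmap B (ssp B) (%b. (1, Some b))"
 by (simp add: cmp o_def cm_Some)

lemma susp_closed:
 assumes "susp B n c PH0 XI"
 shows "eqn (Sing B) (cd (pb (%b. (1, Some b)) PH0)) 0" "deg n (pb (%b. (1, Some b)) PH0)=pb (%b. (1, Some b)) PH0"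
proof -
 let ?j = "%b. (1, Some b)"
 have "eqn (Sing B) (pb ?j (cd PH0)) (pb ?j (pb sq XI))" using assms unfolding susp_def by (intro mp_eqn[OF mp_Sing[OF cm_end]]) blast
 also have "eqn (Sing B) (pb ?j (pb sq XI)) (pb (sq \<circ> ?j) 0)"
  unfolding pb_pb by (rule mp_eqn[OF mp_None[OF cmc[OF cm_end cm_sq]]]) (use assms in "auto simp: susp_def sq_base")
 finally show "eqn (Sing B) (cd (pb ?j PH0)) 0" by (simp add: pb_cd)
 show "deg n (pb ?j PH0)=pb ?j PH0" using assms by (simp add: susp_def flip: pb_deg)
qed

text \<open>Subtracting the pullback along the constant map makes the cocycle vanish at the base
  point; as n is odd, this pullback is exact. The primitive is the prism operator of the contraction
  (s t, y) of the cylinder, whose initial end is mapped to the base point.\<close>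

lemma susp_ex:
 assumes c: "eqn (Sing (SSP B)) (cd c) 0" and n: "odd n"
 obtains PH0 XI where "susp B n c PH0 XI"
proof -
 let ?X = "SSP B" and ?I = "ssp B"
 let ?c = "deg (Suc n) c"
 define XI where "XI=?c - pb (%_. None) ?c"
 define H where "H s x=(s * fst x, snd x)" for s :: real and x :: "real \<times> 'a option"
 have cc: "eqn (Sing ?X) (cd ?c) 0" using eq_clat[OF c] unfolding clat_deg by blast
 have "coh (Sing ?X) (pb (%_. None) ?c) 0" by (rule const_xct[where m = "Suc n"]) (use n in auto)
 from coh_df[OF coh_refl this] have 1: "coh (Sing ?X) XI ?c" by (simp add: XI_def)
 have 2: "deg (Suc n) XI=XI" by (simp add: XI_def deg_df flip: pb_deg)
 have 3: "eqn (Sub ?X {None}) XI 0" using const_Sub[of ?X None ?c] by (simp add: XI_def eqn_def)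
 have x: "eqn (Sing ?X) (cd XI) 0" using coh_closed[OF 1] cc by simp
 let ?f = "pb sq XI"
 have cf: "eqn (Sing ?I) (cd ?f) 0" using mp_eqn[OF mp_Sing[OF cm_sq] x] by (simp add: pb_cd)
 have "cmap (prt unitI ?I) (topo {0..1}) (%x. fst x * fst (snd x))"
  unfolding cmis
  by (intro conjI cm_bilinear[OF bounded_bilinear_mult] cm_fst cm_snd) (auto simp: mult_le_one)
 then have cH: "cmap (prt unitI ?I) ?I (%(t, x). H t x)"
  by (simp add: H_def spde cmp o_def cm_snd cms)
 have "maps sq (Sub ?I sbase) (Sub ?X {None})" by (rule mp_Sub[OF cm_sq]) (use sq_base(1) in auto)
 from mp_eqn[OF this 3] have fb: "eqn (Sub ?I sbase) ?f 0" by simp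
 have "eqn (Sub ?I sbase) (hop H ?f) 0" by (rule hop_Sub0[OF cH _ fb]) (auto simp: H_def)
 from eq_deg[OF this, of n] have 4: "eqn (Sub ?I sbase) (deg n (hop H ?f)) 0" by (simp add: deg_0)
 have "eqn (Sing ?I) (pb (H 1) ?f) ?f" by (rule pb_id_on) (simp add: H_def)
 moreover have "eqn (Sing ?I) (pb (H 0) ?f) 0"
 proof -
  have "cmap ?I ?I (H 0)" by (simp add: H_def[abs_def] cmp o_def cms)
  from mp_eqn[OF mp_None[OF cmc[OF this cm_sq]] 3]
  show ?thesis by (simp add: pb_pb sq_base H_def)
 qed
 ultimately have "eqn (Sing ?I) (cd (hop H ?f)) ?f" using hty_cl[OF cH cf] by (simp add: eqn_def)
 from eq_deg[OF this, of "Suc n"] have 5: "eqn (Sing ?I) (cd (deg n (hop H ?f))) ?f" by (simp add: cd_deg 2 flip: pb_deg)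
 show ?thesis by (rule that[of "deg n (hop H ?f)" XI]) (use 1 2 3 4 5 in "simp add: susp_def")
qed

text \<open>Over the suspension of K the cocycle has a primitive \<open>et\<close> vanishing at the
  base point. \<open>PH0\<close> minus the pullback of \<open>et\<close> is closed on the cylinder
  over K and 0 at t = 0, hence exact at t = 1, where the pullback of \<open>et\<close> is 0 as
  well.\<close>

lemma susp_xct:
 assumes s: "susp B n c PH0 XI" and c: "coh (Sing (SSP (sbt1 B K))) (pb (%x. x) c) 0"
 shows "coh (Sub B K) (pb (%b. (1, Some b)) PH0) 0"
proof -
 let ?K = "sbt1 B K"
 let ?X = "SSP B" and ?XK = "SSP ?K" and ?I = "ssp B" and ?J = "prt unitI ?K"
 have x: "coh (Sing ?X) XI (deg (Suc n) c)" "eqn (Sub ?X {None}) XI 0" "eqn (Sub ?I sbase) PH0 0" "eqn (Sing ?I) (cd PH0) (pb sq XI)"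
  using s by (simp_all add: susp_def)
 have "coh (Sing ?XK) (pb (%x. x) XI) (deg (Suc n) (pb (%x. x) c))"
  using coh_pb[OF mp_Sing[OF sma_inclusion] x(1)] by (simp add: pb_deg)
 from coh_trans[OF this coh_deg[OF c]] obtain et' where et': "eqn (Sing ?XK) (pb (%x. x) XI) (cd et')" by (auto simp: coh_def deg_0)
 \<comment> \<open>Normalised to vanish at the base point; it stays a primitive because
   \<open>XI\<close> vanishes there.\<close>
 define et where "et=et' - pb (%_. None) et'"
 have m: "maps (%_. None) (Sing ?XK) (Sing ?XK)" by (rule mp_Sing) (simp add: None_sma)
 have m': "maps (%_. None) (Sing ?XK) (Sub ?X {None})" by (rule mp_None) (simp_all add: None_sma)
 have "eqn (Sing ?XK) (pb (%_. None) (cd et')) 0"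
  using eq_trans[OF eq_sym[OF mp_eqn[OF m et']]] mp_eqn[OF m' x(2)] by (simp add: pb_pb o_def)
 then have et: "eqn (Sing ?XK) (pb (%x. x) XI) (cd et)" using et' by (simp add: et_def cd_df eqn_def flip: pb_cd)
 have et0: "eqn (Sub ?XK {None}) et 0" using const_Sub[of ?XK None et'] by (simp add: et_def eqn_def)
 define r where "r=(%x :: real \<times> 'a. (fst x, Some (snd x)))"
 have r: "cmap ?J (ssp ?K) r" 
  unfolding r_def by (simp add: cmp o_def cmf cm_snd cm_Some)
 have r': "cmap ?J ?I r"
  unfolding r_def using cm_snd[OF cmfs[OF cm_Some], of unitI B K] by (simp add: cmp o_def cmf)
 have q: "cmap ?J ?XK (sq \<circ> r)" by (rule cmc[OF r cm_sq])
 define wm where "wm=pb r PH0 - pb (sq \<circ> r) et"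
 have "eqn (Sing ?J) (pb r (cd PH0)) (pb r (pb sq XI))" by (rule mp_eqn[OF mp_Sing[OF r'] x(4)])
 moreover have "eqn (Sing ?J) (pb (sq \<circ> r) (pb (%x. x) XI)) (pb (sq \<circ> r) (cd et))" by (rule mp_eqn[OF mp_Sing[OF q] et])
 ultimately have wm: "eqn (Sing ?J) (cd wm) 0" by (simp add: wm_def cd_df pb_pb o_def eqn_def flip: pb_cd)
 have p: "cmap ?K ?J (Pair t)" if "t:{0..1}" for t using that by (simp add: cmp o_def)
 have e: "eqn (Sing ?K) (pb (Pair t) (pb (sq \<circ> r) et)) 0" if "t=0 | t=1" for t
 proof -
  have N: "(sq \<circ> r \<circ> Pair t) y=None" for y using that sq_base by (auto simp: r_def)
  have "t:{0..1}" using that by auto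
  from mp_eqn[OF mp_None[OF cmc[OF p[OF this] q] N] et0] show ?thesis by (simp add: pb_pb o_def)
 qed
 have "eqn (Sing ?K) (pb (Pair 0) (pb r PH0)) 0"
 proof -
  have "maps (r \<circ> Pair 0) (Sing ?K) (Sub ?I sbase)"
   by (rule mp_Sing) (use cmc[OF p r', of 0] in "auto simp: cmis r_def")
  from mp_eqn[OF this x(3)] show ?thesis by (simp add: pb_pb)
 qed
 with e[of 0] have "eqn (Sing ?K) (pb (Pair 0) wm) 0" by (simp add: wm_def pb_df eqn_def)
 moreover have "eqn (Sing ?K) (pb (Pair 1) wm) (pb (Pair 0) wm + cd (hop Pair wm))"
  by (rule hty_cl[OF _ wm]) (simp add: spde)
 ultimately have "eqn (Sing ?K) (pb (Pair 1) (pb r PH0)) (cd (hop Pair wm))" using e[of 1] by (simp add: wm_def pb_df eqn_def)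
 moreover have "r \<circ> Pair 1=(%b. (1, Some b))" by (auto simp: r_def)
 ultimately show ?thesis unfolding coh_def pb_pb by (intro exI[of _ "hop Pair wm"]) simp
qed

text \<open>A set of cocycles is treated as a union of classes, represented by cochains vanishing on the members of a cover.\<close>

definition vset :: "'b topology=>nat=>('b tc=>bool)=>'b cochain set=>bool" where
 "vset B n P C<->C~={}&(ALL ps:C. EX ze. P ze&ps:cl n B ze&cl n B ze \<subseteq> C&eqn (Sing B) (cd ze) 0&deg n ze=ze)"

text \<open>Members are replaced by the good representatives of their classes, on which
  \<open>cl_cup\<close> computes the product.\<close>

lemma vset_cup:
 assumes C: "vset B p P C" "vset B q Q D" and R: "!!ze xi. P ze==>Q xi==>R (ze \<smile> xi)"
 shows "vset B (p+q) R (cup p q B C D)"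
proof -
 have *: "EX ze. R ze&coh_class (p+q) B (cochain_cup p q B fi ps) \<subseteq> cl (p+q) B ze&cl (p+q) B ze \<subseteq> cup p q B C D&eqn (Sing B) (cd ze) 0&deg (p+q) ze=ze"
  if fi: "fi:C" and ps: "ps:D" for fi ps
 proof -
  obtain ze where z: "P ze" "fi:cl p B ze" "cl p B ze \<subseteq> C" "eqn (Sing B) (cd ze) 0" "deg p ze=ze" using C(1) fi unfolding vset_def by blast
  obtain xi where x: "Q xi" "ps:cl q B xi" "cl q B xi \<subseteq> D" "eqn (Sing B) (cd xi) 0" "deg q xi=xi" using C(2) ps unfolding vset_def by blast
  have e: "cup p q B (cl p B ze) (cl q B xi) = cl (p+q) B (ze \<smile> xi)"
   using cl_cup[OF eq_clat[OF z(4)] eq_clat[OF x(4)], of p q] by (simp add: z(5) x(5))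
  have "coh_class (p+q) B (cochain_cup p q B fi ps) \<subseteq> cl (p+q) B (ze \<smile> xi)" unfolding e[symmetric] cup_def using z(2) x(2) by blast
  moreover have "cl (p+q) B (ze \<smile> xi) \<subseteq> cup p q B C D" unfolding e[symmetric] cup_def using z(3) x(3) by blast
  moreover have "eqn (Sing B) (cd (ze \<smile> xi)) 0"
   using eq_cup0_l[OF z(4), of xi] eq_cup0_r[OF x(4), of "ci ze"] by (simp add: cd_cup eqn_def)
  moreover have "deg (p+q) (ze \<smile> xi)=ze \<smile> xi" using deg_cup[of p ze q xi] by (simp add: z(5) x(5))
  ultimately show ?thesis using R[OF z(1) x(1)] by blast
 qed
 obtain fi ps where "fi:C" "ps:D" using C by (auto simp: vset_def)
 from *[OF this] have "cup p q B C D~={}" using cl_nonempty by blast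
 moreover have "EX ze. R ze&x:cl (p+q) B ze&cl (p+q) B ze \<subseteq> cup p q B C D&eqn (Sing B) (cd ze) 0&deg (p+q) ze=ze" if x: "x:cup p q B C D" for x
 proof -
  obtain fi ps where "fi:C" "ps:D" "x:coh_class (p+q) B (cochain_cup p q B fi ps)" using x unfolding cup_def by blast
  with *[of fi ps] show ?thesis by blast
 qed
 ultimately show ?thesis unfolding vset_def by blast
qed

text \<open>A primitive on K is itself a total cochain, so subtracting its coboundary changes the
  representative within its class on all of B.\<close>

lemma vset_restrict:
 assumes C: "vset B n (%ze. coh (Sub B K) ze 0) C"
 shows "vset B n (%ze. eqn (Sub B K) ze 0) C"
proof -
 have "EX ze'. eqn (Sub B K) ze' 0&cl n B ze' = cl n B ze&eqn (Sing B) (cd ze') 0&deg n ze'=ze'"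
  if z: "coh (Sub B K) ze 0" "eqn (Sing B) (cd ze) 0" "deg n ze=ze" for ze
 proof -
  obtain tt where tt: "eqn (Sub B K) ze (cd tt)" using z(1) by (auto simp: coh_def)
  let ?z = "deg n (ze - cd tt)"
  have "eqn (Sub B K) (ze - cd tt) 0" using tt by (simp add: eqn_def)
  from eq_deg[OF this, of n] have 1: "eqn (Sub B K) ?z 0" by (simp add: deg_0)
  have "cohn n B ?z ze" unfolding cohn_def by (intro exI[of _ "- tt"]) (simp add: deg_def cd_um)
  moreover have "eqn (Sing B) (cd ?z) 0" using eq_deg[OF z(2), of "Suc n"] by (simp add: cd_deg cd_df deg_0)
  ultimately show ?thesis using 1 cl_cong by (metis deg_deg)
 qed
 then show ?thesis using C unfolding vset_def by metis
qed

theorem theorem1p1: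
  fixes B :: "'b topology"
    and F :: "'b \<Rightarrow> ('h::complex_hilbert \<Rightarrow>\<^sub>L 'h)"
    and \<kappa> :: "((complex \<times> 'b option) option \<Rightarrow> ('h \<Rightarrow>\<^sub>L 'h)) set"
    and k :: nat and \<epsilon> :: real and i :: "nat \<Rightarrow> nat"
  assumes "\<not> finite_dimensional (UNIV :: 'h set)"
    and "\<exists>D :: 'h set. countable D \<and> closure D = UNIV"
    and "compact_space B"
    and "continuous_map B Fred_tilde F"
    and "represents_K1 B F \<kappa>"
    and "0 < \<epsilon>" and "\<epsilon> < 1"
    and "\<And>b. b \<in> topspace B \<Longrightarrow>
           finite (spec (F b) \<inter> complex_of_real ` {-\<epsilon><..<\<epsilon>}) \<and>
           card (spec (F b) \<inter> complex_of_real ` {-\<epsilon><..<\<epsilon>}) \<le> k"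
    and "strict_mono_on {..k} i" and "0 < i 0"
  shows "cup_product B (\<lambda>j. 2 * i j - 1) (\<lambda>j. c_odd B (i j) \<kappa>) k
           = \<one>\<^bsub>cohomology_group (\<Sum>j\<le>k. 2 * i j - 1) B\<^esub>"
proof -
 let ?X = "SSP B"
 obtain A where \<kappa>: "\<kappa>:K1 B" and A: "homotopic_with (%_. True) B Fred_tilde F A" "\<kappa>=K0_class ?X None (ASg A)"
  using assms(5) unfolding represents_K1_def by blast
 let ?f = "ASg A" and ?P = "%h. invertible_op (h None)"
 \<comment> \<open>Membership of \<open>\<kappa>\<close> in \<open>K1 B\<close> provides a
   continuous g in the class. Through the homotopy to g the loop \<open>ASg A\<close> is seen to be
   continuous into \<open>Fred0\<close> and to belong to its own class.\<close>
 obtain g where g: "\<kappa>=K0_class ?X None g" "cmap ?X (topo Fred0) g" "invertible_op (g None)" using \<kappa> unfolding K0_def by blast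
 have "homotopic_with ?P ?X (topo Fred0) g g" using g(2,3) by simp
 then have "g:K0_class ?X None ?f" unfolding A(2)[symmetric] g(1) by (simp add: K0_class_def)
 then have h: "homotopic_with ?P ?X (topo Fred0) ?f g" by (simp add: K0_class_def)
 have ff: "?f:K0_class ?X None ?f"
  unfolding K0_class_def mem_Collect_eq by (rule homotopic_with_trans[OF h homotopic_with_symD[OF h]])
 note X = sma_cpt[OF assms(3)] sma_cnd[of B]
 have "fam ?X ?f" by (rule Fred0_fam[OF conjunct1[OF homotopic_with_imp_continuous_maps[OF h]]])
 then obtain c where c: "ch ?X ?f c" using ch_ex[OF X] by blast
 have cc: "eqn (Sing ?X) (cd (c m)) 0" for m using c by (auto simp: ch_def chf_def chern_def)
 have ck: "chern_K0 ?X m \<kappa> = cl (2 * m) ?X (c m)" for m unfolding A(2) by (rule chn_K0_eq[OF assms(1) X ff c])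
 have F: "sfam B F" by (rule sfam_Fred_tilde[OF assms(4)])
 obtain N where N: "N >= 1" "!!b. b:tsp1 B==>norm (F b)<=N" using sfam_bound[OF F assms(3)] by metis
 obtain a V K where V: "!!j. openin B (V j)" "!!j. closedin B (K j)" "!!j. V j \<subseteq> K j" "tsp1 B=(\<Union>j\<le>k. V j)"
  "!!j b. b:K j==>EX \<delta>>0. ALL v. \<delta> * norm v<=norm ((F b+a j *R dfc (F b)) v)"
  using spectral_cover[OF F assms(3) N assms(6,7,8)] by metis
 \<comment> \<open>So the natural subtraction in \<open>2 * i j - 1\<close> is exact, and these
   degrees are odd, as \<open>susp_ex\<close> asks.\<close>
 have i: "i j > 0" if "j<=k" for j using assms(9,10) that by (cases j) (auto simp: strict_mono_on_def intro: less_trans)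
 have 1: "vset B (2 * i j - 1) (%\<zeta>. eqn (Sub B (V j)) \<zeta> 0) (c_odd B (i j) \<kappa>)" if j: "j<=k" for j
 proof -
  let ?n = "2 * i j - 1"
  have v: "coh (Sing (SSP (sbt1 B (K j)))) (pb (%x. x) (c (i j))) 0"
   by (rule chn_vanish[OF assms(3) A(1) c V(2) N V(5) i[OF j]])
  note co = c_odd_eq[OF i[OF j] ck]
  obtain \<Phi> \<Xi> where "susp B ?n (c (i j)) \<Phi> \<Xi>" using susp_ex[OF cc, of ?n] i[OF j] by auto
  then have "c_odd B (i j) \<kappa>~={}" unfolding co using cl_nonempty[of ?n B "pb (%b. (1, Some b)) \<Phi>"] by blast
  then have "vset B ?n (%\<zeta>. coh (Sub B (K j)) \<zeta> 0) (c_odd B (i j) \<kappa>)"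
   unfolding vset_def co using susp_closed susp_xct[OF _ v] by blast
  \<comment> \<open>Exactness was shown over the closed \<open>K j\<close>, where the base stays
    compact; vanishing is passed on to the open \<open>V j\<close>, since \<open>sm_xct\<close>
    needs an open cover.\<close>
  from vset_restrict[OF this] show ?thesis
   unfolding vset_def using eq_mono[OF _ Sub_mono[OF V(3)[of j]]] by blast
 qed
 have 2: "vset B (\<Sum>j\<le>m. 2 * i j - 1) (%\<zeta>. ALL j<=m. eqn (Sub B (V j)) \<zeta> 0) (cup_product B (%j. 2 * i j - 1) (%j. c_odd B (i j) \<kappa>) m)" if "m<=k" for m
  using that
 proof (induction m)
  case (Suc m)
  have "vset B ((\<Sum>j\<le>m. 2 * i j - 1)+(2 * i (Suc m) - 1)) (%\<zeta>. ALL j<=Suc m. eqn (Sub B (V j)) \<zeta> 0)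
   (cup (\<Sum>j\<le>m. 2 * i j - 1) (2 * i (Suc m) - 1) B (cup_product B (%j. 2 * i j - 1) (%j. c_odd B (i j) \<kappa>) m) (c_odd B (i (Suc m)) \<kappa>))"
  proof (rule vset_cup[OF Suc.IH 1])
   fix \<zeta> \<xi> assume z: "ALL j<=m. eqn (Sub B (V j)) \<zeta> 0" "eqn (Sub B (V (Suc m))) \<xi> 0"
   show "ALL j<=Suc m. eqn (Sub B (V j)) (\<zeta> \<smile> \<xi>) 0"
   proof (intro allI impI)
    fix j assume "j<=Suc m"
    then consider "j<=m" | "j=Suc m" by linarith
    then show "eqn (Sub B (V j)) (\<zeta> \<smile> \<xi>) 0"
     by cases (use z eq_cup0_l[OF _ fcl_Sing] eq_cup0_r[OF _ fcl_Sing] in blast)+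
   qed
  qed (use Suc.prems in auto)
  then show ?case by (simp add: zero_fun_def)
 qed (use 1[of 0] in "simp add: zero_fun_def")
 let ?d = "\<Sum>j\<le>k. 2 * i j - 1" and ?C = "cup_product B (%j. 2 * i j - 1) (%j. c_odd B (i j) \<kappa>) k"
 have 3: "cl ?d B \<zeta> = cl ?d B 0" if z: "ALL j<=k. eqn (Sub B (V j)) \<zeta> 0" "eqn (Sing B) (cd \<zeta>) 0" for \<zeta>
 proof -
  have "eqn (small B (V ` {..k})) \<zeta> 0" using z(1) by (auto simp: eqn_def small_def Sing_def sss)
  then obtain \<eta> where "eqn (Sing B) \<zeta> (cd \<eta>)" using sm_xct[of "V ` {..k}" B \<zeta>] V(1,4) z(2) by (metis (no_types, lifting) image_iff order_refl)
  then have "cohn ?d B \<zeta> 0" by (auto simp: cohn_def eqn_def)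
  then show ?thesis by (simp add: cl_cong)
 qed
 \<comment> \<open>The union is nonempty and every class in it is the zero class, so it is equal to
   that class.\<close>
 have "?C~={}" "\<psi>:?C==>\<psi>:cl ?d B 0&cl ?d B 0 \<subseteq> ?C" for \<psi>
  using 2[OF order_refl] 3 unfolding vset_def by (blast, metis)
 then show ?thesis unfolding cl_one by blast
qed

end
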